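(* Let $\psi$ be a (sufficiently regular) solution of $\square_g\psi=0$ on the expanding region $\mathcal{R}^+$ of a subextremal Schwarzschild–de Sitter spacetime, and suppose that for some $r_0\in(r_{\mathcal{C}},\infty)$ $$\sum_{k=0}^2 E[\partial_r^k\psi](r_0)<\infty.$$ Then, identifying each $\Sigma_r$ with $\mathbb{R}\times\mathbb{S}^2$ via $(t,\omega)$, the following limits exist, the limits being taken in the norm of the homogeneous Sobolev space $\dot H^1(\mathbb{R}\times\mathbb{S}^2)$: $$\psi_0=\lim_{r\to\infty}\psi,\qquad \psi_2=\lim_{r\to\infty}\big[r^2(\psi-\psi_0)\big],\qquad \psi_3=\lim_{r\to\infty}\Big[r^3\Big(\psi-\psi_0-\frac{\psi_2}{r^2}\Big)\Big].$$
   Context: Fix $\Lambda>0$ and $m$ with $0<3m<1/\sqrt{\Lambda}$ (subextremal). Let $D(r)=\frac{\Lambda}{3}r^2-1+\frac{2m}{r}$ and let $r_{\mathcal{C}}$ be its largest positive root. The expanding region is $\mathcal{R}^+=(r_{\mathcal{C}},\infty)_r\times\mathbb{R}_t\times\mathbb{S}^2$ with metric $g=-D(r)^{-1}dr^2+D(r)dt^2+r^2\gamma_{\mathbb{S}^2}$, $\gamma_{\mathbb{S}^2}$ the round metric. The lapse is $\phi=D(r)^{-1/2}$. In these coordinates $\square_g\psi=\phi^2\partial_t^2\psi-r^{-2}\partial_r(r^2\phi^{-2}\partial_r\psi)+r^{-2}\Delta_{\mathbb{S}^2}\psi$. $\Sigma_r=\{r=\text{const}\}$, identified with $\mathbb{R}\times\mathbb{S}^2$.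 The energy of $\psi$ on $\Sigma_r$ is the $\partial_r$-energy flux $$E[\psi](r)=\frac12\int_{\mathbb{R}\times\mathbb{S}^2}\Big(r^2\phi^{-2}(\partial_r\psi)^2+r^2\phi^2(\partial_t\psi)^2+|\nabla_{\mathbb{S}^2}\psi|^2_{\gamma}\Big)\,dt\,d\mu_{\gamma},$$ equivalently $\frac12\int_{\Sigma_r}\phi^{-1}\big[(\partial_r\psi)^2+\phi^2|\overline\nabla\psi|^2\big]d\mu_{\overline g_r}$ with $\overline g_r$ the induced metric on $\Sigma_r$. *)

theory Defs
  imports "HOL-Analysis.Analysis"
begin

definition SdS_D :: "real \<Rightarrow> real \<Rightarrow> real \<Rightarrow> real" where
  "SdS_D \<Lambda> m r = \<Lambda> / 3 * r\<^sup>2 - 1 + 2 * m / r"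

definition SdS_rC :: "real \<Rightarrow> real \<Rightarrow> real" where
  "SdS_rC \<Lambda> m = (GREATEST r. r > 0 \<and> SdS_D \<Lambda> m r = 0)"

definition lapse :: "real \<Rightarrow> real \<Rightarrow> real \<Rightarrow> real" where
  "lapse \<Lambda> m r = 1 / sqrt (SdS_D \<Lambda> m r)"

fun Ck_on :: "nat \<Rightarrow> 'a::euclidean_space set \<Rightarrow> ('a \<Rightarrow> real) \<Rightarrow> bool" where
  "Ck_on 0 S f = continuous_on S f"
| "Ck_on (Suc k) S f =
     ((\<forall>x\<in>S. f differentiable (at x)) \<and>
      (\<forall>i\<in>Basis. Ck_on k S (\<lambda>x. frechet_derivative f (at x) i)))"

definition smooth_on :: "'a::euclidean_space set \<Rightarrow> ('a \<Rightarrow> real) \<Rightarrow> bool" where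
  "smooth_on S f = (\<forall>k. Ck_on k S f)"

definition sph :: "real \<Rightarrow> real \<Rightarrow> real^3" where
  "sph \<theta> \<phi> = vector [sin \<theta> * cos \<phi>, sin \<theta> * sin \<phi>, cos \<theta>]"

text \<open>Functions of (r,t,omega) on the expanding region, omega in S^2 = sphere 0 1 in R^3.
  Radial derivative of such a function.\<close>
definition dr :: "(real \<Rightarrow> real \<Rightarrow> real^3 \<Rightarrow> real) \<Rightarrow> (real \<Rightarrow> real \<Rightarrow> real^3 \<Rightarrow> real)" where
  "dr u = (\<lambda>r t \<omega>. deriv (\<lambda>s. u s t \<omega>) r)"

definition box_g :: "real \<Rightarrow> real \<Rightarrow> (real \<Rightarrow> real \<Rightarrow> real^3 \<Rightarrow> real)
    \<Rightarrow> real \<Rightarrow> real \<Rightarrow> real \<Rightarrow> real \<Rightarrow> real" where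
  "box_g \<Lambda> m \<psi> r t \<theta> \<phi> =
     (lapse \<Lambda> m r)\<^sup>2 * deriv (\<lambda>s. deriv (\<lambda>s'. \<psi> r s' (sph \<theta> \<phi>)) s) t
     - (1 / r\<^sup>2) * deriv (\<lambda>s. s\<^sup>2 / (lapse \<Lambda> m s)\<^sup>2 * deriv (\<lambda>s'. \<psi> s' t (sph \<theta> \<phi>)) s) r
     + (1 / r\<^sup>2) *
       ((1 / sin \<theta>) * deriv (\<lambda>a. sin a * deriv (\<lambda>a'. \<psi> r t (sph a' \<phi>)) a) \<theta>
        + (1 / (sin \<theta>)\<^sup>2) * deriv (\<lambda>b. deriv (\<lambda>b'. \<psi> r t (sph \<theta> b')) b) \<phi>)"

text \<open>The d_r-energy flux through Sigma_r (integral over R_t x S^2, the surface measure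
  of S^2 written in spherical coordinates as sin theta d theta d phi).\<close>
definition energy :: "real \<Rightarrow> real \<Rightarrow> (real \<Rightarrow> real \<Rightarrow> real^3 \<Rightarrow> real) \<Rightarrow> real \<Rightarrow> ennreal" where
  "energy \<Lambda> m u r = ennreal (1/2) *
     (\<integral>\<^sup>+t. (\<integral>\<^sup>+\<theta>\<in>{0<..<pi}. (\<integral>\<^sup>+\<phi>\<in>{0<..<2*pi}.
        ennreal ((r\<^sup>2 / (lapse \<Lambda> m r)\<^sup>2 * (dr u r t (sph \<theta> \<phi>))\<^sup>2
                + r\<^sup>2 * (lapse \<Lambda> m r)\<^sup>2 * (deriv (\<lambda>s. u r s (sph \<theta> \<phi>)) t)\<^sup>2
                + ((deriv (\<lambda>a. u r t (sph a \<phi>)) \<theta>)\<^sup>2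
                   + (deriv (\<lambda>b. u r t (sph \<theta> b)) \<phi>)\<^sup>2 / (sin \<theta>)\<^sup>2))
                * sin \<theta>) \<partial>lborel) \<partial>lborel) \<partial>lborel)"

text \<open>Coordinate domain (t, theta, phi) in R x (0,pi) x R (phi-periodic cover of the chart);
  a function f on R x S^2 is pulled back to (t,theta,phi) |-> f t (sph theta phi).\<close>
definition coord_dom :: "(real \<times> real \<times> real) set" where
  "coord_dom = UNIV \<times> {0<..<pi} \<times> UNIV"

definition test_fn :: "(real \<times> real \<times> real \<Rightarrow> real) \<Rightarrow> bool" where
  "test_fn \<zeta> \<longleftrightarrow> smooth_on UNIV \<zeta> \<and> compact (closure {p. \<zeta> p \<noteq> 0})
                  \<and> closure {p. \<zeta> p \<noteq> 0} \<subseteq> coord_dom"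

definition has_weak_grad :: "(real \<Rightarrow> real^3 \<Rightarrow> real)
    \<Rightarrow> (real \<Rightarrow> real \<Rightarrow> real \<Rightarrow> real \<times> real \<times> real) \<Rightarrow> bool" where
  "has_weak_grad f G \<longleftrightarrow>
     (let F = (\<lambda>(t, \<theta>, \<phi>). f t (sph \<theta> \<phi>));
          Gt = (\<lambda>(t, \<theta>, \<phi>). fst (G t \<theta> \<phi>));
          G\<theta> = (\<lambda>(t, \<theta>, \<phi>). fst (snd (G t \<theta> \<phi>)));
          G\<phi> = (\<lambda>(t, \<theta>, \<phi>). snd (snd (G t \<theta> \<phi>)))
      in F \<in> borel_measurable lborel \<and> Gt \<in> borel_measurable lborel \<and>
         G\<theta> \<in> borel_measurable lborel \<and> G\<phi> \<in> borel_measurable lborel \<and>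
         (\<forall>K. compact K \<and> K \<subseteq> coord_dom \<longrightarrow>
            set_integrable lborel K F \<and> set_integrable lborel K Gt \<and>
            set_integrable lborel K G\<theta> \<and> set_integrable lborel K G\<phi>) \<and>
         (\<forall>\<zeta>. test_fn \<zeta> \<longrightarrow>
            (\<integral>p. F p * frechet_derivative \<zeta> (at p) (1, 0, 0) \<partial>lborel) = - (\<integral>p. Gt p * \<zeta> p \<partial>lborel) \<and>
            (\<integral>p. F p * frechet_derivative \<zeta> (at p) (0, 1, 0) \<partial>lborel) = - (\<integral>p. G\<theta> p * \<zeta> p \<partial>lborel) \<and>
            (\<integral>p. F p * frechet_derivative \<zeta> (at p) (0, 0, 1) \<partial>lborel) = - (\<integral>p. G\<phi> p * \<zeta> p \<partial>lborel)))"

definition grad_sq_norm :: "(real \<Rightarrow> real \<Rightarrow> real \<Rightarrow> real \<times> real \<times> real) \<Rightarrow> ennreal" where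
  "grad_sq_norm G =
     (\<integral>\<^sup>+t. (\<integral>\<^sup>+\<theta>\<in>{0<..<pi}. (\<integral>\<^sup>+\<phi>\<in>{0<..<2*pi}.
        ennreal (((fst (G t \<theta> \<phi>))\<^sup>2 + (fst (snd (G t \<theta> \<phi>)))\<^sup>2
                  + (snd (snd (G t \<theta> \<phi>)))\<^sup>2 / (sin \<theta>)\<^sup>2) * sin \<theta>) \<partial>lborel) \<partial>lborel) \<partial>lborel)"

definition wgrad :: "(real \<Rightarrow> real^3 \<Rightarrow> real) \<Rightarrow> real \<Rightarrow> real \<Rightarrow> real \<Rightarrow> real \<times> real \<times> real" where
  "wgrad f = (SOME G. has_weak_grad f G)"

definition in_H1dot :: "(real \<Rightarrow> real^3 \<Rightarrow> real) \<Rightarrow> bool" where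
  "in_H1dot f \<longleftrightarrow> (\<exists>G. has_weak_grad f G \<and> grad_sq_norm G < \<infinity>)"

definition H1dot_dist_sq :: "(real \<Rightarrow> real^3 \<Rightarrow> real) \<Rightarrow> (real \<Rightarrow> real^3 \<Rightarrow> real) \<Rightarrow> ennreal" where
  "H1dot_dist_sq f g = grad_sq_norm (\<lambda>t \<theta> \<phi>. wgrad f t \<theta> \<phi> - wgrad g t \<theta> \<phi>)"

end

theory Submission
  imports Defs
begin

text \<open>
  With \<open>\<tau> = 1 / r\<close> and \<open>p = \<tau>\<^sup>2 D\<close>, which is smooth and positive up to \<open>\<tau> = 0\<close>, put
  \<open>F\<^sub>0 = \<psi>\<close>, \<open>F\<^sub>1 = (p / \<tau>) \<partial>\<^sub>\<tau> \<psi>\<close> and \<open>F\<^sub>2 = \<partial>\<^sub>\<tau> F\<^sub>1\<close>, \<open>F\<^sub>3 = \<partial>\<^sub>\<tau> F\<^sub>2\<close>.  Differentiating the wave equation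
  once removes its singular coefficient: \<open>F\<^sub>1\<close> solves a wave equation that is regular at \<open>\<tau> = 0\<close> with second derivatives
  of \<open>F\<^sub>0\<close> as source, so energy estimates in finite time control the gradients of \<open>F\<^sub>0, F\<^sub>1, F\<^sub>2\<close> uniformly as \<open>\<tau> \<rightarrow> 0\<close>; finite speed
  of propagation makes them tight in \<open>t\<close>.  Since \<open>\<partial>\<^sub>\<tau> \<psi> = (\<tau> / p) F\<^sub>1\<close> and \<open>p = \<Lambda> / 3 + O(\<tau>\<^sup>2)\<close>, Taylor's formula gives
  \<open>\<psi> = f\<^sub>0 + \<tau>\<^sup>2 f\<^sub>1 / (2 \<Lambda> / 3) + \<tau>\<^sup>3 f\<^sub>2 / \<Lambda> + o(\<tau>\<^sup>3)\<close> with \<open>f\<^sub>j = lim F\<^sub>j\<close>.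
\<close>

section \<open>Partial derivatives and smooth functions\<close>

text \<open>The obstacle is that the hypothesis bounds energies up to level 2, whereas convergence
  of the gradient of \<open>F 2\<close> asks for its \<tau>-derivative, that is for level 3.
  Smoothness makes level 3 finite on bounded ranges of t, and there the energy estimate yields
  convergence; the level 2 energy, finite on the whole slice, makes large |t| negligible uniformly
  in \<tau>. A second obstacle is that \<open>wgrad\<close> is a choice among weak gradients and
  that the limits must be functions possessing one: each gradient component at a fixed point of the
  slice is treated as a curve in \<tau>, its limit exists at almost every point, and weak
  derivatives pass to the limit by dominated convergence. Finally, polar coordinates degenerate at
  the poles. The pulled back solution is still smooth across them, so the flux through a small
  circle around a pole carries a factor \<open>sin \<epsilon>\<close> and disappears with
  \<epsilon>. Convergence to \<open>\<psi>0\<close> and \<open>\<psi>2\<close> is read off from the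
  cubic remainder, because the later coefficients have finite norm.\<close>

definition pdiff :: "'a::euclidean_space \<Rightarrow> ('a \<Rightarrow> real) \<Rightarrow> 'a \<Rightarrow> real" where
  "pdiff v f x = frechet_derivative f (at x) v"

lemma pdiff_eqI: "(f has_derivative f') (at x) \<Longrightarrow> pdiff v f x = f' v"
  by (simp add: pdiff_def frechet_derivative_at[symmetric])

lemma differentiable_has_derivative_pdiff:
  "f differentiable (at x) \<Longrightarrow> (f has_derivative (\<lambda>v. pdiff v f x)) (at x)"
  by (simp add: pdiff_def frechet_derivative_works)

lemma has_derivative_comp_curve_pdiff:
  fixes f :: "'a::euclidean_space \<Rightarrow> real" and g :: "real \<Rightarrow> 'a"
  assumes "f differentiable (at (g s))" "(g has_vector_derivative v) (at s within A)"
  shows "((\<lambda>s. f (g s)) has_real_derivative pdiff v f (g s)) (at s within A)"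
proof -
  have "((\<lambda>s. f (g s)) has_derivative (\<lambda>h. pdiff (h *\<^sub>R v) f (g s))) (at s within A)"
    using has_derivative_compose[OF assms(2)[unfolded has_vector_derivative_def]
        differentiable_has_derivative_pdiff[OF assms(1)]] .
  moreover have "(\<lambda>h. pdiff (h *\<^sub>R v) f (g s)) = (\<lambda>h. pdiff v f (g s) * h)"
    using linear_frechet_derivative[OF assms(1)] by (auto simp: pdiff_def linear_scale fun_eq_iff)
  ultimately show ?thesis by (simp add: has_field_derivative_def)
qed

lemma pdiff_transform_open:
  assumes "open S" "\<And>y. y \<in> S \<Longrightarrow> f y = g y" "x \<in> S"
  shows "f differentiable (at x) \<longleftrightarrow> g differentiable (at x)" "pdiff v f x = pdiff v g x"
proof -
  have *: "(f has_derivative f') (at x) \<longleftrightarrow> (g has_derivative f') (at x)" for f'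
    using assms has_derivative_transform_within_open[of f f' x UNIV S g]
      has_derivative_transform_within_open[of g f' x UNIV S f] by auto
  show "f differentiable (at x) \<longleftrightarrow> g differentiable (at x)"
    by (simp add: differentiable_def *)
  show "pdiff v f x = pdiff v g x" by (simp add: pdiff_def frechet_derivative_def *)
qed

lemma Ck_on_Suc_pdiff:
  "Ck_on (Suc k) S f \<longleftrightarrow> (\<forall>x\<in>S. f differentiable (at x)) \<and> (\<forall>i\<in>Basis. Ck_on k S (pdiff i f))"
  by (simp add: pdiff_def[abs_def])

lemma Ck_on_cong:
  assumes "open S" "\<And>x. x \<in> S \<Longrightarrow> f x = g x"
  shows "Ck_on k S f \<longleftrightarrow> Ck_on k S g"
  using assms(2)
proof (induction k arbitrary: f g)
  case 0
  then show ?case by (simp cong: continuous_on_cong)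
next
  case (Suc k)
  have "Ck_on k S (pdiff i f) \<longleftrightarrow> Ck_on k S (pdiff i g)" for i
    by (rule Suc.IH) (use Suc.prems assms pdiff_transform_open(2)[OF assms(1), of f g] in auto)
  then show ?case using pdiff_transform_open(1)[OF assms(1), of f g] Suc.prems
    by (auto simp: Ck_on_Suc_pdiff simp del: Ck_on.simps)
qed

text \<open>Serves twice: as the vehicle of the smoothness proofs, and later (\<open>tc\<close>) as
  the ring of coefficient functions of \<tau>, where induction over the generation yields
  derivatives and bounds.\<close>

inductive alg_gen :: "('a \<Rightarrow> real) set \<Rightarrow> ('a \<Rightarrow> real) \<Rightarrow> bool" for B where
  alg_base: "f \<in> B \<Longrightarrow> alg_gen B f"
| alg_const: "alg_gen B (\<lambda>_. c)"
| alg_add: "alg_gen B f \<Longrightarrow> alg_gen B g \<Longrightarrow> alg_gen B (\<lambda>x. f x + g x)"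
| alg_mult: "alg_gen B f \<Longrightarrow> alg_gen B g \<Longrightarrow> alg_gen B (\<lambda>x. f x * g x)"

lemma alg_sum: "(\<And>j. j \<in> J \<Longrightarrow> alg_gen B (f j)) \<Longrightarrow> alg_gen B (\<lambda>x. \<Sum>j\<in>J. f j x)"
proof (induction J rule: infinite_finite_induct)
  case (insert j J)
  then show ?case by (simp add: alg_add)
qed (auto intro: alg_const)

lemma pdiff_add:
  "f differentiable (at x) \<Longrightarrow> g differentiable (at x) \<Longrightarrow>
    pdiff v (\<lambda>x. f x + g x) x = pdiff v f x + pdiff v g x"
  by (rule pdiff_eqI[of _ "\<lambda>v. pdiff v f x + pdiff v g x"])
     (intro derivative_intros differentiable_has_derivative_pdiff)

lemma pdiff_mult:
  "f differentiable (at x) \<Longrightarrow> g differentiable (at x) \<Longrightarrow>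
    pdiff v (\<lambda>x. f x * g x) x = f x * pdiff v g x + pdiff v f x * g x"
  by (rule pdiff_eqI[of _ "\<lambda>v. f x * pdiff v g x + pdiff v f x * g x"])
     (intro derivative_intros differentiable_has_derivative_pdiff)

lemma alg_gen_differentiable:
  assumes "\<And>f x. f \<in> B \<Longrightarrow> x \<in> S \<Longrightarrow> f differentiable (at x)" "alg_gen B f" "x \<in> S"
  shows "f differentiable (at x)"
  using assms(2) by induction (use assms(1,3) in auto)

text \<open>An algebra of functions generated by a set closed under partial derivatives, up to the
  algebra, is closed under partial derivatives itself, hence consists of smooth functions.\<close>

lemma alg_gen_pdiff:
  assumes dB: "\<And>f x. f \<in> B \<Longrightarrow> x \<in> S \<Longrightarrow> f differentiable (at x)"
    and cB: "\<And>f. f \<in> B \<Longrightarrow> \<exists>g. alg_gen B g \<and> (\<forall>x\<in>S. pdiff i f x = g x)"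
    and "alg_gen B f"
  shows "\<exists>g. alg_gen B g \<and> (\<forall>x\<in>S. pdiff i f x = g x)"
  using assms(3)
proof induction
  case (alg_base f)
  then show ?case using cB by blast
next
  case (alg_const c)
  show ?case by (rule exI[of _ "\<lambda>_. 0"]) (auto intro: alg_gen.alg_const simp: pdiff_def)
next
  case (alg_add f g)
  then obtain f' g' where "alg_gen B f'" "alg_gen B g'" "\<forall>x\<in>S. pdiff i f x = f' x"
    "\<forall>x\<in>S. pdiff i g x = g' x" by blast
  then show ?case using alg_add alg_gen_differentiable[OF dB]
    by (intro exI[of _ "\<lambda>x. f' x + g' x"]) (auto intro: alg_gen.alg_add simp: pdiff_add)
next
  case (alg_mult f g)
  then obtain f' g' where "alg_gen B f'" "alg_gen B g'" "\<forall>x\<in>S. pdiff i f x = f' x"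
    "\<forall>x\<in>S. pdiff i g x = g' x" by blast
  then show ?case using alg_mult alg_gen_differentiable[OF dB]
    by (intro exI[of _ "\<lambda>x. f x * g' x + f' x * g x"])
       (auto intro!: alg_gen.alg_add alg_gen.alg_mult simp: pdiff_mult)
qed

lemma alg_gen_smooth:
  assumes "open S"
    and dB: "\<And>f x. f \<in> B \<Longrightarrow> x \<in> S \<Longrightarrow> f differentiable (at x)"
    and cB: "\<And>f i. f \<in> B \<Longrightarrow> i \<in> Basis \<Longrightarrow> \<exists>g. alg_gen B g \<and> (\<forall>x\<in>S. pdiff i f x = g x)"
    and f: "alg_gen B f"
  shows "smooth_on S f"
proof -
  have "Ck_on k S f" for k
    using f
  proof (induction k arbitrary: f)
    case 0
    then show ?case using alg_gen_differentiable[OF dB]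
      by (auto intro!: differentiable_imp_continuous_on
          simp: differentiable_on_def differentiable_at_withinI)
  next
    case (Suc k)
    have "Ck_on k S (pdiff i f)" if i: "i \<in> Basis" for i
    proof -
      obtain g where "alg_gen B g" "\<forall>x\<in>S. pdiff i f x = g x"
        using alg_gen_pdiff[of B S i f, OF dB cB[OF _ i] Suc.prems] by blast
      then show ?thesis using Suc.IH Ck_on_cong[OF assms(1), of "pdiff i f" g] by auto
    qed
    then show ?case using alg_gen_differentiable[OF dB _ ] Suc.prems
      by (auto simp: Ck_on_Suc_pdiff simp del: Ck_on.simps)
  qed
  then show ?thesis by (simp add: smooth_on_def)
qed

lemma smooth_on_differentiable: "smooth_on S f \<Longrightarrow> x \<in> S \<Longrightarrow> f differentiable (at x)"
  unfolding smooth_on_def by (metis Ck_on_Suc_pdiff)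

lemma smooth_on_continuous: "smooth_on S f \<Longrightarrow> continuous_on S f"
  unfolding smooth_on_def by (metis Ck_on.simps(1))

lemma smooth_on_pdiff: "smooth_on S f \<Longrightarrow> i \<in> Basis \<Longrightarrow> smooth_on S (pdiff i f)"
  unfolding smooth_on_def by (metis Ck_on_Suc_pdiff)

lemma smooth_on_subset:
  assumes "smooth_on T f" "S \<subseteq> T"
  shows "smooth_on S f"
proof -
  have "Ck_on k T f \<Longrightarrow> Ck_on k S f" for k
    by (induction k arbitrary: f) (use assms(2) in \<open>auto intro: continuous_on_subset\<close>)
  then show ?thesis using assms(1) by (auto simp: smooth_on_def)
qed

lemma smooth_on_alg:
  assumes "open S" "alg_gen {f. smooth_on S f} f"
  shows "smooth_on S f"
  using assms(1) _ _ assms(2)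
  by (rule alg_gen_smooth) (auto intro: smooth_on_differentiable alg_base dest: smooth_on_pdiff)

lemma smooth_on_const: "open S \<Longrightarrow> smooth_on S (\<lambda>_. c)"
  by (rule smooth_on_alg) (auto intro: alg_gen.intros)

lemma smooth_on_add: "open S \<Longrightarrow> smooth_on S f \<Longrightarrow> smooth_on S g \<Longrightarrow> smooth_on S (\<lambda>x. f x + g x)"
  by (rule smooth_on_alg[OF _ alg_add[OF alg_base alg_base]]) auto

lemma smooth_on_mult: "open S \<Longrightarrow> smooth_on S f \<Longrightarrow> smooth_on S g \<Longrightarrow> smooth_on S (\<lambda>x. f x * g x)"
  by (rule smooth_on_alg[OF _ alg_mult[OF alg_base alg_base]]) auto

lemma smooth_on_minus: "open S \<Longrightarrow> smooth_on S f \<Longrightarrow> smooth_on S (\<lambda>x. - f x)"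
  using smooth_on_mult[of S "\<lambda>_. -1" f] smooth_on_const[of S "-1"] by simp

lemma smooth_on_diff: "open S \<Longrightarrow> smooth_on S f \<Longrightarrow> smooth_on S g \<Longrightarrow> smooth_on S (\<lambda>x. f x - g x)"
  using smooth_on_add[of S f "\<lambda>x. - g x"] smooth_on_minus[of S g] by simp

lemma smooth_on_power: "open S \<Longrightarrow> smooth_on S f \<Longrightarrow> smooth_on S (\<lambda>x. f x ^ n)"
  by (induction n) (auto intro!: smooth_on_const smooth_on_mult)

lemma smooth_on_linear:
  assumes "open S" "bounded_linear f"
  shows "smooth_on S f"
  using assms(1) _ _ alg_base[of f "{f}"]
proof (rule alg_gen_smooth)
  show "\<And>g x. g \<in> {f} \<Longrightarrow> x \<in> S \<Longrightarrow> g differentiable (at x)"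
    using bounded_linear_imp_differentiable[OF assms(2)] by auto
  show "\<And>g i. g \<in> {f} \<Longrightarrow> i \<in> Basis \<Longrightarrow> \<exists>h. alg_gen {f} h \<and> (\<forall>x\<in>S. pdiff i g x = h x)"
    using pdiff_eqI[OF bounded_linear_imp_has_derivative[OF assms(2)]]
    by (auto intro!: exI[of _ "\<lambda>_. f _"] alg_const)
qed simp

text \<open>Higher derivatives of a composition are never written out: by the chain rule a first
  derivative is a sum of products of functions that are smooth on \<open>S\<close> or are again
  compositions of a smooth function with \<open>g\<close>, so these two kinds generate an algebra
  closed under differentiation.\<close>

lemma smooth_on_compose:
  fixes g :: "'a::euclidean_space \<Rightarrow> 'b::euclidean_space"
  assumes S: "open S" and h: "smooth_on T h" and g: "\<And>j. j \<in> Basis \<Longrightarrow> smooth_on S (\<lambda>x. g x \<bullet> j)"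
    and sub: "g ` S \<subseteq> T"
  shows "smooth_on S (\<lambda>x. h (g x))"
proof -
  define B where "B = {f. smooth_on S f} \<union> {\<lambda>x. h (g x) | h. smooth_on T h}"
  have dg: "(g has_derivative (\<lambda>v. \<Sum>j\<in>Basis. pdiff v (\<lambda>x. g x \<bullet> j) x *\<^sub>R j)) (at x)" if "x \<in> S" for x
    using that
    by (subst has_derivative_componentwise_within)
       (auto simp: inner_sum_left inner_Basis if_distrib if_distribR sum.delta cong: if_cong
         intro!: differentiable_has_derivative_pdiff smooth_on_differentiable[OF g])
  have comp: "((\<lambda>x. h (g x)) has_derivative
      (\<lambda>v. \<Sum>j\<in>Basis. pdiff j h (g x) * pdiff v (\<lambda>x. g x \<bullet> j) x)) (at x)"
    if "x \<in> S" "smooth_on T h" for x h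
  proof -
    have dh: "h differentiable (at (g x))"
      using smooth_on_differentiable that sub by blast
    have "((\<lambda>x. h (g x)) has_derivative
        (\<lambda>v. pdiff (\<Sum>j\<in>Basis. pdiff v (\<lambda>x. g x \<bullet> j) x *\<^sub>R j) h (g x))) (at x)"
      using has_derivative_compose[OF dg[OF that(1)] differentiable_has_derivative_pdiff[OF dh]] .
    moreover have "pdiff (\<Sum>j\<in>Basis. c j *\<^sub>R j) h (g x) = (\<Sum>j\<in>Basis. pdiff j h (g x) * c j)" for c
      using linear_frechet_derivative[OF dh] by (simp add: pdiff_def linear_sum linear_scale mult.commute)
    ultimately show ?thesis by simp
  qed
  show ?thesis using S
  proof (rule alg_gen_smooth)
    show "f differentiable (at x)" if "f \<in> B" "x \<in> S" for f x
      using that comp by (auto simp: B_def intro: smooth_on_differentiable differentiableI)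
    show "\<exists>k. alg_gen B k \<and> (\<forall>x\<in>S. pdiff i f x = k x)" if fi: "f \<in> B" "i \<in> Basis" for f i
    proof (cases "smooth_on S f")
      case True
      then show ?thesis using fi(2)
        by (intro exI[of _ "pdiff i f"]) (auto simp: B_def intro!: alg_base smooth_on_pdiff)
    next
      case False
      then obtain h where h: "f = (\<lambda>x. h (g x))" "smooth_on T h" using fi(1) by (auto simp: B_def)
      have "alg_gen B (\<lambda>x. \<Sum>j\<in>Basis. pdiff j h (g x) * pdiff i (\<lambda>x. g x \<bullet> j) x)"
      proof (rule alg_sum, rule alg_mult)
        fix j :: 'b assume j: "j \<in> Basis"
        show "alg_gen B (\<lambda>x. pdiff j h (g x))"
          by (rule alg_base) (use smooth_on_pdiff[OF h(2) j] in \<open>auto simp: B_def\<close>)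
        show "alg_gen B (\<lambda>x. pdiff i (\<lambda>x. g x \<bullet> j) x)"
          by (rule alg_base) (use smooth_on_pdiff[OF g[OF j] fi(2)] in \<open>auto simp: B_def\<close>)
      qed
      then show ?thesis using pdiff_eqI[OF comp] h by blast
    qed
    show "alg_gen B (\<lambda>x. h (g x))" using h by (auto simp: B_def intro!: alg_base)
  qed
qed

lemma pdiff_real: "(f has_real_derivative d) (at x) \<Longrightarrow> pdiff 1 f x = d"
  using pdiff_eqI[of f "\<lambda>h. d * h" x 1] by (simp add: has_field_derivative_def)

lemma smooth_on_inverse_real: "smooth_on (- {0::real}) inverse"
proof (rule alg_gen_smooth[of _ "{inverse}"])
  have d: "(inverse has_real_derivative - (inverse x * inverse x)) (at x)" if "x \<noteq> 0" for x :: real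
    using DERIV_inverse[OF that] by (simp add: power2_eq_square)
  show "f differentiable (at x)" if "f \<in> {inverse}" "x \<in> - {0}" for f and x :: real
    using d[of x] that by (auto simp: has_field_derivative_def differentiable_def)
  have "alg_gen {inverse} (\<lambda>x::real. (-1) * (inverse x * inverse x))"
    by (intro alg_mult alg_const alg_base) auto
  then show "\<exists>g. alg_gen {inverse} g \<and> (\<forall>x\<in>- {0}. pdiff i f x = g x)"
    if "f \<in> {inverse}" "i \<in> Basis" for f and i :: real
    using that pdiff_real[OF d] by force
qed (auto intro: alg_base)

lemma smooth_on_inverse:
  "open S \<Longrightarrow> smooth_on S f \<Longrightarrow> (\<And>x. x \<in> S \<Longrightarrow> f x \<noteq> 0) \<Longrightarrow> smooth_on S (\<lambda>x. inverse (f x))"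
  by (rule smooth_on_compose[OF _ smooth_on_inverse_real]) auto

lemma smooth_on_divide:
  "open S \<Longrightarrow> smooth_on S f \<Longrightarrow> smooth_on S g \<Longrightarrow> (\<And>x. x \<in> S \<Longrightarrow> g x \<noteq> 0) \<Longrightarrow>
    smooth_on S (\<lambda>x. f x / g x)"
  using smooth_on_mult[of S f "\<lambda>x. inverse (g x)"] smooth_on_inverse[of S g]
  by (simp add: divide_inverse)

lemma smooth_on_sin_cos_real: "alg_gen {sin, cos} f \<Longrightarrow> smooth_on UNIV f" for f :: "real \<Rightarrow> real"
proof (erule alg_gen_smooth[rotated 3])
  show "g differentiable (at x)" if "g \<in> {sin, cos}" for g and x :: real
    using that DERIV_sin[of x] DERIV_cos[of x] by (auto simp: has_field_derivative_def differentiable_def)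
  have "alg_gen {sin, cos} (\<lambda>x::real. (-1) * sin x)" "alg_gen {sin, cos} (cos :: real \<Rightarrow> real)"
    by (intro alg_mult alg_const alg_base; simp)+
  then show "\<exists>g. alg_gen {sin, cos} g \<and> (\<forall>x\<in>UNIV. pdiff i f x = g x)"
    if "f \<in> {sin, cos}" "i \<in> Basis" for f and i :: real
    using that pdiff_real[OF DERIV_sin] pdiff_real[OF DERIV_cos] by force
qed auto

lemma smooth_on_sin: "open S \<Longrightarrow> smooth_on S f \<Longrightarrow> smooth_on S (\<lambda>x. sin (f x))"
  by (rule smooth_on_compose[OF _ smooth_on_sin_cos_real[OF alg_base]]) auto

lemma smooth_on_cos: "open S \<Longrightarrow> smooth_on S f \<Longrightarrow> smooth_on S (\<lambda>x. cos (f x))"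
  by (rule smooth_on_compose[OF _ smooth_on_sin_cos_real[OF alg_base]]) auto

lemmas smooth_on_intros = smooth_on_const smooth_on_add smooth_on_mult smooth_on_minus
  smooth_on_diff smooth_on_power smooth_on_inverse smooth_on_divide smooth_on_sin smooth_on_cos

section \<open>Symmetry of second derivatives\<close>

lemma second_difference_mvt:
  assumes S: "smooth_on S f" "ball x e \<subseteq> S" and h: "0 < h" "h * (norm i + norm j) < e"
    and ij: "i \<in> Basis" "j \<in> Basis"
  shows "\<exists>\<xi>. dist x \<xi> \<le> h * (norm i + norm j) \<and>
    f (x + h *\<^sub>R i + h *\<^sub>R j) - f (x + h *\<^sub>R i) - f (x + h *\<^sub>R j) + f x = h * h * pdiff j (pdiff i f) \<xi>"
proof -
  have near: "dist x (x + s *\<^sub>R i + u *\<^sub>R j) \<le> h * (norm i + norm j)"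
    if "0 \<le> s" "s \<le> h" "0 \<le> u" "u \<le> h" for s u
  proof -
    have "norm (s *\<^sub>R i + u *\<^sub>R j) \<le> s * norm i + u * norm j"
      using that norm_triangle_ineq[of "s *\<^sub>R i" "u *\<^sub>R j"] by simp
    also have "\<dots> \<le> h * norm i + h * norm j"
      using that by (intro add_mono mult_right_mono) auto
    finally show ?thesis by (simp add: dist_norm norm_minus_commute algebra_simps)
  qed
  then have inS: "x + s *\<^sub>R i + u *\<^sub>R j \<in> S" if "0 \<le> s" "s \<le> h" "0 \<le> u" "u \<le> h" for s u
    using that S(2) h(2) by fastforce
  have D: "((\<lambda>s. f (x + s *\<^sub>R i + u *\<^sub>R j)) has_real_derivative pdiff i f (x + s *\<^sub>R i + u *\<^sub>R j)) (at s)"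
    if "0 \<le> s" "s \<le> h" "0 \<le> u" "u \<le> h" for s u
    by (rule has_derivative_comp_curve_pdiff[where g = "\<lambda>s. x + s *\<^sub>R i + u *\<^sub>R j",
          OF smooth_on_differentiable[OF S(1) inS[OF that]]])
       (auto intro!: derivative_eq_intros simp: has_vector_derivative_def)
  have "\<exists>s>0. s < h \<and> (f (x + h *\<^sub>R i + h *\<^sub>R j) - f (x + h *\<^sub>R i + 0 *\<^sub>R j)) - (f (x + 0 *\<^sub>R i + h *\<^sub>R j) - f (x + 0 *\<^sub>R i + 0 *\<^sub>R j))
      = (h - 0) * (pdiff i f (x + s *\<^sub>R i + h *\<^sub>R j) - pdiff i f (x + s *\<^sub>R i + 0 *\<^sub>R j))"
    using h D[of _ h] D[of _ 0] by (intro MVT2 DERIV_diff) auto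
  then obtain s where s: "0 < s" "s < h"
    "f (x + h *\<^sub>R i + h *\<^sub>R j) - f (x + h *\<^sub>R i) - f (x + h *\<^sub>R j) + f x =
      h * (pdiff i f (x + s *\<^sub>R i + h *\<^sub>R j) - pdiff i f (x + s *\<^sub>R i + 0 *\<^sub>R j))"
    by auto
  have "\<exists>u>0. u < h \<and> pdiff i f (x + s *\<^sub>R i + h *\<^sub>R j) - pdiff i f (x + s *\<^sub>R i + 0 *\<^sub>R j) =
      (h - 0) * pdiff j (pdiff i f) (x + s *\<^sub>R i + u *\<^sub>R j)"
  proof (intro MVT2)
    fix u assume u: "0 \<le> u" "u \<le> h"
    show "((\<lambda>u. pdiff i f (x + s *\<^sub>R i + u *\<^sub>R j)) has_real_derivative
        pdiff j (pdiff i f) (x + s *\<^sub>R i + u *\<^sub>R j)) (at u)"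
      using u s by (intro has_derivative_comp_curve_pdiff[where g = "\<lambda>u. x + s *\<^sub>R i + u *\<^sub>R j", OF smooth_on_differentiable[OF smooth_on_pdiff[OF S(1) ij(1)] inS]])
         (auto intro!: derivative_eq_intros simp: has_vector_derivative_def)
  qed (use h in auto)
  then obtain u where u: "0 < u" "u < h" "pdiff i f (x + s *\<^sub>R i + h *\<^sub>R j) - pdiff i f (x + s *\<^sub>R i + 0 *\<^sub>R j) =
      h * pdiff j (pdiff i f) (x + s *\<^sub>R i + u *\<^sub>R j)" by auto
  show ?thesis
    by (rule exI[of _ "x + s *\<^sub>R i + u *\<^sub>R j"]) (use s u near[of s u] in auto)
qed

text \<open>The second difference over a square of side \<open>h\<close> is symmetric in the two
  directions, and the mean value theorem, applied in one order or the other, turns it into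
  \<open>h * h\<close> times either mixed derivative at a nearby point. Continuity of the second
  derivatives then closes the gap as \<open>h\<close> tends to 0.\<close>

lemma pdiff_commute:
  assumes S: "open S" "smooth_on S f" "x \<in> S" and ij: "i \<in> Basis" "j \<in> Basis"
  shows "pdiff i (pdiff j f) x = pdiff j (pdiff i f) x"
proof -
  obtain e where e: "e > 0" "ball x e \<subseteq> S" using S openE by blast
  define c where "c = norm i + norm j"
  have c: "c = 2" using ij by (simp add: c_def)
  \<comment> \<open>Basis vectors have norm 1, so intermediate points lie within
    \<open>2 * h n\<close> of \<open>x\<close>; the factor 3 keeps this below
    \<open>e\<close>.\<close>
  define h where "h n = e / (3 * real (Suc n))" for n
  have h: "0 < h n" "h n * c < e" for n
    using e mult_strict_left_mono[of 2 "3 * real (Suc n)" e] of_nat_0_less_iff[of "Suc n", where 'a = real]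
    by (auto simp: h_def c divide_less_eq)
  have "\<exists>\<xi>. dist x \<xi> \<le> h n * c \<and> f (x + h n *\<^sub>R i + h n *\<^sub>R j) - f (x + h n *\<^sub>R i) - f (x + h n *\<^sub>R j) + f x
      = h n * h n * pdiff j (pdiff i f) \<xi>" for n
    using second_difference_mvt[OF S(2) e(2) h[of n, unfolded c_def] ij] by (simp add: c_def)
  then obtain \<xi> where \<xi>: "\<And>n. dist x (\<xi> n) \<le> h n * c"
    "\<And>n. f (x + h n *\<^sub>R i + h n *\<^sub>R j) - f (x + h n *\<^sub>R i) - f (x + h n *\<^sub>R j) + f x
      = h n * h n * pdiff j (pdiff i f) (\<xi> n)" by metis
  have "\<exists>\<xi>. dist x \<xi> \<le> h n * c \<and> f (x + h n *\<^sub>R j + h n *\<^sub>R i) - f (x + h n *\<^sub>R j) - f (x + h n *\<^sub>R i) + f x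
      = h n * h n * pdiff i (pdiff j f) \<xi>" for n
    using second_difference_mvt[OF S(2) e(2) _ _ ij(2,1), of "h n"] h[of n, unfolded c_def] 
    by (simp add: c_def add.commute)
  then obtain \<eta> where \<eta>: "\<And>n. dist x (\<eta> n) \<le> h n * c"
    "\<And>n. f (x + h n *\<^sub>R j + h n *\<^sub>R i) - f (x + h n *\<^sub>R j) - f (x + h n *\<^sub>R i) + f x
      = h n * h n * pdiff i (pdiff j f) (\<eta> n)" by metis
  have eq: "pdiff j (pdiff i f) (\<xi> n) = pdiff i (pdiff j f) (\<eta> n)" for n
  proof -
    have "h n * h n * pdiff j (pdiff i f) (\<xi> n) = h n * h n * pdiff i (pdiff j f) (\<eta> n)"
      unfolding \<xi>(2)[symmetric] \<eta>(2)[symmetric] by (simp add: add.assoc add.commute add.left_commute)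
    then show ?thesis using h(1)[of n] by simp
  qed
  have h0: "(\<lambda>n. h n * c) \<longlonglongrightarrow> 0"
    unfolding h_def using tendsto_mult_right_zero[OF LIMSEQ_inverse_real_of_nat, of "e / 3 * c"]
    by (simp add: field_simps)
  have lim: "y \<longlonglongrightarrow> x" if "\<And>n. dist x (y n) \<le> h n * c" for y
    by (rule metric_tendsto_imp_tendsto[OF h0])
       (use that in \<open>auto intro!: always_eventually simp: dist_commute intro: order_trans[OF _ abs_ge_self]\<close>)
  have cont: "isCont (pdiff k (pdiff l f)) x" if "k \<in> Basis" "l \<in> Basis" for k l
    using smooth_on_continuous[OF smooth_on_pdiff[OF smooth_on_pdiff[OF S(2)]]] that S(1,3)
    by (simp add: continuous_on_eq_continuous_at)
  have "(\<lambda>n. pdiff j (pdiff i f) (\<xi> n)) \<longlonglongrightarrow> pdiff j (pdiff i f) x"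
       "(\<lambda>n. pdiff i (pdiff j f) (\<eta> n)) \<longlonglongrightarrow> pdiff i (pdiff j f) x"
    using isCont_tendsto_compose[OF cont lim] \<xi>(1) \<eta>(1) ij by auto
  then show ?thesis using LIMSEQ_unique by (simp add: eq) blast
qed

section \<open>Flat functions and bumps supported on boxes\<close>

definition flat_exp :: "nat \<Rightarrow> real \<Rightarrow> real \<Rightarrow> real" where
  "flat_exp n c x = (if x > 0 then exp (- c / x) / x ^ n else 0)"

lemma flat_exp_tendsto_0:
  assumes "c > 0"
  shows "((flat_exp n c) \<longlongrightarrow> 0) (at 0)"
proof -
  have at_top: "LIM x at_right 0. c / x :> at_top"
    using filterlim_tendsto_pos_mult_at_top[OF tendsto_const assms filterlim_inverse_at_top_right]
    by (simp add: divide_inverse)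
  \<comment> \<open>In the variable \<open>c / x\<close>, which tends to infinity, this is the decay
    of a power against the exponential.\<close>
  have "((\<lambda>x. inverse (c ^ n) * ((c / x) ^ n / exp (c / x))) \<longlongrightarrow> 0) (at_right 0)"
    by (rule tendsto_mult_right_zero[OF filterlim_compose[OF tendsto_power_div_exp_0 at_top]])
  then have "((flat_exp n c) \<longlongrightarrow> 0) (at_right 0)"
    by (rule Lim_transform_eventually)
       (use assms in \<open>auto simp: flat_exp_def eventually_at_right_field exp_minus field_simps intro!: exI[of _ 1]\<close>)
  moreover have "((flat_exp n c) \<longlongrightarrow> 0) (at_left 0)"
    by (rule Lim_transform_eventually[OF tendsto_const])
       (auto simp: flat_exp_def eventually_at_left_field intro!: exI[of _ "-1"])
  ultimately show ?thesis by (simp add: filterlim_split_at)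
qed

lemma flat_exp_DERIV:
  assumes "c > 0"
  shows "(flat_exp n c has_real_derivative c * flat_exp (n + 2) c x + (- real n) * flat_exp (n + 1) c x) (at x)"
proof -
  consider "x > 0" | "x < 0" | "x = 0" by linarith
  then show ?thesis
  proof cases
    case 1
    have "((\<lambda>x. exp (- c / x) / x ^ n) has_real_derivative c * flat_exp (n + 2) c x + (- real n) * flat_exp (n + 1) c x) (at x)"
    proof (rule DERIV_cong)
      show "((\<lambda>x. exp (- c / x) / x ^ n) has_real_derivative
          (exp (- c / x) * (c / x\<^sup>2) * x ^ n - exp (- c / x) * (real n * x ^ (n - 1))) / (x ^ n * x ^ n)) (at x)"
        using 1 by (auto intro!: derivative_eq_intros simp: power2_eq_square)
      show "(exp (- c / x) * (c / x\<^sup>2) * x ^ n - exp (- c / x) * (real n * x ^ (n - 1))) / (x ^ n * x ^ n)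
          = c * flat_exp (n + 2) c x + (- real n) * flat_exp (n + 1) c x"
        using 1 by (cases n) (auto simp: flat_exp_def field_simps power2_eq_square)
    qed
    then show ?thesis
      by (rule DERIV_cong_ev[THEN iffD1, rotated -1, OF _ refl _ refl])
         (use 1 in \<open>auto simp: flat_exp_def eventually_nhds intro!: exI[of _ "{0<..}"]\<close>)
  next
    case 2
    have "((\<lambda>x. 0) has_real_derivative c * flat_exp (n + 2) c x + (- real n) * flat_exp (n + 1) c x) (at x)"
      using 2 by (simp add: flat_exp_def)
    then show ?thesis
      by (rule DERIV_cong_ev[THEN iffD1, rotated -1, OF _ refl _ refl])
         (use 2 in \<open>auto simp: flat_exp_def eventually_nhds intro!: exI[of _ "{..<0}"]\<close>)
  next
    case 3
    \<comment> \<open>The difference quotient at 0 of the function with exponent \<open>n\<close> is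
      the function with exponent \<open>n + 1\<close>.\<close>
    have "((\<lambda>h. (flat_exp n c (0 + h) - flat_exp n c 0) / h) \<longlongrightarrow> 0) (at 0)"
      by (rule Lim_transform_eventually[OF flat_exp_tendsto_0[OF assms, of "n + 1"]])
         (auto simp: flat_exp_def intro!: always_eventually)
    then show ?thesis by (simp add: 3 DERIV_def) (simp add: flat_exp_def)
  qed
qed

text \<open>Affine arguments \<open>p \<bullet> v + d\<close> are built into the generators, so that
  cutoffs in all directions and their derivatives stay in one algebra.\<close>

lemma flat_exp_alg_smooth:
  fixes f :: "'a::euclidean_space \<Rightarrow> real"
  assumes "alg_gen {\<lambda>p. flat_exp n c (p \<bullet> v + d) | n c v d. c > 0} f"
  shows "smooth_on UNIV f"
proof (rule alg_gen_smooth[OF _ _ _ assms])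
  have D: "((\<lambda>p. flat_exp n c (p \<bullet> v + d)) has_derivative
      (\<lambda>w. (c * flat_exp (n + 2) c (p \<bullet> v + d) + (- real n) * flat_exp (n + 1) c (p \<bullet> v + d)) * (w \<bullet> v))) (at p)"
    if "c > 0" for n c d and v p :: 'a
    by (rule has_derivative_compose[where f = "\<lambda>p. p \<bullet> v + d" and f' = "\<lambda>w. w \<bullet> v",
            OF _ flat_exp_DERIV[OF that, unfolded has_field_derivative_def]])
       (auto intro!: derivative_eq_intros)
  let ?B = "{\<lambda>p::'a. flat_exp n c (p \<bullet> v + d) | n c v d. c > 0}"
  show "f differentiable (at x)" if "f \<in> ?B" for f x
    using that D unfolding differentiable_def by blast
  show "\<exists>g. alg_gen ?B g \<and> (\<forall>x\<in>UNIV. pdiff i f x = g x)" if fB: "f \<in> ?B" for f i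
  proof -
    obtain n c v d where f: "f = (\<lambda>p. flat_exp n c (p \<bullet> v + d))" "c > 0" using fB by auto
    have "alg_gen ?B (\<lambda>p. (c * flat_exp (n + 2) c (p \<bullet> v + d) + (- real n) * flat_exp (n + 1) c (p \<bullet> v + d)) * (i \<bullet> v))"
      by (intro alg_mult alg_add alg_const alg_base) (use f(2) in blast)+
    then show ?thesis using pdiff_eqI[OF D[OF f(2)]] f(1) by blast
  qed
qed simp

lemma alg_prod: "(\<And>j. j \<in> J \<Longrightarrow> alg_gen B (f j)) \<Longrightarrow> alg_gen B (\<lambda>x. \<Prod>j\<in>J. f j x)"
proof (induction J rule: infinite_finite_induct)
  case (insert j J)
  then show ?case by (simp add: alg_mult)
qed (auto intro: alg_const)

text \<open>Nonzero exactly on the open box, and convergent to the indicator of the box as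
  \<open>c\<close> tends to 0: box indicators become limits of test functions without any
  convolution.\<close>

definition bump :: "real \<Rightarrow> 'a::euclidean_space \<Rightarrow> 'a \<Rightarrow> 'a \<Rightarrow> real" where
  "bump c a b p = (\<Prod>i\<in>Basis. flat_exp 0 c (p \<bullet> i - a \<bullet> i) * flat_exp 0 c (b \<bullet> i - p \<bullet> i))"

lemma bump_smooth: "c > 0 \<Longrightarrow> smooth_on UNIV (bump c a b)"
proof -
  assume c: "c > 0"
  have "flat_exp 0 c (p \<bullet> i - a \<bullet> i) = flat_exp 0 c (p \<bullet> i + (- (a \<bullet> i)))"
       "flat_exp 0 c (b \<bullet> i - p \<bullet> i) = flat_exp 0 c (p \<bullet> (- i) + b \<bullet> i)" for p i :: 'a
    by (simp_all add: algebra_simps)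
  then have "bump c a b = (\<lambda>p. \<Prod>i\<in>Basis. flat_exp 0 c (p \<bullet> i + (- (a \<bullet> i))) * flat_exp 0 c (p \<bullet> (- i) + b \<bullet> i))"
    by (simp add: bump_def fun_eq_iff)
  moreover have "smooth_on UNIV (\<lambda>p. \<Prod>i\<in>Basis. flat_exp 0 c (p \<bullet> i + (- (a \<bullet> i))) * flat_exp 0 c (p \<bullet> (- i) + b \<bullet> i))"
    by (rule flat_exp_alg_smooth, intro alg_prod alg_mult alg_base; use c in blast)
  ultimately show ?thesis by metis
qed

lemma bump_nonzero_iff: "bump c a b p \<noteq> 0 \<longleftrightarrow> p \<in> box a b"
  by (auto simp: bump_def flat_exp_def box_def)

lemma bump_bounds:
  assumes "c \<ge> 0" shows "0 \<le> bump c a b p" "bump c a b p \<le> 1"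
proof -
  have *: "0 \<le> flat_exp 0 c x" "flat_exp 0 c x \<le> 1" for x using assms by (auto simp: flat_exp_def)
  show "0 \<le> bump c a b p" unfolding bump_def by (intro prod_nonneg mult_nonneg_nonneg *)
  show "bump c a b p \<le> 1" unfolding bump_def by (intro prod_le_1 conjI mult_nonneg_nonneg mult_le_one *)
qed

lemma bump_tendsto: "(\<lambda>n. bump (1 / real (Suc n)) a b p) \<longlonglongrightarrow> indicator (box a b) p"
proof (cases "p \<in> box a b")
  case True
  have "(\<lambda>n. flat_exp 0 (1 / real (Suc n)) x) \<longlonglongrightarrow> 1" if "x > 0" for x
  proof -
    have "(\<lambda>n. inverse (real (Suc n)) * (- 1 / x)) \<longlonglongrightarrow> 0"
      by (rule tendsto_mult_left_zero[OF LIMSEQ_inverse_real_of_nat])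
    from tendsto_exp[OF this] show ?thesis using that by (simp add: flat_exp_def field_simps)
  qed
  then have "(\<lambda>n. bump (1 / real (Suc n)) a b p) \<longlonglongrightarrow> (\<Prod>i\<in>(Basis::'a set). 1 * 1)"
    unfolding bump_def using True by (intro tendsto_prod tendsto_mult) (auto simp: box_def)
  then show ?thesis using True by simp
next
  case False
  then have "bump c a b p = 0" for c using bump_nonzero_iff by blast
  then show ?thesis using False by simp
qed

text \<open>Open boxes are stable under intersection and generate the Borel sets, and the sets over
  which \<open>h\<close> has integral zero form a Dynkin system containing them; \<open>tot\<close>
  is what closes it under complements.\<close>

lemma integral_boxes_zero_imp_AE_zero:
  fixes h :: "'a::euclidean_space \<Rightarrow> real"
  assumes int: "integrable lborel h"
    and box0: "\<And>a b. (\<integral>x. indicator (box a b) x * h x \<partial>lborel) = 0"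
    and tot: "(\<integral>x. h x \<partial>lborel) = 0"
  shows "AE x in lborel. h x = 0"
proof (rule sigma_finite_measure.density_zero[OF lborel.sigma_finite_measure_axioms int])
  fix A :: "'a set" assume "A \<in> sets lborel"
  then have A: "A \<in> sigma_sets UNIV (range (\<lambda>(a, b). box a b))" by (simp add: borel_eq_box)
  have I: "integrable lborel (\<lambda>x. indicator A x * h x)" if "A \<in> sets borel" for A
    using integrable_mult_indicator[of A lborel h] that int by simp
  have "(\<integral>x. indicator A x * h x \<partial>lborel) = 0"
  proof -
    have "Int_stable (range (\<lambda>(a, b). box a b :: 'a set))"
      by (force simp: Int_stable_def box_Int_box)
    moreover have "range (\<lambda>(a, b). box a b :: 'a set) \<subseteq> Pow UNIV" by auto
    ultimately show ?thesis using A
  proof (induction rule: sigma_sets_induct_disjoint)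
    case (basic A)
    then show ?case using box0 by auto
  next
    case empty
    then show ?case by simp
  next
    case (compl A)
    then have "A \<in> sets borel" by (simp add: borel_eq_box)
    then have "(\<integral>x. h x - indicator A x * h x \<partial>lborel) = 0"
      using compl I int tot by (subst Bochner_Integration.integral_diff) auto
    moreover have "indicator (UNIV - A) x * h x = h x - indicator A x * h x" for x
      by (auto simp: indicator_def)
    ultimately show ?case by simp
  next
    case (union F)
    have F: "F i \<in> sets borel" for i using union by (auto simp: borel_eq_box)
    have "set_lebesgue_integral lborel (\<Union>i. F i) h = (\<Sum>i. set_lebesgue_integral lborel (F i) h)"
    proof (rule lebesgue_integral_countable_add)
      show "set_integrable lborel (\<Union>i. F i) h"
        using I[of "\<Union>i. F i"] F by (auto simp: set_integrable_def)
    qed (use F union in \<open>auto simp: disjoint_family_on_def\<close>)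
    then show ?case using union by (simp add: set_lebesgue_integral_def)
  qed
  qed
  then show "set_lebesgue_integral lborel A h = 0" by (simp add: set_lebesgue_integral_def)
qed

section \<open>Weak gradients on the cylinder\<close>

text \<open>Together with \<open>weak_pd\<close>, separates \<open>has_weak_grad\<close> into
  conditions on single functions, so that each component of a gradient can be treated alone.\<close>

definition loc_int :: "(real \<times> real \<times> real \<Rightarrow> real) \<Rightarrow> bool" where
  "loc_int F \<longleftrightarrow> F \<in> borel_measurable lborel \<and>
    (\<forall>K. compact K \<and> K \<subseteq> coord_dom \<longrightarrow> set_integrable lborel K F)"

definition weak_pd :: "real \<times> real \<times> real \<Rightarrow> (real \<times> real \<times> real \<Rightarrow> real) \<Rightarrow>
    (real \<times> real \<times> real \<Rightarrow> real) \<Rightarrow> bool" where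
  "weak_pd v F g \<longleftrightarrow> (\<forall>\<zeta>. test_fn \<zeta> \<longrightarrow>
    (\<integral>p. F p * pdiff v \<zeta> p \<partial>lborel) = - (\<integral>p. g p * \<zeta> p \<partial>lborel))"

definition pull :: "(real \<Rightarrow> real^3 \<Rightarrow> real) \<Rightarrow> real \<times> real \<times> real \<Rightarrow> real" where
  "pull f = (\<lambda>(t, \<theta>, \<phi>). f t (sph \<theta> \<phi>))"

abbreviation "grad_of a b c \<equiv> (\<lambda>t \<theta> \<phi>. (a (t, \<theta>, \<phi>), b (t, \<theta>, \<phi>), c (t, \<theta>, \<phi>)))"

lemma grad_of_cases: "\<exists>a b c. G = grad_of a b c"
  by (rule exI[of _ "\<lambda>(t, \<theta>, \<phi>). fst (G t \<theta> \<phi>)"], rule exI[of _ "\<lambda>(t, \<theta>, \<phi>). fst (snd (G t \<theta> \<phi>))"],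
      rule exI[of _ "\<lambda>(t, \<theta>, \<phi>). snd (snd (G t \<theta> \<phi>))"]) (simp add: fun_eq_iff)

lemma has_weak_grad_iff:
  "has_weak_grad f (grad_of a b c) \<longleftrightarrow> loc_int (pull f) \<and> loc_int a \<and> loc_int b \<and> loc_int c \<and>
    weak_pd (1, 0, 0) (pull f) a \<and> weak_pd (0, 1, 0) (pull f) b \<and> weak_pd (0, 0, 1) (pull f) c"
proof -
  have eta: "(\<lambda>(t, \<theta>, \<phi>). k (t, \<theta>, \<phi>)) = k" for k :: "real \<times> real \<times> real \<Rightarrow> real"
    by (simp add: fun_eq_iff)
  show ?thesis
    unfolding has_weak_grad_def Let_def fst_conv snd_conv eta loc_int_def weak_pd_def pull_def pdiff_def
    by blast
qed

lemma test_fn_support: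
  assumes "test_fn \<zeta>"
  obtains K where "compact K" "K \<subseteq> coord_dom" "\<And>p. p \<notin> K \<Longrightarrow> \<zeta> p = 0" "\<And>p v. p \<notin> K \<Longrightarrow> pdiff v \<zeta> p = 0"
proof -
  define K where "K = closure {p. \<zeta> p \<noteq> 0}"
  have z: "\<zeta> p = 0" if "p \<notin> K" for p using that closure_subset[of "{p. \<zeta> p \<noteq> 0}"] by (auto simp: K_def)
  have "pdiff v \<zeta> p = 0" if "p \<notin> K" for p v
  proof -
    \<comment> \<open>Off the closed support the function vanishes on an open set, so its
      derivatives vanish as well.\<close>
    have "open (- K)" unfolding K_def by (rule open_Compl[OF closed_closure])
    then have "pdiff v \<zeta> p = pdiff v (\<lambda>_. 0) p"
      by (rule pdiff_transform_open(2)) (use z that in auto)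
    then show ?thesis by (simp add: pdiff_def)
  qed
  moreover have "compact K" "K \<subseteq> coord_dom" using assms by (simp_all add: test_fn_def K_def)
  ultimately show thesis using z that[of K] by blast
qed

lemma loc_int_mult_integrable:
  assumes "loc_int F" "compact K" "K \<subseteq> coord_dom" "continuous_on UNIV k" "\<And>p. p \<notin> K \<Longrightarrow> k p = 0"
  shows "integrable lborel (\<lambda>p. F p * k p)"
proof -
  obtain M where M: "\<And>p. p \<in> K \<Longrightarrow> \<bar>k p\<bar> \<le> M"
    using compact_imp_bounded[OF compact_continuous_image[OF continuous_on_subset[OF assms(4)] assms(2)]]
    by (auto simp: bounded_iff)
  have "integrable lborel (\<lambda>p. M * (indicator K p * F p))"
    using assms(1-3) by (auto simp: loc_int_def set_integrable_def)
  then show ?thesis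
  proof (rule Bochner_Integration.integrable_bound)
    have "k \<in> borel_measurable borel" using assms(4) by (rule borel_measurable_continuous_onI)
    then show "(\<lambda>p. F p * k p) \<in> borel_measurable lborel"
      using assms(1) by (auto simp: loc_int_def)
    show "AE p in lborel. norm (F p * k p) \<le> norm (M * (indicator K p * F p))"
    proof (intro always_eventually allI)
      fix p show "norm (F p * k p) \<le> norm (M * (indicator K p * F p))"
        using assms(5)[of p] M[of p] mult_right_mono[of "\<bar>k p\<bar>" "\<bar>M\<bar>" "\<bar>F p\<bar>"]
        by (cases "p \<in> K") (auto simp: abs_mult mult.commute)
    qed
  qed
qed

lemma test_fn_integrable:
  assumes "loc_int F" "test_fn \<zeta>"
  shows "integrable lborel (\<lambda>p. F p * \<zeta> p)" "v \<in> Basis \<Longrightarrow> integrable lborel (\<lambda>p. F p * pdiff v \<zeta> p)"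
proof -
  obtain K where K: "compact K" "K \<subseteq> coord_dom" "\<And>p. p \<notin> K \<Longrightarrow> \<zeta> p = 0" "\<And>p v. p \<notin> K \<Longrightarrow> pdiff v \<zeta> p = 0"
    using test_fn_support[OF assms(2)] by blast
  have s: "smooth_on UNIV \<zeta>" using assms(2) by (simp add: test_fn_def)
  show "integrable lborel (\<lambda>p. F p * \<zeta> p)"
    using loc_int_mult_integrable[OF assms(1) K(1,2) smooth_on_continuous[OF s] K(3)] .
  show "v \<in> Basis \<Longrightarrow> integrable lborel (\<lambda>p. F p * pdiff v \<zeta> p)"
    using loc_int_mult_integrable[OF assms(1) K(1,2) smooth_on_continuous[OF smooth_on_pdiff[OF s]] K(4)] by blast
qed

lemma loc_int_lincomb:
  assumes "loc_int F" "loc_int F'"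
  shows "loc_int (\<lambda>p. a * F p + b * F' p)"
  using assms by (auto simp: loc_int_def intro!: set_integral_add(1))

lemma weak_pd_lincomb:
  assumes "loc_int F" "loc_int F'" "loc_int g" "loc_int g'" "weak_pd v F g" "weak_pd v F' g'" "v \<in> Basis"
  shows "weak_pd v (\<lambda>p. a * F p + b * F' p) (\<lambda>p. a * g p + b * g' p)"
  unfolding weak_pd_def
proof (intro allI impI)
  fix \<zeta> assume \<zeta>: "test_fn \<zeta>"
  have "(\<integral>p. (a * F p + b * F' p) * pdiff v \<zeta> p \<partial>lborel)
      = (\<integral>p. a * (F p * pdiff v \<zeta> p) + b * (F' p * pdiff v \<zeta> p) \<partial>lborel)"
    by (simp add: algebra_simps)
  also have "\<dots> = a * (\<integral>p. F p * pdiff v \<zeta> p \<partial>lborel) + b * (\<integral>p. F' p * pdiff v \<zeta> p \<partial>lborel)"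
    using test_fn_integrable(2)[OF _ \<zeta> assms(7)] assms by (subst Bochner_Integration.integral_add) auto
  also have "\<dots> = - (a * (\<integral>p. g p * \<zeta> p \<partial>lborel) + b * (\<integral>p. g' p * \<zeta> p \<partial>lborel))"
    using assms \<zeta> by (simp add: weak_pd_def)
  also have "\<dots> = - (\<integral>p. a * (g p * \<zeta> p) + b * (g' p * \<zeta> p) \<partial>lborel)"
    using test_fn_integrable(1)[OF _ \<zeta>] assms by (subst Bochner_Integration.integral_add) auto
  finally show "(\<integral>p. (a * F p + b * F' p) * pdiff v \<zeta> p \<partial>lborel) = - (\<integral>p. (a * g p + b * g' p) * \<zeta> p \<partial>lborel)"
    by (simp add: algebra_simps)
qed

lemma has_weak_grad_lincomb:
  assumes "has_weak_grad f (grad_of a b c)" "has_weak_grad f' (grad_of a' b' c')"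
  shows "has_weak_grad (\<lambda>t \<omega>. x * f t \<omega> + y * f' t \<omega>)
    (grad_of (\<lambda>p. x * a p + y * a' p) (\<lambda>p. x * b p + y * b' p) (\<lambda>p. x * c p + y * c' p))"
proof -
  have "pull (\<lambda>t \<omega>. x * f t \<omega> + y * f' t \<omega>) = (\<lambda>p. x * pull f p + y * pull f' p)"
    by (auto simp: pull_def fun_eq_iff)
  then show ?thesis
    using assms has_weak_grad_iff[of "\<lambda>t \<omega>. x * f t \<omega> + y * f' t \<omega>" "\<lambda>p. x * a p + y * a' p"
        "\<lambda>p. x * b p + y * b' p" "\<lambda>p. x * c p + y * c' p"] unfolding has_weak_grad_iff
    by (auto intro!: loc_int_lincomb weak_pd_lincomb simp: Basis_prod_def zero_prod_def)
qed

lemma compact_in_coord_boxes: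
  assumes "compact K" "K \<subseteq> coord_dom"
  obtains T \<epsilon> where "T > 0" "0 < \<epsilon>" "\<epsilon> < pi / 2" "K \<subseteq> {- T..T} \<times> {\<epsilon>..pi - \<epsilon>} \<times> {- T..T}"
proof (cases "K = {}")
  case True
  then show thesis using that[of 1 1] pi_gt3 by auto
next
  case False
  obtain R where R: "\<And>p. p \<in> K \<Longrightarrow> norm p \<le> R" using compact_imp_bounded[OF assms(1)] by (auto simp: bounded_iff)
  have c: "continuous_on K (\<lambda>p. sin (fst (snd p)))" by (intro continuous_intros)
  obtain q where q: "q \<in> K" "\<And>p. p \<in> K \<Longrightarrow> sin (fst (snd q)) \<le> sin (fst (snd p))"
    using continuous_attains_inf[OF assms(1) False c] by auto
  \<comment> \<open>The minimum of the sine of the polar angle over \<open>K\<close>. Since both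
    \<open>\<theta>\<close> and \<open>pi - \<theta>\<close> are at least
    \<open>sin \<theta>\<close>, it measures the distance of \<open>K\<close> from both
    poles.\<close>
  define s where "s = sin (fst (snd q))"
  have s: "s > 0" using q(1) assms(2) by (auto simp: s_def coord_dom_def intro!: sin_gt_zero)
  define \<epsilon> where "\<epsilon> = min (s / 2) 1"
  have e: "0 < \<epsilon>" "\<epsilon> < pi / 2" "\<epsilon> < s" using s pi_gt3 by (auto simp: \<epsilon>_def)
  have "p \<in> {- (\<bar>R\<bar> + 1)..\<bar>R\<bar> + 1} \<times> {\<epsilon>..pi - \<epsilon>} \<times> {- (\<bar>R\<bar> + 1)..\<bar>R\<bar> + 1}" if p: "p \<in> K" for p
  proof -
    obtain t \<theta> \<phi> where [simp]: "p = (t, \<theta>, \<phi>)" by (cases p)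
    have th: "0 < \<theta>" "\<theta> < pi" using p assms(2) by (auto simp: coord_dom_def)
    have "s \<le> sin \<theta>" using q(2)[OF p] by (simp add: s_def)
    moreover have "sin \<theta> \<le> \<theta>" using th sin_x_le_x by simp
    moreover have "sin \<theta> \<le> pi - \<theta>" using th sin_x_le_x[of "pi - \<theta>"] by simp
    moreover have "\<bar>t\<bar> \<le> R" using R[OF p] norm_fst_le[of t "(\<theta>, \<phi>)"] by simp
    moreover have "\<bar>\<phi>\<bar> \<le> R" using R[OF p] norm_snd_le[of "(\<theta>, \<phi>)" t] norm_snd_le[of \<phi> \<theta>] by simp
    ultimately show ?thesis using e by auto
  qed
  then have "K \<subseteq> {- (\<bar>R\<bar> + 1)..\<bar>R\<bar> + 1} \<times> {\<epsilon>..pi - \<epsilon>} \<times> {- (\<bar>R\<bar> + 1)..\<bar>R\<bar> + 1}" by blast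
  then show thesis by (intro that[of "\<bar>R\<bar> + 1" \<epsilon>]) (use e in auto)
qed

text \<open>Bumps converge boundedly to the indicator of their box, so \<open>h\<close> has integral
  zero over every open box whose closed box lies in the chart. This is enough on each box of a
  countable exhaustion of \<open>coord_dom\<close>.\<close>

lemma fundamental_lemma_variations:
  assumes "loc_int h" "\<And>\<zeta>. test_fn \<zeta> \<Longrightarrow> (\<integral>p. h p * \<zeta> p \<partial>lborel) = 0"
  shows "AE p in lborel. p \<in> coord_dom \<longrightarrow> h p = 0"
proof -
  have hm: "h \<in> borel_measurable borel" using assms(1) by (simp add: loc_int_def)
  have box0: "(\<integral>p. indicator (box a b) p * h p \<partial>lborel) = 0" if sub: "cbox a b \<subseteq> coord_dom" for a b
  proof -
    have "(\<lambda>n. \<integral>p. h p * bump (1 / real (Suc n)) a b p \<partial>lborel) \<longlonglongrightarrow> (\<integral>p. h p * indicator (box a b) p \<partial>lborel)"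
    proof (rule integral_dominated_convergence[where w = "\<lambda>p. \<bar>indicator (cbox a b) p * h p\<bar>"])
      have bm: "bump (1 / real (Suc n)) a b \<in> borel_measurable borel" for n
        by (intro borel_measurable_continuous_onI smooth_on_continuous bump_smooth) simp
      show "(\<lambda>p. h p * bump (1 / real (Suc n)) a b p) \<in> borel_measurable lborel" for n
        using hm bm by simp
      show "(\<lambda>p. h p * indicator (box a b) p) \<in> borel_measurable lborel" using hm by simp
      show "integrable lborel (\<lambda>p. \<bar>indicator (cbox a b) p * h p\<bar>)"
        using assms(1) sub compact_cbox by (auto simp: loc_int_def set_integrable_def intro!: integrable_abs)
      show "AE p in lborel. (\<lambda>n. h p * bump (1 / real (Suc n)) a b p) \<longlonglongrightarrow> h p * indicator (box a b) p"
        by (intro always_eventually allI tendsto_mult_left bump_tendsto)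
      show "AE p in lborel. norm (h p * bump (1 / real (Suc n)) a b p) \<le> \<bar>indicator (cbox a b) p * h p\<bar>" for n
      proof (intro always_eventually allI)
        fix p
        show "norm (h p * bump (1 / real (Suc n)) a b p) \<le> \<bar>indicator (cbox a b) p * h p\<bar>"
        proof (cases "p \<in> box a b")
          case True
          then have "p \<in> cbox a b" using box_subset_cbox by blast
          then show ?thesis using bump_bounds[of "1 / real (Suc n)" a b p]
            by (simp add: abs_mult mult_left_le)
        next
          case False
          then have "bump (1 / real (Suc n)) a b p = 0" using bump_nonzero_iff by blast
          then show ?thesis by simp
        qed
      qed
    qed
    moreover have "(\<integral>p. h p * bump (1 / real (Suc n)) a b p \<partial>lborel) = 0" for n
    proof (rule assms(2))
      have "{p. bump (1 / real (Suc n)) a b p \<noteq> 0} = box a b" using bump_nonzero_iff by blast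
      moreover have "closure (box a b) \<subseteq> cbox a b" by (rule closure_minimal[OF box_subset_cbox closed_cbox])
      moreover have "compact (closure (box a b))" using bounded_box by (simp add: compact_closure)
      ultimately show "test_fn (bump (1 / real (Suc n)) a b)"
        using sub bump_smooth[of "1 / real (Suc n)" a b] unfolding test_fn_def by auto
    qed
    ultimately show ?thesis using LIMSEQ_unique[OF _ tendsto_const] by (simp add: mult.commute)
  qed
  have AEbox: "AE p in lborel. indicator (box A B) p * h p = 0" if sub: "cbox A B \<subseteq> coord_dom" for A B
  proof (rule integral_boxes_zero_imp_AE_zero)
    have i: "integrable lborel (\<lambda>p. indicator (cbox A B) p * h p)"
      using assms(1) sub compact_cbox by (auto simp: loc_int_def set_integrable_def)
    have "integrable lborel (\<lambda>p. indicator (box A B) p * (indicator (cbox A B) p * h p))"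
      using integrable_mult_indicator[OF _ i, of "box A B"] by simp
    moreover have "indicator (box A B) p * (indicator (cbox A B) p * h p) = indicator (box A B) p * h p" for p
      using box_subset_cbox[of A B] by (auto simp: indicator_def)
    ultimately show "integrable lborel (\<lambda>p. indicator (box A B) p * h p)" by simp
    show "(\<integral>p. indicator (box A B) p * h p \<partial>lborel) = 0" using box0[OF sub] .
    show "(\<integral>p. indicator (box a b) p * (indicator (box A B) p * h p) \<partial>lborel) = 0" for a b
    proof -
      obtain c d where cd: "box a b \<inter> box A B = box c d" using box_Int_box by blast
      show ?thesis
      proof (cases "box c d = {}")
        case True
        then have "(\<lambda>p. indicator (box a b) p * (indicator (box A B) p * h p)) = (\<lambda>_. 0)"
          using cd by (auto simp: indicator_def fun_eq_iff)
        then show ?thesis by (simp only: Bochner_Integration.integral_zero)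
      next
        case False
        \<comment> \<open>Only for a nonempty open box is the closed box its closure; this is what
          puts \<open>cbox c d\<close> inside the chart.\<close>
        have "cbox c d = closure (box c d)" using closure_box[OF False] by simp
        also have "\<dots> \<subseteq> cbox A B" using cd box_subset_cbox[of A B] by (intro closure_minimal) auto
        finally have "(\<integral>p. indicator (box c d) p * h p \<partial>lborel) = 0" using box0 sub by blast
        moreover have "(\<lambda>p. indicator (box a b) p * (indicator (box A B) p * h p)) = (\<lambda>p. indicator (box c d) p * h p)"
          using cd[symmetric] by (auto simp: indicator_def fun_eq_iff)
        ultimately show ?thesis by (simp only:)
      qed
    qed
  qed
  \<comment> \<open>Countably many boxes exhausting \<open>coord_dom\<close>. The last coordinate is
    unbounded because the chart is the periodic cover in \<phi>.\<close>
  define A B where "A n = (- real (Suc n), 1 / real (Suc n), - real (Suc n))"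
    and "B n = (real (Suc n), pi - 1 / real (Suc n), real (Suc n))" for n
  have "AE p in lborel. \<forall>n. indicator (box (A n) (B n)) p * h p = 0"
  proof (subst AE_all_countable, intro allI AEbox)
    fix n show "cbox (A n) (B n) \<subseteq> coord_dom"
    proof
      fix p assume p: "p \<in> cbox (A n) (B n)"
      obtain t \<theta> \<phi> where [simp]: "p = (t, \<theta>, \<phi>)" by (cases p)
      have "1 / real (Suc n) \<le> \<theta>" "\<theta> \<le> pi - 1 / real (Suc n)"
        using p by (auto simp: A_def B_def cbox_Pair_eq)
      moreover have "1 / real (Suc n) > 0" by simp
      ultimately have "0 < \<theta>" "\<theta> < pi" by linarith+
      then show "p \<in> coord_dom" by (simp add: coord_dom_def)
    qed
  qed
  then show ?thesis
  proof (rule AE_mp, intro always_eventually allI impI)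
    fix p assume *: "\<forall>n. indicator (box (A n) (B n)) p * h p = 0" and p: "p \<in> coord_dom"
    obtain t \<theta> \<phi> where [simp]: "p = (t, \<theta>, \<phi>)" by (cases p)
    have th: "0 < \<theta>" "\<theta> < pi" using p by (auto simp: coord_dom_def)
    obtain n where n: "real n > max \<bar>t\<bar> \<bar>\<phi>\<bar>" "real n > max (1 / \<theta>) (1 / (pi - \<theta>))"
      using reals_Archimedean2[of "max (max \<bar>t\<bar> \<bar>\<phi>\<bar>) (max (1 / \<theta>) (1 / (pi - \<theta>)))"] by auto
    have "1 / real (Suc n) < \<theta>" "1 / real (Suc n) < pi - \<theta>"
      using n th by (auto simp: field_simps)
    then have "p \<in> box (A n) (B n)" using n by (auto simp: A_def B_def box_def Basis_prod_def)
    then show "h p = 0" using * by (metis indicator_simps(1) mult_1)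
  qed
qed

text \<open>The difference of two weak derivatives of one function annihilates every test function.
  This makes the arbitrary choice in \<open>wgrad\<close> harmless almost everywhere on the
  chart.\<close>

lemma weak_pd_unique:
  assumes "loc_int g" "loc_int g'" "weak_pd v F g" "weak_pd v F g'"
  shows "AE p in lborel. p \<in> coord_dom \<longrightarrow> g p = g' p"
proof -
  have "AE p in lborel. p \<in> coord_dom \<longrightarrow> 1 * g p + (- 1) * g' p = 0"
  proof (rule fundamental_lemma_variations[OF loc_int_lincomb[OF assms(1,2)]])
    fix \<zeta> assume \<zeta>: "test_fn \<zeta>"
    have "(\<integral>p. g p * \<zeta> p \<partial>lborel) = (\<integral>p. g' p * \<zeta> p \<partial>lborel)" using assms(3,4) \<zeta> by (simp add: weak_pd_def)
    then show "(\<integral>p. (1 * g p + - 1 * g' p) * \<zeta> p \<partial>lborel) = 0"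
      using test_fn_integrable(1)[OF _ \<zeta>] assms(1,2) by (simp add: left_diff_distrib)
  qed
  then show ?thesis by (rule AE_mp) (auto intro!: always_eventually)
qed

text \<open>By translation invariance of Lebesgue measure every difference quotient of
  \<open>k\<close> has integral zero, and the quotients converge to the derivative while staying
  bounded on a fixed ball.\<close>

lemma integral_pdiff_compact_support:
  fixes k :: "'a::euclidean_space \<Rightarrow> real"
  assumes s: "smooth_on UNIV k" and K: "compact K" "\<And>p. p \<notin> K \<Longrightarrow> k p = 0" and i: "i \<in> Basis"
  shows "(\<integral>p. pdiff i k p \<partial>lborel) = 0"
proof -
  obtain R where R: "\<And>p. p \<in> K \<Longrightarrow> norm p \<le> R" "R > 0"
    using bounded_pos[THEN iffD1, OF compact_imp_bounded[OF K(1)]] by auto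
  have c: "continuous_on UNIV (pdiff i k)" by (rule smooth_on_continuous[OF smooth_on_pdiff[OF s i]])
  \<comment> \<open>The steps \<open>h n\<close> are at most 1, so difference quotients live in the
    ball of radius \<open>R + 1\<close> and their mean value points in the one of radius
    \<open>R + 2\<close>.\<close>
  obtain M where "\<forall>p\<in>cball 0 (R + 2). \<bar>pdiff i k p\<bar> \<le> M"
    using compact_imp_bounded[OF compact_continuous_image[OF continuous_on_subset[OF c subset_UNIV] compact_cball[of 0 "R + 2"]]]
    by (auto simp: bounded_iff)
  then have M: "\<bar>pdiff i k p\<bar> \<le> M" if "norm p \<le> R + 2" for p using that by simp
  define h where "h n = 1 / real (Suc n)" for n
  have h: "0 < h n" "h n \<le> 1" for n by (auto simp: h_def)
  have h0: "h \<longlonglongrightarrow> 0" unfolding h_def using LIMSEQ_inverse_real_of_nat by (simp add: divide_inverse)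
  have D: "((\<lambda>s. k (p + s *\<^sub>R i)) has_real_derivative pdiff i k (p + s *\<^sub>R i)) (at s)" for p s
    by (rule has_derivative_comp_curve_pdiff[where g = "\<lambda>s. p + s *\<^sub>R i", OF smooth_on_differentiable[OF s]])
       (auto intro!: derivative_eq_intros simp: has_vector_derivative_def)
  have km: "k \<in> borel_measurable borel" by (intro borel_measurable_continuous_onI smooth_on_continuous s)
  have "integrable lborel (\<lambda>p. indicator K p *\<^sub>R k p)"
    by (rule borel_integrable_compact[OF K(1) continuous_on_subset[OF smooth_on_continuous[OF s]]]) auto
  moreover have "(\<lambda>p. indicator K p *\<^sub>R k p) = k" using K(2) by (auto simp: indicator_def fun_eq_iff)
  ultimately have ki: "integrable lborel k" by simp
  have tr: "integrable lborel (\<lambda>p. k (c + p)) \<and> (\<integral>p. k (c + p) \<partial>lborel) = (\<integral>p. k p \<partial>lborel)" for c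
    using ki km integrable_distr_eq[of "(+) c" lborel borel k] integral_distr[of "(+) c" lborel borel k]
    by (simp add: lborel_distr_plus)
  have "(\<lambda>n. \<integral>p. (k (h n *\<^sub>R i + p) - k p) / h n \<partial>lborel) \<longlonglongrightarrow> (\<integral>p. pdiff i k p \<partial>lborel)"
  proof (rule integral_dominated_convergence[where w = "\<lambda>p. M * indicator (cball 0 (R + 1)) p"])
    show "pdiff i k \<in> borel_measurable lborel" using borel_measurable_continuous_onI[OF c] by simp
    have "continuous_on UNIV (\<lambda>p. k (h n *\<^sub>R i + p))" for n
      by (intro continuous_on_compose2[OF smooth_on_continuous[OF s]] continuous_intros) auto
    then show "(\<lambda>p. (k (h n *\<^sub>R i + p) - k p) / h n) \<in> borel_measurable lborel" for n
      using km borel_measurable_continuous_onI by auto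
    show "integrable lborel (\<lambda>p. M * indicator (cball 0 (R + 1)) p)"
      by (intro integrable_mult_right integrable_real_indicator) (use emeasure_bounded_finite[OF bounded_cball] in auto)
    show "AE p in lborel. (\<lambda>n. (k (h n *\<^sub>R i + p) - k p) / h n) \<longlonglongrightarrow> pdiff i k p"
    proof (intro always_eventually allI)
      fix p
      have "((\<lambda>s. (k (p + (0 + s) *\<^sub>R i) - k (p + 0 *\<^sub>R i)) / s) \<longlongrightarrow> pdiff i k (p + 0 *\<^sub>R i)) (at 0)"
        using D[of p 0] unfolding DERIV_def .
      then have "((\<lambda>s. (k (s *\<^sub>R i + p) - k p) / s) \<longlongrightarrow> pdiff i k p) (at 0)" by (simp add: add.commute)
      moreover have "filterlim h (at 0) sequentially"
        using h0 h(1) by (auto simp: filterlim_at intro!: always_eventually) (metis less_irrefl)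
      ultimately show "(\<lambda>n. (k (h n *\<^sub>R i + p) - k p) / h n) \<longlonglongrightarrow> pdiff i k p" by (rule filterlim_compose)
    qed
    show "AE p in lborel. norm ((k (h n *\<^sub>R i + p) - k p) / h n) \<le> M * indicator (cball 0 (R + 1)) p" for n
    proof (intro always_eventually allI)
      fix p
      show "norm ((k (h n *\<^sub>R i + p) - k p) / h n) \<le> M * indicator (cball 0 (R + 1)) p"
      proof (cases "norm p \<le> R + 1")
        case True
        obtain s where s: "0 < s" "s < h n" "k (p + h n *\<^sub>R i) - k (p + 0 *\<^sub>R i) = (h n - 0) * pdiff i k (p + s *\<^sub>R i)"
          using MVT2[of 0 "h n" "\<lambda>s. k (p + s *\<^sub>R i)" "\<lambda>s. pdiff i k (p + s *\<^sub>R i)"] h(1)[of n] D by blast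
        have "norm (p + s *\<^sub>R i) \<le> norm p + s * 1" using norm_triangle_ineq[of p "s *\<^sub>R i"] s i by simp
        then have "\<bar>pdiff i k (p + s *\<^sub>R i)\<bar> \<le> M" using True s h(2)[of n] by (intro M) linarith
        moreover have "(k (h n *\<^sub>R i + p) - k p) / h n = pdiff i k (p + s *\<^sub>R i)"
          using s(3) h(1)[of n] by (simp add: add.commute)
        ultimately show ?thesis using True by simp
      next
        case False
        have "norm p \<le> norm (h n *\<^sub>R i + p) + h n"
          using norm_triangle_ineq4[of "h n *\<^sub>R i + p" "h n *\<^sub>R i"] i h(1)[of n] by simp
        then have "h n *\<^sub>R i + p \<notin> K" "p \<notin> K" using R(1) False h(2)[of n] by fastforce+
        then show ?thesis using K(2) False by simp
      qed
    qed
  qed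
  moreover have "(\<integral>p. (k (h n *\<^sub>R i + p) - k p) / h n \<partial>lborel) = 0" for n
    using tr[of "h n *\<^sub>R i"] ki by simp
  ultimately have "(\<lambda>n. 0) \<longlonglongrightarrow> (\<integral>p. pdiff i k p \<partial>lborel)" by (simp only:)
  then show ?thesis by (rule LIMSEQ_unique[OF _ tendsto_const])
qed

lemma continuous_loc_int: "continuous_on UNIV F \<Longrightarrow> loc_int F"
  unfolding loc_int_def set_integrable_def
  using borel_measurable_continuous_onI[of F] borel_integrable_compact[OF _ continuous_on_subset[of UNIV F]]
  by simp

text \<open>Integration by parts is the vanishing integral of the derivative of the compactly
  supported product \<open>F p * \<zeta> p\<close>.\<close>

lemma smooth_weak_pd:
  assumes s: "smooth_on UNIV F" and i: "i \<in> Basis"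
  shows "weak_pd i F (pdiff i F)"
  unfolding weak_pd_def
proof (intro allI impI)
  fix \<zeta> assume \<zeta>: "test_fn \<zeta>"
  obtain K where K: "compact K" "K \<subseteq> coord_dom" "\<And>p. p \<notin> K \<Longrightarrow> \<zeta> p = 0" "\<And>p v. p \<notin> K \<Longrightarrow> pdiff v \<zeta> p = 0"
    using test_fn_support[OF \<zeta>] by blast
  have sz: "smooth_on UNIV \<zeta>" using \<zeta> by (simp add: test_fn_def)
  have "(\<integral>p. pdiff i (\<lambda>p. F p * \<zeta> p) p \<partial>lborel) = 0"
    by (rule integral_pdiff_compact_support[OF _ K(1)]) (use s sz i K in \<open>auto intro!: smooth_on_mult\<close>)
  moreover have "pdiff i (\<lambda>p. F p * \<zeta> p) p = F p * pdiff i \<zeta> p + pdiff i F p * \<zeta> p" for p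
    by (intro pdiff_mult smooth_on_differentiable[OF s] smooth_on_differentiable[OF sz]) auto
  ultimately have "(\<integral>p. F p * pdiff i \<zeta> p + pdiff i F p * \<zeta> p \<partial>lborel) = 0" by simp
  then show "(\<integral>p. F p * pdiff i \<zeta> p \<partial>lborel) = - (\<integral>p. pdiff i F p * \<zeta> p \<partial>lborel)"
    using test_fn_integrable[OF _ \<zeta>] i continuous_loc_int[OF smooth_on_continuous[OF s]]
      continuous_loc_int[OF smooth_on_continuous[OF smooth_on_pdiff[OF s i]]] by simp
qed

lemma loc_int_limit:
  assumes "\<And>n. Fn n \<in> borel_measurable lborel" "F \<in> borel_measurable lborel"
    and "AE p in lborel. p \<in> coord_dom \<longrightarrow> (\<lambda>n. Fn n p) \<longlonglongrightarrow> F p"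
    and "\<And>K. compact K \<Longrightarrow> K \<subseteq> coord_dom \<Longrightarrow>
      \<exists>W. set_integrable lborel K W \<and> (AE p in lborel. p \<in> K \<longrightarrow> (\<forall>n. \<bar>Fn n p\<bar> \<le> W p))"
  shows "loc_int F"
  unfolding loc_int_def set_integrable_def
proof (intro conjI allI impI, fact assms(2))
  fix K assume "compact K \<and> K \<subseteq> coord_dom"
  then have K: "compact K" "K \<subseteq> coord_dom" by auto
  obtain W where W: "set_integrable lborel K W" "AE p in lborel. p \<in> K \<longrightarrow> (\<forall>n. \<bar>Fn n p\<bar> \<le> W p)"
    using assms(4)[OF K] by blast
  have Ks: "K \<in> sets borel" using K(1) by (simp add: borel_compact)
  show "integrable lborel (\<lambda>p. indicator K p *\<^sub>R F p)"
  proof (rule Bochner_Integration.integrable_bound[OF W(1)[unfolded set_integrable_def]])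
    show "(\<lambda>p. indicator K p *\<^sub>R F p) \<in> borel_measurable lborel" using assms(2) Ks by simp
    show "AE p in lborel. norm (indicator K p *\<^sub>R F p) \<le> norm (indicator K p *\<^sub>R W p)"
      using assms(3) W(2)
    proof eventually_elim
      case (elim p)
      show ?case
      proof (cases "p \<in> K")
        case True
        then have "(\<lambda>n. \<bar>Fn n p\<bar>) \<longlonglongrightarrow> \<bar>F p\<bar>" using elim K(2) by (auto intro: tendsto_rabs)
        then have "\<bar>F p\<bar> \<le> W p" using elim True by (intro LIMSEQ_le_const2) auto
        then show ?thesis using True by simp
      qed simp
    qed
  qed
qed

text \<open>Against a fixed test function both sides converge by dominated convergence on its
  support; convergence almost everywhere with a majorant on compact sets takes the place of
  convergence in a norm.\<close>

lemma weak_pd_limit: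
  assumes m: "\<And>n. Fn n \<in> borel_measurable lborel" "F \<in> borel_measurable lborel"
      "\<And>n. gn n \<in> borel_measurable lborel" "g \<in> borel_measurable lborel"
    and l: "AE p in lborel. p \<in> coord_dom \<longrightarrow> (\<lambda>n. Fn n p) \<longlonglongrightarrow> F p"
      "AE p in lborel. p \<in> coord_dom \<longrightarrow> (\<lambda>n. gn n p) \<longlonglongrightarrow> g p"
    and d: "\<And>K. compact K \<Longrightarrow> K \<subseteq> coord_dom \<Longrightarrow>
      \<exists>W. set_integrable lborel K W \<and> (AE p in lborel. p \<in> K \<longrightarrow> (\<forall>n. \<bar>Fn n p\<bar> \<le> W p))"
      "\<And>K. compact K \<Longrightarrow> K \<subseteq> coord_dom \<Longrightarrow>
      \<exists>W. set_integrable lborel K W \<and> (AE p in lborel. p \<in> K \<longrightarrow> (\<forall>n. \<bar>gn n p\<bar> \<le> W p))"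
    and w: "\<And>n. weak_pd v (Fn n) (gn n)" and v: "v \<in> Basis"
  shows "weak_pd v F g"
  unfolding weak_pd_def
proof (intro allI impI)
  fix \<zeta> assume \<zeta>: "test_fn \<zeta>"
  have sz: "smooth_on UNIV \<zeta>" using \<zeta> by (simp add: test_fn_def)
  obtain K where K: "compact K" "K \<subseteq> coord_dom" "\<And>p. p \<notin> K \<Longrightarrow> \<zeta> p = 0" "\<And>p v. p \<notin> K \<Longrightarrow> pdiff v \<zeta> p = 0"
    using test_fn_support[OF \<zeta>] by blast
  have lim: "(\<lambda>n. \<integral>p. Fn n p * k p \<partial>lborel) \<longlonglongrightarrow> (\<integral>p. F p * k p \<partial>lborel)"
    if m: "\<And>n. Fn n \<in> borel_measurable lborel" "F \<in> borel_measurable lborel"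
     and l: "AE p in lborel. p \<in> coord_dom \<longrightarrow> (\<lambda>n. Fn n p) \<longlonglongrightarrow> F p"
     and d: "\<exists>W. set_integrable lborel K W \<and> (AE p in lborel. p \<in> K \<longrightarrow> (\<forall>n. \<bar>Fn n p\<bar> \<le> W p))"
     and k: "continuous_on UNIV k" "\<And>p. p \<notin> K \<Longrightarrow> k p = 0"
   for Fn :: "nat \<Rightarrow> real \<times> real \<times> real \<Rightarrow> real" and F k
  proof -
    obtain W where W: "set_integrable lborel K W" "AE p in lborel. p \<in> K \<longrightarrow> (\<forall>n. \<bar>Fn n p\<bar> \<le> W p)"
      using d by blast
    obtain M where M: "\<And>p. p \<in> K \<Longrightarrow> \<bar>k p\<bar> \<le> M"
      using compact_imp_bounded[OF compact_continuous_image[OF continuous_on_subset[OF k(1)] K(1)]]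
      by (auto simp: bounded_iff)
    have km: "k \<in> borel_measurable borel" using k(1) by (rule borel_measurable_continuous_onI)
    show ?thesis
    proof (rule integral_dominated_convergence[where w = "\<lambda>p. M * (indicator K p * W p)"])
      show "(\<lambda>p. F p * k p) \<in> borel_measurable lborel" "(\<lambda>p. Fn n p * k p) \<in> borel_measurable lborel" for n
        using km m by auto
      show "integrable lborel (\<lambda>p. M * (indicator K p * W p))" using W(1) by (simp add: set_integrable_def)
      show "AE p in lborel. (\<lambda>n. Fn n p * k p) \<longlonglongrightarrow> F p * k p"
        using l
      proof eventually_elim
        case (elim p)
        show ?case
          using elim K(2) k(2)[of p] by (cases "p \<in> K") (auto intro!: tendsto_mult_right)
      qed
      show "AE p in lborel. norm (Fn n p * k p) \<le> M * (indicator K p * W p)" for n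
        using W(2)
      proof eventually_elim
        case (elim p)
        show ?case
        proof (cases "p \<in> K")
          case True
          then have "\<bar>Fn n p\<bar> * \<bar>k p\<bar> \<le> W p * M" using elim M[OF True] by (intro mult_mono) (auto intro: order_trans[OF abs_ge_zero])
          then show ?thesis using True by (simp add: abs_mult mult.commute)
        qed (simp add: k(2))
      qed
    qed
  qed
  have "(\<lambda>n. \<integral>p. Fn n p * pdiff v \<zeta> p \<partial>lborel) \<longlonglongrightarrow> (\<integral>p. F p * pdiff v \<zeta> p \<partial>lborel)"
    by (rule lim[OF m(1,2) l(1) d(1)[OF K(1,2)] smooth_on_continuous[OF smooth_on_pdiff[OF sz v]] K(4)])
  moreover have "(\<lambda>n. - (\<integral>p. gn n p * \<zeta> p \<partial>lborel)) \<longlonglongrightarrow> - (\<integral>p. g p * \<zeta> p \<partial>lborel)"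
    by (rule tendsto_minus[OF lim[OF m(3,4) l(2) d(2)[OF K(1,2)] smooth_on_continuous[OF sz] K(3)]])
  moreover have "(\<integral>p. Fn n p * pdiff v \<zeta> p \<partial>lborel) = - (\<integral>p. gn n p * \<zeta> p \<partial>lborel)" for n
    using w \<zeta> by (simp add: weak_pd_def)
  ultimately show "(\<integral>p. F p * pdiff v \<zeta> p \<partial>lborel) = - (\<integral>p. g p * \<zeta> p \<partial>lborel)"
    using LIMSEQ_unique by simp
qed

section \<open>The homogeneous Sobolev distance as an integral over the chart\<close>

definition sph_dom :: "(real \<times> real \<times> real) set" where
  "sph_dom = UNIV \<times> {0<..<pi} \<times> {0<..<2*pi}"

definition sph_dens :: "real \<times> real \<times> real \<Rightarrow> real \<times> real \<times> real \<Rightarrow> real" where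
  "sph_dens = (\<lambda>(t, \<theta>, \<phi>) (a, b, c). (a\<^sup>2 + b\<^sup>2 + c\<^sup>2 / (sin \<theta>)\<^sup>2) * sin \<theta>)"

lemma sph_dom_sin: "q \<in> sph_dom \<Longrightarrow> 0 < sin (fst (snd q))"
  by (auto simp: sph_dom_def intro: sin_gt_zero)

lemma sph_dom_sets [measurable]: "sph_dom \<in> sets borel"
  unfolding sph_dom_def by (intro borel_open open_Times) auto

text \<open>Tonelli turns the iterated integrals of \<open>energy\<close> and
  \<open>grad_sq_norm\<close> into one integral over a Borel set, where convergence theorems and
  almost everywhere arguments are available.\<close>

lemma nn_integral_sph_dom:
  assumes [measurable]: "k \<in> borel_measurable borel"
  shows "(\<integral>\<^sup>+t. (\<integral>\<^sup>+\<theta>\<in>{0<..<pi}. (\<integral>\<^sup>+\<phi>\<in>{0<..<2*pi}. k (t, \<theta>, \<phi>) \<partial>lborel) \<partial>lborel) \<partial>lborel)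
    = (\<integral>\<^sup>+p\<in>sph_dom. k p \<partial>lborel)"
proof -
  have m: "(\<lambda>p. k p * indicator sph_dom p) \<in> borel_measurable (lborel \<Otimes>\<^sub>M lborel)"
    unfolding lborel_prod by simp
  have m2: "(\<lambda>q. k (t, q) * indicator sph_dom (t, q)) \<in> borel_measurable (lborel \<Otimes>\<^sub>M lborel)" for t
    unfolding lborel_prod by measurable
  have "(\<integral>\<^sup>+p\<in>sph_dom. k p \<partial>lborel) = (\<integral>\<^sup>+p. k p * indicator sph_dom p \<partial>(lborel \<Otimes>\<^sub>M lborel))"
    by (simp add: lborel_prod)
  also have "\<dots> = (\<integral>\<^sup>+t. \<integral>\<^sup>+q. k (t, q) * indicator sph_dom (t, q) \<partial>lborel \<partial>lborel)"
    by (rule lborel.nn_integral_fst[OF m, symmetric])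
  also have "\<dots> = (\<integral>\<^sup>+t. \<integral>\<^sup>+\<theta>. \<integral>\<^sup>+\<phi>. k (t, \<theta>, \<phi>) * indicator sph_dom (t, \<theta>, \<phi>) \<partial>lborel \<partial>lborel \<partial>lborel)"
    using lborel.nn_integral_fst[OF m2] by (simp add: lborel_prod)
  also have "\<dots> = (\<integral>\<^sup>+t. \<integral>\<^sup>+\<theta>. (\<integral>\<^sup>+\<phi>. (k (t, \<theta>, \<phi>) * indicator {0<..<2*pi} \<phi>) \<partial>lborel) * indicator {0<..<pi} \<theta> \<partial>lborel \<partial>lborel)"
  proof (intro nn_integral_cong)
    fix t \<theta> :: real
    have "(\<integral>\<^sup>+\<phi>. k (t, \<theta>, \<phi>) * indicator sph_dom (t, \<theta>, \<phi>) \<partial>lborel)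
      = (\<integral>\<^sup>+\<phi>. (k (t, \<theta>, \<phi>) * indicator {0<..<2*pi} \<phi>) * indicator {0<..<pi} \<theta> \<partial>lborel)"
      by (intro nn_integral_cong) (auto simp: sph_dom_def indicator_def)
    also have "\<dots> = (\<integral>\<^sup>+\<phi>. (k (t, \<theta>, \<phi>) * indicator {0<..<2*pi} \<phi>) \<partial>lborel) * indicator {0<..<pi} \<theta>"
      by (rule nn_integral_multc) measurable
    finally show "(\<integral>\<^sup>+\<phi>. k (t, \<theta>, \<phi>) * indicator sph_dom (t, \<theta>, \<phi>) \<partial>lborel) = \<dots>" .
  qed
  finally show ?thesis by simp
qed

lemma sph_dens_measurable [measurable]:
  assumes [measurable]: "a \<in> borel_measurable borel" "b \<in> borel_measurable borel" "c \<in> borel_measurable borel"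
  shows "(\<lambda>p. sph_dens p (a p, b p, c p)) \<in> borel_measurable borel"
proof -
  have [measurable]: "(\<lambda>p::real \<times> real \<times> real. sin (fst (snd p))) \<in> borel_measurable borel"
    by (intro borel_measurable_continuous_onI continuous_intros)
  have "(\<lambda>p. sph_dens p (a p, b p, c p)) =
      (\<lambda>p. ((a p)\<^sup>2 + (b p)\<^sup>2 + (c p)\<^sup>2 / (sin (fst (snd p)))\<^sup>2) * sin (fst (snd p)))"
    by (auto simp: sph_dens_def)
  then show ?thesis by simp
qed

lemma grad_sq_norm_eq:
  assumes "a \<in> borel_measurable borel" "b \<in> borel_measurable borel" "c \<in> borel_measurable borel"
  shows "grad_sq_norm (grad_of a b c) = (\<integral>\<^sup>+p\<in>sph_dom. ennreal (sph_dens p (a p, b p, c p)) \<partial>lborel)"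
  using nn_integral_sph_dom[of "\<lambda>p. ennreal (sph_dens p (a p, b p, c p))"] sph_dens_measurable[OF assms]
  by (simp add: grad_sq_norm_def sph_dens_def)

lemma sph_dom_coord_dom: "sph_dom \<subseteq> coord_dom"
  by (auto simp: sph_dom_def coord_dom_def)

text \<open>By \<open>weak_pd_unique\<close> the gradients selected by \<open>wgrad\<close> may be
  exchanged for any known weak gradients; only then can a distance be computed.\<close>

lemma H1dot_dist_sq_eq:
  assumes "has_weak_grad f (grad_of a b c)" "has_weak_grad g (grad_of a' b' c')"
  shows "H1dot_dist_sq f g = (\<integral>\<^sup>+p\<in>sph_dom. ennreal (sph_dens p (a p - a' p, b p - b' p, c p - c' p)) \<partial>lborel)"
proof -
  obtain x y z where xyz: "wgrad f = grad_of x y z" using grad_of_cases by blast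
  obtain x' y' z' where xyz': "wgrad g = grad_of x' y' z'" using grad_of_cases by blast
  have f: "has_weak_grad f (grad_of x y z)" using someI[of "has_weak_grad f", OF assms(1)] xyz by (simp add: wgrad_def)
  have g: "has_weak_grad g (grad_of x' y' z')" using someI[of "has_weak_grad g", OF assms(2)] xyz' by (simp add: wgrad_def)
  note fs = f[unfolded has_weak_grad_iff] assms(1)[unfolded has_weak_grad_iff]
  note gs = g[unfolded has_weak_grad_iff] assms(2)[unfolded has_weak_grad_iff]
  have ae: "AE p in lborel. p \<in> coord_dom \<longrightarrow> x p = a p" "AE p in lborel. p \<in> coord_dom \<longrightarrow> y p = b p"
     "AE p in lborel. p \<in> coord_dom \<longrightarrow> z p = c p" "AE p in lborel. p \<in> coord_dom \<longrightarrow> x' p = a' p"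
     "AE p in lborel. p \<in> coord_dom \<longrightarrow> y' p = b' p" "AE p in lborel. p \<in> coord_dom \<longrightarrow> z' p = c' p"
    using weak_pd_unique fs gs by blast+
  have "H1dot_dist_sq f g = grad_sq_norm (grad_of (\<lambda>p. x p - x' p) (\<lambda>p. y p - y' p) (\<lambda>p. z p - z' p))"
    by (simp add: H1dot_dist_sq_def xyz xyz')
  also have "\<dots> = (\<integral>\<^sup>+p\<in>sph_dom. ennreal (sph_dens p (x p - x' p, y p - y' p, z p - z' p)) \<partial>lborel)"
    using fs gs by (intro grad_sq_norm_eq) (auto simp: loc_int_def)
  also have "\<dots> = (\<integral>\<^sup>+p\<in>sph_dom. ennreal (sph_dens p (a p - a' p, b p - b' p, c p - c' p)) \<partial>lborel)"
    using ae by (intro nn_integral_cong_AE, eventually_elim) (use sph_dom_coord_dom in \<open>auto simp: indicator_def\<close>)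
  finally show ?thesis .
qed

section \<open>The commuted wave equation\<close>

type_synonym R4 = "real \<times> real \<times> real \<times> real"

abbreviation "d0 \<equiv> pdiff ((1, 0, 0, 0) :: R4)"
abbreviation "d1 \<equiv> pdiff ((0, 1, 0, 0) :: R4)"
abbreviation "d2 \<equiv> pdiff ((0, 0, 1, 0) :: R4)"
abbreviation "d3 \<equiv> pdiff ((0, 0, 0, 1) :: R4)"

abbreviation thv :: "R4 \<Rightarrow> real" where "thv x \<equiv> fst (snd (snd x))"

lemma Basis_R4: "(1, 0, 0, 0) \<in> (Basis :: R4 set)" "(0, 1, 0, 0) \<in> (Basis :: R4 set)"
    "(0, 0, 1, 0) \<in> (Basis :: R4 set)" "(0, 0, 0, 1) \<in> (Basis :: R4 set)"
  by (auto simp: Basis_prod_def zero_prod_def)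

lemma pdiff_coord_DERIV:
  assumes "f differentiable (at (\<tau>, t, \<theta>, \<phi>))"
  shows "((\<lambda>s. f (s, t, \<theta>, \<phi>)) has_real_derivative d0 f (\<tau>, t, \<theta>, \<phi>)) (at \<tau>)"
    "((\<lambda>s. f (\<tau>, s, \<theta>, \<phi>)) has_real_derivative d1 f (\<tau>, t, \<theta>, \<phi>)) (at t)"
    "((\<lambda>s. f (\<tau>, t, s, \<phi>)) has_real_derivative d2 f (\<tau>, t, \<theta>, \<phi>)) (at \<theta>)"
    "((\<lambda>s. f (\<tau>, t, \<theta>, s)) has_real_derivative d3 f (\<tau>, t, \<theta>, \<phi>)) (at \<phi>)"
proof -
  show "((\<lambda>s. f (s, t, \<theta>, \<phi>)) has_real_derivative d0 f (\<tau>, t, \<theta>, \<phi>)) (at \<tau>)"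
    by (rule has_derivative_comp_curve_pdiff[where g = "\<lambda>s. (s, t, \<theta>, \<phi>)", OF assms])
       (auto intro!: derivative_eq_intros simp: has_vector_derivative_def zero_prod_def)
  show "((\<lambda>s. f (\<tau>, s, \<theta>, \<phi>)) has_real_derivative d1 f (\<tau>, t, \<theta>, \<phi>)) (at t)"
    by (rule has_derivative_comp_curve_pdiff[where g = "\<lambda>s. (\<tau>, s, \<theta>, \<phi>)", OF assms])
       (auto intro!: derivative_eq_intros simp: has_vector_derivative_def zero_prod_def)
  show "((\<lambda>s. f (\<tau>, t, s, \<phi>)) has_real_derivative d2 f (\<tau>, t, \<theta>, \<phi>)) (at \<theta>)"
    by (rule has_derivative_comp_curve_pdiff[where g = "\<lambda>s. (\<tau>, t, s, \<phi>)", OF assms])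
       (auto intro!: derivative_eq_intros simp: has_vector_derivative_def zero_prod_def)
  show "((\<lambda>s. f (\<tau>, t, \<theta>, s)) has_real_derivative d3 f (\<tau>, t, \<theta>, \<phi>)) (at \<phi>)"
    by (rule has_derivative_comp_curve_pdiff[where g = "\<lambda>s. (\<tau>, t, \<theta>, s)", OF assms])
       (auto intro!: derivative_eq_intros simp: has_vector_derivative_def zero_prod_def)
qed

lemma pdiff_coord_eqI:
  assumes "f differentiable (at (\<tau>, t, \<theta>, \<phi>))"
  shows "((\<lambda>s. f (s, t, \<theta>, \<phi>)) has_real_derivative D) (at \<tau>) \<Longrightarrow> d0 f (\<tau>, t, \<theta>, \<phi>) = D"
    "((\<lambda>s. f (\<tau>, s, \<theta>, \<phi>)) has_real_derivative D) (at t) \<Longrightarrow> d1 f (\<tau>, t, \<theta>, \<phi>) = D"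
    "((\<lambda>s. f (\<tau>, t, s, \<phi>)) has_real_derivative D) (at \<theta>) \<Longrightarrow> d2 f (\<tau>, t, \<theta>, \<phi>) = D"
    "((\<lambda>s. f (\<tau>, t, \<theta>, s)) has_real_derivative D) (at \<phi>) \<Longrightarrow> d3 f (\<tau>, t, \<theta>, \<phi>) = D"
  using pdiff_coord_DERIV[OF assms] DERIV_unique by blast+

lemma smooth_on_d:
  assumes "smooth_on S f"
  shows "smooth_on S (d0 f)" "smooth_on S (d1 f)" "smooth_on S (d2 f)" "smooth_on S (d3 f)"
  using smooth_on_pdiff[OF assms] Basis_R4 by auto

lemma smooth_on_thv: "open S \<Longrightarrow> smooth_on S thv" "open S \<Longrightarrow> smooth_on S (fst :: R4 \<Rightarrow> real)"
    "open S \<Longrightarrow> smooth_on S (\<lambda>x::R4. fst (snd x))"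
  by (auto intro!: smooth_on_linear bounded_linear_intros)

lemma d_commute:
  assumes "open S" "smooth_on S f" "x \<in> S"
  shows "d0 (d1 f) x = d1 (d0 f) x" "d0 (d2 f) x = d2 (d0 f) x" "d0 (d3 f) x = d3 (d0 f) x"
  using pdiff_commute[OF assms] Basis_R4 by auto

text \<open>The Laplacian of the round unit sphere in polar coordinates.\<close>

definition lap :: "(R4 \<Rightarrow> real) \<Rightarrow> R4 \<Rightarrow> real" where
  "lap f x = d2 (d2 f) x + cos (thv x) / sin (thv x) * d2 f x + d3 (d3 f) x / (sin (thv x))\<^sup>2"

definition chart_reg :: "real \<Rightarrow> R4 set" where
  "chart_reg T = {0<..<T} \<times> UNIV \<times> {0<..<pi} \<times> UNIV"

definition full_reg :: "real \<Rightarrow> R4 set" where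
  "full_reg T = {0<..<T} \<times> UNIV \<times> UNIV \<times> UNIV"

lemma open_reg: "open (chart_reg T)" "open (full_reg T)"
  unfolding chart_reg_def full_reg_def by (intro open_Times; auto)+

lemma chart_sub_full: "chart_reg T \<subseteq> full_reg T"
  by (auto simp: chart_reg_def full_reg_def)

lemma chart_sin_pos: "x \<in> chart_reg T \<Longrightarrow> sin (thv x) > 0"
  by (auto simp: chart_reg_def intro: sin_gt_zero)

lemma smooth_chart: "smooth_on (full_reg T) f \<Longrightarrow> smooth_on (chart_reg T) f"
  using smooth_on_subset chart_sub_full by blast

text \<open>The usual energy of a wave operator with coefficients \<alpha> in t and \<beta> on the
  sphere, times the area factor \<open>sin \<theta>\<close>. The last line is a correction for
  sources \<open>d1 (d1 G)\<close> and \<open>lap H\<close>, which have one derivative too many for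
  a direct estimate.\<close>

definition energy_dens where
  "energy_dens \<alpha> \<beta> f G H x = sin (thv x) * ((d0 f x)\<^sup>2 / 2 + \<alpha> (fst x) * (d1 f x)\<^sup>2 / 2
     + \<beta> (fst x) * ((d2 f x)\<^sup>2 + (d3 f x / sin (thv x))\<^sup>2) / 2
     + d1 G x * d1 f x + d2 H x * d2 f x + d3 H x / sin (thv x) * (d3 f x / sin (thv x)))"

definition flux_t where
  "flux_t \<alpha> f G x = sin (thv x) * (d0 f x * (\<alpha> (fst x) * d1 f x + d1 G x))"

text \<open>The area factor \<open>sin \<theta>\<close> is held back and reappears under the
  derivative in the divergence: this function is then smooth across the poles, and the true flux
  through a circle \<open>\<theta> = \<epsilon>\<close> is \<open>sin \<epsilon>\<close> times a
  locally bounded quantity.\<close>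

definition flux_th where
  "flux_th \<beta> f H x = d0 f x * (\<beta> (fst x) * d2 f x + d2 H x)"

definition flux_ph where
  "flux_ph \<beta> f H x = d0 f x * (\<beta> (fst x) * d3 f x + d3 H x) / sin (thv x)"

lemma smooth_on_coef: "smooth_on {0<..<T} c \<Longrightarrow> smooth_on (full_reg T) (\<lambda>x. c (fst x))"
proof (rule smooth_on_compose[where g = fst and T = "{0<..<T}", OF open_reg(2)])
  show "smooth_on (full_reg T) (\<lambda>x. fst x \<bullet> j)" if "j \<in> Basis" for j :: real
    using that smooth_on_thv(2)[OF open_reg(2)] by simp
qed (auto simp: full_reg_def)

lemma energy_smooth:
  assumes "smooth_on {0<..<T} \<alpha>" "smooth_on {0<..<T} \<beta>"
    and "smooth_on (full_reg T) f" "smooth_on (full_reg T) G" "smooth_on (full_reg T) H"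
  shows "smooth_on (chart_reg T) (energy_dens \<alpha> \<beta> f G H)" "smooth_on (chart_reg T) (flux_t \<alpha> f G)"
    "smooth_on (full_reg T) (flux_th \<beta> f H)" "smooth_on (chart_reg T) (flux_ph \<beta> f H)"
proof -
  note s = smooth_on_coef[OF assms(1)] smooth_on_coef[OF assms(2)] smooth_on_d[OF assms(3)]
    smooth_on_d[OF assms(4)] smooth_on_d[OF assms(5)]
  have nz: "\<And>x. x \<in> chart_reg T \<Longrightarrow> sin (thv x) \<noteq> 0" using chart_sin_pos by force
  note s' = s[THEN smooth_chart]
  show "smooth_on (chart_reg T) (energy_dens \<alpha> \<beta> f G H)" "smooth_on (chart_reg T) (flux_t \<alpha> f G)"
    "smooth_on (chart_reg T) (flux_ph \<beta> f H)"
    unfolding energy_dens_def flux_t_def flux_ph_def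
    by (intro smooth_on_intros s' smooth_on_thv open_reg nz; simp)+
  show "smooth_on (full_reg T) (flux_th \<beta> f H)"
    unfolding flux_th_def by (intro smooth_on_intros s open_reg)
qed

text \<open>Multiply the equation by \<open>\<partial>\<^sub>\<tau> f\<close>: the source terms, being second derivatives of lower order
  quantities, are absorbed into the energy density through \<open>\<nabla>G \<cdot> \<nabla>f\<close> cross terms, since their
  \<open>\<tau>\<close>-derivatives are again first order.\<close>

lemma energy_identity:
  assumes \<alpha>: "smooth_on {0<..<T} \<alpha>" "\<And>\<tau>. \<tau> \<in> {0<..<T} \<Longrightarrow> (\<alpha> has_real_derivative \<alpha>' \<tau>) (at \<tau>)"
    and \<beta>: "smooth_on {0<..<T} \<beta>" "\<And>\<tau>. \<tau> \<in> {0<..<T} \<Longrightarrow> (\<beta> has_real_derivative \<beta>' \<tau>) (at \<tau>)"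
    and s: "smooth_on (full_reg T) f" "smooth_on (full_reg T) G" "smooth_on (full_reg T) H"
    and x: "x \<in> chart_reg T"
    and eq: "d0 (d0 f) x = \<alpha> (fst x) * d1 (d1 f) x + \<beta> (fst x) * lap f x + d1 (d1 G) x + lap H x"
  shows "d0 (energy_dens \<alpha> \<beta> f G H) x = d1 (flux_t \<alpha> f G) x
      + d2 (\<lambda>x. sin (thv x) * flux_th \<beta> f H x) x + d3 (flux_ph \<beta> f H) x
      + sin (thv x) * (\<alpha>' (fst x) * (d1 f x)\<^sup>2 / 2 + \<beta>' (fst x) * ((d2 f x)\<^sup>2 + (d3 f x / sin (thv x))\<^sup>2) / 2
        + d1 (d0 G) x * d1 f x + d2 (d0 H) x * d2 f x + d3 (d0 H) x / sin (thv x) * (d3 f x / sin (thv x)))"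
proof -
  obtain \<tau> t \<theta> \<phi> where [simp]: "x = (\<tau>, t, \<theta>, \<phi>)" by (cases x)
  have \<tau>: "\<tau> \<in> {0<..<T}" using x by (simp add: chart_reg_def)
  have xf: "x \<in> full_reg T" using x chart_sub_full by blast
  have sn: "sin \<theta> > 0" using chart_sin_pos[OF x] by simp
  note dd = smooth_on_differentiable[OF _ xf, simplified]
  note D = pdiff_coord_DERIV[OF dd]
  note sm = smooth_on_d[OF s(1)] smooth_on_d[OF s(2)] smooth_on_d[OF s(3)]
  note es = energy_smooth[OF \<alpha>(1) \<beta>(1) s]
  note com = d_commute[OF open_reg(2) s(1) xf, simplified] d_commute[OF open_reg(2) s(2) xf, simplified]
     d_commute[OF open_reg(2) s(3) xf, simplified]
  have d12: "d1 (d0 f) (\<tau>, t, \<theta>, \<phi>) = d1 (d0 f) (\<tau>, t, \<theta>, \<phi>)" by simp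
  have E0: "d0 (energy_dens \<alpha> \<beta> f G H) (\<tau>, t, \<theta>, \<phi>) = sin \<theta> *
      (d0 f (\<tau>,t,\<theta>,\<phi>) * d0 (d0 f) (\<tau>,t,\<theta>,\<phi>) + \<alpha>' \<tau> * (d1 f (\<tau>,t,\<theta>,\<phi>))\<^sup>2 / 2 + \<alpha> \<tau> * (d1 f (\<tau>,t,\<theta>,\<phi>) * d0 (d1 f) (\<tau>,t,\<theta>,\<phi>))
       + \<beta>' \<tau> * ((d2 f (\<tau>,t,\<theta>,\<phi>))\<^sup>2 + (d3 f (\<tau>,t,\<theta>,\<phi>) / sin \<theta>)\<^sup>2) / 2
       + \<beta> \<tau> * (d2 f (\<tau>,t,\<theta>,\<phi>) * d0 (d2 f) (\<tau>,t,\<theta>,\<phi>) + d3 f (\<tau>,t,\<theta>,\<phi>) * d0 (d3 f) (\<tau>,t,\<theta>,\<phi>) / (sin \<theta>)\<^sup>2)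
       + d0 (d1 G) (\<tau>,t,\<theta>,\<phi>) * d1 f (\<tau>,t,\<theta>,\<phi>) + d1 G (\<tau>,t,\<theta>,\<phi>) * d0 (d1 f) (\<tau>,t,\<theta>,\<phi>)
       + d0 (d2 H) (\<tau>,t,\<theta>,\<phi>) * d2 f (\<tau>,t,\<theta>,\<phi>) + d2 H (\<tau>,t,\<theta>,\<phi>) * d0 (d2 f) (\<tau>,t,\<theta>,\<phi>)
       + (d0 (d3 H) (\<tau>,t,\<theta>,\<phi>) * d3 f (\<tau>,t,\<theta>,\<phi>) + d3 H (\<tau>,t,\<theta>,\<phi>) * d0 (d3 f) (\<tau>,t,\<theta>,\<phi>)) / (sin \<theta>)\<^sup>2)"
  proof (rule pdiff_coord_eqI(1))
    show "energy_dens \<alpha> \<beta> f G H differentiable at (\<tau>, t, \<theta>, \<phi>)"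
      using smooth_on_differentiable[OF es(1) x] by simp
    show "((\<lambda>s. energy_dens \<alpha> \<beta> f G H (s, t, \<theta>, \<phi>)) has_real_derivative sin \<theta> *
      (d0 f (\<tau>,t,\<theta>,\<phi>) * d0 (d0 f) (\<tau>,t,\<theta>,\<phi>) + \<alpha>' \<tau> * (d1 f (\<tau>,t,\<theta>,\<phi>))\<^sup>2 / 2 + \<alpha> \<tau> * (d1 f (\<tau>,t,\<theta>,\<phi>) * d0 (d1 f) (\<tau>,t,\<theta>,\<phi>))
       + \<beta>' \<tau> * ((d2 f (\<tau>,t,\<theta>,\<phi>))\<^sup>2 + (d3 f (\<tau>,t,\<theta>,\<phi>) / sin \<theta>)\<^sup>2) / 2
       + \<beta> \<tau> * (d2 f (\<tau>,t,\<theta>,\<phi>) * d0 (d2 f) (\<tau>,t,\<theta>,\<phi>) + d3 f (\<tau>,t,\<theta>,\<phi>) * d0 (d3 f) (\<tau>,t,\<theta>,\<phi>) / (sin \<theta>)\<^sup>2)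
       + d0 (d1 G) (\<tau>,t,\<theta>,\<phi>) * d1 f (\<tau>,t,\<theta>,\<phi>) + d1 G (\<tau>,t,\<theta>,\<phi>) * d0 (d1 f) (\<tau>,t,\<theta>,\<phi>)
       + d0 (d2 H) (\<tau>,t,\<theta>,\<phi>) * d2 f (\<tau>,t,\<theta>,\<phi>) + d2 H (\<tau>,t,\<theta>,\<phi>) * d0 (d2 f) (\<tau>,t,\<theta>,\<phi>)
       + (d0 (d3 H) (\<tau>,t,\<theta>,\<phi>) * d3 f (\<tau>,t,\<theta>,\<phi>) + d3 H (\<tau>,t,\<theta>,\<phi>) * d0 (d3 f) (\<tau>,t,\<theta>,\<phi>)) / (sin \<theta>)\<^sup>2)) (at \<tau>)"
      unfolding energy_dens_def fst_conv snd_conv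
      using sn by (auto intro!: derivative_eq_intros D(1) sm \<alpha>(2) \<beta>(2) \<tau> simp: power2_eq_square field_simps)
  qed
  have P1: "d1 (flux_t \<alpha> f G) (\<tau>, t, \<theta>, \<phi>) = sin \<theta> * (d1 (d0 f) (\<tau>,t,\<theta>,\<phi>) * (\<alpha> \<tau> * d1 f (\<tau>,t,\<theta>,\<phi>) + d1 G (\<tau>,t,\<theta>,\<phi>))
      + d0 f (\<tau>,t,\<theta>,\<phi>) * (\<alpha> \<tau> * d1 (d1 f) (\<tau>,t,\<theta>,\<phi>) + d1 (d1 G) (\<tau>,t,\<theta>,\<phi>)))"
  proof (rule pdiff_coord_eqI(2))
    show "flux_t \<alpha> f G differentiable at (\<tau>, t, \<theta>, \<phi>)"
      using smooth_on_differentiable[OF es(2) x] by simp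
    show "((\<lambda>s. flux_t \<alpha> f G (\<tau>, s, \<theta>, \<phi>)) has_real_derivative sin \<theta> * (d1 (d0 f) (\<tau>,t,\<theta>,\<phi>) * (\<alpha> \<tau> * d1 f (\<tau>,t,\<theta>,\<phi>) + d1 G (\<tau>,t,\<theta>,\<phi>))
      + d0 f (\<tau>,t,\<theta>,\<phi>) * (\<alpha> \<tau> * d1 (d1 f) (\<tau>,t,\<theta>,\<phi>) + d1 (d1 G) (\<tau>,t,\<theta>,\<phi>)))) (at t)"
      unfolding flux_t_def fst_conv snd_conv
      by (auto intro!: derivative_eq_intros D(2) sm simp: field_simps)
  qed
  have Q2: "d2 (\<lambda>x. sin (thv x) * flux_th \<beta> f H x) (\<tau>, t, \<theta>, \<phi>) = cos \<theta> * (d0 f (\<tau>,t,\<theta>,\<phi>) * (\<beta> \<tau> * d2 f (\<tau>,t,\<theta>,\<phi>) + d2 H (\<tau>,t,\<theta>,\<phi>)))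
      + sin \<theta> * (d2 (d0 f) (\<tau>,t,\<theta>,\<phi>) * (\<beta> \<tau> * d2 f (\<tau>,t,\<theta>,\<phi>) + d2 H (\<tau>,t,\<theta>,\<phi>))
      + d0 f (\<tau>,t,\<theta>,\<phi>) * (\<beta> \<tau> * d2 (d2 f) (\<tau>,t,\<theta>,\<phi>) + d2 (d2 H) (\<tau>,t,\<theta>,\<phi>)))"
  proof (rule pdiff_coord_eqI(3))
    have "smooth_on (full_reg T) (\<lambda>x. sin (thv x) * flux_th \<beta> f H x)"
      by (intro smooth_on_intros es smooth_on_thv open_reg)
    then show "(\<lambda>x. sin (thv x) * flux_th \<beta> f H x) differentiable at (\<tau>, t, \<theta>, \<phi>)"
      using smooth_on_differentiable[OF _ xf] by simp
    show "((\<lambda>s. sin (thv (\<tau>, t, s, \<phi>)) * flux_th \<beta> f H (\<tau>, t, s, \<phi>)) has_real_derivative cos \<theta> * (d0 f (\<tau>,t,\<theta>,\<phi>) * (\<beta> \<tau> * d2 f (\<tau>,t,\<theta>,\<phi>) + d2 H (\<tau>,t,\<theta>,\<phi>)))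
      + sin \<theta> * (d2 (d0 f) (\<tau>,t,\<theta>,\<phi>) * (\<beta> \<tau> * d2 f (\<tau>,t,\<theta>,\<phi>) + d2 H (\<tau>,t,\<theta>,\<phi>))
      + d0 f (\<tau>,t,\<theta>,\<phi>) * (\<beta> \<tau> * d2 (d2 f) (\<tau>,t,\<theta>,\<phi>) + d2 (d2 H) (\<tau>,t,\<theta>,\<phi>)))) (at \<theta>)"
      unfolding flux_th_def fst_conv snd_conv
      by (auto intro!: derivative_eq_intros D(3) sm simp: field_simps)
  qed
  have R3: "d3 (flux_ph \<beta> f H) (\<tau>, t, \<theta>, \<phi>) = (d3 (d0 f) (\<tau>,t,\<theta>,\<phi>) * (\<beta> \<tau> * d3 f (\<tau>,t,\<theta>,\<phi>) + d3 H (\<tau>,t,\<theta>,\<phi>))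
      + d0 f (\<tau>,t,\<theta>,\<phi>) * (\<beta> \<tau> * d3 (d3 f) (\<tau>,t,\<theta>,\<phi>) + d3 (d3 H) (\<tau>,t,\<theta>,\<phi>))) / sin \<theta>"
  proof (rule pdiff_coord_eqI(4))
    show "flux_ph \<beta> f H differentiable at (\<tau>, t, \<theta>, \<phi>)"
      using smooth_on_differentiable[OF es(4) x] by simp
    show "((\<lambda>s. flux_ph \<beta> f H (\<tau>, t, \<theta>, s)) has_real_derivative (d3 (d0 f) (\<tau>,t,\<theta>,\<phi>) * (\<beta> \<tau> * d3 f (\<tau>,t,\<theta>,\<phi>) + d3 H (\<tau>,t,\<theta>,\<phi>))
      + d0 f (\<tau>,t,\<theta>,\<phi>) * (\<beta> \<tau> * d3 (d3 f) (\<tau>,t,\<theta>,\<phi>) + d3 (d3 H) (\<tau>,t,\<theta>,\<phi>))) / sin \<theta>) (at \<phi>)"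
      unfolding flux_ph_def fst_conv snd_conv
      using sn by (auto intro!: derivative_eq_intros D(4) sm simp: field_simps)
  qed
  \<comment> \<open>Once \<open>com\<close> has brought mixed derivatives into one order, all
    derivatives are independent letters and the claim is an identity of rational functions.\<close>
  have alg: "s * (a0 * (al * a11 + be * (a22 + c / s * a2 + a33 / s\<^sup>2) + g11 + (h22 + c / s * h2 + h33 / s\<^sup>2)) + A + al * (a1 * a01)
       + B + be * (a2 * a02 + a3 * a03 / s\<^sup>2) + k1 * a1 + g1 * a01 + k2 * a2 + h2 * a02 + (k3 * a3 + h3 * a03) / s\<^sup>2)
     = s * (a01 * (al * a1 + g1) + a0 * (al * a11 + g11))
       + (c * (a0 * (be * a2 + h2)) + s * (a02 * (be * a2 + h2) + a0 * (be * a22 + h22)))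
       + (a03 * (be * a3 + h3) + a0 * (be * a33 + h33)) / s
       + s * (A + B + k1 * a1 + k2 * a2 + k3 / s * (a3 / s))"
    if "s > 0" for s a0 al a11 be a22 c a2 a33 g11 h22 h2 h33 A a1 a01 B a02 a3 a03 k1 g1 k2 k3 h3 :: real
    using that by (simp add: field_simps power2_eq_square)
  have eq': "d0 (d0 f) (\<tau>,t,\<theta>,\<phi>) = \<alpha> \<tau> * d1 (d1 f) (\<tau>,t,\<theta>,\<phi>) + \<beta> \<tau> * (d2 (d2 f) (\<tau>,t,\<theta>,\<phi>) + cos \<theta> / sin \<theta> * d2 f (\<tau>,t,\<theta>,\<phi>) + d3 (d3 f) (\<tau>,t,\<theta>,\<phi>) / (sin \<theta>)\<^sup>2)
      + d1 (d1 G) (\<tau>,t,\<theta>,\<phi>) + (d2 (d2 H) (\<tau>,t,\<theta>,\<phi>) + cos \<theta> / sin \<theta> * d2 H (\<tau>,t,\<theta>,\<phi>) + d3 (d3 H) (\<tau>,t,\<theta>,\<phi>) / (sin \<theta>)\<^sup>2)"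
    using eq unfolding lap_def by (simp only: \<open>x = (\<tau>, t, \<theta>, \<phi>)\<close> fst_conv snd_conv)
  show ?thesis
    unfolding \<open>x = (\<tau>, t, \<theta>, \<phi>)\<close> E0 P1 Q2 R3 eq' com fst_conv snd_conv
    by (rule alg[OF sn])
qed

section \<open>Commutation with coefficients depending on tau and with the spherical
  Laplacian\<close>

lemma pdiff_const: "pdiff v (\<lambda>_. c) = (\<lambda>_. 0)"
  by (simp add: fun_eq_iff pdiff_def)

lemma coef_pdiff:
  assumes "x \<in> full_reg T" "smooth_on (full_reg T) f" "smooth_on {0<..<T} c"
    and "(c has_real_derivative c') (at (fst x))"
  shows "d0 (\<lambda>x. c (fst x) * f x) x = c' * f x + c (fst x) * d0 f x"
    "d1 (\<lambda>x. c (fst x) * f x) x = c (fst x) * d1 f x"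
    "d2 (\<lambda>x. c (fst x) * f x) x = c (fst x) * d2 f x"
    "d3 (\<lambda>x. c (fst x) * f x) x = c (fst x) * d3 f x"
proof -
  have ch: "((\<lambda>x. c (fst x)) has_derivative (\<lambda>v. c' * fst v)) (at x)"
    using has_derivative_compose[OF bounded_linear_imp_has_derivative[OF bounded_linear_fst]
        assms(4)[unfolded has_field_derivative_def]] by simp
  have f: "f differentiable at x" using smooth_on_differentiable assms(1,2) by blast
  show "d0 (\<lambda>x. c (fst x) * f x) x = c' * f x + c (fst x) * d0 f x"
    "d1 (\<lambda>x. c (fst x) * f x) x = c (fst x) * d1 f x"
    "d2 (\<lambda>x. c (fst x) * f x) x = c (fst x) * d2 f x"
    "d3 (\<lambda>x. c (fst x) * f x) x = c (fst x) * d3 f x"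
    using pdiff_mult[OF differentiableI[OF ch] f] pdiff_eqI[OF ch] by auto
qed

lemma lap_transform:
  assumes "\<And>x. x \<in> full_reg T \<Longrightarrow> f x = g x" "x \<in> full_reg T"
  shows "d1 (d1 f) x = d1 (d1 g) x" "lap f x = lap g x"
proof -
  have 1: "pdiff v f y = pdiff v g y" if "y \<in> full_reg T" for v y
    using pdiff_transform_open(2)[OF open_reg(2)] assms(1) that by blast
  then have "pdiff v (pdiff w f) x = pdiff v (pdiff w g) x" for v w
    using pdiff_transform_open(2)[OF open_reg(2), of T "pdiff w f" "pdiff w g"] assms(2) by blast
  then show "d1 (d1 f) x = d1 (d1 g) x" "lap f x = lap g x" using 1 assms(2) by (auto simp: lap_def)
qed

lemma lap_add:
  assumes "smooth_on (full_reg T) f" "smooth_on (full_reg T) g" "x \<in> full_reg T"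
  shows "d1 (d1 (\<lambda>x. f x + g x)) x = d1 (d1 f) x + d1 (d1 g) x" "lap (\<lambda>x. f x + g x) x = lap f x + lap g x"
proof -
  have 1: "pdiff v (\<lambda>x. f x + g x) y = pdiff v f y + pdiff v g y" if "y \<in> full_reg T" for v y
    using pdiff_add smooth_on_differentiable assms that by blast
  have "pdiff v (pdiff w (\<lambda>x. f x + g x)) x = pdiff v (pdiff w f) x + pdiff v (pdiff w g) x"
    if "w \<in> Basis" for v w
    using pdiff_transform_open(2)[OF open_reg(2), of T "pdiff w (\<lambda>x. f x + g x)" "\<lambda>x. pdiff w f x + pdiff w g x"]
      pdiff_add[OF smooth_on_differentiable smooth_on_differentiable, OF smooth_on_pdiff assms(3) smooth_on_pdiff assms(3)]
      assms that 1 by auto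
  then show "d1 (d1 (\<lambda>x. f x + g x)) x = d1 (d1 f) x + d1 (d1 g) x" "lap (\<lambda>x. f x + g x) x = lap f x + lap g x"
    using 1[OF assms(3)] Basis_R4 by (auto simp: lap_def add_divide_distrib algebra_simps)
qed

lemma lap_cmult:
  assumes "smooth_on (full_reg T) f" "smooth_on {0<..<T} c" "x \<in> full_reg T"
  shows "d1 (d1 (\<lambda>x. c (fst x) * f x)) x = c (fst x) * d1 (d1 f) x"
    "lap (\<lambda>x. c (fst x) * f x) x = c (fst x) * lap f x"
proof -
  have c': "(c has_real_derivative pdiff 1 c \<tau>) (at \<tau>)" if "\<tau> \<in> {0<..<T}" for \<tau>
    using has_derivative_comp_curve_pdiff[of c "\<lambda>s. s" \<tau> 1 UNIV] smooth_on_differentiable[OF assms(2) that] by simp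
  have 1: "d1 (\<lambda>x. c (fst x) * g x) y = c (fst y) * d1 g y" "d2 (\<lambda>x. c (fst x) * g x) y = c (fst y) * d2 g y"
      "d3 (\<lambda>x. c (fst x) * g x) y = c (fst y) * d3 g y"
    if "y \<in> full_reg T" "smooth_on (full_reg T) g" for y g
    using coef_pdiff[OF that(1,2) assms(2) c'] that(1) by (auto simp: full_reg_def)
  note tr = pdiff_transform_open(2)[OF open_reg(2) _ assms(3)]
  have "d1 (d1 (\<lambda>x. c (fst x) * f x)) x = d1 (\<lambda>x. c (fst x) * d1 f x) x"
    "d2 (d2 (\<lambda>x. c (fst x) * f x)) x = d2 (\<lambda>x. c (fst x) * d2 f x) x"
    "d3 (d3 (\<lambda>x. c (fst x) * f x)) x = d3 (\<lambda>x. c (fst x) * d3 f x) x"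
    by (rule tr, rule 1, assumption, rule assms(1))+
  then show "d1 (d1 (\<lambda>x. c (fst x) * f x)) x = c (fst x) * d1 (d1 f) x"
    "lap (\<lambda>x. c (fst x) * f x) x = c (fst x) * lap f x"
    using 1[OF assms(3)] assms(1) smooth_on_d[OF assms(1)] by (auto simp: lap_def algebra_simps)
qed

text \<open>The coefficients of \<open>lap\<close> depend on \<theta> alone, so nothing but the
  symmetry of mixed derivatives is involved.\<close>

lemma d0_lap_commute:
  assumes "smooth_on (full_reg T) f" "x \<in> chart_reg T"
  shows "d0 (d1 (d1 f)) x = d1 (d1 (d0 f)) x" "d0 (lap f) x = lap (d0 f) x"
proof -
  have xf: "x \<in> full_reg T" using assms(2) chart_sub_full by blast
  note s = smooth_on_d[OF assms(1)]
  have c: "d0 (pdiff w (pdiff w f)) x = pdiff w (pdiff w (d0 f)) x" if w: "w \<in> Basis" for w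
  proof -
    have "d0 (pdiff w (pdiff w f)) x = pdiff w (d0 (pdiff w f)) x"
      by (rule pdiff_commute[OF open_reg(2) smooth_on_pdiff[OF assms(1) w] xf Basis_R4(1) w])
    also have "\<dots> = pdiff w (pdiff w (d0 f)) x"
      by (rule pdiff_transform_open(2)[OF open_reg(2) _ xf])
         (rule pdiff_commute[OF open_reg(2) assms(1) _ Basis_R4(1) w])
    finally show ?thesis .
  qed
  show "d0 (d1 (d1 f)) x = d1 (d1 (d0 f)) x" by (rule c) (rule Basis_R4)
  obtain \<tau> t \<theta> \<phi> where x: "x = (\<tau>, t, \<theta>, \<phi>)" by (cases x)
  have sn: "sin \<theta> > 0" using chart_sin_pos[OF assms(2)] by (simp add: x)
  have nz: "\<And>x. x \<in> chart_reg T \<Longrightarrow> sin (thv x) \<noteq> 0" using chart_sin_pos by force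
  have "smooth_on (chart_reg T) (lap f)"
    unfolding lap_def by (intro smooth_on_intros smooth_chart[OF smooth_on_d(3)] smooth_chart[OF smooth_on_d(4)] s
        smooth_chart[OF s(3)] smooth_on_thv open_reg; use nz in simp)
  then have dl: "lap f differentiable at (\<tau>, t, \<theta>, \<phi>)" using smooth_on_differentiable assms(2) x by blast
  note dd = smooth_on_differentiable[OF _ xf, unfolded x]
  have "d0 (lap f) (\<tau>, t, \<theta>, \<phi>) = d0 (d2 (d2 f)) (\<tau>, t, \<theta>, \<phi>)
      + cos \<theta> / sin \<theta> * d0 (d2 f) (\<tau>, t, \<theta>, \<phi>) + d0 (d3 (d3 f)) (\<tau>, t, \<theta>, \<phi>) / (sin \<theta>)\<^sup>2"
  proof (rule pdiff_coord_eqI(1)[OF dl])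
    show "((\<lambda>s. lap f (s, t, \<theta>, \<phi>)) has_real_derivative d0 (d2 (d2 f)) (\<tau>, t, \<theta>, \<phi>)
      + cos \<theta> / sin \<theta> * d0 (d2 f) (\<tau>, t, \<theta>, \<phi>) + d0 (d3 (d3 f)) (\<tau>, t, \<theta>, \<phi>) / (sin \<theta>)\<^sup>2) (at \<tau>)"
      unfolding lap_def fst_conv snd_conv
      by (intro DERIV_add DERIV_cmult DERIV_cdivide pdiff_coord_DERIV(1) dd smooth_on_d s)
  qed
  then show "d0 (lap f) x = lap (d0 f) x"
    using c[OF Basis_R4(3)] c[OF Basis_R4(4)] d_commute(2)[OF open_reg(2) assms(1) xf] by (simp add: lap_def x)
qed

text \<open>The facts about the rescaled solution on which the energy estimates rest;
  \<open>L\<close> stands for \<open>\<Lambda> / 3\<close> and \<open>T\<close> for the reciprocal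
  of the horizon radius. No negative power of \<tau> occurs in \<open>F_wave\<close>, which is the
  gain of passing from \<open>F 0\<close> to \<open>F 1\<close>.\<close>

locale wave_hierarchy =
  fixes L m T \<tau>0 :: real and p :: "real \<Rightarrow> real" and F :: "nat \<Rightarrow> R4 \<Rightarrow> real"
  defines "p \<equiv> \<lambda>\<tau>. L - \<tau>\<^sup>2 + 2 * m * \<tau> ^ 3"
  assumes tau0: "0 < \<tau>0" "\<tau>0 < T"
    and p_pos: "\<And>\<tau>. 0 \<le> \<tau> \<Longrightarrow> \<tau> < T \<Longrightarrow> p \<tau> > 0"
    and F_smooth: "\<And>j. smooth_on (full_reg T) (F j)"
    and F_periodic: "\<And>j \<tau> t \<theta> \<phi>. F j (\<tau>, t, \<theta>, \<phi> + 2 * pi) = F j (\<tau>, t, \<theta>, \<phi>)"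
    and F_0: "\<And>x. x \<in> full_reg T \<Longrightarrow> d0 (F 0) x = fst x * inverse (p (fst x)) * F 1 x"
    and F_Suc: "\<And>j x. x \<in> full_reg T \<Longrightarrow> d0 (F (Suc j)) x = F (Suc (Suc j)) x"
    and F_wave: "\<And>x. x \<in> chart_reg T \<Longrightarrow> d0 (d0 (F 1)) x =
        (inverse (p (fst x)))\<^sup>2 * d1 (d1 (F 1)) x + inverse (p (fst x)) * lap (F 1) x
        + (2 - 6 * m * fst x) * (inverse (p (fst x)))\<^sup>2 * d1 (d1 (F 0)) x"
begin

abbreviation "tc \<equiv> alg_gen {\<lambda>\<tau>. \<tau>, \<lambda>\<tau>. inverse (p \<tau>)}"

lemma tc_id: "tc (\<lambda>\<tau>. \<tau>)" and tc_invp: "tc (\<lambda>\<tau>. inverse (p \<tau>))"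
  by (auto intro: alg_base)

lemma tc_uminus: "tc c \<Longrightarrow> tc (\<lambda>\<tau>. - c \<tau>)"
  using alg_mult[OF alg_const[of _ "-1"], of "{\<lambda>\<tau>. \<tau>, \<lambda>\<tau>. inverse (p \<tau>)}" c] by simp

lemma tc_power: "tc c \<Longrightarrow> tc (\<lambda>\<tau>. c \<tau> ^ n)"
  by (induction n) (auto intro: alg_const alg_mult)

lemma tc_diff: "tc c \<Longrightarrow> tc c' \<Longrightarrow> tc (\<lambda>\<tau>. c \<tau> - c' \<tau>)"
  using alg_add[OF _ tc_uminus, of c c'] by simp

lemmas tc_intros = tc_id tc_invp alg_const alg_add alg_mult tc_uminus tc_diff tc_power

lemma p_deriv: "(p has_real_derivative (- 2 * \<tau> + 6 * m * \<tau>\<^sup>2)) (at \<tau>)"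
  unfolding p_def by (auto intro!: derivative_eq_intros simp: power2_eq_square)

text \<open>The derivative of \<open>inverse (p \<tau>)\<close> is a polynomial in \<tau> times the
  square of \<open>inverse (p \<tau>)\<close>. Hence all coefficients produced by repeated
  \<tau>-differentiation stay in the algebra, and with \<open>tc_bounded\<close> they stay bounded
  as \<tau> tends to 0.\<close>

lemma tc_deriv:
  assumes "tc c"
  shows "\<exists>c'. tc c' \<and> (\<forall>\<tau>\<in>{0<..<T}. (c has_real_derivative c' \<tau>) (at \<tau>))"
  using assms
proof induction
  case (alg_base f)
  have 1: "tc (\<lambda>\<tau>. 1)" by (rule alg_const)
  have 2: "tc (\<lambda>\<tau>. - ((- 2 * \<tau> + 6 * m * \<tau>\<^sup>2) * inverse (p \<tau>) ^ 2))" by (intro tc_intros)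
  have "\<forall>\<tau>\<in>{0<..<T}. ((\<lambda>\<tau>. inverse (p \<tau>)) has_real_derivative
      - ((- 2 * \<tau> + 6 * m * \<tau>\<^sup>2) * inverse (p \<tau>) ^ 2)) (at \<tau>)"
  proof
    fix \<tau> assume "\<tau> \<in> {0<..<T}"
    then have "p \<tau> \<noteq> 0" using p_pos[of \<tau>] by auto
    then show "((\<lambda>\<tau>. inverse (p \<tau>)) has_real_derivative
      - ((- 2 * \<tau> + 6 * m * \<tau>\<^sup>2) * inverse (p \<tau>) ^ 2)) (at \<tau>)"
      by (auto intro!: derivative_eq_intros p_deriv simp: power2_eq_square)
  qed
  with 2 have i: "\<exists>c'. tc c' \<and> (\<forall>\<tau>\<in>{0<..<T}. ((\<lambda>\<tau>. inverse (p \<tau>)) has_real_derivative c' \<tau>) (at \<tau>))" by blast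
  have "\<exists>c'. tc c' \<and> (\<forall>\<tau>\<in>{0<..<T}. ((\<lambda>\<tau>. \<tau>) has_real_derivative c' \<tau>) (at \<tau>))"
    using 1 by (intro exI[of _ "\<lambda>_. 1"]) auto
  with i alg_base show ?case by auto
next
  case (alg_const c)
  show ?case by (intro exI[of _ "\<lambda>_. 0"]) (auto intro: alg_gen.alg_const)
next
  case (alg_add f g)
  then obtain f' g' where "tc f'" "tc g'" "\<forall>\<tau>\<in>{0<..<T}. (f has_real_derivative f' \<tau>) (at \<tau>)"
    "\<forall>\<tau>\<in>{0<..<T}. (g has_real_derivative g' \<tau>) (at \<tau>)" by blast
  then show ?case by (intro exI[of _ "\<lambda>x. f' x + g' x"]) (auto intro: alg_gen.alg_add DERIV_add)
next
  case (alg_mult f g)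
  then obtain f' g' where "tc f'" "tc g'" "\<forall>\<tau>\<in>{0<..<T}. (f has_real_derivative f' \<tau>) (at \<tau>)"
    "\<forall>\<tau>\<in>{0<..<T}. (g has_real_derivative g' \<tau>) (at \<tau>)" by blast
  then show ?case using alg_mult
    by (intro exI[of _ "\<lambda>x. f' x * g x + g' x * f x"]) (auto intro!: alg_gen.alg_add alg_gen.alg_mult DERIV_mult)
qed

lemma tc_bounded:
  assumes "tc c"
  shows "\<exists>M>0. \<forall>\<tau>\<in>{0..\<tau>0}. \<bar>c \<tau>\<bar> \<le> M"
proof -
  have "continuous_on {0..\<tau>0} c"
    using assms
  proof induction
    case (alg_base f)
    have "continuous_on {0..\<tau>0} p" unfolding p_def by (intro continuous_intros)
    then show ?case using alg_base p_pos tau0 by (force intro!: continuous_intros)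
  qed (auto intro!: continuous_intros)
  then obtain M where "\<forall>\<tau>\<in>{0..\<tau>0}. \<bar>c \<tau>\<bar> \<le> M"
    using compact_imp_bounded[OF compact_continuous_image[OF _ compact_Icc], of 0 \<tau>0 c] by (auto simp: bounded_iff)
  then show ?thesis by (intro exI[of _ "\<bar>M\<bar> + 1"]) force
qed

text \<open>\<open>p\<close> is bounded above on the compact interval, endpoint 0 included. This is
  the uniform hyperbolicity from which coercivity of the energies comes.\<close>

lemma p_bounds: "\<exists>a>0. \<forall>\<tau>\<in>{0..\<tau>0}. a \<le> inverse (p \<tau>)"
proof -
  have "continuous_on {0..\<tau>0} p" unfolding p_def by (intro continuous_intros)
  then obtain M where M: "\<forall>\<tau>\<in>{0..\<tau>0}. \<bar>p \<tau>\<bar> \<le> M"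
    using compact_imp_bounded[OF compact_continuous_image[OF _ compact_Icc], of 0 \<tau>0 p] by (auto simp: bounded_iff)
  have "M > 0" using M p_pos[of 0] tau0 by force
  have "inverse M \<le> inverse (p \<tau>)" if "\<tau> \<in> {0..\<tau>0}" for \<tau>
    using order_trans[OF abs_ge_self bspec[OF M that]] that p_pos[of \<tau>] tau0 by (intro le_imp_inverse_le) auto
  then show ?thesis using \<open>M > 0\<close> by (intro exI[of _ "inverse M"]) auto
qed

lemma tc_smooth: "tc c \<Longrightarrow> smooth_on {0<..<T} c"
proof (rule alg_gen_smooth)
  show "f differentiable at x" if "f \<in> {\<lambda>\<tau>. \<tau>, \<lambda>\<tau>. inverse (p \<tau>)}" "x \<in> {0<..<T}" for f x
    using tc_deriv[OF alg_base[OF that(1)]] that(2) by (auto simp: real_differentiable_def)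
  show "\<exists>g. tc g \<and> (\<forall>x\<in>{0<..<T}. pdiff i f x = g x)"
    if fi: "f \<in> {\<lambda>\<tau>. \<tau>, \<lambda>\<tau>. inverse (p \<tau>)}" "i \<in> Basis" for f i
  proof -
    obtain c' where "tc c'" "\<forall>\<tau>\<in>{0<..<T}. (f has_real_derivative c' \<tau>) (at \<tau>)"
      using tc_deriv[OF alg_base[OF fi(1)]] by blast
    then show ?thesis using fi(2) pdiff_real by auto
  qed
qed auto

text \<open>The \<tau>-derivative is counted from level 1 on: level 0 is handled through the
  transport relation \<open>F_0\<close> instead of a wave equation, and its t and angular
  derivatives are what the sources contain.\<close>

definition n_dens :: "nat \<Rightarrow> R4 \<Rightarrow> real" where
  "n_dens j x = (if j = 0 then 0 else (d0 (F j) x)\<^sup>2) + (d1 (F j) x)\<^sup>2 + (d2 (F j) x)\<^sup>2 + (d3 (F j) x / sin (thv x))\<^sup>2"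

definition N_dens :: "nat \<Rightarrow> R4 \<Rightarrow> real" where
  "N_dens J x = (\<Sum>i\<le>J. n_dens i x)"

lemma n_dens_nonneg: "0 \<le> n_dens j x" by (simp add: n_dens_def)

lemma N_dens_nonneg: "0 \<le> N_dens J x" unfolding N_dens_def by (intro sum_nonneg n_dens_nonneg)

lemma n_le_N: "i \<le> J \<Longrightarrow> n_dens i x \<le> N_dens J x"
  unfolding N_dens_def by (rule member_le_sum) (auto simp: n_dens_nonneg)

lemma N_dens_mono: "J \<le> K \<Longrightarrow> N_dens J x \<le> N_dens K x"
  unfolding N_dens_def by (rule sum_mono2) (auto simp: n_dens_nonneg)

text \<open>Combinations of \<open>F 0, ..., F J\<close> with coefficients that are bounded up to \<open>\<tau> = 0\<close> together with
  all derivatives: the shape of the sources produced by commuting with \<open>\<partial>\<^sub>\<tau>\<close>.\<close>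

inductive lvl :: "nat \<Rightarrow> (R4 \<Rightarrow> real) \<Rightarrow> bool" where
  lvl_F: "i \<le> J \<Longrightarrow> lvl J (F i)"
| lvl_zero: "lvl J (\<lambda>_. 0)"
| lvl_add: "lvl J f \<Longrightarrow> lvl J g \<Longrightarrow> lvl J (\<lambda>x. f x + g x)"
| lvl_cmult: "tc c \<Longrightarrow> lvl J f \<Longrightarrow> lvl J (\<lambda>x. c (fst x) * f x)"

lemma lvl_smooth: "lvl J G \<Longrightarrow> smooth_on (full_reg T) G"
proof (induction rule: lvl.induct)
  case (lvl_cmult c J f)
  then show ?case by (intro smooth_on_mult open_reg smooth_on_coef tc_smooth)
qed (auto intro!: F_smooth smooth_on_const smooth_on_add open_reg)

lemma lvl_mono: "lvl J G \<Longrightarrow> J \<le> K \<Longrightarrow> lvl K G"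
  by (induction rule: lvl.induct) (auto intro: lvl.intros)

lemma lvl_periodic: "lvl J G \<Longrightarrow> G (\<tau>, t, \<theta>, \<phi> + 2 * pi) = G (\<tau>, t, \<theta>, \<phi>)"
  by (induction rule: lvl.induct) (auto simp: F_periodic)

text \<open>A \<tau>-derivative costs one level: \<open>F i\<close> becomes
  \<open>F (Suc i)\<close>, and for \<open>i = 0\<close> the extra factor
  \<open>\<tau> * inverse (p \<tau>)\<close> is an admissible coefficient.\<close>

lemma lvl_d0: "lvl J G \<Longrightarrow> \<exists>G'. lvl (Suc J) G' \<and> (\<forall>x\<in>full_reg T. d0 G x = G' x)"
proof (induction rule: lvl.induct)
  case (lvl_F i J)
  show ?case
  proof (cases i)
    case 0
    have "lvl (Suc J) (\<lambda>x. (\<lambda>\<tau>. \<tau> * inverse (p \<tau>)) (fst x) * F 1 x)"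
      by (rule lvl_cmult) (auto intro!: tc_intros lvl.lvl_F)
    then show ?thesis using 0 F_0 by auto
  next
    case (Suc k)
    then show ?thesis using lvl_F F_Suc by (intro exI[of _ "F (Suc i)"]) (auto intro: lvl.lvl_F)
  qed
next
  case (lvl_zero J)
  show ?case by (rule exI[of _ "\<lambda>_. 0"]) (auto intro: lvl.lvl_zero simp: pdiff_def)
next
  case (lvl_add J f g)
  then obtain f' g' where "lvl (Suc J) f'" "lvl (Suc J) g'" "\<forall>x\<in>full_reg T. d0 f x = f' x"
     "\<forall>x\<in>full_reg T. d0 g x = g' x" by blast
  then show ?case
    using lvl_add smooth_on_differentiable[OF lvl_smooth]
    by (intro exI[of _ "\<lambda>x. f' x + g' x"]) (auto intro: lvl.lvl_add simp: pdiff_add)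
next
  case (lvl_cmult c J f)
  then obtain f' where f': "lvl (Suc J) f'" "\<forall>x\<in>full_reg T. d0 f x = f' x" by blast
  obtain c' where c': "tc c'" "\<forall>\<tau>\<in>{0<..<T}. (c has_real_derivative c' \<tau>) (at \<tau>)"
    using tc_deriv lvl_cmult by blast
  have "lvl (Suc J) (\<lambda>x. c' (fst x) * f x + c (fst x) * f' x)"
    by (intro lvl.lvl_add lvl.lvl_cmult c' f' lvl_mono[OF lvl_cmult(2)] lvl_cmult) simp
  moreover have "d0 (\<lambda>x. c (fst x) * f x) x = c' (fst x) * f x + c (fst x) * f' x" if "x \<in> full_reg T" for x
    using coef_pdiff(1)[OF that lvl_smooth[OF lvl_cmult(2)] tc_smooth[OF lvl_cmult(1)]] c'(2) f'(2) that
    by (auto simp: full_reg_def)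
  ultimately show ?case by blast
qed

text \<open>Coefficients depend on \<tau> alone, so t and angular derivatives treat them as
  constants, bounded on \<open>{0..\<tau>0}\<close>.\<close>

lemma lvl_bound:
  "lvl J G \<Longrightarrow> \<exists>C\<ge>0. \<forall>x\<in>chart_reg T. fst x \<le> \<tau>0 \<longrightarrow>
    (d1 G x)\<^sup>2 + (d2 G x)\<^sup>2 + (d3 G x / sin (thv x))\<^sup>2 \<le> C * N_dens J x"
proof (induction rule: lvl.induct)
  case (lvl_F i J)
  have "(d1 (F i) x)\<^sup>2 + (d2 (F i) x)\<^sup>2 + (d3 (F i) x / sin (thv x))\<^sup>2 \<le> 1 * N_dens J x" for x
    using n_le_N[OF lvl_F, of x] by (auto simp: n_dens_def split: if_splits) (smt (verit) zero_le_power2)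
  then show ?case by (intro exI[of _ 1]) auto
next
  case (lvl_zero J)
  show ?case by (rule exI[of _ 0]) (auto simp: pdiff_def)
next
  case (lvl_add J f g)
  then obtain C D where C: "C \<ge> 0" "\<And>x. x \<in> chart_reg T \<Longrightarrow> fst x \<le> \<tau>0 \<Longrightarrow>
      (d1 f x)\<^sup>2 + (d2 f x)\<^sup>2 + (d3 f x / sin (thv x))\<^sup>2 \<le> C * N_dens J x"
    and D: "D \<ge> 0" "\<And>x. x \<in> chart_reg T \<Longrightarrow> fst x \<le> \<tau>0 \<Longrightarrow>
      (d1 g x)\<^sup>2 + (d2 g x)\<^sup>2 + (d3 g x / sin (thv x))\<^sup>2 \<le> D * N_dens J x" by blast
  have sq: "(a + b)\<^sup>2 \<le> 2 * a\<^sup>2 + 2 * b\<^sup>2" for a b :: real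
    using zero_le_power2[of "a - b"] by (simp add: power2_eq_square algebra_simps)
  have "(d1 (\<lambda>x. f x + g x) x)\<^sup>2 + (d2 (\<lambda>x. f x + g x) x)\<^sup>2 + (d3 (\<lambda>x. f x + g x) x / sin (thv x))\<^sup>2
      \<le> (2 * C + 2 * D) * N_dens J x" if x: "x \<in> chart_reg T" "fst x \<le> \<tau>0" for x
  proof -
    have "x \<in> full_reg T" using x chart_sub_full by blast
    then have "f differentiable at x" "g differentiable at x"
      using lvl_add smooth_on_differentiable[OF lvl_smooth] by blast+
    then show ?thesis
      using C(2)[OF x] D(2)[OF x] sq[of "d1 f x" "d1 g x"] sq[of "d2 f x" "d2 g x"]
        sq[of "d3 f x / sin (thv x)" "d3 g x / sin (thv x)"]
      by (simp add: pdiff_add add_divide_distrib algebra_simps)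
  qed
  then show ?case using C(1) D(1) by (intro exI[of _ "2 * C + 2 * D"]) auto
next
  case (lvl_cmult c J f)
  then obtain C where C: "C \<ge> 0" "\<And>x. x \<in> chart_reg T \<Longrightarrow> fst x \<le> \<tau>0 \<Longrightarrow>
      (d1 f x)\<^sup>2 + (d2 f x)\<^sup>2 + (d3 f x / sin (thv x))\<^sup>2 \<le> C * N_dens J x" by blast
  obtain M where M: "M > 0" "\<forall>\<tau>\<in>{0..\<tau>0}. \<bar>c \<tau>\<bar> \<le> M" using tc_bounded lvl_cmult by blast
  obtain c' where c': "\<forall>\<tau>\<in>{0<..<T}. (c has_real_derivative c' \<tau>) (at \<tau>)"
    using tc_deriv lvl_cmult by blast
  have "(d1 (\<lambda>x. c (fst x) * f x) x)\<^sup>2 + (d2 (\<lambda>x. c (fst x) * f x) x)\<^sup>2 + (d3 (\<lambda>x. c (fst x) * f x) x / sin (thv x))\<^sup>2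
      \<le> (M\<^sup>2 * C) * N_dens J x" if x: "x \<in> chart_reg T" "fst x \<le> \<tau>0" for x
  proof -
    have xf: "x \<in> full_reg T" using x chart_sub_full by blast
    have xt: "fst x \<in> {0<..<T}" using x by (auto simp: chart_reg_def)
    have "\<bar>c (fst x)\<bar> \<le> M" using M xt x(2) by auto
    then have c2: "(c (fst x))\<^sup>2 \<le> M\<^sup>2" using abs_le_square_iff[of "c (fst x)" M] M(1) by simp
    have "(d1 (\<lambda>x. c (fst x) * f x) x)\<^sup>2 + (d2 (\<lambda>x. c (fst x) * f x) x)\<^sup>2 + (d3 (\<lambda>x. c (fst x) * f x) x / sin (thv x))\<^sup>2
      = (c (fst x))\<^sup>2 * ((d1 f x)\<^sup>2 + (d2 f x)\<^sup>2 + (d3 f x / sin (thv x))\<^sup>2)"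
      unfolding coef_pdiff(2-4)[OF xf lvl_smooth[OF lvl_cmult(2)] tc_smooth[OF lvl_cmult(1)] bspec[OF c' xt]]
      by (simp add: power_mult_distrib power_divide algebra_simps)
    also have "\<dots> \<le> M\<^sup>2 * (C * N_dens J x)" using c2 C(2)[OF x] by (intro mult_mono) auto
    finally show ?thesis by simp
  qed
  then show ?case using C(1) by (intro exI[of _ "M\<^sup>2 * C"]) auto
qed

lemma lvl_d0_bound:
  assumes "lvl J G"
  shows "\<exists>C\<ge>0. \<forall>x\<in>chart_reg T. fst x \<le> \<tau>0 \<longrightarrow>
    (d1 (d0 G) x)\<^sup>2 + (d2 (d0 G) x)\<^sup>2 + (d3 (d0 G) x / sin (thv x))\<^sup>2 \<le> C * N_dens (Suc J) x"
proof -
  obtain G' where G': "lvl (Suc J) G'" "\<forall>x\<in>full_reg T. d0 G x = G' x" using lvl_d0[OF assms] by blast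
  have "d1 (d0 G) x = d1 G' x" "d2 (d0 G) x = d2 G' x" "d3 (d0 G) x = d3 G' x" if "x \<in> chart_reg T" for x
    using pdiff_transform_open(2)[OF open_reg(2), of T "d0 G" G'] G'(2) that chart_sub_full by blast+
  then show ?thesis using lvl_bound[OF G'(1)] by simp
qed

text \<open>Differentiating the equation of \<open>F (Suc k)\<close> leaves the commutators
  \<open>al' * d1 (d1 f)\<close> and \<open>be' * lap f\<close>. As their coefficients depend on
  \<tau> alone, they slide under the operators; the commutators are again sources of the same shape,
  one level below the new unknown.\<close>

lemma F_equation:
  "\<exists>G H. lvl k G \<and> lvl k H \<and> (\<forall>x\<in>chart_reg T. d0 (d0 (F (Suc k))) x =
     (inverse (p (fst x)))\<^sup>2 * d1 (d1 (F (Suc k))) x + inverse (p (fst x)) * lap (F (Suc k)) x + d1 (d1 G) x + lap H x)"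
proof (induction k)
  case 0
  let ?q = "\<lambda>\<tau>. (2 - 6 * m * \<tau>) * (inverse (p \<tau>))\<^sup>2"
  have q: "tc ?q" by (intro tc_intros)
  have "lvl 0 (\<lambda>x. ?q (fst x) * F 0 x)" by (rule lvl_cmult[OF q]) (simp add: lvl_F)
  moreover have "d1 (d1 (\<lambda>x. ?q (fst x) * F 0 x)) x = ?q (fst x) * d1 (d1 (F 0)) x" "lap (\<lambda>_. 0) x = 0"
    if "x \<in> chart_reg T" for x
    using lap_cmult(1)[OF F_smooth tc_smooth[OF q], of x 0] that chart_sub_full by (auto simp: lap_def pdiff_const)
  ultimately show ?case
    using F_wave by (intro exI[of _ "\<lambda>x. ?q (fst x) * F 0 x"] exI[of _ "\<lambda>_. 0"]) (simp add: lvl_zero)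
next
  case (Suc k)
  define f where "f = F (Suc k)"
  have f: "smooth_on (full_reg T) f" unfolding f_def by (rule F_smooth)
  obtain G H where GH: "lvl k G" "lvl k H" and eq: "\<And>x. x \<in> chart_reg T \<Longrightarrow> d0 (d0 f) x =
     (inverse (p (fst x)))\<^sup>2 * d1 (d1 f) x + inverse (p (fst x)) * lap f x + d1 (d1 G) x + lap H x"
    using Suc.IH unfolding f_def by blast
  note sG = lvl_smooth[OF GH(1)] note sH = lvl_smooth[OF GH(2)]
  obtain G' where G': "lvl (Suc k) G'" "\<And>x. x \<in> full_reg T \<Longrightarrow> d0 G x = G' x" using lvl_d0[OF GH(1)] by blast
  obtain H' where H': "lvl (Suc k) H'" "\<And>x. x \<in> full_reg T \<Longrightarrow> d0 H x = H' x" using lvl_d0[OF GH(2)] by blast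
  let ?al = "\<lambda>\<tau>. (inverse (p \<tau>))\<^sup>2" let ?be = "\<lambda>\<tau>. inverse (p \<tau>)"
  have tal: "tc ?al" and tbe: "tc ?be" by (intro tc_intros)+
  obtain al' where al': "tc al'" "\<forall>\<tau>\<in>{0<..<T}. (?al has_real_derivative al' \<tau>) (at \<tau>)" using tc_deriv[OF tal] by blast
  obtain be' where be': "tc be'" "\<forall>\<tau>\<in>{0<..<T}. (?be has_real_derivative be' \<tau>) (at \<tau>)" using tc_deriv[OF tbe] by blast
  have lG: "lvl (Suc k) (\<lambda>x. al' (fst x) * f x + G' x)" and lH: "lvl (Suc k) (\<lambda>x. be' (fst x) * f x + H' x)"
    unfolding f_def by (intro lvl_add lvl_cmult al' be' G' H' lvl_F order_refl)+
  have "d0 (d0 (F (Suc (Suc k)))) x =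
     ?al (fst x) * d1 (d1 (F (Suc (Suc k)))) x + ?be (fst x) * lap (F (Suc (Suc k))) x
     + d1 (d1 (\<lambda>x. al' (fst x) * f x + G' x)) x + lap (\<lambda>x. be' (fst x) * f x + H' x) x"
    if x: "x \<in> chart_reg T" for x
  proof -
    have xf: "x \<in> full_reg T" using x chart_sub_full by blast
    have xt: "fst x \<in> {0<..<T}" using x by (auto simp: chart_reg_def)
    have f2: "\<And>y. y \<in> full_reg T \<Longrightarrow> F (Suc (Suc k)) y = d0 f y" using F_Suc[of _ k] by (simp add: f_def)
    have nz: "\<And>x. x \<in> chart_reg T \<Longrightarrow> sin (thv x) \<noteq> 0" using chart_sin_pos by force
    have sl: "smooth_on (chart_reg T) (lap g)" if "smooth_on (full_reg T) g" for g
      unfolding lap_def by (intro smooth_on_intros smooth_chart[OF smooth_on_d(3)] smooth_chart[OF smooth_on_d(4)]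
          smooth_chart[OF smooth_on_d(3)[OF that]] smooth_on_d that smooth_on_thv open_reg; use nz in simp)
    have s11: "smooth_on (chart_reg T) (d1 (d1 g))" if "smooth_on (full_reg T) g" for g
      by (intro smooth_chart smooth_on_d that)
    have "d0 (d0 (F (Suc (Suc k)))) x = d0 (d0 (d0 f)) x"
      by (rule pdiff_transform_open(2)[OF open_reg(2) _ xf], rule pdiff_transform_open(2)[OF open_reg(2) f2])
    also have "\<dots> = d0 (\<lambda>x. (?al (fst x) * d1 (d1 f) x + ?be (fst x) * lap f x) + (d1 (d1 G) x + lap H x)) x"
      by (rule pdiff_transform_open(2)[OF open_reg(1) _ x]) (simp add: eq)
    also have "\<dots> = (d0 (\<lambda>x. ?al (fst x) * d1 (d1 f) x) x + d0 (\<lambda>x. ?be (fst x) * lap f x) x)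
        + (d0 (d1 (d1 G)) x + d0 (lap H) x)"
    proof -
      have d: "\<And>g. smooth_on (chart_reg T) g \<Longrightarrow> g differentiable at x" using smooth_on_differentiable x by blast
      have c: "smooth_on (chart_reg T) (\<lambda>x. ?al (fst x))" "smooth_on (chart_reg T) (\<lambda>x. ?be (fst x))"
        using smooth_chart smooth_on_coef[OF tc_smooth[OF tal]] smooth_on_coef[OF tc_smooth[OF tbe]] by blast+
      note ss = smooth_on_mult[OF open_reg(1) c(1) s11[OF f]] smooth_on_mult[OF open_reg(1) c(2) sl[OF f]] s11[OF sG] sl[OF sH]
      show ?thesis
        by (simp only: pdiff_add[OF d[OF smooth_on_add[OF open_reg(1) ss(1,2)]] d[OF smooth_on_add[OF open_reg(1) ss(3,4)]]]
            pdiff_add[OF d[OF ss(1)] d[OF ss(2)]] pdiff_add[OF d[OF ss(3)] d[OF ss(4)]])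
    qed
    also have "d0 (\<lambda>x. ?al (fst x) * d1 (d1 f) x) x = al' (fst x) * d1 (d1 f) x + ?al (fst x) * d1 (d1 (d0 f)) x"
      using coef_pdiff(1)[OF xf smooth_on_d(2)[OF smooth_on_d(2)[OF f]] tc_smooth[OF tal]] al'(2) xt
        d0_lap_commute(1)[OF f x] by auto
    also have "d0 (\<lambda>x. ?be (fst x) * lap f x) x = be' (fst x) * lap f x + ?be (fst x) * lap (d0 f) x"
    proof -
      have "(\<lambda>x. ?be (fst x)) differentiable at x" "lap f differentiable at x"
        using smooth_on_differentiable[OF smooth_on_coef[OF tc_smooth[OF tbe]] xf] smooth_on_differentiable[OF sl[OF f] x] by auto
      from pdiff_mult[OF this, of "(1,0,0,0)"] show ?thesis
        using coef_pdiff(1)[OF xf smooth_on_const[OF open_reg(2), of T 1] tc_smooth[OF tbe]] be'(2) xt d0_lap_commute(2)[OF f x]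
        by (simp add: pdiff_def)
    qed
    also have "d0 (d1 (d1 G)) x = d1 (d1 G') x"
      using d0_lap_commute(1)[OF sG x] lap_transform(1)[of T "d0 G" G' x] G'(2) xf by auto
    also have "d0 (lap H) x = lap H' x"
      using d0_lap_commute(2)[OF sH x] lap_transform(2)[of T "d0 H" H' x] H'(2) xf by auto
    also have "d1 (d1 (d0 f)) x = d1 (d1 (F (Suc (Suc k)))) x"
      using lap_transform(1)[of T "d0 f" "F (Suc (Suc k))" x] f2 xf by auto
    also have "lap (d0 f) x = lap (F (Suc (Suc k))) x"
      using lap_transform(2)[of T "d0 f" "F (Suc (Suc k))" x] f2 xf by auto
    finally have *: "d0 (d0 (F (Suc (Suc k)))) x = (al' (fst x) * d1 (d1 f) x + ?al (fst x) * d1 (d1 (F (Suc (Suc k)))) x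
        + (be' (fst x) * lap f x + ?be (fst x) * lap (F (Suc (Suc k))) x)) + (d1 (d1 G') x + lap H' x)" .
    have "smooth_on (full_reg T) (\<lambda>x. al' (fst x) * f x)" "smooth_on (full_reg T) (\<lambda>x. be' (fst x) * f x)"
      by (intro smooth_on_mult open_reg smooth_on_coef tc_smooth al' be' f)+
    then have "d1 (d1 (\<lambda>x. al' (fst x) * f x + G' x)) x = al' (fst x) * d1 (d1 f) x + d1 (d1 G') x"
      "lap (\<lambda>x. be' (fst x) * f x + H' x) x = be' (fst x) * lap f x + lap H' x"
      using lap_add(1)[OF _ lvl_smooth[OF G'(1)] xf] lap_add(2)[OF _ lvl_smooth[OF H'(1)] xf]
        lap_cmult[OF f tc_smooth[OF al'(1)] xf] lap_cmult[OF f tc_smooth[OF be'(1)] xf] by auto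
    then show ?thesis using * by simp
  qed
  then show ?case using lG lH by blast
qed

end

section \<open>Coercivity and flux bounds for the energy density\<close>

lemma quadratic_lower:
  fixes a :: real
  assumes "a > 0" "a \<le> al" "a \<le> be" "g1\<^sup>2 \<le> B" "h2\<^sup>2 + h3\<^sup>2 \<le> B"
  shows "f0\<^sup>2 / 2 + a / 4 * (f1\<^sup>2 + f2\<^sup>2 + f3\<^sup>2) - 2 * B / a
    \<le> f0\<^sup>2 / 2 + al * f1\<^sup>2 / 2 + be * (f2\<^sup>2 + f3\<^sup>2) / 2 + g1 * f1 + h2 * f2 + h3 * f3"
proof -
  have c: "- (a / 4 * x\<^sup>2) - y\<^sup>2 / a \<le> y * x" for x y
  proof -
    \<comment> \<open>Completing the square spends half of the available
      \<open>a / 2 * x\<^sup>2\<close> on the cross term; the other half is the \<open>a / 4\<close>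
      of the claim.\<close>
    have "0 \<le> (a * x / 2 + y)\<^sup>2 / a" using assms(1) by simp
    also have "\<dots> = a / 4 * x\<^sup>2 + y * x + y\<^sup>2 / a" using assms(1) by (simp add: field_simps power2_eq_square)
    finally show ?thesis by simp
  qed
  have "a * f1\<^sup>2 \<le> al * f1\<^sup>2" "a * (f2\<^sup>2 + f3\<^sup>2) \<le> be * (f2\<^sup>2 + f3\<^sup>2)"
    using assms by (auto intro!: mult_right_mono)
  moreover have "g1\<^sup>2 / a + (h2\<^sup>2 / a + h3\<^sup>2 / a) \<le> 2 * B / a"
    using assms by (simp add: divide_right_mono flip: add_divide_distrib)
  moreover have "a / 4 * (f1\<^sup>2 + f2\<^sup>2 + f3\<^sup>2) = a * f1\<^sup>2 / 2 + a * (f2\<^sup>2 + f3\<^sup>2) / 2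
      - a / 4 * f1\<^sup>2 - a / 4 * f2\<^sup>2 - a / 4 * f3\<^sup>2" by (simp add: field_simps)
  ultimately show ?thesis using c[of f1 g1] c[of f2 h2] c[of f3 h3] by linarith
qed

lemma prod_le_squares: "\<bar>x * y\<bar> \<le> x\<^sup>2 / 2 + y\<^sup>2 / (2::real)"
proof -
  have "0 \<le> (\<bar>x\<bar> - \<bar>y\<bar>)\<^sup>2" by simp
  then show ?thesis by (simp add: power2_eq_square algebra_simps abs_mult)
qed

lemma quadratic_upper:
  fixes A :: real
  assumes "\<bar>al\<bar> \<le> A" "\<bar>be\<bar> \<le> A" "g1\<^sup>2 \<le> B" "h2\<^sup>2 + h3\<^sup>2 \<le> B"
  shows "\<bar>al * f1\<^sup>2 / 2 + be * (f2\<^sup>2 + f3\<^sup>2) / 2 + g1 * f1 + h2 * f2 + h3 * f3\<bar>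
    \<le> (A + 1) * (f1\<^sup>2 + f2\<^sup>2 + f3\<^sup>2) + B"
proof -
  have "\<bar>al * f1\<^sup>2\<bar> \<le> A * f1\<^sup>2" "\<bar>be * (f2\<^sup>2 + f3\<^sup>2)\<bar> \<le> A * (f2\<^sup>2 + f3\<^sup>2)"
    using assms by (auto simp: abs_mult intro!: mult_right_mono)
  moreover have "A \<ge> 0" using assms(1) by simp
  moreover have "A * (f2\<^sup>2 + f3\<^sup>2) = A * f2\<^sup>2 + A * f3\<^sup>2" "0 \<le> A * f1\<^sup>2" "0 \<le> A * f2\<^sup>2" "0 \<le> A * f3\<^sup>2"
      "(A + 1) * (f1\<^sup>2 + f2\<^sup>2 + f3\<^sup>2) = A * f1\<^sup>2 + A * f2\<^sup>2 + A * f3\<^sup>2 + f1\<^sup>2 + f2\<^sup>2 + f3\<^sup>2"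
    using \<open>A \<ge> 0\<close> by (auto simp: algebra_simps)
  moreover have "0 \<le> f1\<^sup>2" "0 \<le> f2\<^sup>2" "0 \<le> f3\<^sup>2" by auto
  ultimately show ?thesis
    using prod_le_squares[of g1 f1] prod_le_squares[of h2 f2] prod_le_squares[of h3 f3] assms(3,4)
    unfolding abs_le_iff by (elim conjE, intro conjI) argo+
qed

lemma flux_bound:
  fixes A :: real
  assumes "\<bar>al\<bar> \<le> A" "g1\<^sup>2 \<le> B"
  shows "\<bar>f0 * (al * f1 + g1)\<bar> \<le> (A + 1) * (f0\<^sup>2 + f1\<^sup>2) + B"
proof -
  have "\<bar>al * (f0 * f1)\<bar> \<le> A * (f0\<^sup>2 / 2 + f1\<^sup>2 / 2)"
    unfolding abs_mult[of al] using assms prod_le_squares[of f0 f1] by (intro mult_mono) auto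
  moreover have "0 \<le> A * (f0\<^sup>2 + f1\<^sup>2)" using assms by auto
  moreover have "A * (f0\<^sup>2 / 2 + f1\<^sup>2 / 2) = A * (f0\<^sup>2 + f1\<^sup>2) / 2" by (simp add: algebra_simps)
  moreover have "f0 * (al * f1 + g1) = al * (f0 * f1) + f0 * g1"
      "(A + 1) * (f0\<^sup>2 + f1\<^sup>2) = A * (f0\<^sup>2 + f1\<^sup>2) + f0\<^sup>2 + f1\<^sup>2" by (auto simp: algebra_simps)
  moreover have "0 \<le> f0\<^sup>2" "0 \<le> f1\<^sup>2" "0 \<le> g1\<^sup>2" by auto
  ultimately show ?thesis using prod_le_squares[of f0 g1] assms(2)
    unfolding abs_le_iff by (elim conjE, intro conjI) argo+
qed

lemma inner3_bound:
  "\<bar>a1 * b1 + a2 * b2 + a3 * b3\<bar> \<le> (a1\<^sup>2 + a2\<^sup>2 + a3\<^sup>2) + (b1\<^sup>2 + b2\<^sup>2 + b3\<^sup>2)" for a1 :: real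
proof -
  have "0 \<le> a1\<^sup>2" "0 \<le> a2\<^sup>2" "0 \<le> a3\<^sup>2" "0 \<le> b1\<^sup>2" "0 \<le> b2\<^sup>2" "0 \<le> b3\<^sup>2" by auto
  then show ?thesis using prod_le_squares[of a1 b1] prod_le_squares[of a2 b2] prod_le_squares[of a3 b3]
    unfolding abs_le_iff by (elim conjE, intro conjI) argo+
qed

lemma has_derivative_translate:
  fixes f :: "'a::real_normed_vector \<Rightarrow> 'b::real_normed_vector"
  shows "(f has_derivative f') (at (x + a)) \<longleftrightarrow> ((\<lambda>y. f (y + a)) has_derivative f') (at x)"
proof
  assume "(f has_derivative f') (at (x + a))"
  then show "((\<lambda>y. f (y + a)) has_derivative f') (at x)"
    using has_derivative_compose[OF has_derivative_add[OF has_derivative_ident has_derivative_const], of f f' x a] by simp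
next
  assume "((\<lambda>y. f (y + a)) has_derivative f') (at x)"
  then show "(f has_derivative f') (at (x + a))"
    using has_derivative_compose[OF has_derivative_diff[OF has_derivative_ident has_derivative_const], of "\<lambda>y. f (y + a)" f' "x + a" a] by simp
qed

lemma pdiff_translate: "pdiff v f (x + a) = pdiff v (\<lambda>y. f (y + a)) x"
  by (simp add: pdiff_def frechet_derivative_def has_derivative_translate)

lemma pdiff_periodic:
  fixes f :: "R4 \<Rightarrow> real"
  assumes "\<And>\<tau> t \<theta> \<phi>. f (\<tau>, t, \<theta>, \<phi> + a) = f (\<tau>, t, \<theta>, \<phi>)"
  shows "pdiff v f (\<tau>, t, \<theta>, \<phi> + a) = pdiff v f (\<tau>, t, \<theta>, \<phi>)"
proof -
  have "(\<lambda>y. f (y + (0, 0, 0, a))) = f" using assms by (auto simp: fun_eq_iff)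
  then show ?thesis using pdiff_translate[of v f "(\<tau>, t, \<theta>, \<phi>)" "(0, 0, 0, a)"] by simp
qed

lemma pdiff_lincomb:
  "f differentiable (at x) \<Longrightarrow> g differentiable (at x) \<Longrightarrow>
    pdiff v (\<lambda>x. c * f x + g x) x = c * pdiff v f x + pdiff v g x"
  by (rule pdiff_eqI[of _ "\<lambda>v. c * pdiff v f x + pdiff v g x"])
     (auto intro!: derivative_eq_intros differentiable_has_derivative_pdiff)

text \<open>What a localized estimate towards \<tau> = 0 requires: \<open>e\<close> equivalent to
  the weighted density, \<open>P\<close> bounded by \<open>e\<close> (finite speed in t),
  \<open>Q\<close> smooth at the poles and multiplied by \<open>sin \<theta>\<close>,
  \<open>R\<close> periodic. The inequality is one-sided because the evolution runs towards smaller
  \<tau>. The error density \<open>N'\<close> may exceed \<open>N\<close>, as happens at level 0,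
  whose growth involves \<open>F 1\<close>.\<close>

definition energy_current where
  "energy_current T \<tau>0 N N' e P Q R C \<longleftrightarrow>
    smooth_on (chart_reg T) e \<and> smooth_on (chart_reg T) P \<and> smooth_on (full_reg T) Q \<and> smooth_on (chart_reg T) R \<and>
    C > 0 \<and> (\<forall>\<tau> t \<theta> \<phi>. R (\<tau>, t, \<theta>, \<phi> + 2 * pi) = R (\<tau>, t, \<theta>, \<phi>)) \<and>
    (\<forall>x\<in>chart_reg T. fst x \<le> \<tau>0 \<longrightarrow>
      sin (thv x) * N x \<le> C * e x \<and> e x \<le> C * (sin (thv x) * N x) \<and> \<bar>P x\<bar> \<le> C * e x \<and>
      d1 P x + d2 (\<lambda>x. sin (thv x) * Q x) x + d3 R x \<le> d0 e x + C * (sin (thv x) * N' x))"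

section \<open>Construction of energy currents for the hierarchy\<close>

context wave_hierarchy begin

lemma n_dens_chart_smooth: "smooth_on (chart_reg T) (n_dens j)"
proof -
  have nz: "\<And>x. x \<in> chart_reg T \<Longrightarrow> sin (thv x) \<noteq> 0" using chart_sin_pos by force
  note s = smooth_on_d[OF F_smooth[of j]]
  have s0: "smooth_on (chart_reg T) (\<lambda>x. (if j = 0 then 0 else (d0 (F j) x)\<^sup>2))"
    by (cases "j = 0") (auto intro!: smooth_on_intros open_reg s[THEN smooth_chart])
  show ?thesis unfolding n_dens_def
    by (intro s0 smooth_on_add smooth_on_power smooth_on_divide smooth_on_sin smooth_on_thv open_reg s[THEN smooth_chart] nz; assumption)
qed

text \<open>At level 0 there is only an ordinary differential equation at each point: the gradient
  of \<open>F 0\<close> changes at the rate \<open>\<tau> * inverse (p \<tau>)\<close> times the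
  gradient of \<open>F 1\<close>. Hence all fluxes are zero and the error sits at level 1.\<close>

lemma current_base: "\<exists>e P Q R C. energy_current T \<tau>0 (N_dens 0) (N_dens 1) e P Q R C"
proof -
  have tk: "tc (\<lambda>\<tau>. \<tau> * inverse (p \<tau>))" by (intro tc_intros)
  obtain M where M: "M > 0" "\<forall>\<tau>\<in>{0..\<tau>0}. \<bar>\<tau> * inverse (p \<tau>)\<bar> \<le> M" using tc_bounded[OF tk] by blast
  define e where "e x = sin (thv x) * n_dens 0 x" for x
  have N0: "N_dens 0 x = n_dens 0 x" for x by (simp add: N_dens_def)
  have es: "smooth_on (chart_reg T) e"
    unfolding e_def by (intro smooth_on_mult smooth_on_sin smooth_on_thv open_reg n_dens_chart_smooth)
  have "0 \<le> d0 e x + (1 + 2 * M) * (sin (thv x) * N_dens 1 x)" if x: "x \<in> chart_reg T" "fst x \<le> \<tau>0" for x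
  proof -
    obtain \<tau> t \<theta> \<phi> where xx: "x = (\<tau>, t, \<theta>, \<phi>)" by (cases x)
    have xf: "x \<in> full_reg T" using x chart_sub_full by blast
    have xt: "0 < \<tau>" "\<tau> < T" "\<tau> \<le> \<tau>0" using x by (auto simp: chart_reg_def xx)
    have sn: "sin \<theta> > 0" using chart_sin_pos[OF x(1)] by (simp add: xx)
    define k where "k = \<tau> * inverse (p \<tau>)"
    have k: "\<bar>k\<bar> \<le> M" using M xt by (auto simp: k_def)
    obtain k' where k': "\<forall>\<tau>\<in>{0<..<T}. ((\<lambda>\<tau>. \<tau> * inverse (p \<tau>)) has_real_derivative k' \<tau>) (at \<tau>)" using tc_deriv[OF tk] by blast
    have F0c: "d0 (F 0) y = (\<lambda>\<tau>. \<tau> * inverse (p \<tau>)) (fst y) * F 1 y" if "y \<in> full_reg T" for y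
      using F_0[OF that] by simp
    have dF: "d0 (d1 (F 0)) x = k * d1 (F 1) x" "d0 (d2 (F 0)) x = k * d2 (F 1) x" "d0 (d3 (F 0)) x = k * d3 (F 1) x"
      using d_commute[OF open_reg(2) F_smooth xf] pdiff_transform_open(2)[OF open_reg(2) F0c xf]
        coef_pdiff(2-4)[OF xf F_smooth tc_smooth[OF tk], of "k' \<tau>"] k' xt by (auto simp: k_def xx)
    note D = pdiff_coord_DERIV(1)[OF smooth_on_differentiable[OF smooth_on_d(2)[OF F_smooth] xf[unfolded xx]]]
      pdiff_coord_DERIV(1)[OF smooth_on_differentiable[OF smooth_on_d(3)[OF F_smooth] xf[unfolded xx]]]
      pdiff_coord_DERIV(1)[OF smooth_on_differentiable[OF smooth_on_d(4)[OF F_smooth] xf[unfolded xx]]]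
    have "d0 e (\<tau>, t, \<theta>, \<phi>) = sin \<theta> * (2 * (d1 (F 0) x * d0 (d1 (F 0)) x) + 2 * (d2 (F 0) x * d0 (d2 (F 0)) x)
        + 2 * ((d3 (F 0) x / sin \<theta>) * (d0 (d3 (F 0)) x / sin \<theta>)))"
    proof (rule pdiff_coord_eqI(1)[OF smooth_on_differentiable[OF es x(1)[unfolded xx]]])
      show "((\<lambda>s. e (s, t, \<theta>, \<phi>)) has_real_derivative sin \<theta> * (2 * (d1 (F 0) x * d0 (d1 (F 0)) x) + 2 * (d2 (F 0) x * d0 (d2 (F 0)) x)
        + 2 * ((d3 (F 0) x / sin \<theta>) * (d0 (d3 (F 0)) x / sin \<theta>)))) (at \<tau>)"
        unfolding e_def n_dens_def xx
        using sn by (auto intro!: derivative_eq_intros D simp: power2_eq_square field_simps)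
    qed
    also have "\<dots> = sin \<theta> * (2 * k * (d1 (F 0) x * d1 (F 1) x + d2 (F 0) x * d2 (F 1) x
        + (d3 (F 0) x / sin \<theta>) * (d3 (F 1) x / sin \<theta>)))"
      unfolding dF by (simp add: algebra_simps)
    finally have d0e: "d0 e x = \<dots>" by (simp add: xx)
    let ?S = "d1 (F 0) x * d1 (F 1) x + d2 (F 0) x * d2 (F 1) x + (d3 (F 0) x / sin \<theta>) * (d3 (F 1) x / sin \<theta>)"
    have S: "\<bar>?S\<bar> \<le> N_dens 1 x"
    proof -
      have "N_dens 1 x = n_dens 0 x + n_dens 1 x" by (simp add: N_dens_def)
      then show ?thesis
        by (intro order_trans[OF inner3_bound]) (simp add: n_dens_def xx)
    qed
    have "\<bar>2 * k * ?S\<bar> \<le> 2 * M * N_dens 1 x"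
      unfolding abs_mult using k S M(1) by (intro mult_mono) auto
    then have "- (2 * M * N_dens 1 x) \<le> 2 * k * ?S" by linarith
    from mult_left_mono[OF this, of "sin \<theta>"] have "0 \<le> d0 e x + 2 * M * (sin \<theta> * N_dens 1 x)"
      using sn by (simp add: d0e algebra_simps)
    also have "\<dots> \<le> d0 e x + (1 + 2 * M) * (sin \<theta> * N_dens 1 x)"
      using sn N_dens_nonneg[of 1 x] by (simp add: algebra_simps)
    finally show ?thesis by (simp add: xx)
  qed
  moreover have "sin (thv x) * N_dens 0 x \<le> (1 + 2 * M) * e x" "e x \<le> (1 + 2 * M) * (sin (thv x) * N_dens 0 x)" "0 \<le> e x"
    if "x \<in> chart_reg T" for x
    using chart_sin_pos[OF that] n_dens_nonneg[of 0 x] M(1) by (auto simp: e_def N0 algebra_simps)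
  moreover have "d1 (\<lambda>_. 0) x = 0" "d2 (\<lambda>x. sin (thv x) * 0) x = 0" "d3 (\<lambda>_. 0) x = 0" for x
    by (auto simp: pdiff_const)
  ultimately have "energy_current T \<tau>0 (N_dens 0) (N_dens 1) e (\<lambda>_. 0) (\<lambda>_. 0) (\<lambda>_. 0) (1 + 2 * M)"
    using M(1) es unfolding energy_current_def
    by (auto intro!: smooth_on_const open_reg mult_nonneg_nonneg simp: pdiff_const)
  then show ?thesis by blast
qed

lemma current_step:
  assumes "energy_current T \<tau>0 (N_dens J) (N_dens (Suc J)) e P Q R C"
  shows "\<exists>e P Q R C. energy_current T \<tau>0 (N_dens (Suc J)) (N_dens (Suc J)) e P Q R C"
proof -
  obtain G H where GH: "lvl J G" "lvl J H" and eq: "\<And>x. x \<in> chart_reg T \<Longrightarrow> d0 (d0 (F (Suc J))) x =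
     (inverse (p (fst x)))\<^sup>2 * d1 (d1 (F (Suc J))) x + inverse (p (fst x)) * lap (F (Suc J)) x + d1 (d1 G) x + lap H x"
    using F_equation by blast
  define f where "f = F (Suc J)"
  define al where "al = (\<lambda>\<tau>. (inverse (p \<tau>))\<^sup>2)" define be where "be = (\<lambda>\<tau>. inverse (p \<tau>))"
  have tal: "tc al" and tbe: "tc be" unfolding al_def be_def by (intro tc_intros)+
  obtain al' where al': "tc al'" "\<forall>\<tau>\<in>{0<..<T}. (al has_real_derivative al' \<tau>) (at \<tau>)" using tc_deriv[OF tal] by blast
  obtain be' where be': "tc be'" "\<forall>\<tau>\<in>{0<..<T}. (be has_real_derivative be' \<tau>) (at \<tau>)" using tc_deriv[OF tbe] by blast
  note sm = F_smooth[of "Suc J", folded f_def] lvl_smooth[OF GH(1)] lvl_smooth[OF GH(2)]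
  obtain a0 where a0: "a0 > 0" "\<forall>\<tau>\<in>{0..\<tau>0}. a0 \<le> inverse (p \<tau>)" using p_bounds by blast
  \<comment> \<open>The coefficients are \<open>inverse (p \<tau>)\<close> and its square, so both
    powers of the lower bound occur.\<close>
  define a where "a = min a0 (a0\<^sup>2)"
  have a: "a > 0" "\<And>\<tau>. \<tau> \<in> {0..\<tau>0} \<Longrightarrow> a \<le> al \<tau>" "\<And>\<tau>. \<tau> \<in> {0..\<tau>0} \<Longrightarrow> a \<le> be \<tau>"
  proof -
    show "a > 0" using a0 by (simp add: a_def)
    show "a \<le> be \<tau>" if "\<tau> \<in> {0..\<tau>0}" for \<tau> using a0 that by (auto simp: a_def be_def intro: min.coboundedI1)
    show "a \<le> al \<tau>" if "\<tau> \<in> {0..\<tau>0}" for \<tau>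
      unfolding a_def al_def using a0 that by (intro min.coboundedI2 power_mono) auto
  qed
  obtain A1 A2 A3 A4 where A: "A1 > 0" "\<forall>\<tau>\<in>{0..\<tau>0}. \<bar>al \<tau>\<bar> \<le> A1" "A2 > 0" "\<forall>\<tau>\<in>{0..\<tau>0}. \<bar>be \<tau>\<bar> \<le> A2"
    "A3 > 0" "\<forall>\<tau>\<in>{0..\<tau>0}. \<bar>al' \<tau>\<bar> \<le> A3" "A4 > 0" "\<forall>\<tau>\<in>{0..\<tau>0}. \<bar>be' \<tau>\<bar> \<le> A4"
    using tc_bounded[OF tal] tc_bounded[OF tbe] tc_bounded[OF al'(1)] tc_bounded[OF be'(1)] by metis
  define A where "A = A1 + A2 + A3 + A4"
  have A: "A > 0" "\<And>\<tau>. \<tau> \<in> {0..\<tau>0} \<Longrightarrow> \<bar>al \<tau>\<bar> \<le> A" "\<And>\<tau>. \<tau> \<in> {0..\<tau>0} \<Longrightarrow> \<bar>be \<tau>\<bar> \<le> A"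
     "\<And>\<tau>. \<tau> \<in> {0..\<tau>0} \<Longrightarrow> \<bar>al' \<tau>\<bar> \<le> A" "\<And>\<tau>. \<tau> \<in> {0..\<tau>0} \<Longrightarrow> \<bar>be' \<tau>\<bar> \<le> A"
    using A unfolding A_def by (fastforce intro: add_pos_pos)+
  obtain B1 where B1: "B1 \<ge> 0" "\<And>x. x \<in> chart_reg T \<Longrightarrow> fst x \<le> \<tau>0 \<Longrightarrow> (d1 G x)\<^sup>2 + (d2 G x)\<^sup>2 + (d3 G x / sin (thv x))\<^sup>2 \<le> B1 * N_dens J x"
    using lvl_bound[OF GH(1)] by blast
  obtain B2 where B2: "B2 \<ge> 0" "\<And>x. x \<in> chart_reg T \<Longrightarrow> fst x \<le> \<tau>0 \<Longrightarrow> (d1 H x)\<^sup>2 + (d2 H x)\<^sup>2 + (d3 H x / sin (thv x))\<^sup>2 \<le> B2 * N_dens J x"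
    using lvl_bound[OF GH(2)] by blast
  obtain B3 where B3: "B3 \<ge> 0" "\<And>x. x \<in> chart_reg T \<Longrightarrow> fst x \<le> \<tau>0 \<Longrightarrow> (d1 (d0 G) x)\<^sup>2 + (d2 (d0 G) x)\<^sup>2 + (d3 (d0 G) x / sin (thv x))\<^sup>2 \<le> B3 * N_dens (Suc J) x"
    using lvl_d0_bound[OF GH(1)] by blast
  obtain B4 where B4: "B4 \<ge> 0" "\<And>x. x \<in> chart_reg T \<Longrightarrow> fst x \<le> \<tau>0 \<Longrightarrow> (d1 (d0 H) x)\<^sup>2 + (d2 (d0 H) x)\<^sup>2 + (d3 (d0 H) x / sin (thv x))\<^sup>2 \<le> B4 * N_dens (Suc J) x"
    using lvl_d0_bound[OF GH(2)] by blast
  note B = B1 B2 B3 B4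
  define B where "B = B1 + B2 + B3 + B4"
  have Bnn: "B \<ge> 0" using B unfolding B_def by linarith
  have BG: "(d1 G x)\<^sup>2 \<le> B * N_dens J x" "(d2 H x)\<^sup>2 + (d3 H x / sin (thv x))\<^sup>2 \<le> B * N_dens J x"
     "(d1 (d0 G) x)\<^sup>2 \<le> B * N_dens (Suc J) x" "(d2 (d0 H) x)\<^sup>2 + (d3 (d0 H) x / sin (thv x))\<^sup>2 \<le> B * N_dens (Suc J) x"
    if x: "x \<in> chart_reg T" "fst x \<le> \<tau>0" for x
  proof -
    have m: "Bi * N_dens K x \<le> B * N_dens K x" if "Bi \<le> B" for Bi K
      using that N_dens_nonneg by (intro mult_right_mono) auto
    have le: "B1 \<le> B" "B2 \<le> B" "B3 \<le> B" "B4 \<le> B" using B(1,3,5,7) unfolding B_def by linarith+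
    note q = zero_le_power2[of "d1 H x"] zero_le_power2[of "d2 G x"] zero_le_power2[of "d3 G x / sin (thv x)"]
       zero_le_power2[of "d1 (d0 H) x"] zero_le_power2[of "d2 (d0 G) x"] zero_le_power2[of "d3 (d0 G) x / sin (thv x)"]
    show "(d1 G x)\<^sup>2 \<le> B * N_dens J x" using B(2)[OF x] m[OF le(1), of J] q by linarith
    show "(d2 H x)\<^sup>2 + (d3 H x / sin (thv x))\<^sup>2 \<le> B * N_dens J x" using B(4)[OF x] m[OF le(2), of J] q by linarith
    show "(d1 (d0 G) x)\<^sup>2 \<le> B * N_dens (Suc J) x" using B(6)[OF x] m[OF le(3), of "Suc J"] q by linarith
    show "(d2 (d0 H) x)\<^sup>2 + (d3 (d0 H) x / sin (thv x))\<^sup>2 \<le> B * N_dens (Suc J) x"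
      using B(8)[OF x] m[OF le(4), of "Suc J"] q by linarith
  qed
  note ec = assms[unfolded energy_current_def]
  have C: "C > 0" using ec by blast
  \<comment> \<open>Chosen so that \<open>M * e x\<close> pays for the loss \<open>2 * B / a\<close>
    in \<open>quadratic_lower\<close> and still leaves one full copy of the old density.\<close>
  define M where "M = C * (1 + 2 * B / a)"
  have M: "M > 0" using C Bnn a(1) unfolding M_def by (intro mult_pos_pos add_pos_nonneg) auto
  \<comment> \<open>The smaller of the two coefficients left over in
    \<open>quadratic_lower\<close>.\<close>
  define c1 where "c1 = min (1 / 2) (a / 4)"
  have c1: "c1 > 0" "c1 \<le> 1 / 2" "c1 \<le> a / 4" using a(1) by (auto simp: c1_def)
  define E where "E = energy_dens al be f G H"
  define e' where "e' x = M * e x + E x" for x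
  define P' where "P' x = M * P x + flux_t al f G x" for x
  define Q' where "Q' x = M * Q x + flux_th be f H x" for x
  define R' where "R' x = M * R x + flux_ph be f H x" for x
  note es = energy_smooth[OF tc_smooth[OF tal] tc_smooth[OF tbe] sm, folded E_def]
  have smooth': "smooth_on (chart_reg T) e'" "smooth_on (chart_reg T) P'" "smooth_on (full_reg T) Q'" "smooth_on (chart_reg T) R'"
    unfolding e'_def P'_def Q'_def R'_def using ec by (auto intro!: smooth_on_intros open_reg es)
  have nd: "n_dens (Suc J) x = (d0 f x)\<^sup>2 + (d1 f x)\<^sup>2 + (d2 f x)\<^sup>2 + (d3 f x / sin (thv x))\<^sup>2" for x
    by (simp add: n_dens_def f_def)
  have NS: "N_dens (Suc J) x = N_dens J x + n_dens (Suc J) x" for x by (simp add: N_dens_def)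
  \<comment> \<open>Large enough that each upper bound below follows by discarding nonnegative
    terms. \<open>D'\<close> afterwards converts bounds by the density into bounds by
    \<open>e'\<close>.\<close>
  define D where "D = M * C + M * C * C + A + B + 2"
  have D: "D > 0" using M C A(1) Bnn by (auto simp: D_def intro!: add_nonneg_pos)
  define D' where "D' = D / c1 + D"
  have D': "D' \<ge> D" "D' \<ge> 1 / c1" "D' > 0" "D' \<ge> D / c1"
  proof -
    have "D \<ge> 1" using M C A(1) Bnn by (auto simp: D_def)
    then show "D' \<ge> D" "D' \<ge> 1 / c1" "D' > 0" "D' \<ge> D / c1" using D c1 divide_right_mono[of 1 D c1] by (auto simp: D'_def add_nonneg_pos)
  qed
  have main: "sin (thv x) * N_dens (Suc J) x \<le> D' * e' x \<and> e' x \<le> D' * (sin (thv x) * N_dens (Suc J) x) \<and>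
      \<bar>P' x\<bar> \<le> D' * e' x \<and> d1 P' x + d2 (\<lambda>x. sin (thv x) * Q' x) x + d3 R' x \<le> d0 e' x + D' * (sin (thv x) * N_dens (Suc J) x)"
    if x: "x \<in> chart_reg T" "fst x \<le> \<tau>0" for x
  proof -
    define s where "s = sin (thv x)"
    have s: "s > 0" using chart_sin_pos[OF x(1)] by (simp add: s_def)
    have xt: "fst x \<in> {0..\<tau>0}" "fst x \<in> {0<..<T}" using x by (auto simp: chart_reg_def)
    have xf: "x \<in> full_reg T" using x chart_sub_full by blast
    have old: "s * N_dens J x \<le> C * e x" "e x \<le> C * (s * N_dens J x)" "\<bar>P x\<bar> \<le> C * e x"
      "d1 P x + d2 (\<lambda>x. sin (thv x) * Q x) x + d3 R x \<le> d0 e x + C * (s * N_dens (Suc J) x)"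
      using ec x by (auto simp: s_def)
    define N where "N = N_dens J x" define n where "n = n_dens (Suc J) x"
    have Nn: "N \<ge> 0" "n \<ge> 0" using N_dens_nonneg n_dens_nonneg by (auto simp: N_def n_def)
    define f0 f1 f2 f3 where ff: "f0 = d0 f x" "f1 = d1 f x" "f2 = d2 f x" "f3 = d3 f x / s"
    define g1 h2 h3 where gg: "g1 = d1 G x" "h2 = d2 H x" "h3 = d3 H x / s"
    have n: "n = f0\<^sup>2 + f1\<^sup>2 + f2\<^sup>2 + f3\<^sup>2" by (simp add: n_def nd ff s_def)
    have gb: "g1\<^sup>2 \<le> B * N" "h2\<^sup>2 + h3\<^sup>2 \<le> B * N" using BG(1,2)[OF x] by (auto simp: gg N_def s_def)
    define S where "S = al (fst x) * f1\<^sup>2 / 2 + be (fst x) * (f2\<^sup>2 + f3\<^sup>2) / 2 + g1 * f1 + h2 * f2 + h3 * f3"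
    have Ex: "E x = s * (f0\<^sup>2 / 2 + S)"
      unfolding E_def energy_dens_def S_def by (simp add: ff gg s_def)
    have lo: "f0\<^sup>2 / 2 + a / 4 * (f1\<^sup>2 + f2\<^sup>2 + f3\<^sup>2) - 2 * (B * N) / a \<le> f0\<^sup>2 / 2 + S"
      using quadratic_lower[OF a(1) a(2)[OF xt(1)] a(3)[OF xt(1)] gb, of f0 f1 f2 f3] by (simp add: S_def)
    have up: "f0\<^sup>2 / 2 + S \<le> (A + 1) * n + B * N"
    proof -
      have "S \<le> (A + 1) * (f1\<^sup>2 + f2\<^sup>2 + f3\<^sup>2) + B * N"
        using quadratic_upper[OF A(2)[OF xt(1)] A(3)[OF xt(1)] gb, of f1 f2 f3] unfolding S_def by linarith
      moreover have "f0\<^sup>2 / 2 \<le> (A + 1) * f0\<^sup>2" using A(1) by (simp add: algebra_simps)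
      ultimately show ?thesis by (simp add: n algebra_simps)
    qed
    have Me: "s * N * (1 + 2 * B / a) \<le> M * e x"
    proof -
      have "(s * N) * (1 + 2 * B / a) \<le> (C * e x) * (1 + 2 * B / a)"
        using old(1) Bnn a(1) by (intro mult_right_mono) (auto simp: N_def)
      then show ?thesis by (simp add: M_def mult_ac)
    qed
    have lower: "c1 * (s * (N + n)) \<le> e' x"
    proof -
      have "c1 * n \<le> f0\<^sup>2 / 2 + a / 4 * (f1\<^sup>2 + f2\<^sup>2 + f3\<^sup>2)"
      proof -
        have "c1 * f0\<^sup>2 \<le> 1 / 2 * f0\<^sup>2" "c1 * (f1\<^sup>2 + f2\<^sup>2 + f3\<^sup>2) \<le> a / 4 * (f1\<^sup>2 + f2\<^sup>2 + f3\<^sup>2)"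
          using c1 by (intro mult_right_mono; auto)+
        then show ?thesis by (simp add: n algebra_simps)
      qed
      then have "c1 * n - 2 * (B * N) / a \<le> f0\<^sup>2 / 2 + S" using lo by linarith
      from mult_left_mono[OF this, of s] have "s * (c1 * n) - s * (2 * (B * N) / a) \<le> E x"
        using s by (simp add: Ex algebra_simps)
      moreover have "c1 * (s * N) \<le> s * N" using c1 s Nn mult_right_mono[of c1 1 "s * N"] by simp
      moreover have "s * N * (1 + 2 * B / a) = s * N + s * (2 * (B * N) / a)" by (simp add: algebra_simps)
      ultimately show ?thesis using Me by (simp add: e'_def algebra_simps)
    qed
    have sNn: "0 \<le> s * N" "0 \<le> s * n" using s Nn by auto
    have MC: "M * e x \<le> M * C * (s * N)" using mult_left_mono[OF old(2), of M] M by (simp add: N_def mult_ac)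
    have e0: "0 \<le> e x" using order_trans[OF sNn(1)[unfolded N_def] old(1)] C by (simp add: zero_le_mult_iff)
    have E'': "e' x \<le> D * (s * (N + n))"
    proof -
      have "E x \<le> s * ((A + 1) * n + B * N)" unfolding Ex using up s by simp
      moreover have "D * (s * (N + n)) = M * C * (s * N) + s * ((A + 1) * n + B * N)
          + (M * C * (s * n) + M * C * C * (s * (N + n)) + s * n + B * (s * n) + (A + 2) * (s * N))"
        unfolding D_def by (simp add: algebra_simps)
      moreover have "0 \<le> M * C * (s * n) + M * C * C * (s * (N + n)) + s * n + B * (s * n) + (A + 2) * (s * N)"
        using M C Bnn A(1) sNn Nn s by (intro add_nonneg_nonneg mult_nonneg_nonneg) auto
      ultimately show ?thesis using MC unfolding e'_def by linarith
    qed
    have NSx: "N_dens (Suc J) x = N + n" by (simp add: NS N_def n_def)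
    have lower': "s * (N + n) \<le> (1 / c1) * e' x" using lower c1(1) by (simp add: field_simps)
    have e'0: "0 \<le> e' x" using lower c1(1) sNn by (smt (verit) mult_nonneg_nonneg distrib_left)
    have i1: "s * (N + n) \<le> D' * e' x" using lower' mult_right_mono[OF D'(2) e'0] by linarith
    have i2: "e' x \<le> D' * (s * (N + n))"
      using E'' mult_right_mono[OF D'(1), of "s * (N + n)"] sNn by (simp add: algebra_simps)
    have P1: "\<bar>P' x\<bar> \<le> D * (s * (N + n))"
    proof -
      have "\<bar>f0 * (al (fst x) * f1 + g1)\<bar> \<le> (A + 1) * (f0\<^sup>2 + f1\<^sup>2) + B * N"
        by (rule flux_bound[OF A(2)[OF xt(1)] gb(1)])
      also have "\<dots> \<le> (A + 1) * n + B * N" using A(1) unfolding n by (intro add_right_mono mult_left_mono) auto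
      finally have "\<bar>f0 * (al (fst x) * f1 + g1)\<bar> \<le> (A + 1) * n + B * N" .
      from mult_left_mono[OF this, of s] have fl: "\<bar>flux_t al f G x\<bar> \<le> s * ((A + 1) * n + B * N)"
        using s by (simp add: flux_t_def s_def ff gg abs_mult)
      have "\<bar>M * P x\<bar> \<le> M * (C * e x)"
        using old(3) M by (simp add: abs_mult mult_left_mono)
      also have "\<dots> \<le> C * (M * C * (s * N))" using MC C by (simp add: mult_left_mono mult.left_commute)
      finally have "\<bar>M * P x\<bar> \<le> M * C * C * (s * N)" by (simp add: mult_ac)
      moreover have "D * (s * (N + n)) = M * C * C * (s * N) + s * ((A + 1) * n + B * N)
          + (M * C * C * (s * n) + M * C * (s * (N + n)) + s * n + B * (s * n) + (A + 2) * (s * N))"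
        unfolding D_def by (simp add: algebra_simps)
      moreover have "0 \<le> M * C * C * (s * n) + M * C * (s * (N + n)) + s * n + B * (s * n) + (A + 2) * (s * N)"
        using M C Bnn A(1) sNn Nn s by (intro add_nonneg_nonneg mult_nonneg_nonneg) auto
      ultimately show ?thesis using fl unfolding P'_def by linarith
    qed
    have "s * (N + n) \<le> e' x / c1" using lower' by simp
    from mult_left_mono[OF this, of D] D have i3: "\<bar>P' x\<bar> \<le> D / c1 * e' x" using P1 by simp
    then have i3: "\<bar>P' x\<bar> \<le> D' * e' x" using mult_right_mono[OF D'(4) e'0] by linarith
    have dx: "e differentiable at x" "P differentiable at x" "R differentiable at x"
      "E differentiable at x" "flux_t al f G differentiable at x" "flux_ph be f H differentiable at x"
      using ec es smooth_on_differentiable x(1) by blast+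
    have sq: "smooth_on (full_reg T) (\<lambda>x. sin (thv x) * Q x)" "smooth_on (full_reg T) (\<lambda>x. sin (thv x) * flux_th be f H x)"
      using ec es by (auto intro!: smooth_on_mult smooth_on_sin smooth_on_thv open_reg)
    have qx: "(\<lambda>x. sin (thv x) * Q x) differentiable at x" "(\<lambda>x. sin (thv x) * flux_th be f H x) differentiable at x"
      using smooth_on_differentiable[OF sq(1) xf] smooth_on_differentiable[OF sq(2) xf] by auto
    have Q'eq: "(\<lambda>x. sin (thv x) * Q' x) = (\<lambda>x. M * (sin (thv x) * Q x) + sin (thv x) * flux_th be f H x)"
      by (simp add: Q'_def algebra_simps)
    have pd: "d1 P' x = M * d1 P x + d1 (flux_t al f G) x" "d3 R' x = M * d3 R x + d3 (flux_ph be f H) x"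
      "d0 e' x = M * d0 e x + d0 E x"
      "d2 (\<lambda>x. sin (thv x) * Q' x) x = M * d2 (\<lambda>x. sin (thv x) * Q x) x + d2 (\<lambda>x. sin (thv x) * flux_th be f H x) x"
      unfolding Q'eq unfolding P'_def[abs_def] R'_def[abs_def] e'_def[abs_def]
      using pdiff_lincomb[OF dx(2,5)] pdiff_lincomb[OF dx(3,6)] pdiff_lincomb[OF dx(1,4)] pdiff_lincomb[OF qx] by auto
    define k1 k2 k3 where kk: "k1 = d1 (d0 G) x" "k2 = d2 (d0 H) x" "k3 = d3 (d0 H) x / s"
    define W where "W = al' (fst x) * f1\<^sup>2 / 2 + be' (fst x) * (f2\<^sup>2 + f3\<^sup>2) / 2 + k1 * f1 + k2 * f2 + k3 * f3"
    have id: "d0 E x = d1 (flux_t al f G) x + d2 (\<lambda>x. sin (thv x) * flux_th be f H x) x + d3 (flux_ph be f H) x + s * W"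
      unfolding E_def W_def ff gg kk s_def
      by (rule energy_identity[OF tc_smooth[OF tal] _ tc_smooth[OF tbe] _ sm x(1)])
         (use al'(2) be'(2) eq[OF x(1)] in \<open>auto simp: f_def al_def be_def\<close>)
    have "\<bar>W\<bar> \<le> (A + 1) * (f1\<^sup>2 + f2\<^sup>2 + f3\<^sup>2) + B * (N + n)"
      unfolding W_def using BG(3,4)[OF x]
      by (intro quadratic_upper A(4,5)[OF xt(1)]) (auto simp: kk s_def NSx)
    also have "\<dots> \<le> (A + 1) * n + B * (N + n)" using A(1) unfolding n by (intro add_right_mono mult_left_mono) auto
    finally have "- ((A + 1) * n + B * (N + n)) \<le> W" by linarith
    from mult_left_mono[OF this less_imp_le[OF s]] have sW: "- (s * ((A + 1) * n + B * (N + n))) \<le> s * W"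
      by (simp only: mult_minus_right)
    have "M * (d1 P x + d2 (\<lambda>x. sin (thv x) * Q x) x + d3 R x) \<le> M * (d0 e x + C * (s * (N + n)))"
      using old(4) M by (simp add: NSx)
    then have "d1 P' x + d2 (\<lambda>x. sin (thv x) * Q' x) x + d3 R' x
        \<le> d0 e' x + (M * C * (s * (N + n)) + s * ((A + 1) * n + B * (N + n)))"
      unfolding pd using id sW by (simp add: algebra_simps)
    also have "M * C * (s * (N + n)) + s * ((A + 1) * n + B * (N + n)) \<le> D * (s * (N + n))"
    proof -
      have "D * (s * (N + n)) = M * C * (s * (N + n)) + s * ((A + 1) * n + B * (N + n))
          + (M * C * C * (s * (N + n)) + s * n + (A + 2) * (s * N))"
        unfolding D_def by (simp add: algebra_simps)
      moreover have "0 \<le> M * C * C * (s * (N + n)) + s * n + (A + 2) * (s * N)"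
        using M C A(1) sNn Nn s by (intro add_nonneg_nonneg mult_nonneg_nonneg) auto
      ultimately show ?thesis by linarith
    qed
    also have "D * (s * (N + n)) \<le> D' * (s * (N + n))"
      using mult_right_mono[OF D'(1), of "s * (N + n)"] sNn by (simp add: distrib_left)
    finally have i4: "d1 P' x + d2 (\<lambda>x. sin (thv x) * Q' x) x + d3 R' x \<le> d0 e' x + D' * (s * (N + n))" by simp
    show ?thesis using i1 i2 i3 i4 unfolding NSx s_def by blast
  qed
  have "R (\<tau>, t, \<theta>, \<phi> + 2 * pi) = R (\<tau>, t, \<theta>, \<phi>)" for \<tau> t \<theta> \<phi> using ec by blast
  moreover have "pdiff v f (\<tau>, t, \<theta>, \<phi> + 2 * pi) = pdiff v f (\<tau>, t, \<theta>, \<phi>)"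
      "pdiff v H (\<tau>, t, \<theta>, \<phi> + 2 * pi) = pdiff v H (\<tau>, t, \<theta>, \<phi>)" for v \<tau> t \<theta> \<phi>
    using pdiff_periodic[of f "2 * pi"] F_periodic pdiff_periodic[of H "2 * pi"] lvl_periodic[OF GH(2)] by (auto simp: f_def)
  ultimately have "R' (\<tau>, t, \<theta>, \<phi> + 2 * pi) = R' (\<tau>, t, \<theta>, \<phi>)" for \<tau> t \<theta> \<phi>
    by (simp add: R'_def flux_ph_def)
  then have "energy_current T \<tau>0 (N_dens (Suc J)) (N_dens (Suc J)) e' P' Q' R' D'"
    unfolding energy_current_def using smooth' main D'(3) by blast
  then show ?thesis by blast
qed

text \<open>Between two steps the error of a closed current at level \<open>Suc J\<close> is
  weakened to level \<open>Suc (Suc J)\<close>, the form that \<open>current_step\<close> takes as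
  input.\<close>

lemma current_exists: "\<exists>e P Q R C. energy_current T \<tau>0 (N_dens (Suc J)) (N_dens (Suc J)) e P Q R C"
proof (induction J)
  case 0
  then show ?case using current_base current_step[of 0] by auto
next
  case (Suc J)
  then obtain e P Q R C where c: "energy_current T \<tau>0 (N_dens (Suc J)) (N_dens (Suc J)) e P Q R C" by blast
  have "energy_current T \<tau>0 (N_dens (Suc J)) (N_dens (Suc (Suc J))) e P Q R C"
    unfolding energy_current_def
  proof (intro conjI ballI impI)
    fix x assume x: "x \<in> chart_reg T" "fst x \<le> \<tau>0"
    have "C > 0" using c by (simp add: energy_current_def)
    then have "C * (sin (thv x) * N_dens (Suc J) x) \<le> C * (sin (thv x) * N_dens (Suc (Suc J)) x)"
      using chart_sin_pos[OF x(1)] N_dens_mono[of "Suc J" "Suc (Suc J)" x] by (intro mult_left_mono) auto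
    moreover have "d1 P x + d2 (\<lambda>x. sin (thv x) * Q x) x + d3 R x \<le> d0 e x + C * (sin (thv x) * N_dens (Suc J) x)"
      using c x by (simp add: energy_current_def)
    ultimately show "d1 P x + d2 (\<lambda>x. sin (thv x) * Q x) x + d3 R x \<le> d0 e x + C * (sin (thv x) * N_dens (Suc (Suc J)) x)"
      by linarith
  qed (use c in \<open>simp_all add: energy_current_def\<close>)
  then show ?case by (rule current_step)
qed

end

section \<open>Propagation of energy\<close>

lemma integral_DERIV:
  fixes f :: "real \<Rightarrow> real"
  assumes "a \<le> b" "\<And>x. x \<in> {a..b} \<Longrightarrow> (f has_real_derivative f' x) (at x)"
  shows "integral {a..b} f' = f b - f a"
  by (rule integral_unique[OF fundamental_theorem_of_calculus[OF assms(1)]])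
     (use assms(2) in \<open>auto simp: has_real_derivative_iff_has_vector_derivative intro: has_vector_derivative_at_within\<close>)

lemma abs_integral_le_content:
  fixes f :: "'a::euclidean_space \<Rightarrow> real"
  assumes "\<And>x. x \<in> cbox a b \<Longrightarrow> \<bar>f x\<bar> \<le> B" "0 \<le> B"
  shows "\<bar>integral (cbox a b) f\<bar> \<le> B * measure lborel (cbox a b)"
proof (cases "f integrable_on cbox a b")
  case True
  then show ?thesis using has_integral_bound[OF assms(2) integrable_integral[OF True]] assms(1) by auto
next
  case False
  then show ?thesis using assms(2) by (simp add: not_integrable_integral)
qed

lemma continuous_on_slice:
  fixes g :: "'a::euclidean_space \<times> 'b::euclidean_space \<Rightarrow> real"
  assumes "continuous_on (cbox (a, c) (b, d)) g"
  shows "x \<in> cbox a b \<Longrightarrow> continuous_on (cbox c d) (\<lambda>y. g (x, y))"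
    "y \<in> cbox c d \<Longrightarrow> continuous_on (cbox a b) (\<lambda>x. g (x, y))"
  by (rule continuous_on_compose2[OF assms]; auto intro!: continuous_intros simp: cbox_Pair_eq)+

lemma integral_prod_swap:
  fixes g :: "'a::euclidean_space \<times> 'b::euclidean_space \<Rightarrow> real"
  assumes "continuous_on (cbox (a, c) (b, d)) g"
  shows "integral (cbox (a, c) (b, d)) g = integral (cbox c d) (\<lambda>y. integral (cbox a b) (\<lambda>x. g (x, y)))"
  unfolding integral_prod_continuous[OF assms]
  by (rule integral_swap_continuous) (use assms in simp)

text \<open>The divergence theorem on a box, with boundary faces sorted by the reason for which they
  drop out: the t-faces vanish, the \<phi>-faces cancel by periodicity, and the \<theta>-faces
  remain as an error of size \<open>k\<close> times their measure.\<close>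

lemma box_divergence:
  fixes E A B R E' A' B' R' :: "R4 \<Rightarrow> real"
  assumes le: "\<tau>1 \<le> \<tau>2" "a \<le> b" "\<epsilon> \<le> \<eta>" "c \<le> d"
  defines "X \<equiv> cbox (\<tau>1, a, \<epsilon>, c) (\<tau>2, b, \<eta>, d)" and "Y \<equiv> cbox (a, \<epsilon>, c) (b, \<eta>, d)"
  assumes c: "continuous_on X E" "continuous_on X E'" "continuous_on X A'" "continuous_on X B'" "continuous_on X R'"
    and D: "\<And>\<tau> t \<theta> \<phi>. (\<tau>, t, \<theta>, \<phi>) \<in> X \<Longrightarrow> ((\<lambda>s. E (s, t, \<theta>, \<phi>)) has_real_derivative E' (\<tau>, t, \<theta>, \<phi>)) (at \<tau>)"
      "\<And>\<tau> t \<theta> \<phi>. (\<tau>, t, \<theta>, \<phi>) \<in> X \<Longrightarrow> ((\<lambda>s. A (\<tau>, s, \<theta>, \<phi>)) has_real_derivative A' (\<tau>, t, \<theta>, \<phi>)) (at t)"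
      "\<And>\<tau> t \<theta> \<phi>. (\<tau>, t, \<theta>, \<phi>) \<in> X \<Longrightarrow> ((\<lambda>s. B (\<tau>, t, s, \<phi>)) has_real_derivative B' (\<tau>, t, \<theta>, \<phi>)) (at \<theta>)"
      "\<And>\<tau> t \<theta> \<phi>. (\<tau>, t, \<theta>, \<phi>) \<in> X \<Longrightarrow> ((\<lambda>s. R (\<tau>, t, \<theta>, s)) has_real_derivative R' (\<tau>, t, \<theta>, \<phi>)) (at \<phi>)"
    and bA: "\<And>\<tau> \<theta> \<phi>. \<tau> \<in> {\<tau>1..\<tau>2} \<Longrightarrow> A (\<tau>, a, \<theta>, \<phi>) = 0" "\<And>\<tau> \<theta> \<phi>. \<tau> \<in> {\<tau>1..\<tau>2} \<Longrightarrow> A (\<tau>, b, \<theta>, \<phi>) = 0"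
    and bR: "\<And>\<tau> t \<theta>. R (\<tau>, t, \<theta>, d) = R (\<tau>, t, \<theta>, c)"
    and bB: "\<And>\<tau> t \<phi>. (\<tau>, t, \<epsilon>, \<phi>) \<in> X \<Longrightarrow> \<bar>B (\<tau>, t, \<epsilon>, \<phi>)\<bar> \<le> k"
      "\<And>\<tau> t \<phi>. (\<tau>, t, \<eta>, \<phi>) \<in> X \<Longrightarrow> \<bar>B (\<tau>, t, \<eta>, \<phi>)\<bar> \<le> k" and k: "0 \<le> k"
    and ineq: "\<And>x. x \<in> X \<Longrightarrow> A' x + B' x + R' x \<le> E' x"
  shows "integral Y (\<lambda>y. E (\<tau>1, y)) \<le> integral Y (\<lambda>y. E (\<tau>2, y)) + 2 * k * ((d - c) * (b - a) * (\<tau>2 - \<tau>1))"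
proof -
  note X = X_def[unfolded cbox_Pair_eq]
  have E: "integral X E' = integral Y (\<lambda>y. E (\<tau>2, y)) - integral Y (\<lambda>y. E (\<tau>1, y))"
  proof -
    have "integral X E' = integral Y (\<lambda>y. integral (cbox \<tau>1 \<tau>2) (\<lambda>s. E' (s, y)))"
      unfolding X_def Y_def by (rule integral_prod_swap) (use c(2) in \<open>simp add: X_def\<close>)
    also have "\<dots> = integral Y (\<lambda>y. E (\<tau>2, y) - E (\<tau>1, y))"
    proof (rule integral_cong)
      fix y assume y: "y \<in> Y"
      show "integral (cbox \<tau>1 \<tau>2) (\<lambda>s. E' (s, y)) = E (\<tau>2, y) - E (\<tau>1, y)"
        using y by (cases y) (auto simp: X Y_def cbox_Pair_eq intro!: integral_DERIV le D(1))
    qed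
    also have "\<dots> = integral Y (\<lambda>y. E (\<tau>2, y)) - integral Y (\<lambda>y. E (\<tau>1, y))"
      unfolding Y_def using c(1) le
      by (intro integral_diff integrable_continuous continuous_on_slice(1)[of \<tau>1 _ \<tau>2]) (auto simp: X_def)
    finally show ?thesis .
  qed
  have slice: "continuous_on (cbox (a, \<epsilon>, c) (b, \<eta>, d)) (\<lambda>y. g (\<tau>, y))"
    if "continuous_on X g" "\<tau> \<in> {\<tau>1..\<tau>2}" for g :: "R4 \<Rightarrow> real" and \<tau>
    using continuous_on_slice(1)[OF that(1)[unfolded X_def]] that(2) by simp
  have slice2: "continuous_on (cbox (\<epsilon>, c) (\<eta>, d)) (\<lambda>y. g (\<tau>, t, y))"
    if "continuous_on X g" "\<tau> \<in> {\<tau>1..\<tau>2}" "t \<in> {a..b}" for g :: "R4 \<Rightarrow> real" and \<tau> t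
    using continuous_on_slice(1)[OF slice[OF that(1,2)]] that(3) by simp
  have A: "integral X A' = 0"
  proof -
    have "integral X A' = integral (cbox \<tau>1 \<tau>2) (\<lambda>\<tau>. integral Y (\<lambda>y. A' (\<tau>, y)))"
      unfolding X_def Y_def by (rule integral_prod_continuous) (use c(3) in \<open>simp add: X_def\<close>)
    also have "\<dots> = integral (cbox \<tau>1 \<tau>2) (\<lambda>\<tau>. 0)"
    proof (rule integral_cong)
      fix \<tau> assume \<tau>: "\<tau> \<in> cbox \<tau>1 \<tau>2"
      have "integral Y (\<lambda>y. A' (\<tau>, y)) = integral (cbox (\<epsilon>, c) (\<eta>, d)) (\<lambda>z. integral (cbox a b) (\<lambda>t. A' (\<tau>, t, z)))"
        unfolding Y_def using \<tau> by (intro integral_prod_swap slice c) auto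
      also have "\<dots> = integral (cbox (\<epsilon>, c) (\<eta>, d)) (\<lambda>z. 0)"
      proof (rule integral_cong)
        fix z assume z: "z \<in> cbox (\<epsilon>, c) (\<eta>, d)"
        obtain \<theta> \<phi> where [simp]: "z = (\<theta>, \<phi>)" by (cases z)
        have "integral (cbox a b) (\<lambda>t. A' (\<tau>, t, z)) = A (\<tau>, b, z) - A (\<tau>, a, z)"
          using z \<tau> by (auto simp: X cbox_Pair_eq intro!: integral_DERIV le D(2))
        then show "integral (cbox a b) (\<lambda>t. A' (\<tau>, t, z)) = 0" using bA \<tau> by simp
      qed
      finally show "integral Y (\<lambda>y. A' (\<tau>, y)) = 0" by simp
    qed
    finally show ?thesis by simp
  qed
  have R: "integral X R' = 0"
  proof -
    have "integral X R' = integral (cbox \<tau>1 \<tau>2) (\<lambda>\<tau>. integral Y (\<lambda>y. R' (\<tau>, y)))"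
      unfolding X_def Y_def by (rule integral_prod_continuous) (use c(5) in \<open>simp add: X_def\<close>)
    also have "\<dots> = integral (cbox \<tau>1 \<tau>2) (\<lambda>\<tau>. 0)"
    proof (rule integral_cong)
      fix \<tau> assume \<tau>: "\<tau> \<in> cbox \<tau>1 \<tau>2"
      have "integral Y (\<lambda>y. R' (\<tau>, y)) = integral (cbox a b) (\<lambda>t. integral (cbox (\<epsilon>, c) (\<eta>, d)) (\<lambda>z. R' (\<tau>, t, z)))"
        unfolding Y_def using \<tau> by (intro integral_prod_continuous slice c) auto
      also have "\<dots> = integral (cbox a b) (\<lambda>t. 0)"
      proof (rule integral_cong)
        fix t assume t: "t \<in> cbox a b"
        have "integral (cbox (\<epsilon>, c) (\<eta>, d)) (\<lambda>z. R' (\<tau>, t, z)) = integral (cbox \<epsilon> \<eta>) (\<lambda>\<theta>. integral (cbox c d) (\<lambda>\<phi>. R' (\<tau>, t, \<theta>, \<phi>)))"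
          using t \<tau> by (intro integral_prod_continuous slice2 c) auto
        also have "\<dots> = integral (cbox \<epsilon> \<eta>) (\<lambda>\<theta>. 0)"
        proof (rule integral_cong)
          fix \<theta> assume \<theta>: "\<theta> \<in> cbox \<epsilon> \<eta>"
          have "integral (cbox c d) (\<lambda>\<phi>. R' (\<tau>, t, \<theta>, \<phi>)) = R (\<tau>, t, \<theta>, d) - R (\<tau>, t, \<theta>, c)"
            using t \<tau> \<theta> by (auto simp: X intro!: integral_DERIV le D(4))
          then show "integral (cbox c d) (\<lambda>\<phi>. R' (\<tau>, t, \<theta>, \<phi>)) = 0" using bR by simp
        qed
        finally show "integral (cbox (\<epsilon>, c) (\<eta>, d)) (\<lambda>z. R' (\<tau>, t, z)) = 0" by simp
      qed
      finally show "integral Y (\<lambda>y. R' (\<tau>, y)) = 0" by simp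
    qed
    finally show ?thesis by simp
  qed
  have B: "\<bar>integral X B'\<bar> \<le> 2 * k * (d - c) * (b - a) * (\<tau>2 - \<tau>1)"
  proof -
    have 1: "\<bar>integral (cbox (\<epsilon>, c) (\<eta>, d)) (\<lambda>z. B' (\<tau>, t, z))\<bar> \<le> 2 * k * (d - c)"
      if \<tau>: "\<tau> \<in> cbox \<tau>1 \<tau>2" and t: "t \<in> cbox a b" for \<tau> t
    proof -
      have eq: "integral (cbox (\<epsilon>, c) (\<eta>, d)) (\<lambda>z. B' (\<tau>, t, z)) = integral (cbox c d) (\<lambda>\<phi>. integral (cbox \<epsilon> \<eta>) (\<lambda>\<theta>. B' (\<tau>, t, \<theta>, \<phi>)))"
        using t \<tau> by (intro integral_prod_swap slice2 c) auto
      have *: "\<bar>integral (cbox \<epsilon> \<eta>) (\<lambda>\<theta>. B' (\<tau>, t, \<theta>, \<phi>))\<bar> \<le> 2 * k" if \<phi>: "\<phi> \<in> cbox c d" for \<phi>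
      proof -
        have "integral (cbox \<epsilon> \<eta>) (\<lambda>\<theta>. B' (\<tau>, t, \<theta>, \<phi>)) = B (\<tau>, t, \<eta>, \<phi>) - B (\<tau>, t, \<epsilon>, \<phi>)"
          using t \<tau> \<phi> by (auto simp: X intro!: integral_DERIV le D(3))
        moreover have "\<bar>B (\<tau>, t, \<eta>, \<phi>)\<bar> \<le> k" "\<bar>B (\<tau>, t, \<epsilon>, \<phi>)\<bar> \<le> k"
          using t \<tau> \<phi> le by (auto simp: X intro!: bB)
        ultimately show ?thesis by linarith
      qed
      have "\<bar>integral (cbox c d) (\<lambda>\<phi>. integral (cbox \<epsilon> \<eta>) (\<lambda>\<theta>. B' (\<tau>, t, \<theta>, \<phi>)))\<bar> \<le> 2 * k * measure lborel (cbox c d)"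
        by (rule abs_integral_le_content) (use * k in auto)
      then show ?thesis unfolding eq using k le by simp
    qed
    have 2: "\<bar>integral Y (\<lambda>y. B' (\<tau>, y))\<bar> \<le> 2 * k * (d - c) * (b - a)" if \<tau>: "\<tau> \<in> cbox \<tau>1 \<tau>2" for \<tau>
    proof -
      have eq: "integral Y (\<lambda>y. B' (\<tau>, y)) = integral (cbox a b) (\<lambda>t. integral (cbox (\<epsilon>, c) (\<eta>, d)) (\<lambda>z. B' (\<tau>, t, z)))"
        unfolding Y_def using \<tau> by (intro integral_prod_continuous slice c) auto
      have "\<bar>integral (cbox a b) (\<lambda>t. integral (cbox (\<epsilon>, c) (\<eta>, d)) (\<lambda>z. B' (\<tau>, t, z)))\<bar> \<le> 2 * k * (d - c) * measure lborel (cbox a b)"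
        by (rule abs_integral_le_content) (use 1[OF \<tau>] k le in auto)
      then show ?thesis unfolding eq using k le by simp
    qed
    have "integral X B' = integral (cbox \<tau>1 \<tau>2) (\<lambda>\<tau>. integral Y (\<lambda>y. B' (\<tau>, y)))"
      unfolding X_def Y_def by (rule integral_prod_continuous) (use c(4) in \<open>simp add: X_def\<close>)
    moreover have "\<bar>integral (cbox \<tau>1 \<tau>2) (\<lambda>\<tau>. integral Y (\<lambda>y. B' (\<tau>, y)))\<bar> \<le> 2 * k * (d - c) * (b - a) * measure lborel (cbox \<tau>1 \<tau>2)"
      by (rule abs_integral_le_content) (use 2 k le in auto)
    ultimately show ?thesis using le by simp
  qed
  have i: "E' integrable_on X" "A' integrable_on X" "B' integrable_on X" "R' integrable_on X"
    using c unfolding X_def by (auto intro: integrable_continuous)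
  have "integral X (\<lambda>x. A' x + B' x + R' x) \<le> integral X E'"
    by (intro integral_le integrable_add i ineq)
  moreover have "integral X (\<lambda>x. A' x + B' x + R' x) = integral X A' + integral X B' + integral X R'"
    using i by (simp add: integral_add integrable_add)
  ultimately show ?thesis using E A R B by (simp add: algebra_simps)
qed

text \<open>Passes from the gauge integrals of \<open>box_divergence\<close> to the Lebesgue
  integrals in which energies are measured.\<close>

lemma nn_integral_continuous_cbox:
  fixes f :: "'a::euclidean_space \<Rightarrow> real"
  assumes c: "continuous_on (cbox a b) f" and nn: "\<And>x. x \<in> cbox a b \<Longrightarrow> 0 \<le> f x"
  shows "(\<integral>\<^sup>+x\<in>cbox a b. ennreal (f x) \<partial>lborel) = ennreal (integral (cbox a b) f)"
proof -
  have i: "integrable lborel (\<lambda>x. indicator (cbox a b) x *\<^sub>R f x)"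
    by (rule borel_integrable_compact[OF compact_cbox c])
  have "(\<integral>\<^sup>+x\<in>cbox a b. ennreal (f x) \<partial>lborel) = (\<integral>\<^sup>+x. ennreal (indicator (cbox a b) x *\<^sub>R f x) \<partial>lborel)"
    by (intro nn_integral_cong) (auto simp: indicator_def)
  also have "\<dots> = ennreal (\<integral>x. indicator (cbox a b) x *\<^sub>R f x \<partial>lborel)"
    by (rule nn_integral_eq_integral[OF i]) (use nn in \<open>auto simp: indicator_def\<close>)
  also have "(\<integral>x. indicator (cbox a b) x *\<^sub>R f x \<partial>lborel) = integral (cbox a b) f"
    using set_borel_integral_eq_integral(2)[of "cbox a b" f] i by (simp add: set_integrable_def set_lebesgue_integral_def)
  finally show ?thesis .
qed

lemma flat_exp_facts:
  "0 \<le> flat_exp n 1 x" "flat_exp 0 1 x \<le> 1" "x \<ge> 1 \<Longrightarrow> exp (- 1) \<le> flat_exp 0 1 x" "x \<le> 0 \<Longrightarrow> flat_exp n 1 x = 0"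
    "continuous_on S (flat_exp n 1)"
    "(flat_exp 0 1 has_real_derivative flat_exp 2 1 x) (at x)"
proof -
  show "continuous_on S (flat_exp n 1)"
    using DERIV_isCont[OF flat_exp_DERIV[of 1 n]] by (intro continuous_at_imp_continuous_on) auto
  show "(flat_exp 0 1 has_real_derivative flat_exp 2 1 x) (at x)" using flat_exp_DERIV[of 1 0 x] by (simp add: numeral_2_eq_2)
qed (auto simp: flat_exp_def divide_le_eq)

text \<open>A weight \<omega> turns the estimate into monotonicity in \<tau>: an exponential factor
  absorbs the error of order zero, in place of Gronwall's inequality, and a cutoff in t widens with
  speed \<open>C\<close> as \<tau> grows, which outruns the flux \<open>P\<close>. The pole faces
  leave the error \<open>k * sin \<epsilon>\<close> with \<open>k\<close> independent of
  \<epsilon>.\<close>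

lemma energy_estimate_box:
  assumes cur: "energy_current T \<tau>0 N N e P Q R C" and tau: "0 < \<tau>1" "\<tau>1 \<le> \<tau>0" "\<tau>0 < T"
    and Nnn: "\<And>x. 0 \<le> N x" and Nm: "\<And>\<tau>. (\<lambda>p. N (\<tau>, p)) \<in> borel_measurable borel" and ab: "a \<le> b" and M: "M = 1 + C * \<tau>0"
  shows "\<exists>k\<ge>0. \<forall>\<epsilon>. 0 < \<epsilon> \<and> \<epsilon> < pi / 2 \<longrightarrow>
    (\<integral>\<^sup>+p\<in>{a..b} \<times> {\<epsilon>..pi - \<epsilon>} \<times> {c..c + 2 * pi}. ennreal (sin (fst (snd p)) * N (\<tau>1, p)) \<partial>lborel)
    \<le> ennreal (C * exp 2 * C * exp (C * C * \<tau>0)) *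
        (\<integral>\<^sup>+p\<in>{a - M..b + M} \<times> {0<..<pi} \<times> {c..c + 2 * pi}. ennreal (sin (fst (snd p)) * N (\<tau>0, p)) \<partial>lborel)
      + ennreal (k * sin \<epsilon>)"
proof -
  note ec = cur[unfolded energy_current_def]
  have C: "C > 0" using ec by blast
  have pt: "sin (thv x) * N x \<le> C * e x" "e x \<le> C * (sin (thv x) * N x)" "\<bar>P x\<bar> \<le> C * e x"
      "d1 P x + d2 (\<lambda>x. sin (thv x) * Q x) x + d3 R x \<le> d0 e x + C * (sin (thv x) * N x)"
    if "x \<in> chart_reg T" "fst x \<le> \<tau>0" for x using ec that by blast+
  define a' b' where ab': "a' = a - M" "b' = b + M"
  have Mp: "M > 0" using M C tau by (simp add: add_pos_pos)
  \<comment> \<open>Both \<open>u\<close> and \<open>v\<close> are at least 1 over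
    \<open>{a..b}\<close>, so the cutoff is at least \<open>exp (- 2)\<close> there. At the t-faces,
    at distance \<open>M = 1 + C * \<tau>0\<close>, one of them is nonpositive and the cutoff is
    0.\<close>
  define u where "u = (\<lambda>x::R4. fst (snd x) - a + 1 + C * fst x)"
  define v where "v = (\<lambda>x::R4. b + 1 - fst (snd x) + C * fst x)"
  define \<omega> where "\<omega> = (\<lambda>x::R4. exp (C * C * fst x) * (flat_exp 0 1 (u x) * flat_exp 0 1 (v x)))"
  define \<omega>' where "\<omega>' = (\<lambda>x::R4. C * C * \<omega> x + C * exp (C * C * fst x) * (flat_exp 2 1 (u x) * flat_exp 0 1 (v x) + flat_exp 0 1 (u x) * flat_exp 2 1 (v x)))"
  define \<omega>t where "\<omega>t = (\<lambda>x::R4. exp (C * C * fst x) * (flat_exp 2 1 (u x) * flat_exp 0 1 (v x) - flat_exp 0 1 (u x) * flat_exp 2 1 (v x)))"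
  have cw: "continuous_on S \<omega>" "continuous_on S \<omega>'" "continuous_on S \<omega>t" for S
    unfolding \<omega>'_def \<omega>t_def \<omega>_def u_def v_def
    by (intro continuous_intros continuous_on_compose2[OF flat_exp_facts(5)[of UNIV]]; simp)+
  have w0: "0 \<le> \<omega> x" for x unfolding \<omega>_def by (intro mult_nonneg_nonneg flat_exp_facts) simp
  have dw: "((\<lambda>s. \<omega> (s, t, \<theta>, \<phi>)) has_real_derivative \<omega>' (\<tau>, t, \<theta>, \<phi>)) (at \<tau>)"
    "((\<lambda>s. \<omega> (\<tau>, s, \<theta>, \<phi>)) has_real_derivative \<omega>t (\<tau>, t, \<theta>, \<phi>)) (at t)" for \<tau> t \<theta> \<phi>
    unfolding \<omega>'_def \<omega>t_def \<omega>_def u_def v_def fst_conv snd_conv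
    by (auto intro!: derivative_eq_intros DERIV_chain2[OF flat_exp_facts(6)] simp: algebra_simps)
  \<comment> \<open>This box reaches the poles, where \<open>Q\<close> is still continuous; a single
    bound therefore serves all \<epsilon>.\<close>
  define Z where "Z = cbox (\<tau>1, a', 0, c) (\<tau>0, b', pi, c + 2 * pi)"
  have Zf: "Z \<subseteq> full_reg T" using tau by (auto simp: Z_def cbox_Pair_eq full_reg_def)
  have cZ: "continuous_on Z (\<lambda>x. \<omega> x * Q x)"
    using ec by (intro continuous_on_mult cw continuous_on_subset[OF smooth_on_continuous Zf]) auto
  then obtain W where "\<forall>x\<in>Z. \<bar>\<omega> x * Q x\<bar> \<le> W"
    using compact_imp_bounded[OF compact_continuous_image[OF cZ compact_cbox[of "(\<tau>1, a', 0, c)" "(\<tau>0, b', pi, c + 2 * pi)", folded Z_def]]]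
    by (auto simp: bounded_iff)
  then have W: "\<bar>\<omega> x * Q x\<bar> \<le> \<bar>W\<bar>" if "x \<in> Z" for x using that by force
  define k where "k = C * exp 2 * (2 * \<bar>W\<bar> * (2 * pi * (b' - a') * (\<tau>0 - \<tau>1)))"
  have k: "k \<ge> 0" unfolding k_def using C tau ab Mp by (intro mult_nonneg_nonneg) (auto simp: ab')
  show ?thesis
  proof (intro exI[of _ k] conjI k allI impI)
    fix \<epsilon> :: real assume \<epsilon>: "0 < \<epsilon> \<and> \<epsilon> < pi / 2"
    define X where "X = cbox (\<tau>1, a', \<epsilon>, c) (\<tau>0, b', pi - \<epsilon>, c + 2 * pi)"
    define Y where "Y = cbox (a', \<epsilon>, c) (b', pi - \<epsilon>, c + 2 * pi)"
    have XZ: "X \<subseteq> Z" using \<epsilon> by (auto simp: X_def Z_def cbox_Pair_eq)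
    have Xc: "X \<subseteq> chart_reg T" using \<epsilon> tau by (auto simp: X_def chart_reg_def cbox_Pair_eq)
    have Xt: "fst x \<le> \<tau>0" if "x \<in> X" for x using that by (auto simp: X_def cbox_Pair_eq)
    have sn: "sin \<epsilon> > 0" using \<epsilon> by (intro sin_gt_zero) auto
    define sQ where "sQ = (\<lambda>x. sin (thv x) * Q x)"
    have sQs: "smooth_on (chart_reg T) sQ" unfolding sQ_def
      using ec by (intro smooth_on_mult smooth_on_sin smooth_on_thv open_reg smooth_chart) auto
    have sm: "smooth_on (chart_reg T) e" "smooth_on (chart_reg T) P" "smooth_on (chart_reg T) R" using ec by auto
    have co: "continuous_on X g" if "smooth_on (chart_reg T) g" for g
      using continuous_on_subset[OF smooth_on_continuous[OF that] Xc] .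
    have dif: "g differentiable at x" if "smooth_on (chart_reg T) g" "x \<in> X" for g x
      using smooth_on_differentiable[OF that(1)] that(2) Xc by blast
    have main: "integral Y (\<lambda>y. \<omega> (\<tau>1, y) * e (\<tau>1, y)) \<le> integral Y (\<lambda>y. \<omega> (\<tau>0, y) * e (\<tau>0, y))
        + 2 * (\<bar>W\<bar> * sin \<epsilon>) * ((c + 2 * pi - c) * (b' - a') * (\<tau>0 - \<tau>1))"
      unfolding Y_def
    proof (rule box_divergence[where ?\<tau>1.0 = \<tau>1 and ?\<tau>2.0 = \<tau>0 and a = a' and b = b' and \<epsilon> = \<epsilon> and \<eta> = "pi - \<epsilon>" and c = c and d = "c + 2 * pi" and E = "\<lambda>x. \<omega> x * e x" and E' = "\<lambda>x. \<omega>' x * e x + \<omega> x * d0 e x"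
          and A = "\<lambda>x. \<omega> x * P x" and A' = "\<lambda>x. \<omega>t x * P x + \<omega> x * d1 P x"
          and B = "\<lambda>x. \<omega> x * sQ x" and B' = "\<lambda>x. \<omega> x * d2 sQ x"
          and R = "\<lambda>x. \<omega> x * R x" and R' = "\<lambda>x. \<omega> x * d3 R x", folded X_def])
      show "\<tau>1 \<le> \<tau>0" "a' \<le> b'" "\<epsilon> \<le> pi - \<epsilon>" "c \<le> c + 2 * pi" "0 \<le> \<bar>W\<bar> * sin \<epsilon>" using tau ab Mp \<epsilon> sn by (auto simp: ab')
      show "continuous_on X (\<lambda>x. \<omega> x * e x)" "continuous_on X (\<lambda>x. \<omega>' x * e x + \<omega> x * d0 e x)"
        "continuous_on X (\<lambda>x. \<omega>t x * P x + \<omega> x * d1 P x)" "continuous_on X (\<lambda>x. \<omega> x * d2 sQ x)"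
        "continuous_on X (\<lambda>x. \<omega> x * d3 R x)"
        by (intro continuous_on_mult continuous_on_add cw co sm smooth_on_d sQs)+
      fix \<tau> t \<theta> \<phi>
      {
        assume x: "(\<tau>, t, \<theta>, \<phi>) \<in> X"
        show "((\<lambda>s. \<omega> (s, t, \<theta>, \<phi>) * e (s, t, \<theta>, \<phi>)) has_real_derivative
            \<omega>' (\<tau>, t, \<theta>, \<phi>) * e (\<tau>, t, \<theta>, \<phi>) + \<omega> (\<tau>, t, \<theta>, \<phi>) * d0 e (\<tau>, t, \<theta>, \<phi>)) (at \<tau>)"
          using DERIV_mult[OF dw(1) pdiff_coord_DERIV(1)[OF dif[OF sm(1) x]]] by (simp add: mult.commute)
        show "((\<lambda>s. \<omega> (\<tau>, s, \<theta>, \<phi>) * P (\<tau>, s, \<theta>, \<phi>)) has_real_derivative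
            \<omega>t (\<tau>, t, \<theta>, \<phi>) * P (\<tau>, t, \<theta>, \<phi>) + \<omega> (\<tau>, t, \<theta>, \<phi>) * d1 P (\<tau>, t, \<theta>, \<phi>)) (at t)"
          using DERIV_mult[OF dw(2) pdiff_coord_DERIV(2)[OF dif[OF sm(2) x]]] by (simp add: mult.commute)
        obtain w where w: "w = \<omega> (\<tau>, t, \<theta>, \<phi>)" by blast
        have wc: "\<omega> (\<tau>, t, s, s') = w" for s s'
          by (auto simp: w \<omega>_def u_def v_def)
        show "((\<lambda>s. \<omega> (\<tau>, t, s, \<phi>) * sQ (\<tau>, t, s, \<phi>)) has_real_derivative \<omega> (\<tau>, t, \<theta>, \<phi>) * d2 sQ (\<tau>, t, \<theta>, \<phi>)) (at \<theta>)"
          unfolding wc by (rule DERIV_cmult[OF pdiff_coord_DERIV(3)[OF dif[OF sQs x]]])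
        show "((\<lambda>s. \<omega> (\<tau>, t, \<theta>, s) * R (\<tau>, t, \<theta>, s)) has_real_derivative \<omega> (\<tau>, t, \<theta>, \<phi>) * d3 R (\<tau>, t, \<theta>, \<phi>)) (at \<phi>)"
          unfolding wc by (rule DERIV_cmult[OF pdiff_coord_DERIV(4)[OF dif[OF sm(3) x]]])
      }
      show "\<omega> (\<tau>, t, \<theta>, c + 2 * pi) * R (\<tau>, t, \<theta>, c + 2 * pi) = \<omega> (\<tau>, t, \<theta>, c) * R (\<tau>, t, \<theta>, c)"
      proof -
        have "R (\<tau>, t, \<theta>, c + 2 * pi) = R (\<tau>, t, \<theta>, c)" using ec by blast
        then show ?thesis by (simp add: \<omega>_def u_def v_def)
      qed
      {
        assume \<tau>: "\<tau> \<in> {\<tau>1..\<tau>0}"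
        then have "C * \<tau> \<le> C * \<tau>0" using C by simp
        then have "u (\<tau>, a', \<theta>, \<phi>) \<le> 0" "v (\<tau>, b', \<theta>, \<phi>) \<le> 0" by (auto simp: u_def v_def ab' M)
        then show "\<omega> (\<tau>, a', \<theta>, \<phi>) * P (\<tau>, a', \<theta>, \<phi>) = 0" "\<omega> (\<tau>, b', \<theta>, \<phi>) * P (\<tau>, b', \<theta>, \<phi>) = 0"
          using flat_exp_facts(4) by (auto simp: \<omega>_def)
      }
      have bd: "\<bar>\<omega> x * sQ x\<bar> \<le> \<bar>W\<bar> * sin \<epsilon>" if "x \<in> X" "sin (thv x) = sin \<epsilon>" for x
        using mult_left_mono[OF W, of x "sin \<epsilon>"] that XZ sn by (auto simp: sQ_def abs_mult mult_ac)
      show "(\<tau>, t, \<epsilon>, \<phi>) \<in> X \<Longrightarrow> \<bar>\<omega> (\<tau>, t, \<epsilon>, \<phi>) * sQ (\<tau>, t, \<epsilon>, \<phi>)\<bar> \<le> \<bar>W\<bar> * sin \<epsilon>"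
        "(\<tau>, t, pi - \<epsilon>, \<phi>) \<in> X \<Longrightarrow> \<bar>\<omega> (\<tau>, t, pi - \<epsilon>, \<phi>) * sQ (\<tau>, t, pi - \<epsilon>, \<phi>)\<bar> \<le> \<bar>W\<bar> * sin \<epsilon>"
        using bd by auto
    next
      fix x assume x: "x \<in> X"
      have old: "sin (thv x) * N x \<le> C * e x" "\<bar>P x\<bar> \<le> C * e x" "d1 P x + d2 sQ x + d3 R x \<le> d0 e x + C * (sin (thv x) * N x)"
        using pt[OF subsetD[OF Xc x] Xt[OF x]] by (simp_all add: sQ_def)
      define g where "g = exp (C * C * fst x)"
      define y1 where "y1 = flat_exp 2 1 (u x) * flat_exp 0 1 (v x)"
      define y2 where "y2 = flat_exp 0 1 (u x) * flat_exp 2 1 (v x)"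
      have y: "0 \<le> y1" "0 \<le> y2" "0 < g" by (auto simp: y1_def y2_def g_def intro!: mult_nonneg_nonneg flat_exp_facts)
      \<comment> \<open>The t-derivative of the cutoff is dominated by its \<tau>-derivative,
        because its edges move with speed \<open>C\<close> and
        \<open>\<bar>P x\<bar> \<le> C * e x\<close>.\<close>
      have "(y1 - y2) * P x \<le> (y1 + y2) * (C * e x)"
      proof -
        have "(y1 - y2) * P x \<le> \<bar>y1 - y2\<bar> * \<bar>P x\<bar>" by (metis abs_ge_self abs_mult)
        also have "\<dots> \<le> (y1 + y2) * (C * e x)" using y old(2) by (intro mult_mono) auto
        finally show ?thesis .
      qed
      then have 1: "\<omega>t x * P x \<le> C * g * (y1 + y2) * e x"
        using mult_left_mono[of _ _ g] y(3) by (simp add: \<omega>t_def g_def y1_def y2_def mult_ac)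
      \<comment> \<open>The error is at most \<open>C * C * e x\<close>, whence the exponent
        \<open>C * C * fst x\<close> in \<omega>.\<close>
      have "C * (sin (thv x) * N x) \<le> C * (C * e x)" using old(1) C by (simp add: mult_left_mono)
      then have "d1 P x + d2 sQ x + d3 R x \<le> d0 e x + C * C * e x" using old(3) by (simp add: mult.assoc)
      from mult_left_mono[OF this w0[of x]]
      have 2: "\<omega> x * (d1 P x + d2 sQ x + d3 R x) \<le> \<omega> x * d0 e x + C * C * \<omega> x * e x" by (simp add: algebra_simps)
      have "\<omega>' x * e x = C * C * \<omega> x * e x + C * g * (y1 + y2) * e x"
        by (simp add: \<omega>'_def g_def y1_def y2_def algebra_simps)
      then show "\<omega>t x * P x + \<omega> x * d1 P x + \<omega> x * d2 sQ x + \<omega> x * d3 R x \<le> \<omega>' x * e x + \<omega> x * d0 e x"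
        using 1 2 by (simp add: algebra_simps)
    qed
    have inX: "(\<tau>, p) \<in> X" if "p \<in> Y" "\<tau> \<in> {\<tau>1..\<tau>0}" for \<tau> p
      using that by (cases p) (auto simp: X_def Y_def cbox_Pair_eq)
    have e0: "0 \<le> e x" "sin (thv x) * N x \<le> C * e x" "e x \<le> C * (sin (thv x) * N x)" "0 < sin (thv x)" if "x \<in> X" for x
    proof -
      show pt': "sin (thv x) * N x \<le> C * e x" "e x \<le> C * (sin (thv x) * N x)"
        using pt[OF subsetD[OF Xc that] Xt[OF that]] by simp_all
      show sp: "0 < sin (thv x)" using chart_sin_pos that Xc by blast
      have "0 \<le> C * e x" using sp Nnn[of x] by (intro order_trans[OF _ pt'(1)]) auto
      then show "0 \<le> e x" using C by (simp add: zero_le_mult_iff)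
    qed
    have nnI: "(\<integral>\<^sup>+p\<in>Y. ennreal (\<omega> (\<tau>, p) * e (\<tau>, p)) \<partial>lborel) = ennreal (integral Y (\<lambda>p. \<omega> (\<tau>, p) * e (\<tau>, p)))"
      if \<tau>: "\<tau> \<in> {\<tau>1..\<tau>0}" for \<tau>
      unfolding Y_def
    proof (rule nn_integral_continuous_cbox)
      show "continuous_on (cbox (a', \<epsilon>, c) (b', pi - \<epsilon>, c + 2 * pi)) (\<lambda>p. \<omega> (\<tau>, p) * e (\<tau>, p))"
        by (rule continuous_on_compose2[OF continuous_on_mult[OF cw(1) co[OF sm(1)]], of _ "\<lambda>p. (\<tau>, p)"])
           (use inX \<tau> in \<open>auto simp: Y_def intro!: continuous_intros\<close>)
      show "0 \<le> \<omega> (\<tau>, p) * e (\<tau>, p)" if "p \<in> cbox (a', \<epsilon>, c) (b', pi - \<epsilon>, c + 2 * pi)" for p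
        using w0 e0(1)[OF inX[OF _ \<tau>]] that by (auto simp: Y_def)
    qed
    have low: "ennreal (sin (fst (snd p)) * N (\<tau>1, p)) * indicator ({a..b} \<times> {\<epsilon>..pi - \<epsilon>} \<times> {c..c + 2 * pi}) p
       \<le> ennreal (C * exp 2) * (ennreal (\<omega> (\<tau>1, p) * e (\<tau>1, p)) * indicator Y p)" for p
    proof (cases "p \<in> {a..b} \<times> {\<epsilon>..pi - \<epsilon>} \<times> {c..c + 2 * pi}")
      case True
      then have pY: "p \<in> Y" using Mp by (auto simp: Y_def cbox_Pair_eq ab')
      have pX: "(\<tau>1, p) \<in> X" by (rule inX[OF pY]) (use tau in auto)
      have "0 \<le> C * \<tau>1" using C tau by simp
      moreover have "a \<le> fst p" "fst p \<le> b" using True by (simp_all add: mem_Times_iff)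
      ultimately have "u (\<tau>1, p) \<ge> 1" "v (\<tau>1, p) \<ge> 1" by (simp_all add: u_def v_def)
      then have "exp (- 1) * exp (- 1) \<le> flat_exp 0 1 (u (\<tau>1, p)) * flat_exp 0 1 (v (\<tau>1, p))"
        by (intro mult_mono flat_exp_facts) auto
      also have "\<dots> \<le> \<omega> (\<tau>1, p)"
        unfolding \<omega>_def using mult_right_mono[of 1 "exp (C * C * \<tau>1)" "flat_exp 0 1 (u (\<tau>1, p)) * flat_exp 0 1 (v (\<tau>1, p))"] C tau
        by (simp add: flat_exp_facts(1))
      finally have "exp (- 2) \<le> \<omega> (\<tau>1, p)" by (simp flip: exp_add)
      from mult_right_mono[OF this e0(1)[OF pX]] have "e (\<tau>1, p) \<le> exp 2 * (\<omega> (\<tau>1, p) * e (\<tau>1, p))"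
        by (simp add: exp_minus field_simps)
      from order_trans[OF e0(2)[OF pX] mult_left_mono[OF this less_imp_le[OF C]]]
      have "sin (fst (snd p)) * N (\<tau>1, p) \<le> C * exp 2 * (\<omega> (\<tau>1, p) * e (\<tau>1, p))"
        by (simp add: mult.assoc)
      then show ?thesis using True pY C by (simp add: ennreal_mult'[symmetric] ennreal_leI)
    qed simp
    have up: "ennreal (\<omega> (\<tau>0, p) * e (\<tau>0, p)) * indicator Y p
       \<le> ennreal (C * exp (C * C * \<tau>0)) * (ennreal (sin (fst (snd p)) * N (\<tau>0, p)) * indicator ({a - M..b + M} \<times> {0<..<pi} \<times> {c..c + 2 * pi}) p)" for p
    proof (cases "p \<in> Y")
      case True
      then have pX: "(\<tau>0, p) \<in> X" by (rule inX) (use tau in auto)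
      have pB: "p \<in> {a - M..b + M} \<times> {0<..<pi} \<times> {c..c + 2 * pi}" using True \<epsilon> by (cases p) (auto simp: Y_def cbox_Pair_eq ab')
      have "\<omega> (\<tau>0, p) \<le> exp (C * C * \<tau>0) * (1 * 1)"
        unfolding \<omega>_def fst_conv by (intro mult_left_mono mult_mono flat_exp_facts) auto
      from mult_mono[OF this e0(3)[OF pX]] have "\<omega> (\<tau>0, p) * e (\<tau>0, p) \<le> C * exp (C * C * \<tau>0) * (sin (fst (snd p)) * N (\<tau>0, p))"
        using e0(1)[OF pX] by (simp add: mult_ac)
      then show ?thesis using True pB C by (simp add: ennreal_mult'[symmetric] ennreal_leI)
    qed simp
    let ?L = "\<integral>\<^sup>+p\<in>{a..b} \<times> {\<epsilon>..pi - \<epsilon>} \<times> {c..c + 2 * pi}. ennreal (sin (fst (snd p)) * N (\<tau>1, p)) \<partial>lborel"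
    let ?R = "\<integral>\<^sup>+p\<in>{a - M..b + M} \<times> {0<..<pi} \<times> {c..c + 2 * pi}. ennreal (sin (fst (snd p)) * N (\<tau>0, p)) \<partial>lborel"
    have mY: "(\<lambda>p. ennreal (\<omega> (\<tau>, p) * e (\<tau>, p)) * indicator Y p) \<in> borel_measurable lborel" if \<tau>: "\<tau> \<in> {\<tau>1..\<tau>0}" for \<tau>
    proof -
      have "continuous_on Y (\<lambda>p. \<omega> (\<tau>, p) * e (\<tau>, p))"
        by (rule continuous_on_compose2[OF continuous_on_mult[OF cw(1) co[OF sm(1)]], of _ "\<lambda>p. (\<tau>, p)"])
           (use inX \<tau> in \<open>auto intro!: continuous_intros\<close>)
      then have "(\<lambda>p. indicator Y p *\<^sub>R (\<omega> (\<tau>, p) * e (\<tau>, p))) \<in> borel_measurable borel"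
        by (intro borel_measurable_continuous_on_indicator) (auto simp: Y_def)
      then have "(\<lambda>p. ennreal (indicator Y p *\<^sub>R (\<omega> (\<tau>, p) * e (\<tau>, p)))) \<in> borel_measurable lborel" by simp
      moreover have "(\<lambda>p. ennreal (indicator Y p *\<^sub>R (\<omega> (\<tau>, p) * e (\<tau>, p)))) = (\<lambda>p. ennreal (\<omega> (\<tau>, p) * e (\<tau>, p)) * indicator Y p)"
        by (auto simp: indicator_def fun_eq_iff)
      ultimately show ?thesis by simp
    qed
    have "?L \<le> (\<integral>\<^sup>+p. ennreal (C * exp 2) * (ennreal (\<omega> (\<tau>1, p) * e (\<tau>1, p)) * indicator Y p) \<partial>lborel)"
      by (intro nn_integral_mono low)
    also have "\<dots> = ennreal (C * exp 2) * (\<integral>\<^sup>+p\<in>Y. ennreal (\<omega> (\<tau>1, p) * e (\<tau>1, p)) \<partial>lborel)"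
      using tau by (intro nn_integral_cmult mY) auto
    also have "\<dots> = ennreal (C * exp 2) * ennreal (integral Y (\<lambda>p. \<omega> (\<tau>1, p) * e (\<tau>1, p)))" using tau by (subst nnI) auto
    also have "\<dots> \<le> ennreal (C * exp 2) * (ennreal (integral Y (\<lambda>p. \<omega> (\<tau>0, p) * e (\<tau>0, p)))
        + ennreal (2 * (\<bar>W\<bar> * sin \<epsilon>) * ((c + 2 * pi - c) * (b' - a') * (\<tau>0 - \<tau>1))))"
    proof (rule mult_left_mono)
      have J0: "0 \<le> integral Y (\<lambda>p. \<omega> (\<tau>0, p) * e (\<tau>0, p))"
      proof (cases "(\<lambda>p. \<omega> (\<tau>0, p) * e (\<tau>0, p)) integrable_on Y")
        case True
        then show ?thesis using w0 e0(1) inX tau by (intro integral_nonneg mult_nonneg_nonneg) auto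
      qed (simp add: not_integrable_integral)
      have X0: "0 \<le> 2 * (\<bar>W\<bar> * sin \<epsilon>) * ((c + 2 * pi - c) * (b' - a') * (\<tau>0 - \<tau>1))"
        using sn tau ab Mp by (intro mult_nonneg_nonneg) (auto simp: ab')
      show "ennreal (integral Y (\<lambda>p. \<omega> (\<tau>1, p) * e (\<tau>1, p))) \<le> ennreal (integral Y (\<lambda>p. \<omega> (\<tau>0, p) * e (\<tau>0, p)))
        + ennreal (2 * (\<bar>W\<bar> * sin \<epsilon>) * ((c + 2 * pi - c) * (b' - a') * (\<tau>0 - \<tau>1)))"
        unfolding ennreal_plus[OF J0 X0, symmetric] by (rule ennreal_leI[OF main])
    qed simp
    also have "\<dots> = ennreal (C * exp 2) * (\<integral>\<^sup>+p\<in>Y. ennreal (\<omega> (\<tau>0, p) * e (\<tau>0, p)) \<partial>lborel) + ennreal (k * sin \<epsilon>)"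
      using tau C by (subst nnI) (auto simp: distrib_left k_def ennreal_mult'[symmetric] mult_ac)
    also have "(\<integral>\<^sup>+p\<in>Y. ennreal (\<omega> (\<tau>0, p) * e (\<tau>0, p)) \<partial>lborel) \<le>
        (\<integral>\<^sup>+p. ennreal (C * exp (C * C * \<tau>0)) * (ennreal (sin (fst (snd p)) * N (\<tau>0, p)) * indicator ({a - M..b + M} \<times> {0<..<pi} \<times> {c..c + 2 * pi}) p) \<partial>lborel)"
      by (intro nn_integral_mono up)
    also have "\<dots> = ennreal (C * exp (C * C * \<tau>0)) * ?R"
    proof (rule nn_integral_cmult)
      have "(\<lambda>p::real \<times> real \<times> real. sin (fst (snd p))) \<in> borel_measurable borel"
        by (intro borel_measurable_continuous_onI continuous_intros)
      moreover have "{a - M..b + M} \<times> {0<..<pi} \<times> {c..c + 2 * pi} \<in> sets borel" by (intro borel_Times) auto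
      ultimately show "(\<lambda>p. ennreal (sin (fst (snd p)) * N (\<tau>0, p)) * indicator ({a - M..b + M} \<times> {0<..<pi} \<times> {c..c + 2 * pi}) p) \<in> borel_measurable lborel"
        using Nm[of \<tau>0] by simp
    qed
    finally show "?L \<le> ennreal (C * exp 2 * C * exp (C * C * \<tau>0)) * ?R + ennreal (k * sin \<epsilon>)"
      using C by (simp add: ennreal_mult'[symmetric] mult_left_mono add_right_mono flip: mult.assoc)
  qed
qed

text \<open>Monotone convergence as the removed polar caps shrink; the error from their boundaries
  tends to 0 with \<open>sin \<epsilon>\<close>.\<close>

lemma energy_estimate_current:
  assumes cur: "energy_current T \<tau>0 N N e P Q R C" and tau: "0 < \<tau>1" "\<tau>1 \<le> \<tau>0" "\<tau>0 < T"
    and Nnn: "\<And>x. 0 \<le> N x" and Nm: "\<And>\<tau>. (\<lambda>p. N (\<tau>, p)) \<in> borel_measurable borel" and ab: "a \<le> b" and M: "M = 1 + C * \<tau>0"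
  shows "(\<integral>\<^sup>+p\<in>{a..b} \<times> {0<..<pi} \<times> {c..c + 2 * pi}. ennreal (sin (fst (snd p)) * N (\<tau>1, p)) \<partial>lborel)
    \<le> ennreal (C * exp 2 * C * exp (C * C * \<tau>0)) *
        (\<integral>\<^sup>+p\<in>{a - M..b + M} \<times> {0<..<pi} \<times> {c..c + 2 * pi}. ennreal (sin (fst (snd p)) * N (\<tau>0, p)) \<partial>lborel)"
    (is "?L \<le> ?R")
proof -
  obtain k where k: "k \<ge> 0" "\<And>\<epsilon>. 0 < \<epsilon> \<Longrightarrow> \<epsilon> < pi / 2 \<Longrightarrow>
    (\<integral>\<^sup>+p\<in>{a..b} \<times> {\<epsilon>..pi - \<epsilon>} \<times> {c..c + 2 * pi}. ennreal (sin (fst (snd p)) * N (\<tau>1, p)) \<partial>lborel) \<le> ?R + ennreal (k * sin \<epsilon>)"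
    using energy_estimate_box[OF assms] by blast
  define \<epsilon> where "\<epsilon> n = 1 / real (Suc n)" for n
  have \<epsilon>: "0 < \<epsilon> n" "\<epsilon> n < pi / 2" for n
  proof -
    have "\<epsilon> n \<le> 1" by (simp add: \<epsilon>_def)
    then show "\<epsilon> n < pi / 2" using pi_gt3 by linarith
    show "0 < \<epsilon> n" by (simp add: \<epsilon>_def)
  qed
  have \<epsilon>0: "\<epsilon> \<longlonglongrightarrow> 0" unfolding \<epsilon>_def using LIMSEQ_inverse_real_of_nat by (simp add: divide_inverse)
  have [measurable]: "(\<lambda>p::real \<times> real \<times> real. sin (fst (snd p))) \<in> borel_measurable borel"
    by (intro borel_measurable_continuous_onI continuous_intros)
  define f where "f n p = ennreal (sin (fst (snd p)) * N (\<tau>1, p)) * indicator ({a..b} \<times> {\<epsilon> n..pi - \<epsilon> n} \<times> {c..c + 2 * pi}) p" for n p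
  have "(\<lambda>n. \<integral>\<^sup>+p. f n p \<partial>lborel) \<longlonglongrightarrow> ?L"
  proof (rule nn_integral_LIMSEQ)
    show "incseq f"
    proof (rule incseq_SucI, rule le_funI)
      fix n p
      have "\<epsilon> (Suc n) \<le> \<epsilon> n" by (simp add: \<epsilon>_def frac_le)
      then show "f n p \<le> f (Suc n) p" by (auto simp: f_def indicator_def)
    qed
    show "f n \<in> borel_measurable lborel" for n
    proof -
      have "{a..b} \<times> {\<epsilon> n..pi - \<epsilon> n} \<times> {c..c + 2 * pi} \<in> sets borel" by (intro borel_Times) auto
      then show ?thesis unfolding f_def[abs_def] using Nm[of \<tau>1] by simp
    qed
    show "(\<lambda>n. f n p) \<longlonglongrightarrow> ennreal (sin (fst (snd p)) * N (\<tau>1, p)) * indicator ({a..b} \<times> {0<..<pi} \<times> {c..c + 2 * pi}) p" for p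
    proof (cases "p \<in> {a..b} \<times> {0<..<pi} \<times> {c..c + 2 * pi}")
      case True
      define \<theta> where "\<theta> = fst (snd p)"
      have "0 < \<theta>" "\<theta> < pi" using True by (auto simp: \<theta>_def)
      then have "\<forall>\<^sub>F n in sequentially. \<epsilon> n < min \<theta> (pi - \<theta>)"
        by (intro order_tendstoD(2)[OF \<epsilon>0]) auto
      then have "\<forall>\<^sub>F n in sequentially. f n p = ennreal (sin (fst (snd p)) * N (\<tau>1, p)) * indicator ({a..b} \<times> {0<..<pi} \<times> {c..c + 2 * pi}) p"
        by eventually_elim (use True in \<open>auto simp: f_def indicator_def \<theta>_def\<close>)
      then show ?thesis by (rule tendsto_eventually)
    next
      case False
      have "f n p = 0" for n using False \<epsilon>[of n] by (auto simp: f_def indicator_def)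
      then show ?thesis using False by simp
    qed
  qed
  moreover have "(\<lambda>n. ?R + ennreal (k * sin (\<epsilon> n))) \<longlonglongrightarrow> ?R + ennreal (k * sin 0)"
    by (intro tendsto_intros \<epsilon>0)
  moreover have "(\<integral>\<^sup>+p. f n p \<partial>lborel) \<le> ?R + ennreal (k * sin (\<epsilon> n))" for n
    unfolding f_def by (rule k(2)[OF \<epsilon>])
  ultimately show ?thesis using LIMSEQ_le[of _ ?L _ "?R + ennreal (k * sin 0)"] by fastforce
qed

section \<open>Energy estimates uniform in tau\<close>

context wave_hierarchy begin

definition E_int :: "nat \<Rightarrow> real \<Rightarrow> real \<Rightarrow> real \<Rightarrow> real \<Rightarrow> ennreal" where
  "E_int J \<tau> a b c = (\<integral>\<^sup>+p\<in>{a..b} \<times> {0<..<pi} \<times> {c..c + 2 * pi}. ennreal (sin (fst (snd p)) * N_dens J (\<tau>, p)) \<partial>lborel)"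

lemma F_slice_continuous:
  assumes "0 < \<tau>" "\<tau> < T" "smooth_on (full_reg T) f"
  shows "continuous_on UNIV (\<lambda>p. f (\<tau>, p))"
  by (rule continuous_on_compose2[OF smooth_on_continuous[OF assms(3)]])
     (use assms in \<open>auto simp: full_reg_def intro!: continuous_intros\<close>)

lemma N_dens_measurable:
  assumes "0 < \<tau>" "\<tau> < T"
  shows "(\<lambda>p. N_dens J (\<tau>, p)) \<in> borel_measurable borel"
proof -
  have [measurable]: "(\<lambda>p::real \<times> real \<times> real. sin (fst (snd p))) \<in> borel_measurable borel"
    by (intro borel_measurable_continuous_onI continuous_intros)
  have [measurable]: "(\<lambda>p. d0 (F j) (\<tau>, p)) \<in> borel_measurable borel" "(\<lambda>p. d1 (F j) (\<tau>, p)) \<in> borel_measurable borel"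
    "(\<lambda>p. d2 (F j) (\<tau>, p)) \<in> borel_measurable borel" "(\<lambda>p. d3 (F j) (\<tau>, p)) \<in> borel_measurable borel" for j
    by (intro borel_measurable_continuous_onI F_slice_continuous assms smooth_on_d F_smooth)+
  show ?thesis unfolding N_dens_def n_dens_def by simp
qed

text \<open>For a given level, one pair of constants works for all intervals and all \<tau>. The
  independence of the interval lets the same estimate serve for local finiteness and for
  tails.\<close>

lemma energy_estimate:
  "\<exists>C>0. \<exists>M>0. \<forall>\<tau>\<in>{0<..\<tau>0}. \<forall>a b c. a \<le> b \<longrightarrow> E_int (Suc J) \<tau> a b c \<le> ennreal C * E_int (Suc J) \<tau>0 (a - M) (b + M) c"
proof -
  obtain e P Q R C where cur: "energy_current T \<tau>0 (N_dens (Suc J)) (N_dens (Suc J)) e P Q R C"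
    using current_exists by blast
  \<comment> \<open>Cut off outside the range of \<tau> so that slices are measurable for every
    \<tau>, as the estimate for general currents asks.\<close>
  define N where "N x = (if fst x \<in> {0<..<T} then N_dens (Suc J) x else 0)" for x
  have C: "C > 0" using cur by (simp add: energy_current_def)
  have "N x = N_dens (Suc J) x" if "x \<in> chart_reg T" for x using that by (auto simp: N_def chart_reg_def)
  then have cur': "energy_current T \<tau>0 N N e P Q R C"
    using cur by (simp add: energy_current_def)
  have Nm: "(\<lambda>p. N (\<tau>, p)) \<in> borel_measurable borel" for \<tau>
    using N_dens_measurable[of \<tau>] by (cases "\<tau> \<in> {0<..<T}") (auto simp: N_def)
  have Nn: "0 \<le> N x" for x using N_dens_nonneg by (simp add: N_def)
  have E: "E_int (Suc J) \<tau> a b c = (\<integral>\<^sup>+p\<in>{a..b} \<times> {0<..<pi} \<times> {c..c + 2 * pi}. ennreal (sin (fst (snd p)) * N (\<tau>, p)) \<partial>lborel)"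
    if "\<tau> \<in> {0<..\<tau>0}" for \<tau> a b c
    using that tau0 by (simp add: E_int_def N_def)
  have "E_int (Suc J) \<tau> a b c \<le> ennreal (C * exp 2 * C * exp (C * C * \<tau>0)) * E_int (Suc J) \<tau>0 (a - (1 + C * \<tau>0)) (b + (1 + C * \<tau>0)) c"
    if "\<tau> \<in> {0<..\<tau>0}" "a \<le> b" for \<tau> a b c
    using that energy_estimate_current[OF cur' _ _ _ Nn Nm, of \<tau> a b _ c] tau0 by (simp add: E)
  moreover have "0 < C * exp 2 * C * exp (C * C * \<tau>0)" "0 < 1 + C * \<tau>0" using C tau0 by (auto intro: add_pos_pos)
  ultimately show ?thesis by blast
qed

end

section \<open>Traces at infinity along a single curve\<close>

text \<open>Expand the nonnegative integral of \<open>(g x - k)\<^sup>2\<close> with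
  \<open>k\<close> the mean slope of \<open>y\<close>.\<close>

lemma CS_interval:
  fixes y g :: "real \<Rightarrow> real"
  assumes ab: "a < b" and D: "\<And>x. x \<in> {a..b} \<Longrightarrow> (y has_real_derivative g x) (at x)" and c: "continuous_on {a..b} g"
  shows "ennreal ((y b - y a)\<^sup>2) \<le> ennreal (b - a) * (\<integral>\<^sup>+x\<in>{a..b}. ennreal ((g x)\<^sup>2) \<partial>lborel)"
proof -
  have I: "integral {a..b} g = y b - y a" by (rule integral_DERIV) (use ab D in auto)
  define k where "k = (y b - y a) / (b - a)"
  have i: "g integrable_on {a..b}" "(\<lambda>x. (g x)\<^sup>2) integrable_on {a..b}"
    using c by (auto intro!: integrable_continuous_real continuous_intros)
  have "0 \<le> integral {a..b} (\<lambda>x. (g x - k)\<^sup>2)"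
    by (rule integral_nonneg) (auto intro!: integrable_continuous_real continuous_intros c)
  also have "integral {a..b} (\<lambda>x. (g x - k)\<^sup>2) = integral {a..b} (\<lambda>x. ((g x)\<^sup>2 - 2 * k * g x) + k\<^sup>2)"
    by (simp add: power2_diff algebra_simps)
  also have "\<dots> = integral {a..b} (\<lambda>x. (g x)\<^sup>2) - 2 * k * (y b - y a) + k\<^sup>2 * (b - a)"
  proof -
    have ik: "(\<lambda>x. 2 * k * g x) integrable_on {a..b}" using integrable_on_cmult_left[OF i(1), of "2 * k"] by simp
    have "integral {a..b} (\<lambda>x. ((g x)\<^sup>2 - 2 * k * g x) + k\<^sup>2) = integral {a..b} (\<lambda>x. (g x)\<^sup>2 - 2 * k * g x) + integral {a..b} (\<lambda>x. k\<^sup>2)"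
      by (rule integral_add[OF integrable_diff[OF i(2) ik]]) auto
    also have "integral {a..b} (\<lambda>x. (g x)\<^sup>2 - 2 * k * g x) = integral {a..b} (\<lambda>x. (g x)\<^sup>2) - integral {a..b} (\<lambda>x. 2 * k * g x)"
      by (rule integral_diff[OF i(2) ik])
    finally show ?thesis using ab by (simp add: I mult.commute)
  qed
  also have "\<dots> = integral {a..b} (\<lambda>x. (g x)\<^sup>2) - (y b - y a)\<^sup>2 / (b - a)"
  proof -
    have "k * (b - a) = y b - y a" using ab by (simp add: k_def)
    then have "2 * k * (y b - y a) = 2 * k\<^sup>2 * (b - a)" "(y b - y a)\<^sup>2 / (b - a) = k\<^sup>2 * (b - a)"
      using ab by (auto simp: power2_eq_square) (simp add: k_def)
    then show ?thesis by simp
  qed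
  finally have "(y b - y a)\<^sup>2 \<le> (b - a) * integral {a..b} (\<lambda>x. (g x)\<^sup>2)"
    using ab by (simp add: field_simps)
  moreover have "(\<integral>\<^sup>+x\<in>{a..b}. ennreal ((g x)\<^sup>2) \<partial>lborel) = ennreal (integral {a..b} (\<lambda>x. (g x)\<^sup>2))"
    using nn_integral_continuous_cbox[of a b "\<lambda>x. (g x)\<^sup>2"] c by (auto intro!: continuous_intros)
  ultimately show ?thesis using ab by (simp add: ennreal_mult'[symmetric] ennreal_leI)
qed

lemma CS_from_zero:
  fixes z w :: "real \<Rightarrow> real"
  assumes t: "0 < \<tau>" and D: "\<And>x. x \<in> {0<..\<tau>} \<Longrightarrow> (z has_real_derivative w x) (at x)"
    and c: "continuous_on {0<..\<tau>} w" and s: "\<And>n. 0 < s n" "s \<longlonglongrightarrow> 0" and l: "(\<lambda>n. z (s n)) \<longlonglongrightarrow> l"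
  shows "ennreal ((z \<tau> - l)\<^sup>2) \<le> ennreal \<tau> * (\<integral>\<^sup>+x\<in>{0<..\<tau>}. ennreal ((w x)\<^sup>2) \<partial>lborel)"
proof (rule LIMSEQ_le_const2)
  show "(\<lambda>n. ennreal ((z \<tau> - z (s n))\<^sup>2)) \<longlonglongrightarrow> ennreal ((z \<tau> - l)\<^sup>2)"
    by (intro tendsto_intros l)
  obtain n0 where n0: "\<And>n. n \<ge> n0 \<Longrightarrow> s n < \<tau>"
    using order_tendstoD(2)[OF s(2) t] by (auto simp: eventually_sequentially)
  show "\<exists>N. \<forall>n\<ge>N. ennreal ((z \<tau> - z (s n))\<^sup>2) \<le> ennreal \<tau> * (\<integral>\<^sup>+x\<in>{0<..\<tau>}. ennreal ((w x)\<^sup>2) \<partial>lborel)"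
  proof (intro exI[of _ n0] allI impI)
    fix n assume n: "n \<ge> n0"
    have sub: "{s n..\<tau>} \<subseteq> {0<..\<tau>}" using s(1)[of n] by auto
    have "ennreal ((z \<tau> - z (s n))\<^sup>2) \<le> ennreal (\<tau> - s n) * (\<integral>\<^sup>+x\<in>{s n..\<tau>}. ennreal ((w x)\<^sup>2) \<partial>lborel)"
      using n0[OF n] sub by (intro CS_interval D continuous_on_subset[OF c]) auto
    also have "\<dots> \<le> ennreal \<tau> * (\<integral>\<^sup>+x\<in>{0<..\<tau>}. ennreal ((w x)\<^sup>2) \<partial>lborel)"
      using sub less_imp_le[OF s(1)[of n]] by (intro mult_mono ennreal_leI nn_integral_mono) (auto simp: indicator_def)
    finally show "ennreal ((z \<tau> - z (s n))\<^sup>2) \<le> ennreal \<tau> * (\<integral>\<^sup>+x\<in>{0<..\<tau>}. ennreal ((w x)\<^sup>2) \<partial>lborel)" .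
  qed
qed

text \<open>A square integrable derivative gives a modulus of continuity of order 1/2 down to 0, so
  \<open>y\<close> is Cauchy along any sequence tending to 0.\<close>

lemma limit_of_L2_derivative:
  fixes y g :: "real \<Rightarrow> real"
  assumes t: "0 < \<tau>0" and D: "\<And>x. x \<in> {0<..\<tau>0} \<Longrightarrow> (y has_real_derivative g x) (at x)"
    and c: "continuous_on {0<..\<tau>0} g" and fin: "(\<integral>\<^sup>+x\<in>{0<..\<tau>0}. ennreal ((g x)\<^sup>2) \<partial>lborel) < \<infinity>"
    and s: "\<And>n. 0 < s n" "\<And>n. s n \<le> \<tau>0" "s \<longlonglongrightarrow> 0"
  shows "convergent (\<lambda>n. y (s n))"
proof -
  define S where "S = enn2real (\<integral>\<^sup>+x\<in>{0<..\<tau>0}. ennreal ((g x)\<^sup>2) \<partial>lborel)"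
  have S: "ennreal S = (\<integral>\<^sup>+x\<in>{0<..\<tau>0}. ennreal ((g x)\<^sup>2) \<partial>lborel)" "0 \<le> S" using fin by (auto simp: S_def)
  have est: "(y b - y a)\<^sup>2 \<le> b * S" if "0 < a" "a \<le> b" "b \<le> \<tau>0" for a b
  proof (cases "a = b")
    case False
    have "ennreal ((y b - y a)\<^sup>2) \<le> ennreal (b - a) * (\<integral>\<^sup>+x\<in>{a..b}. ennreal ((g x)\<^sup>2) \<partial>lborel)"
      using that False by (intro CS_interval D continuous_on_subset[OF c]) auto
    also have "\<dots> \<le> ennreal b * ennreal S"
      unfolding S using that by (intro mult_mono ennreal_leI nn_integral_mono) (auto simp: indicator_def)
    finally show ?thesis using that S(2) by (simp add: ennreal_mult'[symmetric])
  qed (use that S in auto)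
  have "Cauchy (\<lambda>n. y (s n))"
  proof (rule CauchyI)
    fix e :: real assume e: "e > 0"
    have "0 < e\<^sup>2 / (S + 1)" using e S(2) by simp
    then obtain N where N: "\<And>n. n \<ge> N \<Longrightarrow> s n < e\<^sup>2 / (S + 1)"
      using order_tendstoD(2)[OF s(3)] by (meson eventually_sequentially)
    have lt: "b * S < e\<^sup>2" if "0 < b" "b < e\<^sup>2 / (S + 1)" for b
    proof -
      have "b * S \<le> b * (S + 1)" using that by simp
      also have "\<dots> < e\<^sup>2" using that S(2) by (simp add: less_divide_eq)
      finally show ?thesis .
    qed
    have sq: "\<bar>x\<bar> < e" if "x\<^sup>2 < e\<^sup>2" for x using power2_less_imp_less[of "\<bar>x\<bar>" e] that e by simp
    have "norm (y (s m) - y (s n)) < e" if "m \<ge> N" "n \<ge> N" for m n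
    proof (cases "s m \<le> s n")
      case True
      have "\<bar>y (s n) - y (s m)\<bar> < e" using est[OF s(1) True s(2)] lt[OF s(1) N[OF that(2)]] by (intro sq) linarith
      then show ?thesis by (simp add: abs_minus_commute)
    next
      case False
      then have "s n \<le> s m" by simp
      then have "\<bar>y (s m) - y (s n)\<bar> < e" using est[OF s(1) _ s(2)] lt[OF s(1) N[OF that(1)]] by (intro sq) (metis order_le_less_trans)
      then show ?thesis by simp
    qed
    then show "\<exists>M. \<forall>m\<ge>M. \<forall>n\<ge>M. norm (y (s m) - y (s n)) < e" by blast
  qed
  then show ?thesis by (simp add: Cauchy_convergent_iff)
qed

lemma bounded_derivative_diff:
  fixes x g :: "real \<Rightarrow> real"
  assumes D: "\<And>s. s \<in> {0<..b} \<Longrightarrow> (x has_real_derivative g s) (at s)" and K: "\<And>s. s \<in> {0<..b} \<Longrightarrow> \<bar>g s\<bar> \<le> K"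
    and ab: "0 < a" "a \<le> b"
  shows "\<bar>x b - x a\<bar> \<le> K * b"
proof (cases "a = b")
  case True
  have "0 \<le> K" using K[of a] ab by auto
  then show ?thesis using True ab by simp
next
  case False
  obtain z where z: "a < z" "z < b" "x b - x a = (b - a) * g z"
    using MVT2[of a b x g] D ab False by fastforce
  have "\<bar>x b - x a\<bar> = \<bar>g z\<bar> * (b - a)" using z ab by (simp add: abs_mult)
  also have "\<dots> \<le> K * b" using K[of z] z ab by (intro mult_mono) (auto intro: order_trans[OF abs_ge_zero K[of z]])
  finally show ?thesis .
qed

lemma bounded_derivative_from_zero:
  fixes x g :: "real \<Rightarrow> real"
  assumes t: "0 < \<tau>" and D: "\<And>s. s \<in> {0<..\<tau>} \<Longrightarrow> (x has_real_derivative g s) (at s)" and K: "\<And>s. s \<in> {0<..\<tau>} \<Longrightarrow> \<bar>g s\<bar> \<le> K"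
    and s: "\<And>n. 0 < s n" "s \<longlonglongrightarrow> 0" and l: "(\<lambda>n. x (s n)) \<longlonglongrightarrow> 0"
  shows "\<bar>x \<tau>\<bar> \<le> K * \<tau>"
proof -
  obtain n0 where n0: "\<And>n. n \<ge> n0 \<Longrightarrow> s n < \<tau>"
    using order_tendstoD(2)[OF s(2) t] by (auto simp: eventually_sequentially)
  have "(\<lambda>n. \<bar>x \<tau> - x (s n)\<bar>) \<longlonglongrightarrow> \<bar>x \<tau> - 0\<bar>" by (intro tendsto_intros l)
  then have "\<bar>x \<tau> - 0\<bar> \<le> K * \<tau>"
    using bounded_derivative_diff[OF D K s(1) less_imp_le[OF n0]] by (intro LIMSEQ_le_const2) auto
  then show ?thesis by simp
qed

section \<open>Chains of ordinary differential equations in tau\<close>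

context wave_hierarchy begin

text \<open>All traces are taken along this one sequence: limits of countably many slices remain
  measurable and null sets can be collected.\<close>

definition tseq :: "nat \<Rightarrow> real" where "tseq n = \<tau>0 / real (Suc n)"

lemma tseq: "0 < tseq n" "tseq n \<le> \<tau>0" "tseq \<longlonglongrightarrow> 0"
proof -
  show "0 < tseq n" "tseq n \<le> \<tau>0" using tau0 by (auto simp: tseq_def field_simps)
  show "tseq \<longlonglongrightarrow> 0" unfolding tseq_def[abs_def]
    using tendsto_mult_right_zero[OF LIMSEQ_inverse_real_of_nat, of \<tau>0] by (simp add: divide_inverse)
qed

text \<open>Models one component of \<open>F 0\<close> to \<open>F 3\<close> along \<tau> at a fixed
  point of the slice. Limits and Taylor estimates are obtained for such curves first and integrated
  over the slice afterwards.\<close>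

definition chain :: "(nat \<Rightarrow> real \<Rightarrow> real) \<Rightarrow> bool" where
  "chain y \<longleftrightarrow> (\<forall>\<tau>\<in>{0<..<T}. (y 0 has_real_derivative \<tau> * inverse (p \<tau>) * y 1 \<tau>) (at \<tau>) \<and>
    (y 1 has_real_derivative y 2 \<tau>) (at \<tau>) \<and> (y 2 has_real_derivative y 3 \<tau>) (at \<tau>)) \<and> continuous_on {0<..<T} (y 3)"

definition chain_int :: "(nat \<Rightarrow> real \<Rightarrow> real) \<Rightarrow> real \<Rightarrow> ennreal" where
  "chain_int y \<tau> = (\<integral>\<^sup>+\<sigma>\<in>{0<..\<tau>}. ennreal ((y 3 \<sigma>)\<^sup>2) \<partial>lborel)"

lemma sqrt_mult_le: "x\<^sup>2 \<le> a * b \<Longrightarrow> 0 \<le> a \<Longrightarrow> 0 \<le> b \<Longrightarrow> \<bar>x\<bar> \<le> a + b" for x a b :: real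
proof -
  assume "x\<^sup>2 \<le> a * b" "0 \<le> a" "0 \<le> b"
  moreover have "(a + b)\<^sup>2 = a\<^sup>2 + b\<^sup>2 + 2 * (a * b)" by (simp add: power2_eq_square algebra_simps)
  ultimately have "\<bar>x\<bar>\<^sup>2 \<le> (a + b)\<^sup>2" using zero_le_power2[of a] zero_le_power2[of b] mult_nonneg_nonneg[of a b] unfolding power2_abs by linarith
  then show ?thesis using \<open>0 \<le> a\<close> \<open>0 \<le> b\<close> by (metis add_nonneg_nonneg power2_le_imp_le)
qed

text \<open>Integrate downwards from \<tau>0: \<open>y 2\<close> by Cauchy-Schwarz, then
  \<open>y 1\<close> and \<open>y 0\<close> by their bounded derivatives. The bound is linear in
  \<open>chain_int\<close>, hence locally integrable over the slice and usable as a
  majorant.\<close>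

lemma chain_bound:
  "\<exists>B>0. \<forall>y. chain y \<longrightarrow> chain_int y \<tau>0 < \<infinity> \<longrightarrow> (\<forall>j\<le>2. \<forall>\<tau>\<in>{0<..\<tau>0}.
    \<bar>y j \<tau>\<bar> \<le> B * (\<bar>y 0 \<tau>0\<bar> + \<bar>y 1 \<tau>0\<bar> + \<bar>y 2 \<tau>0\<bar> + 1 + enn2real (chain_int y \<tau>0)))"
proof -
  have tk: "tc (\<lambda>\<tau>. \<tau> * inverse (p \<tau>))" by (intro tc_intros)
  obtain k where k: "k > 0" "\<forall>\<tau>\<in>{0..\<tau>0}. \<bar>\<tau> * inverse (p \<tau>)\<bar> \<le> k" using tc_bounded[OF tk] by blast
  define B2 where "B2 = 1 + \<tau>0" define B1 where "B1 = 1 + \<tau>0 * B2" define B0 where "B0 = 1 + \<tau>0 * (k * B1)"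
  have B: "B2 \<ge> 1" "B1 \<ge> 1" "B0 \<ge> 1" using tau0 k by (auto simp: B2_def B1_def B0_def intro!: mult_nonneg_nonneg)
  have "\<bar>y j \<tau>\<bar> \<le> (B0 + B1 + B2) * (\<bar>y 0 \<tau>0\<bar> + \<bar>y 1 \<tau>0\<bar> + \<bar>y 2 \<tau>0\<bar> + 1 + enn2real (chain_int y \<tau>0))"
    if y: "chain y" "chain_int y \<tau>0 < \<infinity>" "j \<le> 2" "\<tau> \<in> {0<..\<tau>0}" for y j \<tau>
  proof -
    define S where "S = enn2real (chain_int y \<tau>0)"
    have S: "ennreal S = chain_int y \<tau>0" "0 \<le> S" using y(2) by (auto simp: S_def)
    \<comment> \<open>The summand 1 gives \<open>A \<ge> 1\<close>, so that the pure constant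
      \<tau>0 can be absorbed into a multiple of \<open>A\<close>.\<close>
    define A where "A = \<bar>y 0 \<tau>0\<bar> + \<bar>y 1 \<tau>0\<bar> + \<bar>y 2 \<tau>0\<bar> + 1 + S"
    have A: "A > 0" "A \<ge> 1" "\<bar>y 0 \<tau>0\<bar> \<le> A" "\<bar>y 1 \<tau>0\<bar> \<le> A" using S(2) by (auto simp: A_def)
    have D: "(y 0 has_real_derivative \<sigma> * inverse (p \<sigma>) * y 1 \<sigma>) (at \<sigma>)" "(y 1 has_real_derivative y 2 \<sigma>) (at \<sigma>)"
       "(y 2 has_real_derivative y 3 \<sigma>) (at \<sigma>)" if "\<sigma> \<in> {0<..\<tau>0}" for \<sigma>
      using y(1) that tau0 by (auto simp: chain_def)
    have c: "continuous_on {0<..\<tau>0} (y 3)" using y(1) tau0 by (auto simp: chain_def intro: continuous_on_subset)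
    have b2: "\<bar>y 2 \<sigma>\<bar> \<le> B2 * A" if s: "\<sigma> \<in> {0<..\<tau>0}" for \<sigma>
    proof -
      have "(y 2 \<tau>0 - y 2 \<sigma>)\<^sup>2 \<le> \<tau>0 * S"
      proof (cases "\<sigma> = \<tau>0")
        case False
        have "ennreal ((y 2 \<tau>0 - y 2 \<sigma>)\<^sup>2) \<le> ennreal (\<tau>0 - \<sigma>) * (\<integral>\<^sup>+x\<in>{\<sigma>..\<tau>0}. ennreal ((y 3 x)\<^sup>2) \<partial>lborel)"
          using s False by (intro CS_interval D continuous_on_subset[OF c]) auto
        also have "\<dots> \<le> ennreal \<tau>0 * ennreal S"
          unfolding S chain_int_def using s by (intro mult_mono ennreal_leI nn_integral_mono) (auto simp: indicator_def)
        finally show ?thesis using tau0 S(2) by (simp add: ennreal_mult'[symmetric])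
      qed (use tau0 S in auto)
      then have "\<bar>y 2 \<tau>0 - y 2 \<sigma>\<bar> \<le> \<tau>0 + S" using tau0 S(2) by (intro sqrt_mult_le) auto
      then have "\<bar>y 2 \<sigma>\<bar> \<le> A + \<tau>0" using A_def by linarith
      also have "\<dots> \<le> B2 * A" using A(2) tau0 by (simp add: B2_def algebra_simps)
      finally show ?thesis .
    qed
    have b1: "\<bar>y 1 \<sigma>\<bar> \<le> B1 * A" if s: "\<sigma> \<in> {0<..\<tau>0}" for \<sigma>
    proof -
      have "\<bar>y 1 \<tau>0 - y 1 \<sigma>\<bar> \<le> B2 * A * \<tau>0" using s b2 D by (intro bounded_derivative_diff[where g = "y 2"]) auto
      then have "\<bar>y 1 \<sigma>\<bar> \<le> A + B2 * A * \<tau>0" using A(4) by linarith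
      also have "\<dots> = B1 * A" by (simp add: B1_def algebra_simps)
      finally show ?thesis .
    qed
    have b0: "\<bar>y 0 \<sigma>\<bar> \<le> B0 * A" if s: "\<sigma> \<in> {0<..\<tau>0}" for \<sigma>
    proof -
      have "\<bar>\<sigma> * inverse (p \<sigma>) * y 1 \<sigma>\<bar> \<le> k * (B1 * A)" if "\<sigma> \<in> {0<..\<tau>0}" for \<sigma>
        unfolding abs_mult[of "\<sigma> * inverse (p \<sigma>)"] using k b1[OF that] that by (intro mult_mono) auto
      then have "\<bar>y 0 \<tau>0 - y 0 \<sigma>\<bar> \<le> k * (B1 * A) * \<tau>0" using s D by (intro bounded_derivative_diff[where g = "\<lambda>\<sigma>. \<sigma> * inverse (p \<sigma>) * y 1 \<sigma>"]) auto
      then have "\<bar>y 0 \<sigma>\<bar> \<le> A + k * (B1 * A) * \<tau>0" using A(3) by linarith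
      also have "\<dots> = B0 * A" by (simp add: B0_def algebra_simps)
      finally show ?thesis .
    qed
    have "0 \<le> B0 * A" "0 \<le> B1 * A" "0 \<le> B2 * A" using B A(1) by (auto intro!: mult_nonneg_nonneg)
    moreover have "j = 0 \<or> j = 1 \<or> j = 2" using y(3) by auto
    ultimately show ?thesis using b0[OF y(4)] b1[OF y(4)] b2[OF y(4)] unfolding A_def[unfolded S_def, symmetric]
      by (auto simp: distrib_right)
  qed
  then show ?thesis using B by (intro exI[of _ "B0 + B1 + B2"]) auto
qed

text \<open>For \<open>j < 2\<close> the derivative is bounded by \<open>chain_bound\<close> and
  hence square integrable; for \<open>j = 2\<close> square integrability is the hypothesis on
  \<open>chain_int\<close>.\<close>

lemma chain_convergent:
  assumes "chain y" "chain_int y \<tau>0 < \<infinity>" "j \<le> 2"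
  shows "convergent (\<lambda>n. y j (tseq n))"
proof -
  have D: "(y 0 has_real_derivative \<sigma> * inverse (p \<sigma>) * y 1 \<sigma>) (at \<sigma>)" "(y 1 has_real_derivative y 2 \<sigma>) (at \<sigma>)"
    "(y 2 has_real_derivative y 3 \<sigma>) (at \<sigma>)" if "\<sigma> \<in> {0<..\<tau>0}" for \<sigma>
    using assms(1) that tau0 by (auto simp: chain_def)
  have c3: "continuous_on {0<..\<tau>0} (y 3)" using assms(1) tau0 by (auto simp: chain_def intro: continuous_on_subset)
  obtain B where B: "B > 0" "\<And>j \<tau>. j \<le> 2 \<Longrightarrow> \<tau> \<in> {0<..\<tau>0} \<Longrightarrow>
    \<bar>y j \<tau>\<bar> \<le> B * (\<bar>y 0 \<tau>0\<bar> + \<bar>y 1 \<tau>0\<bar> + \<bar>y 2 \<tau>0\<bar> + 1 + enn2real (chain_int y \<tau>0))" using chain_bound assms(1,2) by blast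
  define K where "K = B * (\<bar>y 0 \<tau>0\<bar> + \<bar>y 1 \<tau>0\<bar> + \<bar>y 2 \<tau>0\<bar> + 1 + enn2real (chain_int y \<tau>0))"
  have bd: "(\<integral>\<^sup>+x\<in>{0<..\<tau>0}. ennreal ((g x)\<^sup>2) \<partial>lborel) < \<infinity>" if "\<And>\<tau>. \<tau> \<in> {0<..\<tau>0} \<Longrightarrow> \<bar>g \<tau>\<bar> \<le> k" for g :: "real \<Rightarrow> real" and k
  proof -
    have "(\<integral>\<^sup>+x\<in>{0<..\<tau>0}. ennreal ((g x)\<^sup>2) \<partial>lborel) \<le> (\<integral>\<^sup>+x. ennreal (k\<^sup>2) * indicator {0<..\<tau>0} x \<partial>lborel)"
    proof (rule nn_integral_mono)
      fix x
      show "ennreal ((g x)\<^sup>2) * indicator {0<..\<tau>0} x \<le> ennreal (k\<^sup>2) * indicator {0<..\<tau>0} x"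
      proof (cases "x \<in> {0<..\<tau>0}")
        case True
        then have "\<bar>g x\<bar>\<^sup>2 \<le> k\<^sup>2" using that[OF True] by (intro power_mono) auto
        then show ?thesis using True by (simp add: ennreal_leI)
      qed simp
    qed
    also have "\<dots> < \<infinity>" using tau0 by (simp add: nn_integral_cmult_indicator ennreal_mult_less_top)
    finally show ?thesis .
  qed
  have tk: "tc (\<lambda>\<tau>. \<tau> * inverse (p \<tau>))" by (intro tc_intros)
  obtain k where k: "k > 0" "\<forall>\<tau>\<in>{0..\<tau>0}. \<bar>\<tau> * inverse (p \<tau>)\<bar> \<le> k" using tc_bounded[OF tk] by blast
  have c2: "continuous_on {0<..\<tau>0} (y 2)" and c1: "continuous_on {0<..\<tau>0} (y 1)"
    using DERIV_isCont[OF D(2)] DERIV_isCont[OF D(3)] by (auto intro!: continuous_at_imp_continuous_on)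
  have ck: "continuous_on {0<..\<tau>0} (\<lambda>\<tau>. \<tau> * inverse (p \<tau>))"
    by (rule continuous_on_subset[OF smooth_on_continuous[OF tc_smooth[OF tk]]]) (use tau0 in auto)
  note lim = limit_of_L2_derivative[OF tau0(1) _ _ _ tseq]
  consider "j = 0" | "j = 1" | "j = 2" using assms(3) by linarith
  then show ?thesis
  proof cases
    case 1
    show ?thesis unfolding 1
    proof (rule lim[OF D(1)])
      show "continuous_on {0<..\<tau>0} (\<lambda>x. x * inverse (p x) * y 1 x)" by (intro continuous_on_mult ck c1)
      show "(\<integral>\<^sup>+ x\<in>{0<..\<tau>0}. ennreal ((x * inverse (p x) * y 1 x)\<^sup>2)\<partial>lborel) < \<infinity>"
      proof (rule bd[of _ "k * K"])
        fix \<tau> assume t: "\<tau> \<in> {0<..\<tau>0}"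
        show "\<bar>\<tau> * inverse (p \<tau>) * y 1 \<tau>\<bar> \<le> k * K"
          unfolding abs_mult[of "\<tau> * inverse (p \<tau>)"] using k B(2)[of 1, OF _ t] t by (intro mult_mono) (auto simp: K_def)
      qed
    qed
  next
    case 2
    show ?thesis unfolding 2 by (rule lim[OF D(2) c2 bd[of _ K]]) (use B(2)[of 2] in \<open>auto simp: K_def\<close>)
  next
    case 3
    show ?thesis unfolding 3 by (rule lim[OF D(3) c3]) (use assms(2) in \<open>auto simp: chain_int_def\<close>)
  qed
qed

definition clim :: "(nat \<Rightarrow> real \<Rightarrow> real) \<Rightarrow> nat \<Rightarrow> real" where
  "clim y j = lim (\<lambda>n. y j (tseq n))"

lemma clim: "chain y \<Longrightarrow> chain_int y \<tau>0 < \<infinity> \<Longrightarrow> j \<le> 2 \<Longrightarrow> (\<lambda>n. y j (tseq n)) \<longlonglongrightarrow> clim y j"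
  unfolding clim_def using chain_convergent by (simp add: convergent_LIMSEQ_iff)

lemma chain_top_estimate:
  assumes "chain y" "chain_int y \<tau>0 < \<infinity>" "\<tau> \<in> {0<..\<tau>0}"
  shows "ennreal ((y 2 \<tau> - clim y 2)\<^sup>2) \<le> ennreal \<tau> * chain_int y \<tau>"
  unfolding chain_int_def
proof (rule CS_from_zero[OF _ _ _ tseq(1,3) clim[OF assms(1,2)]])
  show "0 < \<tau>" using assms(3) by simp
  show "(y 2 has_real_derivative y 3 x) (at x)" if "x \<in> {0<..\<tau>}" for x
    using assms(1,3) that tau0 by (auto simp: chain_def)
  show "continuous_on {0<..\<tau>} (y 3)" using assms(1,3) tau0 by (auto simp: chain_def intro: continuous_on_subset)
qed simp

text \<open>With \<open>u = y\<^sub>1 / p\<close> one has \<open>y\<^sub>0' = \<tau> u\<close>, so the cubic Taylor remainder of \<open>y\<^sub>0\<close> is controlled by the oscillation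
  of \<open>u'\<close>; there is no linear term, and \<open>p'(0) = 0\<close> removes the contribution of \<open>y\<^sub>1\<close> to \<open>u'(0)\<close>.\<close>

lemma chain_taylor:
  "\<exists>C>0. \<forall>y. chain y \<longrightarrow> chain_int y \<tau>0 < \<infinity> \<longrightarrow> (\<forall>\<tau>\<in>{0<..\<tau>0}.
    ennreal ((y 0 \<tau> - clim y 0 - \<tau>\<^sup>2 * (clim y 1 / (2 * L)) - \<tau> ^ 3 * (clim y 2 / (3 * L)))\<^sup>2)
    \<le> ennreal (C * \<tau> ^ 5) * (\<integral>\<^sup>+\<sigma>\<in>{0<..\<tau>}. ennreal ((y 2 \<sigma> - clim y 2)\<^sup>2 + \<sigma>\<^sup>2 * ((clim y 2)\<^sup>2 + (y 1 \<sigma>)\<^sup>2)) \<partial>lborel))"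
proof -
  have L: "L > 0" "p 0 = L" using p_pos[of 0] tau0 by (auto simp: p_def)
  \<comment> \<open>The three coefficients bounded here are \<open>1 / p\<close>, the quotient of
    \<open>p'\<close> by \<open>\<tau> * p\<^sup>2\<close>, and
    \<open>(1 / p - 1 / L) / \<tau>\<close>. The last two are regular at 0 because
    \<open>p - L\<close> begins with \<open>\<tau>\<^sup>2\<close>.\<close>
  obtain c0 where c0: "c0 > 0" "\<forall>\<tau>\<in>{0..\<tau>0}. \<bar>inverse (p \<tau>)\<bar> \<le> c0" using tc_bounded[OF tc_invp] by blast
  have t1: "tc (\<lambda>\<tau>. (- 2 + 6 * m * \<tau>) * (inverse (p \<tau>))\<^sup>2)" by (intro tc_intros)
  obtain c1 where c1: "c1 > 0" "\<forall>\<tau>\<in>{0..\<tau>0}. \<bar>(- 2 + 6 * m * \<tau>) * (inverse (p \<tau>))\<^sup>2\<bar> \<le> c1" using tc_bounded[OF t1] by blast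
  have t2: "tc (\<lambda>\<tau>. (\<tau> - 2 * m * \<tau>\<^sup>2) * inverse (p \<tau>) * inverse L)" by (intro tc_intros)
  obtain c2 where c2: "c2 > 0" "\<forall>\<tau>\<in>{0..\<tau>0}. \<bar>(\<tau> - 2 * m * \<tau>\<^sup>2) * inverse (p \<tau>) * inverse L\<bar> \<le> c2" using tc_bounded[OF t2] by blast
  define c where "c = c0 + c1 + c2"
  have c: "c > 0" "c0 \<le> c" "c1 \<le> c" "c2 \<le> c" using c0 c1 c2 by (auto simp: c_def)
  show ?thesis
  proof (intro exI[of _ "3 * c\<^sup>2"] conjI allI impI ballI)
    show "0 < 3 * c\<^sup>2" using c by simp
    fix y \<tau> assume y: "chain y" "chain_int y \<tau>0 < \<infinity>" and \<tau>: "\<tau> \<in> {0<..\<tau>0}"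
    define l where "l j = clim y j" for j
    have lim: "(\<lambda>n. y j (tseq n)) \<longlonglongrightarrow> l j" if "j \<le> 2" for j unfolding l_def by (rule clim[OF y that])
    define u where "u \<sigma> = y 1 \<sigma> * inverse (p \<sigma>)" for \<sigma>
    \<comment> \<open>\<open>V\<close> is the derivative of \<open>u\<close>. The remainders satisfy
      \<open>X' = \<sigma> * Z\<close> and \<open>Z' = W\<close>, and both \<open>X\<close> and
      \<open>Z\<close> tend to 0, so two integrations bound \<open>X\<close> by the size of
      \<open>W\<close>.\<close>
    define V where "V \<sigma> = y 2 \<sigma> * inverse (p \<sigma>) - \<sigma> * ((- 2 + 6 * m * \<sigma>) * (inverse (p \<sigma>))\<^sup>2) * y 1 \<sigma>" for \<sigma>
    define W where "W \<sigma> = V \<sigma> - l 2 / L" for \<sigma>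
    define Z where "Z \<sigma> = u \<sigma> - l 1 / L - \<sigma> * (l 2 / L)" for \<sigma>
    define X where "X \<sigma> = y 0 \<sigma> - l 0 - \<sigma>\<^sup>2 * (l 1 / (2 * L)) - \<sigma> ^ 3 * (l 2 / (3 * L))" for \<sigma>
    have D: "(y 0 has_real_derivative \<sigma> * inverse (p \<sigma>) * y 1 \<sigma>) (at \<sigma>)" "(y 1 has_real_derivative y 2 \<sigma>) (at \<sigma>)"
      "(y 2 has_real_derivative y 3 \<sigma>) (at \<sigma>)" "p \<sigma> > 0" if "\<sigma> \<in> {0<..\<tau>}" for \<sigma>
      using y(1) that \<tau> tau0 p_pos[of \<sigma>] by (auto simp: chain_def)
    have DX: "(X has_real_derivative \<sigma> * Z \<sigma>) (at \<sigma>)" if "\<sigma> \<in> {0<..\<tau>}" for \<sigma>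
      unfolding X_def using D[OF that] L(1)
      by (auto intro!: derivative_eq_intros simp: Z_def u_def power2_eq_square field_simps)
    have DZ: "(Z has_real_derivative W \<sigma>) (at \<sigma>)" if "\<sigma> \<in> {0<..\<tau>}" for \<sigma>
      unfolding Z_def u_def using D[OF that] L(1)
      by (auto intro!: derivative_eq_intros p_deriv simp: W_def V_def power2_eq_square field_simps)
    have pc: "isCont p \<sigma>" for \<sigma> using p_deriv DERIV_isCont by blast
    have cW: "continuous_on {0<..\<tau>} W"
      unfolding W_def V_def using D
      by (intro continuous_intros continuous_at_imp_continuous_on ballI DERIV_isCont[OF D(2)] DERIV_isCont[OF D(3)] pc; force)
    have pl: "(\<lambda>n. inverse (p (tseq n))) \<longlonglongrightarrow> inverse L"
      using isCont_tendsto_compose[OF pc tseq(3)] L by (intro tendsto_inverse) auto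
    have Zl: "(\<lambda>n. Z (tseq n)) \<longlonglongrightarrow> l 1 * inverse L - l 1 / L - 0 * (l 2 / L)"
      unfolding Z_def u_def by (intro tendsto_intros lim pl tseq(3)) simp
    have Xl: "(\<lambda>n. X (tseq n)) \<longlonglongrightarrow> l 0 - l 0 - 0\<^sup>2 * (l 1 / (2 * L)) - 0 ^ 3 * (l 2 / (3 * L))"
      unfolding X_def by (intro tendsto_intros lim tseq(3)) simp
    define I where "I = (\<integral>\<^sup>+\<sigma>\<in>{0<..\<tau>}. ennreal ((W \<sigma>)\<^sup>2) \<partial>lborel)"
    have Zb: "ennreal ((Z \<sigma>)\<^sup>2) \<le> ennreal \<tau> * I" if "\<sigma> \<in> {0<..\<tau>}" for \<sigma>
    proof -
      have "ennreal ((Z \<sigma> - 0)\<^sup>2) \<le> ennreal \<sigma> * (\<integral>\<^sup>+x\<in>{0<..\<sigma>}. ennreal ((W x)\<^sup>2) \<partial>lborel)"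
        by (rule CS_from_zero[OF _ DZ _ tseq(1,3)]) (use that Zl in \<open>auto intro: continuous_on_subset[OF cW] simp: divide_inverse\<close>)
      also have "\<dots> \<le> ennreal \<tau> * I"
        unfolding I_def using that by (intro mult_mono ennreal_leI nn_integral_mono) (auto simp: indicator_def)
      finally show ?thesis by simp
    qed
    have XI: "ennreal ((X \<tau>)\<^sup>2) \<le> ennreal (\<tau> ^ 5) * I"
    proof (cases "I = \<infinity>")
      case True
      then show ?thesis using \<tau> by (simp add: ennreal_mult_top)
    next
      case False
      define i where "i = enn2real I"
      have i: "I = ennreal i" "0 \<le> i" using False by (auto simp: i_def less_top)
      have Zb': "\<bar>Z \<sigma>\<bar> \<le> sqrt (\<tau> * i)" if "\<sigma> \<in> {0<..\<tau>}" for \<sigma>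
        using Zb[OF that] i \<tau> by (simp add: ennreal_mult'[symmetric] real_le_rsqrt)
      \<comment> \<open>Cauchy-Schwarz gives \<open>Z\<close> the size
        \<open>sqrt (\<tau> * i)\<close>; integrating it against the weight \<sigma> adds two powers
        of \<tau>, and squaring yields \<open>\<tau> ^ 5 * i\<close>.\<close>
      have "\<bar>X \<tau>\<bar> \<le> (\<tau> * sqrt (\<tau> * i)) * \<tau>"
      proof (rule bounded_derivative_from_zero[OF _ DX _ tseq(1,3)])
        show "\<bar>\<sigma> * Z \<sigma>\<bar> \<le> \<tau> * sqrt (\<tau> * i)" if "\<sigma> \<in> {0<..\<tau>}" for \<sigma>
          unfolding abs_mult using Zb'[OF that] that by (intro mult_mono) auto
      qed (use \<tau> Xl in auto)
      then have "\<bar>X \<tau>\<bar>\<^sup>2 \<le> ((\<tau> * sqrt (\<tau> * i)) * \<tau>)\<^sup>2" by (intro power_mono) auto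
      also have "\<dots> = \<tau> ^ 5 * i" using \<tau> i by (simp add: power_mult_distrib eval_nat_numeral)
      finally show ?thesis using i \<tau> by (simp add: ennreal_mult'[symmetric] ennreal_leI)
    qed
    \<comment> \<open>\<open>W\<close> splits into the oscillation of \<open>y 2\<close> and two
      terms with an explicit factor \<sigma>, one from \<open>1 / p - 1 / L\<close> and one from
      \<open>p'\<close>.\<close>
    have Wb: "(W \<sigma>)\<^sup>2 \<le> 3 * c\<^sup>2 * ((y 2 \<sigma> - l 2)\<^sup>2 + \<sigma>\<^sup>2 * ((l 2)\<^sup>2 + (y 1 \<sigma>)\<^sup>2))" if s: "\<sigma> \<in> {0<..\<tau>}" for \<sigma>
    proof -
      have s0: "\<sigma> \<in> {0..\<tau>0}" using s \<tau> by auto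
      define A1 where "A1 = inverse (p \<sigma>)"
      define A2 where "A2 = (\<sigma> - 2 * m * \<sigma>\<^sup>2) * inverse (p \<sigma>) * inverse L"
      define A3 where "A3 = (- 2 + 6 * m * \<sigma>) * (inverse (p \<sigma>))\<^sup>2"
      have ab: "\<bar>A1\<bar> \<le> c" "\<bar>A2\<bar> \<le> c" "\<bar>A3\<bar> \<le> c" 
        unfolding A1_def A2_def A3_def
        by (rule order_trans[OF bspec[OF c0(2) s0] c(2)], rule order_trans[OF bspec[OF c2(2) s0] c(4)],
            rule order_trans[OF bspec[OF c1(2) s0] c(3)])
      have "inverse (p \<sigma>) - inverse L = \<sigma> * A2"
        using D(4)[OF s] L by (simp add: A2_def field_simps) (simp add: p_def power2_eq_square power3_eq_cube algebra_simps)
      then have "W \<sigma> = (y 2 \<sigma> - l 2) * A1 + l 2 * (\<sigma> * A2) - \<sigma> * A3 * y 1 \<sigma>"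
        by (simp add: W_def V_def A1_def A3_def divide_inverse algebra_simps)
      moreover have "(a + b - d)\<^sup>2 \<le> 3 * (a\<^sup>2 + b\<^sup>2 + d\<^sup>2)" for a b d :: real
        using zero_le_power2[of "a - b"] zero_le_power2[of "a + d"] zero_le_power2[of "b + d"] by (simp add: power2_eq_square algebra_simps)
      ultimately have "(W \<sigma>)\<^sup>2 \<le> 3 * (((y 2 \<sigma> - l 2) * A1)\<^sup>2 + (l 2 * (\<sigma> * A2))\<^sup>2 + (\<sigma> * A3 * y 1 \<sigma>)\<^sup>2)" by metis
      also have "\<dots> = 3 * ((y 2 \<sigma> - l 2)\<^sup>2 * A1\<^sup>2 + \<sigma>\<^sup>2 * (l 2)\<^sup>2 * A2\<^sup>2 + \<sigma>\<^sup>2 * (y 1 \<sigma>)\<^sup>2 * A3\<^sup>2)"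
        by (simp add: power_mult_distrib mult_ac)
      also have "\<dots> \<le> 3 * ((y 2 \<sigma> - l 2)\<^sup>2 * c\<^sup>2 + \<sigma>\<^sup>2 * (l 2)\<^sup>2 * c\<^sup>2 + \<sigma>\<^sup>2 * (y 1 \<sigma>)\<^sup>2 * c\<^sup>2)"
        using ab c(1) by (intro mult_left_mono add_mono) (auto intro!: mult_left_mono simp: abs_le_square_iff[symmetric])
      finally show ?thesis by (simp add: algebra_simps)
    qed
    define K where "K \<sigma> = (y 2 \<sigma> - l 2)\<^sup>2 + \<sigma>\<^sup>2 * ((l 2)\<^sup>2 + (y 1 \<sigma>)\<^sup>2)" for \<sigma>
    have "I \<le> (\<integral>\<^sup>+\<sigma>. ennreal (3 * c\<^sup>2) * (ennreal (K \<sigma>) * indicator {0<..\<tau>} \<sigma>) \<partial>lborel)"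
      unfolding I_def
    proof (rule nn_integral_mono)
      fix \<sigma> show "ennreal ((W \<sigma>)\<^sup>2) * indicator {0<..\<tau>} \<sigma> \<le> ennreal (3 * c\<^sup>2) * (ennreal (K \<sigma>) * indicator {0<..\<tau>} \<sigma>)"
      proof (cases "\<sigma> \<in> {0<..\<tau>}")
        case True
        have "ennreal ((W \<sigma>)\<^sup>2) \<le> ennreal (3 * c\<^sup>2 * K \<sigma>)" using Wb[OF True] unfolding K_def by (rule ennreal_leI)
        also have "\<dots> = ennreal (3 * c\<^sup>2) * ennreal (K \<sigma>)" by (rule ennreal_mult') simp
        finally show ?thesis using True by simp
      qed simp
    qed
    also have "\<dots> = ennreal (3 * c\<^sup>2) * (\<integral>\<^sup>+\<sigma>\<in>{0<..\<tau>}. ennreal (K \<sigma>) \<partial>lborel)"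
    proof (rule nn_integral_cmult)
      have "continuous_on {0<..\<tau>} K"
        unfolding K_def using D
        by (intro continuous_intros continuous_at_imp_continuous_on ballI DERIV_isCont[OF D(2)] DERIV_isCont[OF D(3)])
      then have "(\<lambda>\<sigma>. indicator {0<..\<tau>} \<sigma> *\<^sub>R K \<sigma>) \<in> borel_measurable borel"
        by (intro borel_measurable_continuous_on_indicator) auto
      then have "(\<lambda>\<sigma>. ennreal (indicator {0<..\<tau>} \<sigma> *\<^sub>R K \<sigma>)) \<in> borel_measurable lborel" by simp
      moreover have "(\<lambda>\<sigma>. ennreal (indicator {0<..\<tau>} \<sigma> *\<^sub>R K \<sigma>)) = (\<lambda>\<sigma>. ennreal (K \<sigma>) * indicator {0<..\<tau>} \<sigma>)"
        by (auto simp: indicator_def fun_eq_iff)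
      ultimately show "(\<lambda>\<sigma>. ennreal (K \<sigma>) * indicator {0<..\<tau>} \<sigma>) \<in> borel_measurable lborel" by simp
    qed
    finally have "ennreal (\<tau> ^ 5) * I \<le> ennreal (\<tau> ^ 5) * (ennreal (3 * c\<^sup>2) * (\<integral>\<^sup>+\<sigma>\<in>{0<..\<tau>}. ennreal (K \<sigma>) \<partial>lborel))"
      by (rule mult_left_mono) simp
    also have "\<dots> = ennreal (3 * c\<^sup>2 * \<tau> ^ 5) * (\<integral>\<^sup>+\<sigma>\<in>{0<..\<tau>}. ennreal (K \<sigma>) \<partial>lborel)"
      using \<tau> by (simp add: ennreal_mult' mult_ac)
    finally show "ennreal ((y 0 \<tau> - clim y 0 - \<tau>\<^sup>2 * (clim y 1 / (2 * L)) - \<tau> ^ 3 * (clim y 2 / (3 * L)))\<^sup>2)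
      \<le> ennreal (3 * c\<^sup>2 * \<tau> ^ 5) * (\<integral>\<^sup>+\<sigma>\<in>{0<..\<tau>}. ennreal ((y 2 \<sigma> - clim y 2)\<^sup>2 + \<sigma>\<^sup>2 * ((clim y 2)\<^sup>2 + (y 1 \<sigma>)\<^sup>2)) \<partial>lborel)"
      using XI unfolding X_def l_def K_def by (rule order_trans[rotated])
  qed
qed

end

section \<open>Components of the solution and of its gradient as chains\<close>

definition cmp :: "nat \<Rightarrow> (R4 \<Rightarrow> real) \<Rightarrow> R4 \<Rightarrow> real" where
  "cmp k f x = (if k = 0 then f x else if k = 1 then d1 f x else if k = 2 then d2 f x else d3 f x / sin (thv x))"

lemma sin_theta_measurable [measurable]:
  "(\<lambda>p::real \<times> real \<times> real. sin (fst (snd p))) \<in> borel_measurable borel"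
  "(\<lambda>x::R4. sin (thv x)) \<in> borel_measurable borel"
  by (intro borel_measurable_continuous_onI continuous_intros)+

text \<open>\<open>F_pole\<close> says that the \<phi>-derivative vanishes at the poles with a
  smooth quotient, as it does for any smooth function on the sphere; the frame component is thereby
  bounded there. \<open>fin_energy\<close> is the global hypothesis, and it stops at level
  2.\<close>

locale spherical_wave_hierarchy = wave_hierarchy +
  assumes F_pole: "\<exists>G. smooth_on (full_reg T) G \<and> (\<forall>x\<in>full_reg T. d3 (F 0) x = sin (thv x) * G x)"
    and fin_energy: "(\<integral>\<^sup>+p\<in>UNIV \<times> {0<..<pi} \<times> {0..2 * pi}. ennreal (sin (fst (snd p)) * N_dens 2 (\<tau>0, p)) \<partial>lborel) < \<infinity>"
begin

abbreviation "kap \<equiv> \<lambda>\<tau>. \<tau> * inverse (p \<tau>)"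

lemma tc_kap: "tc kap" by (intro tc_intros)

lemma kap_deriv: "x \<in> full_reg T \<Longrightarrow> \<exists>k'. (kap has_real_derivative k') (at (fst x))"
  using tc_deriv[OF tc_kap] by (auto simp: full_reg_def)

lemma d0_F0: "x \<in> full_reg T \<Longrightarrow> d0 (F 0) x = kap (fst x) * F 1 x"
  using F_0 by simp

lemma d0_d_F:
  assumes "x \<in> full_reg T"
  shows "d0 (d1 (F 0)) x = kap (fst x) * d1 (F 1) x" "d0 (d2 (F 0)) x = kap (fst x) * d2 (F 1) x"
    "d0 (d3 (F 0)) x = kap (fst x) * d3 (F 1) x"
    "d0 (d1 (F (Suc j))) x = d1 (F (Suc (Suc j))) x" "d0 (d2 (F (Suc j))) x = d2 (F (Suc (Suc j))) x"
    "d0 (d3 (F (Suc j))) x = d3 (F (Suc (Suc j))) x"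
proof -
  obtain k' where k': "(kap has_real_derivative k') (at (fst x))" using kap_deriv assms by blast
  note c = d_commute[OF open_reg(2) F_smooth assms]
  note t = pdiff_transform_open(2)[OF open_reg(2) _ assms]
  have t0: "pdiff v (d0 (F 0)) x = pdiff v (\<lambda>x. kap (fst x) * F 1 x) x" for v by (rule t) (rule d0_F0)
  have tS: "pdiff v (d0 (F (Suc j))) x = pdiff v (F (Suc (Suc j))) x" for v by (rule t) (rule F_Suc)
  show "d0 (d1 (F 0)) x = kap (fst x) * d1 (F 1) x" "d0 (d2 (F 0)) x = kap (fst x) * d2 (F 1) x"
    "d0 (d3 (F 0)) x = kap (fst x) * d3 (F 1) x"
    unfolding c t0 by (rule coef_pdiff[OF assms F_smooth tc_smooth[OF tc_kap] k'])+
  show "d0 (d1 (F (Suc j))) x = d1 (F (Suc (Suc j))) x" "d0 (d2 (F (Suc j))) x = d2 (F (Suc (Suc j))) x"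
    "d0 (d3 (F (Suc j))) x = d3 (F (Suc (Suc j))) x"
    unfolding c tS by simp_all
qed

definition yy :: "nat \<Rightarrow> real \<times> real \<times> real \<Rightarrow> nat \<Rightarrow> real \<Rightarrow> real" where
  "yy k q j \<tau> = cmp k (F j) (\<tau>, q)"

text \<open>The t and angular derivatives, and division by \<open>sin \<theta>\<close>, commute with
  the \<tau>-derivative, so every component inherits the relations between the functions
  \<open>F j\<close>.\<close>

lemma chain_yy: "chain (yy k q)"
proof -
  obtain t \<theta> \<phi> where q: "q = (t, \<theta>, \<phi>)" by (cases q)
  have D: "(yy k q 0 has_real_derivative \<tau> * inverse (p \<tau>) * yy k q 1 \<tau>) (at \<tau>)"
    "(yy k q (Suc j) has_real_derivative yy k q (Suc (Suc j)) \<tau>) (at \<tau>)" if \<tau>: "\<tau> \<in> {0<..<T}" for \<tau> j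
  proof -
    have x: "(\<tau>, t, \<theta>, \<phi>) \<in> full_reg T" using \<tau> by (simp add: full_reg_def)
    have DD: "((\<lambda>s. f (s, t, \<theta>, \<phi>)) has_real_derivative d0 f (\<tau>, t, \<theta>, \<phi>)) (at \<tau>)" if "smooth_on (full_reg T) f" for f
      by (rule pdiff_coord_DERIV(1)[OF smooth_on_differentiable[OF that x]])
    note dd = DD[OF F_smooth] DD[OF smooth_on_d(2)[OF F_smooth]] DD[OF smooth_on_d(3)[OF F_smooth]] DD[OF smooth_on_d(4)[OF F_smooth]]
    have eq: "yy k q j = (\<lambda>s. if k = 0 then F j (s, t, \<theta>, \<phi>) else if k = 1 then d1 (F j) (s, t, \<theta>, \<phi>)
        else if k = 2 then d2 (F j) (s, t, \<theta>, \<phi>) else d3 (F j) (s, t, \<theta>, \<phi>) / sin \<theta>)" for j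
      by (auto simp: yy_def cmp_def q fun_eq_iff)
    consider "k = 0" | "k = 1" | "k = 2" | "k > 2" by linarith
    then show "(yy k q 0 has_real_derivative \<tau> * inverse (p \<tau>) * yy k q 1 \<tau>) (at \<tau>)"
    proof cases
      case 1 then show ?thesis unfolding eq using dd(1)[of 0] d0_F0[OF x] by simp
    next
      case 2 then show ?thesis unfolding eq using dd(2)[of 0] d0_d_F(1)[OF x] by simp
    next
      case 3 then show ?thesis unfolding eq using dd(3)[of 0] d0_d_F(2)[OF x] by simp
    next
      case 4 then show ?thesis unfolding eq using DERIV_cdivide[OF dd(4)[of 0], of "sin \<theta>"] d0_d_F(3)[OF x] by simp
    qed
    consider "k = 0" | "k = 1" | "k = 2" | "k > 2" by linarith
    then show "(yy k q (Suc j) has_real_derivative yy k q (Suc (Suc j)) \<tau>) (at \<tau>)"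
    proof cases
      case 1 then show ?thesis unfolding eq using dd(1)[of "Suc j"] F_Suc[OF x, of j] by simp
    next
      case 2 then show ?thesis unfolding eq using dd(2)[of "Suc j"] d0_d_F(4)[OF x, of j] by simp
    next
      case 3 then show ?thesis unfolding eq using dd(3)[of "Suc j"] d0_d_F(5)[OF x, of j] by simp
    next
      case 4 then show ?thesis unfolding eq using DERIV_cdivide[OF dd(4)[of "Suc j"], of "sin \<theta>"] d0_d_F(6)[OF x, of j] by simp
    qed
  qed
  have "continuous_on {0<..<T} (yy k q 3)"
    using DERIV_isCont[OF D(2)[of _ 2]] by (auto simp: eval_nat_numeral intro!: continuous_at_imp_continuous_on)
  then show ?thesis using D(1) D(2)[of _ 0] D(2)[of _ 1] unfolding chain_def by (auto simp: eval_nat_numeral)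
qed

lemma cmp_measurable: "(\<lambda>x. indicator (full_reg T) x * cmp k (F j) x) \<in> borel_measurable borel"
proof -
  have c: "(\<lambda>x. indicator (full_reg T) x *\<^sub>R f x) \<in> borel_measurable borel" if "smooth_on (full_reg T) f" for f :: "R4 \<Rightarrow> real"
    using smooth_on_continuous[OF that] by (intro borel_measurable_continuous_on_indicator) (auto intro: borel_open open_reg)
  have [measurable]: "(\<lambda>x. indicator (full_reg T) x * F j x) \<in> borel_measurable borel"
    "(\<lambda>x. indicator (full_reg T) x * d1 (F j) x) \<in> borel_measurable borel"
    "(\<lambda>x. indicator (full_reg T) x * d2 (F j) x) \<in> borel_measurable borel"
    "(\<lambda>x. indicator (full_reg T) x * d3 (F j) x) \<in> borel_measurable borel"
    using c[OF F_smooth] c[OF smooth_on_d(2)[OF F_smooth]] c[OF smooth_on_d(3)[OF F_smooth]] c[OF smooth_on_d(4)[OF F_smooth]] by auto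
  have "(\<lambda>x. indicator (full_reg T) x * cmp k (F j) x) = (\<lambda>x. if k = 0 then indicator (full_reg T) x * F j x
     else if k = 1 then indicator (full_reg T) x * d1 (F j) x
     else if k = 2 then indicator (full_reg T) x * d2 (F j) x
     else indicator (full_reg T) x * d3 (F j) x / sin (thv x))"
    by (auto simp: cmp_def fun_eq_iff)
  then show ?thesis by simp
qed

lemma yy_measurable: "\<tau> \<in> {0<..<T} \<Longrightarrow> (\<lambda>p. yy k p j \<tau>) \<in> borel_measurable borel"
proof -
  assume t: "\<tau> \<in> {0<..<T}"
  have "(\<lambda>p. (\<tau>, p)) \<in> borel \<rightarrow>\<^sub>M (borel :: R4 measure)" by (intro borel_measurable_continuous_onI continuous_intros)
  from measurable_compose[OF this cmp_measurable[of k j]] show ?thesis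
    using t by (simp add: yy_def full_reg_def)
qed

text \<open>Joint measurability is what the exchange of the integrals over \<sigma> and over the
  slice requires; the indicator makes the function globally Borel.\<close>

lemma yy_joint_measurable:
  "(\<lambda>(p, \<sigma>). indicator {0<..<T} \<sigma> * yy k p j \<sigma>) \<in> borel_measurable (lborel \<Otimes>\<^sub>M lborel)"
proof -
  have "(\<lambda>z::(real \<times> real \<times> real) \<times> real. (snd z, fst z)) \<in> borel \<rightarrow>\<^sub>M (borel :: R4 measure)"
    by (intro borel_measurable_continuous_onI continuous_intros)
  from measurable_compose[OF this cmp_measurable[of k j]]
  have "(\<lambda>z. indicator (full_reg T) (snd z, fst z) * cmp k (F j) (snd z, fst z)) \<in> borel_measurable borel" .
  moreover have "(\<lambda>z. indicator (full_reg T) (snd z, fst z) * cmp k (F j) (snd z, fst z)) = (\<lambda>(p, \<sigma>). indicator {0<..<T} \<sigma> * yy k p j \<sigma>)"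
    by (auto simp: fun_eq_iff yy_def full_reg_def indicator_def)
  ultimately show ?thesis by (simp add: lborel_prod)
qed

text \<open>The factor \<open>sin \<theta>\<close> is constant in \<tau> and survives
  \<tau>-differentiation; from \<open>F 0\<close> to \<open>F 1\<close> one also divides by
  \<open>kap\<close>, which does not vanish for \<tau> > 0.\<close>

lemma pole_factor: "\<exists>G. smooth_on (full_reg T) G \<and> (\<forall>x\<in>full_reg T. d3 (F j) x = sin (thv x) * G x)"
proof -
  have step: "\<exists>G'. smooth_on (full_reg T) G' \<and> (\<forall>x\<in>full_reg T. d0 (d3 f) x = sin (thv x) * G' x)"
    if f: "smooth_on (full_reg T) f" and G: "smooth_on (full_reg T) G" "\<forall>x\<in>full_reg T. d3 f x = sin (thv x) * G x" for f G
  proof (intro exI[of _ "d0 G"] conjI ballI)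
    show "smooth_on (full_reg T) (d0 G)" by (rule smooth_on_d[OF G(1)])
    fix x assume x: "x \<in> full_reg T"
    obtain \<tau> t \<theta> \<phi> where xx: "x = (\<tau>, t, \<theta>, \<phi>)" by (cases x)
    have "d0 (d3 f) x = d0 (\<lambda>x. sin (thv x) * G x) x"
      by (rule pdiff_transform_open(2)[OF open_reg(2) _ x]) (use G(2) in auto)
    also have "\<dots> = sin (thv x) * d0 G x"
      unfolding xx
    proof (rule pdiff_coord_eqI(1))
      have "smooth_on (full_reg T) (\<lambda>x. sin (thv x) * G x)" by (intro smooth_on_mult smooth_on_sin smooth_on_thv open_reg G)
      then show "(\<lambda>x. sin (thv x) * G x) differentiable at (\<tau>, t, \<theta>, \<phi>)" using smooth_on_differentiable x xx by blast
      show "((\<lambda>s. sin (thv (s, t, \<theta>, \<phi>)) * G (s, t, \<theta>, \<phi>)) has_real_derivative sin (thv (\<tau>, t, \<theta>, \<phi>)) * d0 G (\<tau>, t, \<theta>, \<phi>)) (at \<tau>)"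
        unfolding fst_conv snd_conv
        by (rule DERIV_cmult[OF pdiff_coord_DERIV(1)[OF smooth_on_differentiable[OF G(1) x[unfolded xx]]]])
    qed
    finally show "d0 (d3 f) x = sin (thv x) * d0 G x" .
  qed
  show ?thesis
  proof (induction j)
    case 0
    show ?case by (rule F_pole)
  next
    case (Suc j)
    then obtain G where G: "smooth_on (full_reg T) G" "\<forall>x\<in>full_reg T. d3 (F j) x = sin (thv x) * G x" by blast
    obtain G' where G': "smooth_on (full_reg T) G'" "\<forall>x\<in>full_reg T. d0 (d3 (F j)) x = sin (thv x) * G' x"
      using step[OF F_smooth G] by blast
    show ?case
    proof (cases j)
      case 0
      have nz: "kap (fst x) \<noteq> 0" if "x \<in> full_reg T" for x
        using that p_pos[of "fst x"] by (auto simp: full_reg_def)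
      have "smooth_on (full_reg T) (\<lambda>x. G' x / kap (fst x))"
        by (intro smooth_on_divide open_reg G' smooth_on_coef tc_smooth tc_kap nz)
      moreover have "d3 (F 1) x = sin (thv x) * (G' x / kap (fst x))" if x: "x \<in> full_reg T" for x
      proof -
        have "kap (fst x) * d3 (F 1) x = sin (thv x) * G' x" using G'(2) d0_d_F(3)[OF x] x 0 by metis
        then show ?thesis using nz[OF x] by (simp add: nonzero_eq_divide_eq mult.commute del: mult_eq_0_iff)
      qed
      ultimately show ?thesis using 0 by (intro exI[of _ "\<lambda>x. G' x / kap (fst x)"]) auto
    next
      case (Suc i)
      then show ?thesis using G' d0_d_F(6)[of _ i] by (intro exI[of _ G']) auto
    qed
  qed
qed

text \<open>Qualitative finiteness at every level: with the quotient of \<open>pole_factor\<close>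
  in place of the frame component, the density is dominated by a continuous function on a compact
  box. The essential case is level 3, for which no global bound is assumed.\<close>

lemma E_int_finite: "E_int J \<tau>0 a b c < \<infinity>"
proof -
  obtain G where G: "\<And>j. smooth_on (full_reg T) (G j)" "\<And>j x. x \<in> full_reg T \<Longrightarrow> d3 (F j) x = sin (thv x) * G j x"
    using pole_factor by metis
  define h where "h p = (\<Sum>j\<le>J. (d0 (F j) (\<tau>0, p))\<^sup>2 + (d1 (F j) (\<tau>0, p))\<^sup>2 + (d2 (F j) (\<tau>0, p))\<^sup>2 + (G j (\<tau>0, p))\<^sup>2)" for p
  have ch: "continuous_on UNIV h" unfolding h_def
    by (intro continuous_intros F_slice_continuous tau0 smooth_on_d F_smooth G)
  obtain K where K: "\<And>p. p \<in> cbox (a, 0, c) (b, pi, c + 2 * pi) \<Longrightarrow> \<bar>h p\<bar> \<le> K"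
    using compact_imp_bounded[OF compact_continuous_image[OF continuous_on_subset[OF ch subset_UNIV] compact_cbox[of "(a, 0, c)" "(b, pi, c + 2 * pi)"]]]
    by (auto simp: bounded_iff)
  have "E_int J \<tau>0 a b c \<le> (\<integral>\<^sup>+p. ennreal K * indicator (cbox (a, 0, c) (b, pi, c + 2 * pi)) p \<partial>lborel)"
    unfolding E_int_def
  proof (rule nn_integral_mono)
    fix p :: "real \<times> real \<times> real"
    show "ennreal (sin (fst (snd p)) * N_dens J (\<tau>0, p)) * indicator ({a..b} \<times> {0<..<pi} \<times> {c..c + 2 * pi}) p
      \<le> ennreal K * indicator (cbox (a, 0, c) (b, pi, c + 2 * pi)) p"
    proof (cases "p \<in> {a..b} \<times> {0<..<pi} \<times> {c..c + 2 * pi}")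
      case True
      then have pc: "p \<in> cbox (a, 0, c) (b, pi, c + 2 * pi)" by (auto simp: cbox_Pair_eq)
      have sn: "0 < sin (fst (snd p))" "sin (fst (snd p)) \<le> 1" using True by (auto intro: sin_gt_zero)
      have xf: "(\<tau>0, p) \<in> full_reg T" using tau0 by (cases p) (simp add: full_reg_def)
      have "N_dens J (\<tau>0, p) \<le> h p"
        unfolding N_dens_def h_def using sn by (intro sum_mono) (auto simp: n_dens_def G(2)[OF xf])
      then have "sin (fst (snd p)) * N_dens J (\<tau>0, p) \<le> 1 * h p"
        using sn N_dens_nonneg[of J "(\<tau>0, p)"] by (intro mult_mono) auto
      then have "sin (fst (snd p)) * N_dens J (\<tau>0, p) \<le> K" using K[OF pc] by linarith
      then show ?thesis using True pc by (simp add: ennreal_leI)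
    qed simp
  qed
  also have "\<dots> = ennreal K * emeasure lborel (cbox (a, 0, c) (b, pi, c + 2 * pi))"
    by (rule nn_integral_cmult_indicator) simp
  also have "\<dots> < \<infinity>" using emeasure_bounded_finite[OF bounded_cbox] by (auto simp: ennreal_mult_less_top)
  finally show ?thesis .
qed

lemma yy_le_N:
  assumes "\<tau> \<in> {0<..<T}" "1 \<le> k" "j \<le> J"
  shows "(yy k q j \<tau>)\<^sup>2 \<le> N_dens J (\<tau>, q)"
proof -
  have "(yy k q j \<tau>)\<^sup>2 \<le> n_dens j (\<tau>, q)"
    using assms(2) unfolding yy_def cmp_def n_dens_def by (auto simp: add_nonneg_nonneg)
  then show ?thesis using n_le_N[OF assms(3), of "(\<tau>, q)"] by linarith
qed

text \<open>For \<open>k = 0\<close> the value \<open>F 3\<close> is the \<tau>-derivative of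
  \<open>F 2\<close> and thus part of the density at level 2; this covers the undifferentiated
  component as well.\<close>

lemma yy3_le_N:
  assumes "\<tau> \<in> {0<..<T}"
  shows "(yy k q 3 \<tau>)\<^sup>2 \<le> N_dens 3 (\<tau>, q)"
proof (cases "k = 0")
  case True
  have "(\<tau>, q) \<in> full_reg T" using assms by (cases q) (simp add: full_reg_def)
  then have "yy k q 3 \<tau> = d0 (F 2) (\<tau>, q)" using True F_Suc[of "(\<tau>, q)" 1] by (simp add: yy_def cmp_def eval_nat_numeral)
  then have "(yy k q 3 \<tau>)\<^sup>2 \<le> n_dens 2 (\<tau>, q)" by (simp add: n_dens_def add_nonneg_nonneg)
  then show ?thesis using n_le_N[of 2 3 "(\<tau>, q)"] by linarith
next
  case False
  then show ?thesis using yy_le_N[OF assms, of k 3 3 q] by simp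
qed

lemma chain_int_measurable: "\<tau> \<le> \<tau>0 \<Longrightarrow> (\<lambda>p. chain_int (yy k p) \<tau>) \<in> borel_measurable borel"
proof -
  assume t: "\<tau> \<le> \<tau>0"
  note [measurable] = yy_joint_measurable[of k 3]
  have m: "(\<lambda>(p, \<sigma>). ennreal ((indicator {0<..<T} \<sigma> * yy k p 3 \<sigma>)\<^sup>2) * indicator {0<..\<tau>} \<sigma>) \<in> borel_measurable (lborel \<Otimes>\<^sub>M lborel)"
    by measurable
  have "(\<lambda>p. \<integral>\<^sup>+\<sigma>. ennreal ((indicator {0<..<T} \<sigma> * yy k p 3 \<sigma>)\<^sup>2) * indicator {0<..\<tau>} \<sigma> \<partial>lborel) \<in> borel_measurable lborel"
    using lborel.borel_measurable_nn_integral[OF m] by simp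
  moreover have "chain_int (yy k p) \<tau> = (\<integral>\<^sup>+\<sigma>. ennreal ((indicator {0<..<T} \<sigma> * yy k p 3 \<sigma>)\<^sup>2) * indicator {0<..\<tau>} \<sigma> \<partial>lborel)" for p
    unfolding chain_int_def using t tau0 by (intro nn_integral_cong) (auto simp: indicator_def)
  ultimately show ?thesis by simp
qed

text \<open>Exchanging integrals turns the square of level 3 along the chains into level 3 energies
  of slices. These are bounded uniformly in \<sigma> by \<open>energy_estimate\<close>, and the
  length of the \<sigma>-interval supplies the factor \<tau>.\<close>

lemma local_bound:
  "\<exists>A::real. 0 \<le> A \<and> (\<forall>\<tau>\<in>{0<..\<tau>0}. \<forall>k. (\<integral>\<^sup>+p\<in>{a..b} \<times> {0<..<pi} \<times> {c..c + 2 * pi}.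
      ennreal (sin (fst (snd p))) * chain_int (yy k p) \<tau> \<partial>lborel) \<le> ennreal (\<tau> * A))"
proof (cases "a \<le> b")
  case False
  then show ?thesis by (intro exI[of _ 0]) auto
next
  case True
  obtain C M where CM: "C > 0" "M > 0" "\<And>\<tau> a b c. \<tau> \<in> {0<..\<tau>0} \<Longrightarrow> a \<le> b \<Longrightarrow> E_int 3 \<tau> a b c \<le> ennreal C * E_int 3 \<tau>0 (a - M) (b + M) c"
    using energy_estimate[of 2] by (auto simp: eval_nat_numeral)
  define A where "A = enn2real (ennreal C * E_int 3 \<tau>0 (a - M) (b + M) c)"
  have A: "ennreal A = ennreal C * E_int 3 \<tau>0 (a - M) (b + M) c" "0 \<le> A"
    using E_int_finite[of 3 "a - M" "b + M" c] by (auto simp: A_def ennreal_mult_less_top)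
  have "(\<integral>\<^sup>+p\<in>{a..b} \<times> {0<..<pi} \<times> {c..c + 2 * pi}. ennreal (sin (fst (snd p))) * chain_int (yy k p) \<tau> \<partial>lborel) \<le> ennreal (\<tau> * A)"
    if \<tau>: "\<tau> \<in> {0<..\<tau>0}" for \<tau> k
  proof -
    let ?B = "{a..b} \<times> {0<..<pi} \<times> {c..c + 2 * pi}"
    have B [measurable]: "?B \<in> sets borel" by (intro borel_Times) auto
    define g where "g = (\<lambda>(p, \<sigma>). ennreal (sin (fst (snd p))) * indicator ?B p * (ennreal ((indicator {0<..<T} \<sigma> * yy k p 3 \<sigma>)\<^sup>2) * indicator {0<..\<tau>} \<sigma>))"
    note [measurable] = yy_joint_measurable[of k 3]
    have gm: "g \<in> borel_measurable (lborel \<Otimes>\<^sub>M lborel)" unfolding g_def by measurable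
    have ym: "(\<lambda>\<sigma>. indicator {0<..<T} \<sigma> * yy k p 3 \<sigma>) \<in> borel_measurable lborel" for p
      using measurable_compose[OF measurable_Pair1' yy_joint_measurable[of k 3], of p] by simp
    have "(\<integral>\<^sup>+p\<in>?B. ennreal (sin (fst (snd p))) * chain_int (yy k p) \<tau> \<partial>lborel) = (\<integral>\<^sup>+p. \<integral>\<^sup>+\<sigma>. g (p, \<sigma>) \<partial>lborel \<partial>lborel)"
    proof (rule nn_integral_cong)
      fix p
      have "(\<integral>\<^sup>+\<sigma>. g (p, \<sigma>) \<partial>lborel) = ennreal (sin (fst (snd p))) * indicator ?B p * (\<integral>\<^sup>+\<sigma>. ennreal ((indicator {0<..<T} \<sigma> * yy k p 3 \<sigma>)\<^sup>2) * indicator {0<..\<tau>} \<sigma> \<partial>lborel)"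
        unfolding g_def split using ym[of p] by (intro nn_integral_cmult) measurable
      also have "(\<integral>\<^sup>+\<sigma>. ennreal ((indicator {0<..<T} \<sigma> * yy k p 3 \<sigma>)\<^sup>2) * indicator {0<..\<tau>} \<sigma> \<partial>lborel) = chain_int (yy k p) \<tau>"
        unfolding chain_int_def using \<tau> tau0 by (intro nn_integral_cong) (auto simp: indicator_def)
      finally show "ennreal (sin (fst (snd p))) * chain_int (yy k p) \<tau> * indicator ?B p = (\<integral>\<^sup>+\<sigma>. g (p, \<sigma>) \<partial>lborel)"
        by (simp add: mult_ac)
    qed
    also have "\<dots> = (\<integral>\<^sup>+\<sigma>. \<integral>\<^sup>+p. g (p, \<sigma>) \<partial>lborel \<partial>lborel)" by (rule lborel_pair.Fubini'[symmetric]) (use gm in simp)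
    also have "\<dots> \<le> (\<integral>\<^sup>+\<sigma>. ennreal A * indicator {0<..\<tau>} \<sigma> \<partial>lborel)"
    proof (rule nn_integral_mono)
      fix \<sigma>
      show "(\<integral>\<^sup>+p. g (p, \<sigma>) \<partial>lborel) \<le> ennreal A * indicator {0<..\<tau>} \<sigma>"
      proof (cases "\<sigma> \<in> {0<..\<tau>}")
        case s: True
        have "(\<integral>\<^sup>+p. g (p, \<sigma>) \<partial>lborel) \<le> E_int 3 \<sigma> a b c"
          unfolding E_int_def
        proof (rule nn_integral_mono)
          fix p
          show "g (p, \<sigma>) \<le> ennreal (sin (fst (snd p)) * N_dens 3 (\<sigma>, p)) * indicator ?B p"
          proof (cases "p \<in> ?B")
            case pB: True
            have "0 \<le> sin (fst (snd p))" using pB by (auto intro: sin_ge_zero)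
            moreover have "(yy k p 3 \<sigma>)\<^sup>2 \<le> N_dens 3 (\<sigma>, p)" using s \<tau> tau0 by (intro yy3_le_N) auto
            ultimately have "ennreal (sin (fst (snd p))) * ennreal ((yy k p 3 \<sigma>)\<^sup>2) \<le> ennreal (sin (fst (snd p)) * N_dens 3 (\<sigma>, p))"
              by (simp add: ennreal_mult'[symmetric] ennreal_leI mult_left_mono)
            then show ?thesis using pB s \<tau> tau0 by (simp add: g_def indicator_def)
          qed (simp add: g_def)
        qed
        also have "\<dots> \<le> ennreal A" unfolding A using s \<tau> True by (intro CM) auto
        finally show ?thesis using s by simp
      qed (simp add: g_def)
    qed
    also have "\<dots> = ennreal A * emeasure lborel {0<..\<tau>}" by (rule nn_integral_cmult_indicator) simp
    also have "\<dots> = ennreal (\<tau> * A)" using \<tau> A(2) by (simp add: ennreal_mult'[symmetric] mult.commute)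
    finally show ?thesis .
  qed
  then show ?thesis using A(2) by blast
qed

end

section \<open>Slices, limits and the cubic remainder\<close>

context spherical_wave_hierarchy begin

text \<open>\<open>K\<close> may extend over several periods in \<phi>. It is covered by
  \<open>2 * n\<close> period cells, to each of which \<open>local_bound\<close> applies, and the
  weight \<open>sin \<theta>\<close> can be removed because it is bounded below on
  \<open>K\<close>.\<close>

lemma chain_int_compact:
  assumes K: "compact K" "K \<subseteq> coord_dom"
  shows "(\<integral>\<^sup>+q\<in>K. chain_int (yy k q) \<tau>0 \<partial>lborel) < \<infinity>"
proof -
  obtain R \<epsilon> where R: "R > 0" "0 < \<epsilon>" "\<epsilon> < pi / 2" "K \<subseteq> {- R..R} \<times> {\<epsilon>..pi - \<epsilon>} \<times> {- R..R}"
    using compact_in_coord_boxes[OF K] by blast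
  obtain n where n: "R \<le> real n" using real_arch_simple by blast
  define c where "c i = - 2 * pi * real n + 2 * pi * real i" for i :: nat
  define B where "B i = {- R..R} \<times> {0<..<pi} \<times> {c i..c i + 2 * pi}" for i
  have Bm [measurable]: "B i \<in> sets borel" for i unfolding B_def by (intro borel_Times) auto
  have sn: "sin \<epsilon> > 0" using R by (intro sin_gt_zero) auto
  have sle: "sin \<epsilon> \<le> sin \<theta>" if "\<epsilon> \<le> \<theta>" "\<theta> \<le> pi - \<epsilon>" for \<theta>
  proof (cases "\<theta> \<le> pi / 2")
    case True
    then show ?thesis using that R by (intro sin_monotone_2pi_le) auto
  next
    case False
    then have "sin \<epsilon> \<le> sin (pi - \<theta>)" using that R by (intro sin_monotone_2pi_le) auto
    then show ?thesis by simp
  qed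
  define J where "J q = chain_int (yy k q) \<tau>0" for q
  have Jm [measurable]: "J \<in> borel_measurable borel" unfolding J_def[abs_def] by (rule chain_int_measurable) simp
  have "(\<integral>\<^sup>+q\<in>K. J q \<partial>lborel) \<le> (\<integral>\<^sup>+q. (\<Sum>i<2*n. ennreal (1 / sin \<epsilon>) * (ennreal (sin (fst (snd q))) * J q * indicator (B i) q)) \<partial>lborel)"
  proof (rule nn_integral_mono)
    fix q :: "real \<times> real \<times> real"
    show "J q * indicator K q \<le> (\<Sum>i<2*n. ennreal (1 / sin \<epsilon>) * (ennreal (sin (fst (snd q))) * J q * indicator (B i) q))"
    proof (cases "q \<in> K")
      case True
      obtain t \<theta> \<phi> where q: "q = (t, \<theta>, \<phi>)" by (cases q)
      have qq: "- R \<le> t" "t \<le> R" "\<epsilon> \<le> \<theta>" "\<theta> \<le> pi - \<epsilon>" "- R \<le> \<phi>" "\<phi> \<le> R" using True R(4) by (auto simp: q)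
      \<comment> \<open>Position of \<phi> in units of periods, counted from the left end of the
        first cell; its integer part is the index of the cell containing \<phi>.\<close>
      define x where "x = \<phi> / (2 * pi) + real n"
      have Rn: "R / (2 * pi) < real n"
      proof -
        have "R / (2 * pi) < R / 1" using R(1) pi_gt3 by (intro divide_strict_left_mono) auto
        then show ?thesis using n by simp
      qed
      have "- (R / (2 * pi)) \<le> \<phi> / (2 * pi)" "\<phi> / (2 * pi) \<le> R / (2 * pi)"
        using qq(5,6) pi_gt_zero by (auto simp: field_simps)
      then have x: "0 \<le> x" "x < 2 * real n" using Rn by (auto simp: x_def)
      define i where "i = nat \<lfloor>x\<rfloor>"
      have i: "real i \<le> x" "x < real i + 1" "i < 2 * n" using x by (auto simp: i_def) linarith+
      have "\<phi> = 2 * pi * (x - real n)" using pi_gt_zero by (simp add: x_def)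
      then have "c i \<le> \<phi>" "\<phi> \<le> c i + 2 * pi"
        using mult_left_mono[OF i(1), of "2 * pi"] mult_left_mono[OF less_imp_le[OF i(2)], of "2 * pi"] pi_gt_zero
        by (auto simp: c_def algebra_simps)
      then have qB: "q \<in> B i" using qq R(2) by (auto simp: B_def q)
      have "1 \<le> 1 / sin \<epsilon> * sin \<theta>" using sle[OF qq(3,4)] sn by (simp add: field_simps)
      from ennreal_leI[OF this] have "1 * J q \<le> ennreal (1 / sin \<epsilon> * sin \<theta>) * J q" by (intro mult_right_mono) simp_all
      also have "\<dots> = ennreal (1 / sin \<epsilon>) * (ennreal (sin (fst (snd q))) * J q * indicator (B i) q)"
        unfolding ennreal_mult'[OF less_imp_le[OF divide_pos_pos[OF zero_less_one sn]]] using qB by (simp add: q mult.assoc)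
      also have "\<dots> \<le> (\<Sum>i<2*n. ennreal (1 / sin \<epsilon>) * (ennreal (sin (fst (snd q))) * J q * indicator (B i) q))"
        using i(3) by (intro member_le_sum) auto
      finally show ?thesis using True by simp
    qed simp
  qed
  also have "\<dots> = (\<Sum>i<2*n. ennreal (1 / sin \<epsilon>) * (\<integral>\<^sup>+q\<in>B i. ennreal (sin (fst (snd q))) * J q \<partial>lborel))"
    by (subst nn_integral_sum) (auto simp: nn_integral_cmult)
  also have "\<dots> < \<infinity>"
  proof -
    have "(\<integral>\<^sup>+q\<in>B i. ennreal (sin (fst (snd q))) * J q \<partial>lborel) < \<infinity>" for i
    proof -
      obtain A where A: "0 \<le> A" "\<forall>\<tau>\<in>{0<..\<tau>0}. \<forall>k. (\<integral>\<^sup>+q\<in>{- R..R} \<times> {0<..<pi} \<times> {c i..c i + 2 * pi}.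
        ennreal (sin (fst (snd q))) * chain_int (yy k q) \<tau> \<partial>lborel) \<le> ennreal (\<tau> * A)"
        using local_bound[of "- R" R "c i"] by blast
      then have "(\<integral>\<^sup>+q\<in>B i. ennreal (sin (fst (snd q))) * J q \<partial>lborel) \<le> ennreal (\<tau>0 * A)"
        using tau0 unfolding B_def J_def by auto
      then show ?thesis by (rule order_le_less_trans) simp
    qed
    then show ?thesis by (simp add: ennreal_mult_less_top)
  qed
  finally show ?thesis by (simp add: J_def)
qed

text \<open>A nonnegative function with finite integral over each member of a countable exhaustion
  by compact sets is finite almost everywhere.\<close>

lemma AE_chain_int: "AE q in lborel. q \<in> coord_dom \<longrightarrow> (\<forall>k\<le>3. chain_int (yy k q) \<tau>0 < \<infinity>)"
proof -
  define K where "K n = cbox (- real (Suc n), 1 / real (Suc n), - real (Suc n)) (real (Suc n), pi - 1 / real (Suc n), real (Suc n))" for n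
  have sub: "K n \<subseteq> coord_dom" for n
  proof -
    obtain d where d: "d = 1 / real (Suc n)" "d > 0" by simp
    show ?thesis unfolding K_def coord_dom_def d(1)[symmetric] using d(2) by (auto simp: cbox_Pair_eq)
  qed
  have ae: "AE q in lborel. \<forall>n. chain_int (yy k q) \<tau>0 * indicator (K n) q \<noteq> \<infinity>" for k
    unfolding AE_all_countable
  proof
    fix n
    have [measurable]: "(\<lambda>q. chain_int (yy k q) \<tau>0) \<in> borel_measurable borel" by (rule chain_int_measurable) simp
    have "K n \<in> sets borel" by (simp add: K_def)
    then show "AE q in lborel. chain_int (yy k q) \<tau>0 * indicator (K n) q \<noteq> \<infinity>"
      using chain_int_compact[OF _ sub, of n k] by (intro nn_integral_PInf_AE) (auto simp: K_def)
  qed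
  have "AE q in lborel. \<forall>k. \<forall>n. chain_int (yy k q) \<tau>0 * indicator (K n) q \<noteq> \<infinity>"
    by (subst AE_all_countable) (use ae in blast)
  then show ?thesis
  proof eventually_elim
    case (elim q)
    show ?case
    proof (intro impI allI)
      fix k assume "q \<in> coord_dom"
      obtain t \<theta> \<phi> where q: "q = (t, \<theta>, \<phi>)" by (cases q)
      have th: "0 < \<theta>" "\<theta> < pi" using \<open>q \<in> coord_dom\<close> by (auto simp: coord_dom_def q)
      obtain n where n: "real n > max (max \<bar>t\<bar> \<bar>\<phi>\<bar>) (max (1 / \<theta>) (1 / (pi - \<theta>)))" using reals_Archimedean2 by blast
      then have "1 / real (Suc n) < \<theta>" "1 / real (Suc n) < pi - \<theta>" using th by (auto simp: field_simps)
      then have "q \<in> K n" using n by (auto simp: q K_def cbox_Pair_eq)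
      then show "chain_int (yy k q) \<tau>0 < \<infinity>" using elim[rule_format, of k n] by (simp add: less_top)
    qed
  qed
qed

definition ll :: "nat \<Rightarrow> nat \<Rightarrow> real \<times> real \<times> real \<Rightarrow> real" where
  "ll k j q = clim (yy k q) j"

lemma tseq_T: "tseq n \<in> {0<..<T}"
  using tseq(1)[of n] tseq(2)[of n] tau0 by auto

lemma ll_measurable [measurable]: "ll k j \<in> borel_measurable borel"
  unfolding ll_def[abs_def] clim_def
  by (rule borel_measurable_lim_metric) (rule yy_measurable[OF tseq_T])

lemma AE_ll: "AE q in lborel. q \<in> coord_dom \<longrightarrow> (\<forall>k\<le>3. \<forall>j\<le>2. (\<lambda>n. yy k q j (tseq n)) \<longlonglongrightarrow> ll k j q)"
  using AE_chain_int by eventually_elim (auto simp: ll_def intro!: clim chain_yy)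

text \<open>The majorant is that of \<open>chain_bound\<close>: the data at \<tau>0 are continuous
  on \<open>K\<close>, and the remaining term is integrable by
  \<open>chain_int_compact\<close>.\<close>

lemma domination:
  assumes K: "compact K" "K \<subseteq> coord_dom" and kj: "k \<le> 3" "j \<le> 2"
  shows "\<exists>W. set_integrable lborel K W \<and> (AE q in lborel. q \<in> K \<longrightarrow> (\<forall>n. \<bar>yy k q j (tseq n)\<bar> \<le> W q))"
proof -
  obtain B where B: "B > 0" "\<And>y j \<tau>. chain y \<Longrightarrow> chain_int y \<tau>0 < \<infinity> \<Longrightarrow> j \<le> 2 \<Longrightarrow> \<tau> \<in> {0<..\<tau>0} \<Longrightarrow>
    \<bar>y j \<tau>\<bar> \<le> B * (\<bar>y 0 \<tau>0\<bar> + \<bar>y 1 \<tau>0\<bar> + \<bar>y 2 \<tau>0\<bar> + 1 + enn2real (chain_int y \<tau>0))" using chain_bound by blast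
  define W where "W q = B * (\<bar>yy k q 0 \<tau>0\<bar> + \<bar>yy k q 1 \<tau>0\<bar> + \<bar>yy k q 2 \<tau>0\<bar> + 1 + enn2real (chain_int (yy k q) \<tau>0))" for q
  have c: "continuous_on K (\<lambda>q. yy k q i \<tau>0)" for i
  proof -
    have nz: "\<And>q. q \<in> K \<Longrightarrow> sin (fst (snd q)) \<noteq> 0"
      using K(2) sin_gt_zero by (force simp: coord_dom_def)
    have f: "continuous_on K (\<lambda>q. f (\<tau>0, q))" if "smooth_on (full_reg T) f" for f
      using F_slice_continuous[OF tau0 that] continuous_on_subset by blast
    have "continuous_on K (\<lambda>q. d3 (F i) (\<tau>0, q) / sin (thv (\<tau>0, q)))"
      using nz by (intro continuous_intros f smooth_on_d F_smooth) auto
    moreover have "continuous_on K (\<lambda>q. F i (\<tau>0, q))" "continuous_on K (\<lambda>q. d1 (F i) (\<tau>0, q))" "continuous_on K (\<lambda>q. d2 (F i) (\<tau>0, q))"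
      by (intro f smooth_on_d F_smooth)+
    ultimately show ?thesis unfolding yy_def cmp_def
      by (cases "k = 0"; cases "k = 1"; cases "k = 2") auto
  qed
  have "set_integrable lborel K (\<lambda>q. \<bar>yy k q i \<tau>0\<bar>)" for i
    unfolding set_integrable_def by (intro borel_integrable_compact K continuous_intros c)
  moreover have "set_integrable lborel K (\<lambda>q. 1::real)"
    unfolding set_integrable_def by (intro borel_integrable_compact K continuous_intros)
  moreover have "set_integrable lborel K (\<lambda>q. enn2real (chain_int (yy k q) \<tau>0))"
    unfolding set_integrable_def
  proof (rule integrableI_bounded)
    have [measurable]: "(\<lambda>q. chain_int (yy k q) \<tau>0) \<in> borel_measurable borel" by (rule chain_int_measurable) simp
    have [measurable]: "K \<in> sets borel" using K(1) by (simp add: borel_compact)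
    show "(\<lambda>q. indicat_real K q *\<^sub>R enn2real (chain_int (yy k q) \<tau>0)) \<in> borel_measurable lborel" by measurable
    have "(\<integral>\<^sup>+q. ennreal (norm (indicat_real K q *\<^sub>R enn2real (chain_int (yy k q) \<tau>0))) \<partial>lborel) \<le> (\<integral>\<^sup>+q\<in>K. chain_int (yy k q) \<tau>0 \<partial>lborel)"
    proof (rule nn_integral_mono)
      fix q
      have "ennreal (enn2real x) \<le> x" for x by (cases x) auto
      then show "ennreal (norm (indicat_real K q *\<^sub>R enn2real (chain_int (yy k q) \<tau>0))) \<le> chain_int (yy k q) \<tau>0 * indicator K q"
        by (auto simp: indicator_def)
    qed
    also have "\<dots> < \<infinity>" by (rule chain_int_compact[OF K])
    finally show "(\<integral>\<^sup>+q. ennreal (norm (indicat_real K q *\<^sub>R enn2real (chain_int (yy k q) \<tau>0))) \<partial>lborel) < \<infinity>" .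
  qed
  ultimately have "set_integrable lborel K W"
    unfolding W_def by (intro set_integrable_mult_right set_integral_add)
  moreover have "AE q in lborel. q \<in> K \<longrightarrow> (\<forall>n. \<bar>yy k q j (tseq n)\<bar> \<le> W q)"
    using AE_chain_int
  proof eventually_elim
    case (elim q)
    show ?case
    proof (intro impI allI)
      fix n assume "q \<in> K"
      then show "\<bar>yy k q j (tseq n)\<bar> \<le> W q" unfolding W_def
        using elim K(2) kj tseq(1,2)[of n] by (intro B(2) chain_yy) auto
    qed
  qed
  ultimately show ?thesis by blast
qed

lemma slice_smooth:
  assumes "\<tau> \<in> {0<..<T}" "smooth_on (full_reg T) f"
  shows "smooth_on UNIV (\<lambda>q. f (\<tau>, q))" "pdiff (1, 0, 0) (\<lambda>q. f (\<tau>, q)) q = d1 f (\<tau>, q)"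
    "pdiff (0, 1, 0) (\<lambda>q. f (\<tau>, q)) q = d2 f (\<tau>, q)" "pdiff (0, 0, 1) (\<lambda>q. f (\<tau>, q)) q = d3 f (\<tau>, q)"
proof -
  show "smooth_on UNIV (\<lambda>q. f (\<tau>, q))"
  proof (rule smooth_on_compose[OF _ assms(2)])
    have "bounded_linear (\<lambda>q::real \<times> real \<times> real. fst q)" "bounded_linear (\<lambda>q::real \<times> real \<times> real. fst (snd q))"
      "bounded_linear (\<lambda>q::real \<times> real \<times> real. snd (snd q))" by (intro bounded_linear_intros)+
    then show "smooth_on UNIV (\<lambda>q. (\<tau>, q) \<bullet> j)" if "j \<in> Basis" for j :: R4
      using that smooth_on_const[of UNIV \<tau>] smooth_on_const[of UNIV 0] smooth_on_linear[of UNIV]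
      by (auto simp: Basis_prod_def inner_prod_def)
  qed (use assms(1) in \<open>auto simp: full_reg_def\<close>)
  have x: "(\<tau>, q) \<in> full_reg T" using assms(1) by (cases q) (simp add: full_reg_def)
  have "((\<lambda>q. (\<tau>, q)) has_derivative (\<lambda>v. (0, v))) (at q)" by (auto intro!: derivative_eq_intros)
  from has_derivative_compose[OF this differentiable_has_derivative_pdiff[OF smooth_on_differentiable[OF assms(2) x]]]
  have "pdiff v (\<lambda>q. f (\<tau>, q)) q = pdiff (0, v) f (\<tau>, q)" for v by (rule pdiff_eqI)
  then show "pdiff (1, 0, 0) (\<lambda>q. f (\<tau>, q)) q = d1 f (\<tau>, q)"
    "pdiff (0, 1, 0) (\<lambda>q. f (\<tau>, q)) q = d2 f (\<tau>, q)" "pdiff (0, 0, 1) (\<lambda>q. f (\<tau>, q)) q = d3 f (\<tau>, q)" by auto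
qed

lemma yy_components:
  assumes "\<tau> \<in> {0<..<T}"
  shows "yy 0 q j \<tau> = F j (\<tau>, q)" "yy 1 q j \<tau> = d1 (F j) (\<tau>, q)" "yy 2 q j \<tau> = d2 (F j) (\<tau>, q)"
    "sin (fst (snd q)) * yy 3 q j \<tau> = d3 (F j) (\<tau>, q)"
proof -
  have x: "(\<tau>, q) \<in> full_reg T" using assms by (cases q) (simp add: full_reg_def)
  obtain G where "\<forall>x\<in>full_reg T. d3 (F j) x = sin (thv x) * G x" using pole_factor by blast
  then show "sin (fst (snd q)) * yy 3 q j \<tau> = d3 (F j) (\<tau>, q)" using x by (auto simp: yy_def cmp_def)
qed (auto simp: yy_def cmp_def)

lemma Basis_R3: "(1, 0, 0) \<in> (Basis :: (real \<times> real \<times> real) set)" "(0, 1, 0) \<in> (Basis :: (real \<times> real \<times> real) set)"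
    "(0, 0, 1) \<in> (Basis :: (real \<times> real \<times> real) set)"
  by (auto simp: Basis_prod_def zero_prod_def)

lemma slice_weak_pd:
  assumes t: "\<tau> \<in> {0<..<T}"
  shows "weak_pd (1, 0, 0) (\<lambda>q. yy 0 q j \<tau>) (\<lambda>q. yy 1 q j \<tau>)" "weak_pd (0, 1, 0) (\<lambda>q. yy 0 q j \<tau>) (\<lambda>q. yy 2 q j \<tau>)"
    "weak_pd (0, 0, 1) (\<lambda>q. yy 0 q j \<tau>) (\<lambda>q. sin (fst (snd q)) * yy 3 q j \<tau>)"
    "loc_int (\<lambda>q. yy 0 q j \<tau>)" "loc_int (\<lambda>q. yy 1 q j \<tau>)" "loc_int (\<lambda>q. yy 2 q j \<tau>)" "loc_int (\<lambda>q. sin (fst (snd q)) * yy 3 q j \<tau>)"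
proof -
  note s = slice_smooth(1)[OF t F_smooth[of j]]
  have e: "pdiff (1, 0, 0) (\<lambda>q. F j (\<tau>, q)) = (\<lambda>q. d1 (F j) (\<tau>, q))" "pdiff (0, 1, 0) (\<lambda>q. F j (\<tau>, q)) = (\<lambda>q. d2 (F j) (\<tau>, q))"
    "pdiff (0, 0, 1) (\<lambda>q. F j (\<tau>, q)) = (\<lambda>q. d3 (F j) (\<tau>, q))"
    by (intro ext slice_smooth[OF t F_smooth])+
  note c = continuous_loc_int[OF smooth_on_continuous[OF slice_smooth(1)[OF t]]]
  show "weak_pd (1, 0, 0) (\<lambda>q. yy 0 q j \<tau>) (\<lambda>q. yy 1 q j \<tau>)" "weak_pd (0, 1, 0) (\<lambda>q. yy 0 q j \<tau>) (\<lambda>q. yy 2 q j \<tau>)"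
    "weak_pd (0, 0, 1) (\<lambda>q. yy 0 q j \<tau>) (\<lambda>q. sin (fst (snd q)) * yy 3 q j \<tau>)"
    unfolding yy_components[OF t] using smooth_weak_pd[OF s Basis_R3(1)] smooth_weak_pd[OF s Basis_R3(2)] smooth_weak_pd[OF s Basis_R3(3)]
    by (simp_all only: e)
  show "loc_int (\<lambda>q. yy 0 q j \<tau>)" "loc_int (\<lambda>q. yy 1 q j \<tau>)" "loc_int (\<lambda>q. yy 2 q j \<tau>)" "loc_int (\<lambda>q. sin (fst (snd q)) * yy 3 q j \<tau>)"
    unfolding yy_components[OF t] by (intro c smooth_on_d F_smooth)+
qed

lemma slice_weak_grad:
  assumes "\<tau> \<in> {0<..<T}" "pull f = (\<lambda>q. F j (\<tau>, q))"
  shows "has_weak_grad f (grad_of (\<lambda>q. yy 1 q j \<tau>) (\<lambda>q. yy 2 q j \<tau>) (\<lambda>q. sin (fst (snd q)) * yy 3 q j \<tau>))"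
proof -
  have "pull f = (\<lambda>q. yy 0 q j \<tau>)" using assms by (simp add: yy_components)
  then show ?thesis
    using has_weak_grad_iff[of f "\<lambda>q. yy 1 q j \<tau>" "\<lambda>q. yy 2 q j \<tau>" "\<lambda>q. sin (fst (snd q)) * yy 3 q j \<tau>"]
      slice_weak_pd[OF assms(1)] by simp
qed

text \<open>Slices have classical gradients, and \<open>weak_pd_limit\<close> carries their
  integration by parts formulas to the limit. The third component is multiplied back by
  \<open>sin \<theta>\<close> because \<open>has_weak_grad\<close> refers to coordinate
  derivatives.\<close>

lemma limit_weak_grad:
  assumes j: "j \<le> 2" and f: "pull f = ll 0 j"
  shows "has_weak_grad f (grad_of (ll 1 j) (ll 2 j) (\<lambda>q. sin (fst (snd q)) * ll 3 j q))"
proof -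
  have m: "(\<lambda>q. yy k q j (tseq n)) \<in> borel_measurable lborel" for k n using yy_measurable[OF tseq_T] by simp
  have m3: "(\<lambda>q. sin (fst (snd q)) * yy 3 q j (tseq n)) \<in> borel_measurable lborel" for n using m[of 3 n] by simp
  have lm: "ll k j \<in> borel_measurable lborel" "(\<lambda>q. sin (fst (snd q)) * ll 3 j q) \<in> borel_measurable lborel" for k by simp_all
  have l: "AE q in lborel. q \<in> coord_dom \<longrightarrow> (\<lambda>n. yy k q j (tseq n)) \<longlonglongrightarrow> ll k j q" if "k \<le> 3" for k
    using AE_ll by eventually_elim (use that j in auto)
  have l3: "AE q in lborel. q \<in> coord_dom \<longrightarrow> (\<lambda>n. sin (fst (snd q)) * yy 3 q j (tseq n)) \<longlonglongrightarrow> sin (fst (snd q)) * ll 3 j q"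
    using l[OF order_refl] by eventually_elim (auto intro!: tendsto_mult_left)
  have d: "\<exists>W. set_integrable lborel K W \<and> (AE q in lborel. q \<in> K \<longrightarrow> (\<forall>n. \<bar>yy k q j (tseq n)\<bar> \<le> W q))"
    if "compact K" "K \<subseteq> coord_dom" "k \<le> 3" for K k using domination[OF that j] .
  have d3: "\<exists>W. set_integrable lborel K W \<and> (AE q in lborel. q \<in> K \<longrightarrow> (\<forall>n. \<bar>sin (fst (snd q)) * yy 3 q j (tseq n)\<bar> \<le> W q))"
    if K: "compact K" "K \<subseteq> coord_dom" for K
  proof -
    obtain W where W: "set_integrable lborel K W" "AE q in lborel. q \<in> K \<longrightarrow> (\<forall>n. \<bar>yy 3 q j (tseq n)\<bar> \<le> W q)"
      using d[OF K, of 3] by auto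
    have "\<bar>sin a * y\<bar> \<le> \<bar>y\<bar>" for a y :: real
      using mult_right_mono[OF abs_sin_le_one[of a], of "\<bar>y\<bar>"] by (simp add: abs_mult)
    then have "AE q in lborel. q \<in> K \<longrightarrow> (\<forall>n. \<bar>sin (fst (snd q)) * yy 3 q j (tseq n)\<bar> \<le> W q)"
      using W(2)
    proof eventually_elim
      case (elim q)
      then show ?case using \<open>\<And>a y :: real. \<bar>sin a * y\<bar> \<le> \<bar>y\<bar>\<close>[of "fst (snd q)"] order_trans by blast
    qed
    then show ?thesis using W(1) by blast
  qed
  note s = slice_weak_pd[OF tseq_T]
  have "loc_int (ll 0 j)" "loc_int (ll 1 j)" "loc_int (ll 2 j)"
    by (rule loc_int_limit[OF m lm(1) l d]; simp)+
  moreover have "loc_int (\<lambda>q. sin (fst (snd q)) * ll 3 j q)" by (rule loc_int_limit[OF m3 lm(2) l3 d3])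
  moreover have "weak_pd (1, 0, 0) (ll 0 j) (ll 1 j)"
    by (rule weak_pd_limit[OF m lm(1) m lm(1) l l d d s(1)]) (simp_all add: Basis_R3)
  moreover have "weak_pd (0, 1, 0) (ll 0 j) (ll 2 j)"
    by (rule weak_pd_limit[OF m lm(1) m lm(1) l l d d s(2)]) (simp_all add: Basis_R3)
  moreover have "weak_pd (0, 0, 1) (ll 0 j) (\<lambda>q. sin (fst (snd q)) * ll 3 j q)"
    by (rule weak_pd_limit[OF m lm(1) m3 lm(2) l l3 d d3 s(3)]) (simp_all add: Basis_R3)
  ultimately show ?thesis
    using has_weak_grad_iff[of f "ll 1 j" "ll 2 j" "\<lambda>q. sin (fst (snd q)) * ll 3 j q"] f by simp
qed

section \<open>Tightness in t\<close>

definition tail :: "real \<Rightarrow> real \<Rightarrow> ennreal" where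
  "tail \<tau> R = (\<integral>\<^sup>+q\<in>{t. R \<le> \<bar>t\<bar>} \<times> {0<..<pi} \<times> {0..2 * pi}. ennreal (sin (fst (snd q)) * N_dens 2 (\<tau>, q)) \<partial>lborel)"

lemma tail_sets [measurable]: "{t::real. R \<le> \<bar>t\<bar>} \<times> {0<..<pi} \<times> {0..2 * pi} \<in> sets borel"
proof -
  have "{t::real. R \<le> \<bar>t\<bar>} \<in> sets borel" by (intro borel_closed closed_Collect_le continuous_intros)
  then show ?thesis by (intro borel_Times) auto
qed

text \<open>Each of the two half-lines is exhausted by bounded intervals, to which
  \<open>energy_estimate\<close> applies with constants independent of the interval;
  \<open>M\<close> bounds the distance that energy can travel in t.\<close>

lemma tail_bound: "\<exists>C>0. \<exists>M>0. \<forall>\<tau>\<in>{0<..\<tau>0}. \<forall>R. tail \<tau> R \<le> ennreal C * tail \<tau>0 (R - M)"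
proof -
  obtain C M where CM: "C > 0" "M > 0" "\<And>\<tau> a b c. \<tau> \<in> {0<..\<tau>0} \<Longrightarrow> a \<le> b \<Longrightarrow> E_int 2 \<tau> a b c \<le> ennreal C * E_int 2 \<tau>0 (a - M) (b + M) c"
    using energy_estimate[of 1] by (auto simp: eval_nat_numeral)
  have "tail \<tau> R \<le> ennreal (2 * C) * tail \<tau>0 (R - M)" if \<tau>: "\<tau> \<in> {0<..\<tau>0}" for \<tau> R
  proof -
    \<comment> \<open>For negative \<open>R\<close> the tail is the whole slice, and the two
      half-lines start at 0.\<close>
    define r where "r = max R 0"
    define g where "g q = ennreal (sin (fst (snd q)) * N_dens 2 (\<tau>, q))" for q
    have [measurable]: "g \<in> borel_measurable borel" unfolding g_def[abs_def]
      using N_dens_measurable[of \<tau> 2] \<tau> tau0 by simp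
    define S where "S n = ({r..r + real n} \<union> {- r - real n..- r}) \<times> {0<..<pi} \<times> {0..2 * pi}" for n :: nat
    have Sm [measurable]: "S n \<in> sets borel" for n unfolding S_def by (intro borel_Times) auto
    have E1: "E_int 2 \<tau>0 a b 0 \<le> tail \<tau>0 (R - M)" if "\<And>t. a \<le> t \<Longrightarrow> t \<le> b \<Longrightarrow> R - M \<le> \<bar>t\<bar>" for a b
      unfolding E_int_def tail_def by (intro nn_integral_mono) (auto simp: indicator_def that)
    have bound: "(\<integral>\<^sup>+q\<in>S n. g q \<partial>lborel) \<le> ennreal (2 * C) * tail \<tau>0 (R - M)" for n
    proof -
      have "(\<integral>\<^sup>+q\<in>S n. g q \<partial>lborel) \<le> (\<integral>\<^sup>+q. g q * indicator ({r..r + real n} \<times> {0<..<pi} \<times> {0..0 + 2 * pi}) q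
          + g q * indicator ({- r - real n..- r} \<times> {0<..<pi} \<times> {0..0 + 2 * pi}) q \<partial>lborel)"
        by (intro nn_integral_mono) (auto simp: S_def indicator_def)
      also have "\<dots> = E_int 2 \<tau> r (r + real n) 0 + E_int 2 \<tau> (- r - real n) (- r) 0"
      proof -
        have [measurable]: "{a..b::real} \<times> {0<..<pi} \<times> {0..0 + 2 * pi} \<in> sets borel" for a b by (intro borel_Times) auto
        show ?thesis unfolding E_int_def g_def[symmetric] by (rule nn_integral_add) measurable
      qed
      also have "\<dots> \<le> ennreal C * tail \<tau>0 (R - M) + ennreal C * tail \<tau>0 (R - M)"
        using CM(2)
        by (intro add_mono order_trans[OF CM(3)[OF \<tau>]] mult_left_mono E1) (auto simp: r_def abs_if)
      also have "\<dots> = ennreal (2 * C) * tail \<tau>0 (R - M)"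
      proof -
        have "ennreal (2 * C) = ennreal C + ennreal C" using CM(1) ennreal_plus[of C C] by simp
        then show ?thesis by (simp only: distrib_right)
      qed
      finally show ?thesis .
    qed
    have "(\<lambda>n. \<integral>\<^sup>+q\<in>S n. g q \<partial>lborel) \<longlonglongrightarrow> tail \<tau> R"
      unfolding tail_def g_def[symmetric]
    proof (rule nn_integral_LIMSEQ)
      show "incseq (\<lambda>n q. g q * indicator (S n) q)"
        by (rule incseq_SucI, rule le_funI) (auto simp: S_def indicator_def)
      show "(\<lambda>n. g q * indicator (S n) q) \<longlonglongrightarrow> g q * indicator ({t. R \<le> \<bar>t\<bar>} \<times> {0<..<pi} \<times> {0..2 * pi}) q" for q
      proof (rule tendsto_eventually)
        obtain n0 where n0: "\<bar>fst q\<bar> \<le> real n0" using real_arch_simple by blast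
        have "q \<in> S n \<longleftrightarrow> q \<in> {t. R \<le> \<bar>t\<bar>} \<times> {0<..<pi} \<times> {0..2 * pi}" if "n \<ge> n0" for n
        proof -
          have "\<bar>fst q\<bar> \<le> real n" using n0 that by linarith
          then have "fst q \<in> {r..r + real n} \<union> {- r - real n..- r} \<longleftrightarrow> R \<le> \<bar>fst q\<bar>"
            unfolding r_def by auto
          then show ?thesis unfolding S_def by (cases q) auto
        qed
        then show "\<forall>\<^sub>F n in sequentially. g q * indicator (S n) q = g q * indicator ({t. R \<le> \<bar>t\<bar>} \<times> {0<..<pi} \<times> {0..2 * pi}) q"
          by (intro eventually_sequentiallyI[of n0]) (simp add: indicator_def)
      qed
    qed simp
    then show ?thesis using bound by (intro LIMSEQ_le_const2) auto
  qed
  then show ?thesis using CM(1,2) by (intro exI[of _ "2 * C"] conjI exI[of _ M]) auto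
qed

lemma tail_total: "tail \<tau>0 R < \<infinity>"
proof -
  have "tail \<tau>0 R \<le> (\<integral>\<^sup>+q\<in>UNIV \<times> {0<..<pi} \<times> {0..2 * pi}. ennreal (sin (fst (snd q)) * N_dens 2 (\<tau>0, q)) \<partial>lborel)"
    unfolding tail_def by (intro nn_integral_mono) (auto simp: indicator_def)
  then show ?thesis using fin_energy by (rule order_le_less_trans)
qed

lemma tail_small: "e > 0 \<Longrightarrow> \<exists>R. tail \<tau>0 R \<le> ennreal e"
proof -
  assume e: "e > 0"
  define g where "g q = ennreal (sin (fst (snd q)) * N_dens 2 (\<tau>0, q))" for q
  have [measurable]: "g \<in> borel_measurable borel" unfolding g_def[abs_def]
    using N_dens_measurable[of \<tau>0 2] tau0 by simp
  have [measurable]: "UNIV \<times> {0<..<pi} \<times> {0..2 * pi} \<in> sets (borel :: (real \<times> real \<times> real) measure)" by (intro borel_Times) auto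
  define f where "f n q = g q * indicator ({t. real n \<le> \<bar>t\<bar>} \<times> {0<..<pi} \<times> {0..2 * pi}) q" for n q
  define w where "w q = g q * indicator (UNIV \<times> {0<..<pi} \<times> {0..2 * pi}) q" for q
  have "(\<lambda>n. \<integral>\<^sup>+q. f n q \<partial>lborel) \<longlonglongrightarrow> (\<integral>\<^sup>+q. 0 \<partial>(lborel :: (real \<times> real \<times> real) measure))"
  proof (rule nn_integral_dominated_convergence[where u = f and w = w])
    show "f n \<in> borel_measurable lborel" for n unfolding f_def[abs_def] by simp
    show "w \<in> borel_measurable lborel" unfolding w_def[abs_def] by simp
    show "(\<integral>\<^sup>+q. w q \<partial>lborel) < \<infinity>" using fin_energy by (simp add: g_def w_def)
    show "AE q in lborel. (\<lambda>n. f n q) \<longlonglongrightarrow> 0"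
    proof (rule always_eventually, rule allI, rule tendsto_eventually)
      fix q :: "real \<times> real \<times> real"
      obtain n0 where n0: "\<bar>fst q\<bar> < real n0" using reals_Archimedean2 by blast
      show "\<forall>\<^sub>F n in sequentially. f n q = 0"
        using n0 by (intro eventually_sequentiallyI[of n0]) (auto simp: f_def indicator_def)
    qed
    show "AE q in lborel. f n q \<le> w q" for n by (intro always_eventually allI) (auto simp: f_def w_def indicator_def)
  qed simp
  moreover have "(\<integral>\<^sup>+q. f n q \<partial>lborel) = tail \<tau>0 (real n)" for n by (simp add: tail_def f_def g_def)
  ultimately have "(\<lambda>n. tail \<tau>0 (real n)) \<longlonglongrightarrow> (\<integral>\<^sup>+q. 0 \<partial>(lborel :: (real \<times> real \<times> real) measure))" by simp
  then have "(\<lambda>n. tail \<tau>0 (real n)) \<longlonglongrightarrow> 0" by simp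
  then have "\<forall>\<^sub>F n in sequentially. tail \<tau>0 (real n) < ennreal e" using e by (intro order_tendstoD) auto
  then obtain n :: nat where "tail \<tau>0 (real n) < ennreal e" by (auto simp: eventually_sequentially)
  then show ?thesis by (intro exI[of _ "real n"]) simp
qed

definition sph_tail :: "real \<Rightarrow> (real \<times> real \<times> real) set" where
  "sph_tail R = {t. R \<le> \<bar>t\<bar>} \<times> {0<..<pi} \<times> {0<..<2 * pi}"

lemma sph_tail_sets [measurable]: "sph_tail R \<in> sets borel"
proof -
  have "{t::real. R \<le> \<bar>t\<bar>} \<in> sets borel" by (intro borel_closed closed_Collect_le continuous_intros)
  then show ?thesis unfolding sph_tail_def by (intro borel_Times) auto
qed

lemma sph_tail_dom: "sph_tail 0 = sph_dom" "sph_tail R \<subseteq> sph_dom"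
  by (auto simp: sph_tail_def sph_dom_def)

lemma yy_tail:
  assumes "\<tau> \<in> {0<..\<tau>0}" "1 \<le> k" "j \<le> 2"
  shows "(\<integral>\<^sup>+q\<in>sph_tail R. ennreal (sin (fst (snd q)) * (yy k q j \<tau>)\<^sup>2) \<partial>lborel) \<le> tail \<tau> R"
  unfolding tail_def
proof (rule nn_integral_mono)
  fix q :: "real \<times> real \<times> real"
  show "ennreal (sin (fst (snd q)) * (yy k q j \<tau>)\<^sup>2) * indicator (sph_tail R) q
      \<le> ennreal (sin (fst (snd q)) * N_dens 2 (\<tau>, q)) * indicator ({t. R \<le> \<bar>t\<bar>} \<times> {0<..<pi} \<times> {0..2 * pi}) q"
  proof (cases "q \<in> sph_tail R")
    case True
    then have q: "q \<in> {t. R \<le> \<bar>t\<bar>} \<times> {0<..<pi} \<times> {0..2 * pi}" "0 \<le> sin (fst (snd q))"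
      by (auto simp: sph_tail_def intro: sin_ge_zero)
    have "(yy k q j \<tau>)\<^sup>2 \<le> N_dens 2 (\<tau>, q)" using assms tau0 by (intro yy_le_N) auto
    then show ?thesis using q True by (simp add: ennreal_leI mult_left_mono)
  qed simp
qed

text \<open>Fatou's lemma along \<open>tseq\<close>: the limit component is an almost everywhere
  limit of slices that obey the same tail bound.\<close>

lemma ll_tail:
  assumes CM: "C > 0" "\<And>\<tau> R. \<tau> \<in> {0<..\<tau>0} \<Longrightarrow> tail \<tau> R \<le> ennreal C * tail \<tau>0 (R - M)"
    and k: "1 \<le> k" "k \<le> 3" and j: "j \<le> 2"
  shows "(\<integral>\<^sup>+q\<in>sph_tail R. ennreal (sin (fst (snd q)) * (ll k j q)\<^sup>2) \<partial>lborel) \<le> ennreal C * tail \<tau>0 (R - M)"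
proof -
  define u where "u n q = ennreal (sin (fst (snd q)) * (yy k q j (tseq n))\<^sup>2) * indicator (sph_tail R) q" for n q
  have um: "u n \<in> borel_measurable lborel" for n
    unfolding u_def[abs_def] using yy_measurable[OF tseq_T, of k j n] by simp
  have "(\<integral>\<^sup>+q\<in>sph_tail R. ennreal (sin (fst (snd q)) * (ll k j q)\<^sup>2) \<partial>lborel) = (\<integral>\<^sup>+q. liminf (\<lambda>n. u n q) \<partial>lborel)"
  proof (rule nn_integral_cong_AE)
    show "AE q in lborel. ennreal (sin (fst (snd q)) * (ll k j q)\<^sup>2) * indicator (sph_tail R) q = liminf (\<lambda>n. u n q)"
      using AE_ll
    proof eventually_elim
      case (elim q)
      show ?case
      proof (cases "q \<in> sph_tail R")
        case True
        then have "(\<lambda>n. yy k q j (tseq n)) \<longlonglongrightarrow> ll k j q" using elim k j sph_tail_dom sph_dom_coord_dom by blast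
        then have "(\<lambda>n. u n q) \<longlonglongrightarrow> ennreal (sin (fst (snd q)) * (ll k j q)\<^sup>2)"
          unfolding u_def using True by (auto intro!: tendsto_intros)
        from lim_imp_Liminf[OF sequentially_bot this] show ?thesis using True by simp
      next
        case False
        then have "(\<lambda>n. u n q) = (\<lambda>_. 0)" by (simp add: u_def fun_eq_iff)
        then show ?thesis using False by (simp add: Liminf_const)
      qed
    qed
  qed
  also have "\<dots> \<le> liminf (\<lambda>n. \<integral>\<^sup>+q. u n q \<partial>lborel)" by (rule nn_integral_liminf[OF um])
  also have "\<dots> \<le> liminf (\<lambda>n. ennreal C * tail \<tau>0 (R - M))"
  proof (rule Liminf_mono, intro always_eventually allI)
    fix n
    have "tseq n \<in> {0<..\<tau>0}" using tseq(1,2)[of n] by simp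
    then show "(\<integral>\<^sup>+q. u n q \<partial>lborel) \<le> ennreal C * tail \<tau>0 (R - M)"
      unfolding u_def using yy_tail[of "tseq n" k j R] CM(2)[of "tseq n" R] k j by (auto intro: order_trans)
  qed
  also have "\<dots> = ennreal C * tail \<tau>0 (R - M)" by (simp add: Liminf_const)
  finally show ?thesis .
qed

end

section \<open>Convergence of level 2 and the cubic remainder in the mean\<close>

context spherical_wave_hierarchy begin

text \<open>The slice is split at \<open>\<bar>t\<bar> = R1\<close>. Inside,
  \<open>chain_top_estimate\<close> and \<open>local_bound\<close> give smallness as \<sigma> tends
  to 0; outside, slice and limit are separately small. No rate results, since the constant
  \<open>A\<close> of the inner region depends on \<open>R1\<close>.\<close>

lemma top_component_converges:
  assumes k: "1 \<le> k" "k \<le> 3" and e: "e > 0"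
  shows "\<exists>\<delta>>0. \<forall>\<sigma>. 0 < \<sigma> \<and> \<sigma> < \<delta> \<and> \<sigma> \<le> \<tau>0 \<longrightarrow>
    (\<integral>\<^sup>+q\<in>sph_dom. ennreal (sin (fst (snd q)) * (yy k q 2 \<sigma> - ll k 2 q)\<^sup>2) \<partial>lborel) \<le> ennreal e"
proof -
  obtain C M where CM: "C > 0" "M > 0" "\<And>\<tau> R. \<tau> \<in> {0<..\<tau>0} \<Longrightarrow> tail \<tau> R \<le> ennreal C * tail \<tau>0 (R - M)"
    using tail_bound by blast
  \<comment> \<open>Slice and limit each contribute twice \<open>e / 8\<close> from the tail; the
    other half of \<open>e\<close> is left for the inner region.\<close>
  obtain R where R: "tail \<tau>0 R \<le> ennreal (e / (8 * C))" using tail_small[of "e / (8 * C)"] e CM(1) by auto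
  define R1 where "R1 = R + M"
  obtain A where A: "0 \<le> A" "\<And>\<tau> k. \<tau> \<in> {0<..\<tau>0} \<Longrightarrow> (\<integral>\<^sup>+p\<in>{- R1..R1} \<times> {0<..<pi} \<times> {0..0 + 2 * pi}.
      ennreal (sin (fst (snd p))) * chain_int (yy k p) \<tau> \<partial>lborel) \<le> ennreal (\<tau> * A)"
    using local_bound[of "- R1" R1 0] by blast
  \<comment> \<open>The inner region contributes \<open>\<sigma> * \<sigma> * A\<close>: one factor
    \<sigma> is estimated by 1, the other by the second term of the minimum.\<close>
  define \<delta> where "\<delta> = min 1 (e / (2 * (A + 1)))"
  have \<delta>: "\<delta> > 0" using e A(1) by (simp add: \<delta>_def)
  have main: "(\<integral>\<^sup>+q\<in>sph_dom. ennreal (sin (fst (snd q)) * (yy k q 2 \<sigma> - ll k 2 q)\<^sup>2) \<partial>lborel) \<le> ennreal e"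
    if s: "0 < \<sigma>" "\<sigma> < \<delta>" "\<sigma> \<le> \<tau>0" for \<sigma>
  proof -
    have sT: "\<sigma> \<in> {0<..\<tau>0}" "\<sigma> \<in> {0<..<T}" using s tau0 by auto
    let ?B = "{- R1..R1} \<times> {0<..<pi} \<times> {0..0 + 2 * pi}"
    have [measurable]: "?B \<in> sets borel" by (intro borel_Times) auto
    have [measurable]: "(\<lambda>q. yy k q 2 \<sigma>) \<in> borel_measurable borel" "(\<lambda>q. chain_int (yy k q) \<sigma>) \<in> borel_measurable borel"
      using yy_measurable[OF sT(2)] chain_int_measurable[OF s(3)] by auto
    define f1 where "f1 q = ennreal (sin (fst (snd q))) * chain_int (yy k q) \<sigma> * indicator ?B q" for q
    define f2 where "f2 q = ennreal (sin (fst (snd q)) * (yy k q 2 \<sigma>)\<^sup>2) * indicator (sph_tail R1) q" for q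
    define f3 where "f3 q = ennreal (sin (fst (snd q)) * (ll k 2 q)\<^sup>2) * indicator (sph_tail R1) q" for q
    have [measurable]: "f1 \<in> borel_measurable borel" "f2 \<in> borel_measurable borel" "f3 \<in> borel_measurable borel"
      unfolding f1_def[abs_def] f2_def[abs_def] f3_def[abs_def] by measurable
    have "(\<integral>\<^sup>+q\<in>sph_dom. ennreal (sin (fst (snd q)) * (yy k q 2 \<sigma> - ll k 2 q)\<^sup>2) \<partial>lborel)
        \<le> (\<integral>\<^sup>+q. ennreal \<sigma> * f1 q + (2 * f2 q + 2 * f3 q) \<partial>lborel)"
    proof (rule nn_integral_mono_AE)
      show "AE q in lborel. ennreal (sin (fst (snd q)) * (yy k q 2 \<sigma> - ll k 2 q)\<^sup>2) * indicator sph_dom q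
          \<le> ennreal \<sigma> * f1 q + (2 * f2 q + 2 * f3 q)"
        using AE_chain_int
      proof eventually_elim
        case (elim q)
        show ?case
        proof (cases "q \<in> sph_dom")
          case True
          have sn: "0 < sin (fst (snd q))" by (rule sph_dom_sin[OF True])
          have fin: "chain_int (yy k q) \<tau>0 < \<infinity>" using elim True k sph_dom_coord_dom by blast
          show ?thesis
          proof (cases "R1 \<le> \<bar>fst q\<bar>")
            case far: True
            then have qt: "q \<in> sph_tail R1" using True by (auto simp: sph_tail_def sph_dom_def)
            have "(y - l)\<^sup>2 \<le> 2 * y\<^sup>2 + 2 * l\<^sup>2" for y l :: real
              using zero_le_power2[of "y + l"] by (simp add: power2_eq_square algebra_simps)
            from mult_left_mono[OF this less_imp_le[OF sn], of "yy k q 2 \<sigma>" "ll k 2 q"]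
            have "sin (fst (snd q)) * (yy k q 2 \<sigma> - ll k 2 q)\<^sup>2 \<le> 2 * (sin (fst (snd q)) * (yy k q 2 \<sigma>)\<^sup>2) + 2 * (sin (fst (snd q)) * (ll k 2 q)\<^sup>2)"
              by (simp only: distrib_left mult.left_commute[of _ 2])
            then have "ennreal (sin (fst (snd q)) * (yy k q 2 \<sigma> - ll k 2 q)\<^sup>2) \<le> ennreal (2 * (sin (fst (snd q)) * (yy k q 2 \<sigma>)\<^sup>2) + 2 * (sin (fst (snd q)) * (ll k 2 q)\<^sup>2))"
              by (rule ennreal_leI)
            also have "\<dots> = 2 * f2 q + 2 * f3 q"
              using qt sn by (subst ennreal_plus) (auto simp: f2_def f3_def ennreal_mult')
            finally show ?thesis using True by (simp add: add_increasing)
          next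
            case False
            then have qB: "q \<in> ?B" using True by (auto simp: sph_dom_def)
            have "ennreal (sin (fst (snd q)) * (yy k q 2 \<sigma> - ll k 2 q)\<^sup>2) = ennreal (sin (fst (snd q))) * ennreal ((yy k q 2 \<sigma> - ll k 2 q)\<^sup>2)"
              using sn by (intro ennreal_mult') simp
            also have "\<dots> \<le> ennreal (sin (fst (snd q))) * (ennreal \<sigma> * chain_int (yy k q) \<sigma>)"
              unfolding ll_def by (intro mult_left_mono chain_top_estimate chain_yy fin sT) simp
            also have "\<dots> = ennreal \<sigma> * f1 q" using qB by (simp add: f1_def mult_ac)
            finally show ?thesis using True by (simp add: add_increasing2)
          qed
        qed simp
      qed
    qed
    also have "\<dots> = ennreal \<sigma> * (\<integral>\<^sup>+q. f1 q \<partial>lborel) + (2 * (\<integral>\<^sup>+q. f2 q \<partial>lborel) + 2 * (\<integral>\<^sup>+q. f3 q \<partial>lborel))"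
      by (simp add: nn_integral_add nn_integral_cmult)
    also have "\<dots> \<le> ennreal \<sigma> * ennreal (\<sigma> * A) + (2 * (ennreal C * tail \<tau>0 (R1 - M)) + 2 * (ennreal C * tail \<tau>0 (R1 - M)))"
    proof (intro add_mono mult_left_mono)
      show "(\<integral>\<^sup>+q. f1 q \<partial>lborel) \<le> ennreal (\<sigma> * A)" unfolding f1_def by (rule A(2)[OF sT(1)])
      show "(\<integral>\<^sup>+q. f2 q \<partial>lborel) \<le> ennreal C * tail \<tau>0 (R1 - M)"
        unfolding f2_def by (rule order_trans[OF yy_tail[OF sT(1) k(1)] CM(3)[OF sT(1)]]) simp
      show "(\<integral>\<^sup>+q. f3 q \<partial>lborel) \<le> ennreal C * tail \<tau>0 (R1 - M)"
        unfolding f3_def by (rule ll_tail[OF CM(1,3) k]) simp_all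
    qed simp_all
    also have "\<dots> \<le> ennreal (e / 2) + (2 * ennreal (e / 8) + 2 * ennreal (e / 8))"
    proof (intro add_mono mult_left_mono)
      have "\<sigma> * (\<sigma> * A) \<le> 1 * (\<sigma> * (A + 1))" using s A(1) by (intro mult_mono) (auto simp: \<delta>_def)
      also have "\<dots> \<le> e / 2"
      proof -
        have "\<sigma> < e / (2 * (A + 1))" using s by (simp add: \<delta>_def)
        then show ?thesis using A(1) by (simp add: field_simps)
      qed
      finally show "ennreal \<sigma> * ennreal (\<sigma> * A) \<le> ennreal (e / 2)"
        using s by (simp add: ennreal_mult'[symmetric] ennreal_leI)
      have "ennreal C * tail \<tau>0 (R1 - M) \<le> ennreal C * ennreal (e / (8 * C))" using R by (intro mult_left_mono) (simp_all add: R1_def)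
      also have "\<dots> = ennreal (e / 8)" using CM(1) by (simp add: ennreal_mult'[symmetric])
      finally have *: "ennreal C * tail \<tau>0 (R1 - M) \<le> ennreal (e / 8)" .
      show "ennreal C * tail \<tau>0 (R1 - M) \<le> ennreal (e / 8)" by (rule *)
      show "ennreal C * tail \<tau>0 (R1 - M) \<le> ennreal (e / 8)" by (rule *)
    qed simp_all
    also have "\<dots> = ennreal e"
    proof -
      have "2 * ennreal (e / 8) = ennreal (e / 4)" using ennreal_mult'[of 2 "e / 8"] by simp
      then show ?thesis using e by (simp flip: ennreal_plus)
    qed
    finally show ?thesis .
  qed
  then show ?thesis using \<delta> by blast
qed

text \<open>Integrate \<open>chain_taylor\<close> over the slice and exchange integrals. For each
  \<sigma> the oscillation of level 2 is small by \<open>top_component_converges\<close> and the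
  other terms carry \<open>\<sigma>\<^sup>2\<close>; integration over \<sigma> up to \<tau> raises
  \<open>\<tau> ^ 5\<close> to \<open>\<tau> ^ 6\<close>.\<close>

lemma cubic_remainder:
  assumes k: "1 \<le> k" "k \<le> 3" and e: "e > 0"
  shows "\<exists>\<delta>>0. \<forall>\<tau>. 0 < \<tau> \<and> \<tau> < \<delta> \<longrightarrow> (\<integral>\<^sup>+q\<in>sph_dom. ennreal (sin (fst (snd q)) *
    (yy k q 0 \<tau> - ll k 0 q - \<tau>\<^sup>2 * (ll k 1 q / (2 * L)) - \<tau> ^ 3 * (ll k 2 q / (3 * L)))\<^sup>2) \<partial>lborel) \<le> ennreal (e * \<tau> ^ 6)"
proof -
  obtain C1 where C1: "C1 > 0" "\<And>y \<tau>. chain y \<Longrightarrow> chain_int y \<tau>0 < \<infinity> \<Longrightarrow> \<tau> \<in> {0<..\<tau>0} \<Longrightarrow>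
    ennreal ((y 0 \<tau> - clim y 0 - \<tau>\<^sup>2 * (clim y 1 / (2 * L)) - \<tau> ^ 3 * (clim y 2 / (3 * L)))\<^sup>2)
    \<le> ennreal (C1 * \<tau> ^ 5) * (\<integral>\<^sup>+\<sigma>\<in>{0<..\<tau>}. ennreal ((y 2 \<sigma> - clim y 2)\<^sup>2 + \<sigma>\<^sup>2 * ((clim y 2)\<^sup>2 + (y 1 \<sigma>)\<^sup>2)) \<partial>lborel)"
    using chain_taylor by blast
  obtain C M where CM: "C > 0" "M > 0" "\<And>\<tau> R. \<tau> \<in> {0<..\<tau>0} \<Longrightarrow> tail \<tau> R \<le> ennreal C * tail \<tau>0 (R - M)"
    using tail_bound by blast
  define A where "A = enn2real (ennreal C * tail \<tau>0 (0 - M))"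
  have A: "ennreal A = ennreal C * tail \<tau>0 (0 - M)" "0 \<le> A"
    using tail_total[of "0 - M"] by (auto simp: A_def ennreal_mult_less_top)
  \<comment> \<open>The integral over the slice will be at most \<open>2 * e1\<close> for each
    \<sigma>, and the Taylor estimate multiplies by \<open>C1\<close>.\<close>
  define e1 where "e1 = e / (2 * C1)"
  have e1: "e1 > 0" using e C1(1) by (simp add: e1_def)
  obtain \<delta>1 where \<delta>1: "\<delta>1 > 0" "\<And>\<sigma>. 0 < \<sigma> \<Longrightarrow> \<sigma> < \<delta>1 \<Longrightarrow> \<sigma> \<le> \<tau>0 \<Longrightarrow>
    (\<integral>\<^sup>+q\<in>sph_dom. ennreal (sin (fst (snd q)) * (yy k q 2 \<sigma> - ll k 2 q)\<^sup>2) \<partial>lborel) \<le> ennreal e1"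
    using top_component_converges[OF k e1] by blast
  define \<delta> where "\<delta> = min (min \<delta>1 \<tau>0) (min 1 (e1 / (2 * (A + 1))))"
  have \<delta>: "\<delta> > 0" using \<delta>1 tau0 e1 A(2) by (simp add: \<delta>_def)
  have main: "(\<integral>\<^sup>+q\<in>sph_dom. ennreal (sin (fst (snd q)) *
    (yy k q 0 \<tau> - ll k 0 q - \<tau>\<^sup>2 * (ll k 1 q / (2 * L)) - \<tau> ^ 3 * (ll k 2 q / (3 * L)))\<^sup>2) \<partial>lborel) \<le> ennreal (e * \<tau> ^ 6)"
    if t: "0 < \<tau>" "\<tau> < \<delta>" for \<tau>
  proof -
    have tT: "\<tau> \<in> {0<..\<tau>0}" using t by (auto simp: \<delta>_def)
    define \<kappa> where "\<kappa> q \<sigma> = (indicator {0<..<T} \<sigma> * yy k q 2 \<sigma> - ll k 2 q)\<^sup>2 + \<sigma>\<^sup>2 * ((ll k 2 q)\<^sup>2 + (indicator {0<..<T} \<sigma> * yy k q 1 \<sigma>)\<^sup>2)" for q and \<sigma> :: real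
    have ind: "indicator {0<..<T} \<sigma> = (1::real)" if "\<sigma> \<in> {0<..\<tau>}" for \<sigma> using that tT tau0 by auto
    note [measurable] = yy_joint_measurable[of k 2] yy_joint_measurable[of k 1]
    have km: "(\<lambda>(q, \<sigma>). ennreal (\<kappa> q \<sigma>) * indicator {0<..\<tau>} \<sigma>) \<in> borel_measurable (lborel \<Otimes>\<^sub>M lborel)"
      unfolding \<kappa>_def by measurable
    define g where "g = (\<lambda>(q, \<sigma>). ennreal (sin (fst (snd q))) * indicator sph_dom q * (ennreal (\<kappa> q \<sigma>) * indicator {0<..\<tau>} \<sigma>))"
    have gm: "g \<in> borel_measurable (lborel \<Otimes>\<^sub>M lborel)" unfolding g_def using km by measurable
    have km1: "(\<lambda>\<sigma>. ennreal (\<kappa> q \<sigma>) * indicator {0<..\<tau>} \<sigma>) \<in> borel_measurable lborel" for q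
      using measurable_compose[OF measurable_Pair1' km, of q] by simp
    have gi: "(\<integral>\<^sup>+\<sigma>. g (q, \<sigma>) \<partial>lborel) = ennreal (sin (fst (snd q))) * indicator sph_dom q * (\<integral>\<^sup>+\<sigma>\<in>{0<..\<tau>}. ennreal (\<kappa> q \<sigma>) \<partial>lborel)" for q
      unfolding g_def split by (rule nn_integral_cmult[OF km1])
    have gm2: "(\<lambda>q. \<integral>\<^sup>+\<sigma>. g (q, \<sigma>) \<partial>lborel) \<in> borel_measurable lborel"
      using lborel.borel_measurable_nn_integral[of "\<lambda>q \<sigma>. g (q, \<sigma>)" lborel] gm by simp
    have "(\<integral>\<^sup>+q\<in>sph_dom. ennreal (sin (fst (snd q)) *
       (yy k q 0 \<tau> - ll k 0 q - \<tau>\<^sup>2 * (ll k 1 q / (2 * L)) - \<tau> ^ 3 * (ll k 2 q / (3 * L)))\<^sup>2) \<partial>lborel)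
      \<le> (\<integral>\<^sup>+q. ennreal (C1 * \<tau> ^ 5) * (\<integral>\<^sup>+\<sigma>. g (q, \<sigma>) \<partial>lborel) \<partial>lborel)"
    proof (rule nn_integral_mono_AE)
      show "AE q in lborel. ennreal (sin (fst (snd q)) *
       (yy k q 0 \<tau> - ll k 0 q - \<tau>\<^sup>2 * (ll k 1 q / (2 * L)) - \<tau> ^ 3 * (ll k 2 q / (3 * L)))\<^sup>2) * indicator sph_dom q
       \<le> ennreal (C1 * \<tau> ^ 5) * (\<integral>\<^sup>+\<sigma>. g (q, \<sigma>) \<partial>lborel)"
        using AE_chain_int
      proof eventually_elim
        case (elim q)
        show ?case
        proof (cases "q \<in> sph_dom")
          case True
          have sn: "0 < sin (fst (snd q))" by (rule sph_dom_sin[OF True])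
          have fin: "chain_int (yy k q) \<tau>0 < \<infinity>" using elim True k sph_dom_coord_dom by blast
          have eqk: "(\<integral>\<^sup>+\<sigma>\<in>{0<..\<tau>}. ennreal ((yy k q 2 \<sigma> - clim (yy k q) 2)\<^sup>2 + \<sigma>\<^sup>2 * ((clim (yy k q) 2)\<^sup>2 + (yy k q 1 \<sigma>)\<^sup>2)) \<partial>lborel)
              = (\<integral>\<^sup>+\<sigma>\<in>{0<..\<tau>}. ennreal (\<kappa> q \<sigma>) \<partial>lborel)"
            unfolding \<kappa>_def ll_def using ind by (intro nn_integral_cong) (auto simp: indicator_def)
          let ?X = "yy k q 0 \<tau> - ll k 0 q - \<tau>\<^sup>2 * (ll k 1 q / (2 * L)) - \<tau> ^ 3 * (ll k 2 q / (3 * L))"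
          have "ennreal (?X\<^sup>2) \<le> ennreal (C1 * \<tau> ^ 5) * (\<integral>\<^sup>+\<sigma>\<in>{0<..\<tau>}. ennreal (\<kappa> q \<sigma>) \<partial>lborel)"
            using C1(2)[OF chain_yy fin tT] unfolding eqk unfolding ll_def .
          from mult_left_mono[OF this, of "ennreal (sin (fst (snd q)))"]
          have "ennreal (sin (fst (snd q)) * ?X\<^sup>2) \<le> ennreal (C1 * \<tau> ^ 5) * (ennreal (sin (fst (snd q))) * (\<integral>\<^sup>+\<sigma>\<in>{0<..\<tau>}. ennreal (\<kappa> q \<sigma>) \<partial>lborel))"
            using sn ennreal_mult'[of "sin (fst (snd q))" "?X\<^sup>2"] by (simp add: mult.left_commute)
          then show ?thesis unfolding gi using True by simp
        qed simp
      qed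
    qed
    also have "\<dots> = ennreal (C1 * \<tau> ^ 5) * (\<integral>\<^sup>+q. \<integral>\<^sup>+\<sigma>. g (q, \<sigma>) \<partial>lborel \<partial>lborel)" by (rule nn_integral_cmult[OF gm2])
    also have "(\<integral>\<^sup>+q. \<integral>\<^sup>+\<sigma>. g (q, \<sigma>) \<partial>lborel \<partial>lborel) = (\<integral>\<^sup>+\<sigma>. \<integral>\<^sup>+q. g (q, \<sigma>) \<partial>lborel \<partial>lborel)"
      by (rule lborel_pair.Fubini'[symmetric]) (use gm in simp)
    also have "\<dots> \<le> (\<integral>\<^sup>+\<sigma>. ennreal (2 * e1) * indicator {0<..\<tau>} \<sigma> \<partial>lborel)"
    proof (rule nn_integral_mono)
      fix \<sigma>
      show "(\<integral>\<^sup>+q. g (q, \<sigma>) \<partial>lborel) \<le> ennreal (2 * e1) * indicator {0<..\<tau>} \<sigma>"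
      proof (cases "\<sigma> \<in> {0<..\<tau>}")
        case s: True
        have sT: "\<sigma> \<in> {0<..\<tau>0}" "\<sigma> \<in> {0<..<T}" using s tT tau0 by auto
        have sd: "0 < \<sigma>" "\<sigma> < \<delta>1" "\<sigma> \<le> \<tau>0" "\<sigma> < 1" "\<sigma> < e1 / (2 * (A + 1))" using s t by (auto simp: \<delta>_def)
        have [measurable]: "(\<lambda>q. yy k q j \<sigma>) \<in> borel_measurable borel" for j using yy_measurable[OF sT(2)] .
        define f1 where "f1 q = ennreal (sin (fst (snd q)) * (yy k q 2 \<sigma> - ll k 2 q)\<^sup>2) * indicator sph_dom q" for q
        define f2 where "f2 q = ennreal (sin (fst (snd q)) * (ll k 2 q)\<^sup>2) * indicator (sph_tail 0) q" for q
        define f3 where "f3 q = ennreal (sin (fst (snd q)) * (yy k q 1 \<sigma>)\<^sup>2) * indicator (sph_tail 0) q" for q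
        have [measurable]: "f1 \<in> borel_measurable borel" "f2 \<in> borel_measurable borel" "f3 \<in> borel_measurable borel"
          unfolding f1_def[abs_def] f2_def[abs_def] f3_def[abs_def] by measurable
        have "(\<integral>\<^sup>+q. g (q, \<sigma>) \<partial>lborel) \<le> (\<integral>\<^sup>+q. f1 q + ennreal (\<sigma>\<^sup>2) * (f2 q + f3 q) \<partial>lborel)"
        proof (rule nn_integral_mono)
          fix q
          show "g (q, \<sigma>) \<le> f1 q + ennreal (\<sigma>\<^sup>2) * (f2 q + f3 q)"
          proof (cases "q \<in> sph_dom")
            case True
            have sn: "0 < sin (fst (snd q))" by (rule sph_dom_sin[OF True])
            have "g (q, \<sigma>) = ennreal (sin (fst (snd q)) * \<kappa> q \<sigma>)"
              using True s sn by (simp add: g_def ennreal_mult')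
            also have "sin (fst (snd q)) * \<kappa> q \<sigma> = sin (fst (snd q)) * (yy k q 2 \<sigma> - ll k 2 q)\<^sup>2
                + \<sigma>\<^sup>2 * (sin (fst (snd q)) * (ll k 2 q)\<^sup>2 + sin (fst (snd q)) * (yy k q 1 \<sigma>)\<^sup>2)"
              using ind[OF s] by (simp add: \<kappa>_def algebra_simps)
            also have "ennreal \<dots> = f1 q + ennreal (\<sigma>\<^sup>2) * (f2 q + f3 q)"
              using True sn by (simp add: f1_def f2_def f3_def sph_tail_dom ennreal_plus ennreal_mult'' ennreal_mult')
            finally show ?thesis by simp
          qed (simp add: g_def)
        qed
        also have "\<dots> = (\<integral>\<^sup>+q. f1 q \<partial>lborel) + ennreal (\<sigma>\<^sup>2) * ((\<integral>\<^sup>+q. f2 q \<partial>lborel) + (\<integral>\<^sup>+q. f3 q \<partial>lborel))"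
          by (simp add: nn_integral_add nn_integral_cmult)
        also have "\<dots> \<le> ennreal e1 + ennreal (\<sigma>\<^sup>2) * (ennreal A + ennreal A)"
        proof (intro add_mono mult_left_mono)
          show "(\<integral>\<^sup>+q. f1 q \<partial>lborel) \<le> ennreal e1" unfolding f1_def by (rule \<delta>1(2)[OF sd(1-3)])
          show "(\<integral>\<^sup>+q. f2 q \<partial>lborel) \<le> ennreal A" unfolding f2_def A(1) by (rule ll_tail[OF CM(1,3) k]) simp_all
          show "(\<integral>\<^sup>+q. f3 q \<partial>lborel) \<le> ennreal A"
            unfolding f3_def A(1) by (rule order_trans[OF yy_tail[OF sT(1) k(1)] CM(3)[OF sT(1)]]) simp
        qed simp_all
        also have "\<dots> = ennreal (e1 + \<sigma>\<^sup>2 * (A + A))"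
        proof -
          have "0 \<le> \<sigma>\<^sup>2 * (A + A)" using A(2) by simp
          from ennreal_plus[OF less_imp_le[OF e1] this] show ?thesis
            by (simp only: ennreal_mult'[OF zero_le_power2] ennreal_plus[OF A(2) A(2)])
        qed
        also have "\<dots> \<le> ennreal (2 * e1)"
        proof (rule ennreal_leI)
          have "\<sigma>\<^sup>2 * (A + A) \<le> \<sigma> * (2 * (A + 1))"
            using sd A(2) mult_left_le[of \<sigma> \<sigma>] by (intro mult_mono) (auto simp: power2_eq_square)
          also have "\<dots> \<le> e1" using sd(5) A(2) by (simp add: field_simps)
          finally show "e1 + \<sigma>\<^sup>2 * (A + A) \<le> 2 * e1" by simp
        qed
        finally show ?thesis using s by simp
      qed (simp add: g_def)
    qed
    also have "\<dots> = ennreal (2 * e1) * emeasure lborel {0<..\<tau>}" by (rule nn_integral_cmult_indicator) simp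
    also have "\<dots> = ennreal (2 * e1 * \<tau>)" using t e1 by (simp add: ennreal_mult'[symmetric])
    also have "ennreal (C1 * \<tau> ^ 5) * ennreal (2 * e1 * \<tau>) = ennreal (e * \<tau> ^ 6)"
    proof -
      have "C1 * \<tau> ^ 5 * (2 * e1 * \<tau>) = e * \<tau> ^ 6" using C1(1) by (simp add: e1_def eval_nat_numeral)
      then show ?thesis using t C1(1) by (simp add: ennreal_mult'[symmetric])
    qed
    finally show ?thesis by (simp add: mult_left_mono)
  qed
  then show ?thesis using \<delta> by blast
qed

lemma ll_L2: "1 \<le> k \<Longrightarrow> k \<le> 3 \<Longrightarrow> j \<le> 2 \<Longrightarrow> (\<integral>\<^sup>+q\<in>sph_dom. ennreal (sin (fst (snd q)) * (ll k j q)\<^sup>2) \<partial>lborel) < \<infinity>"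
proof -
  assume k: "1 \<le> k" "k \<le> 3" "j \<le> 2"
  obtain C M where CM: "C > 0" "M > 0" "\<And>\<tau> R. \<tau> \<in> {0<..\<tau>0} \<Longrightarrow> tail \<tau> R \<le> ennreal C * tail \<tau>0 (R - M)"
    using tail_bound by blast
  have "(\<integral>\<^sup>+q\<in>sph_dom. ennreal (sin (fst (snd q)) * (ll k j q)\<^sup>2) \<partial>lborel) \<le> ennreal C * tail \<tau>0 (0 - M)"
    using ll_tail[OF CM(1,3) k, of 0] by (simp add: sph_tail_dom)
  also have "\<dots> < \<infinity>" using tail_total[of "0 - M"] by (simp add: ennreal_mult_less_top)
  finally show ?thesis .
qed

end

section \<open>Schwarzschild--de Sitter waves in the coordinate 1/r\<close>

text \<open>At \<open>1 / sqrt \<Lambda>\<close> the function has the value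
  \<open>2 * m * sqrt \<Lambda> - 2 / 3\<close>, negative precisely by subextremality, and from
  \<open>2 / sqrt \<Lambda>\<close> on it is positive. The zeros in between form a nonempty compact
  set, whose maximum gives meaning to \<open>GREATEST\<close>; positivity beyond it follows from the
  intermediate value theorem.\<close>

lemma SdS_rC_props:
  fixes \<Lambda> m :: real
  assumes "\<Lambda> > 0" "0 < 3 * m" "3 * m < 1 / sqrt \<Lambda>"
  shows "SdS_rC \<Lambda> m > 0" "\<And>r. r > SdS_rC \<Lambda> m \<Longrightarrow> SdS_D \<Lambda> m r > 0"
proof -
  define D where "D = SdS_D \<Lambda> m"
  define s where "s = sqrt \<Lambda>"
  have s: "s > 0" "s\<^sup>2 = \<Lambda>" using assms(1) by (auto simp: s_def)
  have cont: "continuous_on A D" if "A \<subseteq> {0<..}" for A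
    unfolding D_def SdS_D_def using that by (intro continuous_intros) auto
  have big: "D r > 0" if "r \<ge> 2 / s" for r
  proof -
    have r0: "r > 0" using that s(1) by (smt (verit) divide_pos_pos)
    have "(2 / s)\<^sup>2 \<le> r\<^sup>2" using that s(1) by (intro power_mono) auto
    then have "\<Lambda> / 3 * (2 / s)\<^sup>2 \<le> \<Lambda> / 3 * r\<^sup>2" using assms(1) by (intro mult_left_mono) auto
    moreover have "\<Lambda> / 3 * (2 / s)\<^sup>2 = 4 / 3" using s assms(1) by (simp add: power_divide)
    moreover have "2 * m / r > 0" using assms(2) r0 by simp
    ultimately show ?thesis by (simp add: D_def SdS_D_def)
  qed
  have neg1: "D (1 / s) < 0"
  proof -
    have "3 * m * s < 1" using assms(3) s(1) by (simp add: s_def[symmetric] field_simps)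
    moreover have "D (1 / s) = 1 / 3 - 1 + 2 * m * s" using s assms(1) by (simp add: D_def SdS_D_def power_divide)
    ultimately show ?thesis by simp
  qed
  have le: "1 / s \<le> 2 / s" using s(1) by (simp add: divide_right_mono)
  have s1: "1 / s > 0" using s(1) by simp
  have sub: "{1 / s..2 / s} \<subseteq> {0<..}" using order_less_le_trans[OF s1] by auto
  have "\<exists>x\<ge>1 / s. x \<le> 2 / s \<and> D x = 0"
    using less_imp_le[OF neg1] less_imp_le[OF big[OF order_refl]] le cont[OF sub] by (rule IVT')
  then obtain r1 where r1: "1 / s \<le> r1" "r1 \<le> 2 / s" "D r1 = 0" by blast
  define Z where "Z = {1 / s..2 / s} \<inter> D -` {0}"
  have "closed Z" unfolding Z_def
    using continuous_closed_preimage[OF cont[OF sub] closed_atLeastAtMost closed_singleton] .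
  moreover have "{1 / s..2 / s} \<inter> Z = Z" by (simp add: Z_def)
  ultimately have "compact Z" using compact_Int_closed[OF compact_Icc, of Z "1 / s" "2 / s"] by simp
  moreover have "Z \<noteq> {}" using r1 by (auto simp: Z_def)
  ultimately obtain rc where rc: "rc \<in> Z" "\<forall>r\<in>Z. r \<le> rc" using compact_attains_sup[of Z] by metis
  have rc0: "D rc = 0" "rc \<ge> 1 / s" using rc(1) by (simp_all add: Z_def)
  have rc_pos: "rc > 0" using less_le_trans[OF s1 rc0(2)] .
  have le_rc: "r \<le> rc" if "r > 0" "D r = 0" for r
  proof (cases "r \<ge> 1 / s")
    case True
    have "r \<le> 2 / s" using big[of r] that by (cases "r \<le> 2 / s") auto
    then show ?thesis using True that by (intro rc(2)[rule_format]) (auto simp: Z_def)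
  qed (use rc0 in linarith)
  have eq: "SdS_rC \<Lambda> m = rc"
    unfolding SdS_rC_def by (rule Greatest_equality) (use rc0 rc_pos le_rc in \<open>auto simp: D_def\<close>)
  show "SdS_rC \<Lambda> m > 0" using eq rc_pos by simp
  show "SdS_D \<Lambda> m r > 0" if "r > SdS_rC \<Lambda> m" for r
  proof (rule ccontr)
    assume "\<not> SdS_D \<Lambda> m r > 0"
    then have neg: "D r \<le> 0" by (simp add: D_def)
    have r: "r > rc" using that eq by simp
    have "r \<le> 2 / s" using big[of r] neg by (cases "r \<le> 2 / s") auto
    have "{r..2 / s} \<subseteq> {0<..}" using r rc_pos by auto
    then have "\<exists>z\<ge>r. z \<le> 2 / s \<and> D z = 0"
      using IVT'[of D r 0 "2 / s", OF neg less_imp_le[OF big[OF order_refl]] _ cont] \<open>r \<le> 2 / s\<close> by metis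
    then obtain z where "r \<le> z" "D z = 0" by blast
    then show False using le_rc[of z] r rc_pos by linarith
  qed
qed

section \<open>The polar chart of the sphere\<close>

lemma norm_sph [simp]: "norm (sph \<theta> \<phi>) = 1"
proof -
  have "sph \<theta> \<phi> \<bullet> sph \<theta> \<phi> = sin \<theta> * cos \<phi> * (sin \<theta> * cos \<phi>) + sin \<theta> * sin \<phi> * (sin \<theta> * sin \<phi>) + cos \<theta> * cos \<theta>"
    by (simp add: sph_def inner_vec_def sum_3 vector_3)
  also have "\<dots> = (sin \<theta>)\<^sup>2 * ((cos \<phi>)\<^sup>2 + (sin \<phi>)\<^sup>2) + (cos \<theta>)\<^sup>2"
    unfolding power2_eq_square by algebra
  also have "\<dots> = 1" using sin_cos_squared_add[of \<theta>] sin_cos_squared_add2[of \<phi>] by simp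
  finally show ?thesis by (simp add: norm_eq_1)
qed

lemma sph_nonzero [simp]: "sph \<theta> \<phi> \<noteq> 0"
  using norm_sph[of \<theta> \<phi>] by fastforce

lemma sph_periodic [simp]: "sph \<theta> (\<phi> + 2 * pi) = sph \<theta> \<phi>"
  by (simp add: sph_def)

text \<open>The unit tangent of the circles of latitude. It does not depend on \<theta>, so the
  degeneration of the \<phi>-derivative at the poles sits entirely in the factor
  \<open>sin \<theta>\<close>.\<close>

definition pole_tangent :: "real \<Rightarrow> real^3" where
  "pole_tangent \<phi> = vector [- sin \<phi>, cos \<phi>, 0]"

lemma sph_phi_derivative: "((\<lambda>s. sph \<theta> s) has_vector_derivative sin \<theta> *\<^sub>R pole_tangent \<phi>) (at \<phi>)"
  unfolding has_vector_derivative_def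
proof (subst has_derivative_componentwise_within, intro ballI)
  fix i :: "real^3" assume "i \<in> Basis"
  then obtain k where i: "i = axis k 1" by (auto simp: Basis_vec_def)
  have "((\<lambda>s. sph \<theta> s $ k) has_real_derivative sin \<theta> * pole_tangent \<phi> $ k) (at \<phi>)"
    using exhaust_3[of k] by (auto simp: sph_def pole_tangent_def vector_3 intro!: derivative_eq_intros)
  then show "((\<lambda>s. sph \<theta> s \<bullet> i) has_derivative (\<lambda>h. h *\<^sub>R sin \<theta> *\<^sub>R pole_tangent \<phi> \<bullet> i)) (at \<phi>)"
    by (simp add: i inner_axis has_field_derivative_def mult_commute_abs mult.assoc)
qed

lemma Basis_R_R_R3: "j \<in> (Basis :: (real \<times> real \<times> (real^3)) set) \<Longrightarrow>
    j = (1, 0, 0) \<or> j = (0, 1, 0) \<or> (\<exists>k. j = (0, 0, axis k 1))"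
  by (auto simp: Basis_prod_def Basis_vec_def zero_prod_def)

lemma DERIV_transform_nhds:
  "(f has_real_derivative D) (at x) \<Longrightarrow> \<forall>\<^sub>F y in nhds x. f y = g y \<Longrightarrow> (g has_real_derivative D) (at x)"
  using DERIV_cong_ev[OF refl _ refl, of f g x D] by simp

section \<open>The rescaled solution and its hierarchy\<close>

locale sds_wave =
  fixes \<Lambda> m r0 :: real and \<psi> :: "real \<Rightarrow> real \<Rightarrow> real^3 \<Rightarrow> real"
  assumes \<Lambda>_pos: "\<Lambda> > 0"
    and subextremal: "0 < 3 * m" "3 * m < 1 / sqrt \<Lambda>"
    and smooth: "smooth_on ({SdS_rC \<Lambda> m<..} \<times> UNIV \<times> - {0})
                   (\<lambda>(r, t, x). \<psi> r t (x /\<^sub>R norm x))"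
    and wave: "\<And>r t \<theta> \<phi>. r > SdS_rC \<Lambda> m \<Longrightarrow> 0 < \<theta> \<Longrightarrow> \<theta> < pi \<Longrightarrow>
                 box_g \<Lambda> m \<psi> r t \<theta> \<phi> = 0"
    and r0: "r0 > SdS_rC \<Lambda> m"
    and finite_energy: "(\<Sum>k\<le>2. energy \<Lambda> m ((dr ^^ k) \<psi>) r0) < \<infinity>"
begin

definition "T = 1 / SdS_rC \<Lambda> m"
definition "\<tau>0 = 1 / r0"

lemma rC: "SdS_rC \<Lambda> m > 0" "\<And>r. r > SdS_rC \<Lambda> m \<Longrightarrow> SdS_D \<Lambda> m r > 0"
  using SdS_rC_props[OF \<Lambda>_pos subextremal] by auto

lemma T_pos: "T > 0" "0 < \<tau>0" "\<tau>0 < T"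
  using rC(1) r0 by (auto simp: T_def \<tau>0_def frac_less2)

lemma inv_T: "0 < \<tau> \<Longrightarrow> \<tau> < T \<Longrightarrow> 1 / \<tau> > SdS_rC \<Lambda> m"
  using rC(1) by (simp add: T_def field_simps)

lemma inv_r: "r > SdS_rC \<Lambda> m \<Longrightarrow> 0 < 1 / r \<and> 1 / r < T"
  using rC(1) by (auto simp: T_def frac_less2)

definition P :: "real \<Rightarrow> real" where "P \<tau> = \<Lambda> / 3 - \<tau>\<^sup>2 + 2 * m * \<tau> ^ 3"

lemma P_D: "0 < \<tau> \<Longrightarrow> SdS_D \<Lambda> m (1 / \<tau>) = P \<tau> / \<tau>\<^sup>2"
  by (simp add: SdS_D_def P_def field_simps power2_eq_square power3_eq_cube)

lemma P_pos: "0 \<le> \<tau> \<Longrightarrow> \<tau> < T \<Longrightarrow> P \<tau> > 0"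
proof (cases "\<tau> = 0")
  case True
  then show ?thesis using \<Lambda>_pos by (simp add: P_def)
next
  case False
  assume "0 \<le> \<tau>" "\<tau> < T"
  then have "P \<tau> / \<tau>\<^sup>2 > 0" using rC(2)[OF inv_T[of \<tau>]] P_D[of \<tau>] False by simp
  then show ?thesis using False by (simp add: zero_less_divide_iff)
qed

lemma P_smooth: "open S \<Longrightarrow> smooth_on S P"
  unfolding P_def[abs_def] by (intro smooth_on_intros smooth_on_linear bounded_linear_ident; assumption)

definition Psi :: "R4 \<Rightarrow> real" where "Psi = (\<lambda>(\<tau>, t, \<theta>, \<phi>). \<psi> (1 / \<tau>) t (sph \<theta> \<phi>))"

definition "chart_map = (\<lambda>(\<tau>, t, \<theta>, \<phi>). (1 / \<tau>, t, sph \<theta> \<phi>))"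

text \<open>The extension constant along rays: it lives on an open subset of ambient space, where
  smoothness and Frechet derivatives make sense.\<close>

definition "ext = (\<lambda>(r, t, x). \<psi> r t (x /\<^sub>R norm x))"

lemma chart_map_smooth: "j \<in> Basis \<Longrightarrow> smooth_on (full_reg T) (\<lambda>x. chart_map x \<bullet> j)"
proof -
  assume j: "j \<in> Basis"
  have bl: "bounded_linear (\<lambda>x::R4. snd (snd (snd x)))" by (intro bounded_linear_intros)
  note lin = smooth_on_thv[OF open_reg(2)[of T]] smooth_on_linear[OF open_reg(2)[of T] bl]
  have nz: "\<And>x. x \<in> full_reg T \<Longrightarrow> fst x \<noteq> 0" by (auto simp: full_reg_def)
  consider "j = (1, 0, 0)" | "j = (0, 1, 0)" | k where "j = (0, 0, axis k 1)" using Basis_R_R_R3[OF j] by blast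
  then show ?thesis
  proof cases
    case 1
    have "(\<lambda>x. chart_map x \<bullet> j) = (\<lambda>x. 1 / fst x)" by (auto simp: chart_map_def 1 fun_eq_iff)
    then show ?thesis by (metis smooth_on_divide[OF open_reg(2) smooth_on_const[OF open_reg(2)] lin(2) nz])
  next
    case 2
    have "(\<lambda>x. chart_map x \<bullet> j) = (\<lambda>x. fst (snd x))" by (auto simp: chart_map_def 2 fun_eq_iff)
    then show ?thesis using lin(3) by metis
  next
    case 3
    have e: "(\<lambda>x. chart_map x \<bullet> j) = (\<lambda>x. sph (thv x) (snd (snd (snd x))) $ k)"
      by (auto simp: chart_map_def 3 fun_eq_iff inner_axis)
    have "k = 1 \<or> k = 2 \<or> k = 3" by (rule exhaust_3)
    then show ?thesis unfolding e sph_def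
      by (auto simp: vector_3 intro!: smooth_on_intros lin open_reg)
  qed
qed

lemma chart_map_image: "chart_map ` full_reg T \<subseteq> {SdS_rC \<Lambda> m<..} \<times> UNIV \<times> - {0}"
  using inv_T by (auto simp: chart_map_def full_reg_def)

lemma pull_smooth: "smooth_on ({SdS_rC \<Lambda> m<..} \<times> UNIV \<times> - {0}) f \<Longrightarrow> smooth_on (full_reg T) (\<lambda>x. f (chart_map x))"
  by (rule smooth_on_compose[OF open_reg(2) _ chart_map_smooth chart_map_image])

lemma Psi_ext: "Psi x = ext (chart_map x)"
  by (cases x) (simp add: Psi_def ext_def chart_map_def)

lemma Psi_smooth: "smooth_on (full_reg T) Psi"
proof -
  have "Psi = (\<lambda>x. ext (chart_map x))" by (simp add: fun_eq_iff Psi_ext)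
  then show ?thesis using pull_smooth[of ext] smooth by (simp add: ext_def)
qed

text \<open>By the chain rule through ambient space, a \<phi>-derivative is the derivative of
  \<open>ext\<close> along \<open>sin \<theta>\<close> times \<open>pole_tangent \<phi>\<close>, a
  combination of two fixed directions with coefficients smooth in \<phi>.\<close>

lemma Psi_pole: "\<exists>G. smooth_on (full_reg T) G \<and> (\<forall>x\<in>full_reg T. d3 Psi x = sin (thv x) * G x)"
proof -
  let ?S = "{SdS_rC \<Lambda> m<..} \<times> (UNIV :: real set) \<times> (- {0} :: (real^3) set)"
  have se: "smooth_on ?S ext" using smooth by (simp add: ext_def)
  define e1 e2 :: "real \<times> real \<times> (real^3)" where e: "e1 = (0, 0, axis 1 1)" "e2 = (0, 0, axis 2 1)"
  have eB: "e1 \<in> Basis" "e2 \<in> Basis" by (auto simp: e Basis_prod_def Basis_vec_def)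
  define G where "G x = - sin (snd (snd (snd x))) * pdiff e1 ext (chart_map x) + cos (snd (snd (snd x))) * pdiff e2 ext (chart_map x)" for x :: R4
  have bl: "bounded_linear (\<lambda>x::R4. snd (snd (snd x)))" by (intro bounded_linear_intros)
  have "smooth_on (full_reg T) G" unfolding G_def
    by (intro smooth_on_intros open_reg pull_smooth smooth_on_pdiff[OF se] eB smooth_on_linear[OF open_reg(2) bl])
  moreover have "d3 Psi x = sin (thv x) * G x" if x: "x \<in> full_reg T" for x
  proof -
    obtain \<tau> t \<theta> \<phi> where xx: "x = (\<tau>, t, \<theta>, \<phi>)" by (cases x)
    have dx: "ext differentiable at (chart_map x)" using smooth_on_differentiable[OF se] chart_map_image x by blast
    have "((\<lambda>s. chart_map (\<tau>, t, \<theta>, s)) has_vector_derivative (0, 0, sin \<theta> *\<^sub>R pole_tangent \<phi>)) (at \<phi>)"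
      unfolding chart_map_def split
      by (intro has_vector_derivative_Pair has_vector_derivative_const sph_phi_derivative)
    then have "((\<lambda>s. ext (chart_map (\<tau>, t, \<theta>, s))) has_real_derivative pdiff (0, 0, sin \<theta> *\<^sub>R pole_tangent \<phi>) ext (chart_map x)) (at \<phi>)"
      using has_derivative_comp_curve_pdiff[where g = "\<lambda>s. chart_map (\<tau>, t, \<theta>, s)" and s = \<phi> and f = ext] dx by (simp add: xx)
    then have "d3 Psi x = pdiff (0, 0, sin \<theta> *\<^sub>R pole_tangent \<phi>) ext (chart_map x)"
      unfolding xx using smooth_on_differentiable[OF Psi_smooth x[unfolded xx]]
      by (intro pdiff_coord_eqI(4)) (simp_all add: Psi_ext)
    also have "(0, 0, sin \<theta> *\<^sub>R pole_tangent \<phi>) = (sin \<theta> * - sin \<phi>) *\<^sub>R e1 + (sin \<theta> * cos \<phi>) *\<^sub>R e2"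
    proof -
      have "sin \<theta> *\<^sub>R pole_tangent \<phi> = (sin \<theta> * - sin \<phi>) *\<^sub>R axis 1 1 + (sin \<theta> * cos \<phi>) *\<^sub>R axis 2 (1::real)"
        by (simp add: vec_eq_iff forall_3 pole_tangent_def vector_3 axis_def)
      then show ?thesis by (simp add: e)
    qed
    also have "pdiff \<dots> ext (chart_map x) = sin \<theta> * - sin \<phi> * pdiff e1 ext (chart_map x) + sin \<theta> * cos \<phi> * pdiff e2 ext (chart_map x)"
      using linear_frechet_derivative[OF dx] by (simp add: pdiff_def linear_add linear_scale linear_diff linear_neg)
    finally show ?thesis by (simp add: G_def xx algebra_simps)
  qed
  ultimately show ?thesis by blast
qed

text \<open>In terms of r, \<open>Fs 1\<close> is \<open>- r * D\<close> times the r-derivative of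
  \<psi>, so the quantity under the outer r-derivative in \<open>box_g\<close> is
  \<open>- r * Fs 1\<close>. This explains the weight \<open>P / \<tau>\<close>.\<close>

fun Fs :: "nat \<Rightarrow> R4 \<Rightarrow> real" where
  "Fs 0 = Psi"
| "Fs (Suc 0) = (\<lambda>x. P (fst x) / fst x * d0 Psi x)"
| "Fs (Suc (Suc n)) = d0 (Fs (Suc n))"

lemma full_fst: "x \<in> full_reg T \<Longrightarrow> 0 < fst x \<and> fst x < T"
  by (auto simp: full_reg_def)

lemma PT_smooth: "smooth_on {0<..<T} (\<lambda>\<tau>. P \<tau> / \<tau>)"
  by (intro smooth_on_divide P_smooth smooth_on_linear bounded_linear_ident) auto

lemma Fs_smooth: "smooth_on (full_reg T) (Fs j)"
proof (induction j rule: Fs.induct)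
  case 2
  show ?case using smooth_on_mult[OF open_reg(2) smooth_on_coef[OF PT_smooth] smooth_on_d(1)[OF Psi_smooth]] by simp
qed (auto intro: Psi_smooth smooth_on_d)

lemma Fs_periodic: "Fs j (\<tau>, t, \<theta>, \<phi> + 2 * pi) = Fs j (\<tau>, t, \<theta>, \<phi>)"
proof -
  have 0: "Psi (\<tau>, t, \<theta>, \<phi> + 2 * pi) = Psi (\<tau>, t, \<theta>, \<phi>)" for \<tau> t \<theta> \<phi> by (simp add: Psi_def)
  have "\<forall>\<tau> t \<theta> \<phi>. Fs j (\<tau>, t, \<theta>, \<phi> + 2 * pi) = Fs j (\<tau>, t, \<theta>, \<phi>)"
    by (induction j rule: Fs.induct) (auto simp: 0 pdiff_periodic)
  then show ?thesis by blast
qed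

lemma Fs_0: "x \<in> full_reg T \<Longrightarrow> d0 (Fs 0) x = fst x * inverse (P (fst x)) * Fs 1 x"
  using full_fst[of x] P_pos[of "fst x"] by (simp add: field_simps)

text \<open>An r-derivative is \<open>- \<tau>\<^sup>2\<close> times a \<tau>-derivative. Stated for
  an arbitrary \<open>u\<close> because it is applied to the iterated r-derivatives of \<psi> and to
  the functions \<open>U\<close> as well.\<close>

lemma dr_pull:
  assumes G: "smooth_on (full_reg T) G" "\<And>\<tau> t \<theta> \<phi>. 0 < \<tau> \<Longrightarrow> \<tau> < T \<Longrightarrow> G (\<tau>, t, \<theta>, \<phi>) = u (1 / \<tau>) t (sph \<theta> \<phi>)"
    and r: "r > SdS_rC \<Lambda> m"
  shows "((\<lambda>s. u s t (sph \<theta> \<phi>)) has_real_derivative - (1 / r)\<^sup>2 * d0 G (1 / r, t, \<theta>, \<phi>)) (at r)"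
    "dr u r t (sph \<theta> \<phi>) = - (1 / r)\<^sup>2 * d0 G (1 / r, t, \<theta>, \<phi>)"
proof -
  have x: "(1 / r, t, \<theta>, \<phi>) \<in> full_reg T" using inv_r[OF r] by (simp add: full_reg_def)
  have rp: "r > 0" using r rC(1) by simp
  have "((\<lambda>s. G (1 / s, t, \<theta>, \<phi>)) has_real_derivative d0 G (1 / r, t, \<theta>, \<phi>) * (- (1 / r)\<^sup>2)) (at r)"
    by (rule DERIV_chain2[where f = "\<lambda>s. G (s, t, \<theta>, \<phi>)" and g = "\<lambda>s. 1 / s", OF pdiff_coord_DERIV(1)[OF smooth_on_differentiable[OF G(1) x]]])
       (use rp in \<open>auto intro!: derivative_eq_intros simp: power2_eq_square divide_simps\<close>)
  moreover have "\<forall>\<^sub>F s in nhds r. G (1 / s, t, \<theta>, \<phi>) = u s t (sph \<theta> \<phi>)"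
  proof -
    have "\<forall>\<^sub>F s in nhds r. s \<in> {SdS_rC \<Lambda> m<..}" using r by (intro eventually_nhds_in_open) auto
    then show ?thesis
    proof eventually_elim
      case (elim s)
      then show ?case using inv_r[of s] G(2)[of "1 / s"] by simp
    qed
  qed
  ultimately show D: "((\<lambda>s. u s t (sph \<theta> \<phi>)) has_real_derivative - (1 / r)\<^sup>2 * d0 G (1 / r, t, \<theta>, \<phi>)) (at r)"
    by (subst DERIV_cong_ev[OF refl _ refl, where g = "\<lambda>s. G (1 / s, t, \<theta>, \<phi>)"])
       (auto simp: mult.commute elim: eventually_mono)
  show "dr u r t (sph \<theta> \<phi>) = - (1 / r)\<^sup>2 * d0 G (1 / r, t, \<theta>, \<phi>)"
    unfolding dr_def using DERIV_imp_deriv[OF D] .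
qed

lemma Psi_pull: "Psi (\<tau>, t, \<theta>, \<phi>) = \<psi> (1 / \<tau>) t (sph \<theta> \<phi>)"
  by (simp add: Psi_def)

lemma lapse_sq: "r > SdS_rC \<Lambda> m \<Longrightarrow> (lapse \<Lambda> m r)\<^sup>2 = (1 / r)\<^sup>2 / P (1 / r)"
proof -
  assume r: "r > SdS_rC \<Lambda> m"
  have "r > 0" using r rC(1) by simp
  then have "SdS_D \<Lambda> m r = P (1 / r) / (1 / r)\<^sup>2" using P_D[of "1 / r"] by simp
  then show ?thesis using rC(2)[OF r] by (simp add: lapse_def power_divide)
qed

text \<open>The wave equation multiplied by \<open>r\<^sup>2\<close>, with its radial bracket
  recognised as \<open>- r * Fs 1\<close>. The factor \<tau> in front of \<open>d0 (Fs 1)\<close>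
  exhibits the singularity at infinity.\<close>

lemma wave_first_order:
  assumes x: "x \<in> chart_reg T"
  shows "fst x * d0 (Fs 1) x - Fs 1 x = inverse (P (fst x)) * d1 (d1 Psi) x + lap Psi x"
proof -
  obtain \<tau> t \<theta> \<phi> where xx: "x = (\<tau>, t, \<theta>, \<phi>)" by (cases x)
  have \<tau>: "0 < \<tau>" "\<tau> < T" and th: "0 < \<theta>" "\<theta> < pi" using x by (auto simp: xx chart_reg_def)
  define r where "r = 1 / \<tau>"
  have r: "r > SdS_rC \<Lambda> m" "1 / r = \<tau>" "r > 0" using inv_T[OF \<tau>] \<tau> by (auto simp: r_def)
  have sn: "sin \<theta> > 0" using th by (intro sin_gt_zero)
  have fr: "(\<tau>, t, \<theta>, \<phi>) \<in> full_reg T" for t \<theta> \<phi> using \<tau> by (simp add: full_reg_def)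
  have dd: "f differentiable at (\<tau>, t, \<theta>, \<phi>)" if "smooth_on (full_reg T) f" for f t \<theta> \<phi>
    using smooth_on_differentiable[OF that fr] .
  note S = Psi_smooth smooth_on_d[OF Psi_smooth]
  have tt: "deriv (\<lambda>s. deriv (\<lambda>s'. \<psi> r s' (sph \<theta> \<phi>)) s) t = d1 (d1 Psi) x"
  proof -
    have "(\<lambda>s. deriv (\<lambda>s'. \<psi> r s' (sph \<theta> \<phi>)) s) = (\<lambda>s. d1 Psi (\<tau>, s, \<theta>, \<phi>))"
      using DERIV_imp_deriv[OF pdiff_coord_DERIV(2)[OF dd[OF S(1)]]] by (simp add: Psi_pull r_def fun_eq_iff)
    then show ?thesis using DERIV_imp_deriv[OF pdiff_coord_DERIV(2)[OF dd[OF S(3)]]] by (simp add: xx)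
  qed
  have pp: "deriv (\<lambda>b. deriv (\<lambda>b'. \<psi> r t (sph \<theta> b')) b) \<phi> = d3 (d3 Psi) x"
  proof -
    have "(\<lambda>s. deriv (\<lambda>s'. \<psi> r t (sph \<theta> s')) s) = (\<lambda>s. d3 Psi (\<tau>, t, \<theta>, s))"
      using DERIV_imp_deriv[OF pdiff_coord_DERIV(4)[OF dd[OF S(1)]]] by (simp add: Psi_pull r_def fun_eq_iff)
    then show ?thesis using DERIV_imp_deriv[OF pdiff_coord_DERIV(4)[OF dd[OF S(5)]]] by (simp add: xx)
  qed
  have th2: "deriv (\<lambda>a. sin a * deriv (\<lambda>a'. \<psi> r t (sph a' \<phi>)) a) \<theta> = cos \<theta> * d2 Psi x + sin \<theta> * d2 (d2 Psi) x"
  proof -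
    have "(\<lambda>a. sin a * deriv (\<lambda>a'. \<psi> r t (sph a' \<phi>)) a) = (\<lambda>a. sin a * d2 Psi (\<tau>, t, a, \<phi>))"
      using DERIV_imp_deriv[OF pdiff_coord_DERIV(3)[OF dd[OF S(1)]]] by (simp add: Psi_pull r_def fun_eq_iff)
    moreover have "((\<lambda>a. sin a * d2 Psi (\<tau>, t, a, \<phi>)) has_real_derivative cos \<theta> * d2 Psi x + sin \<theta> * d2 (d2 Psi) x) (at \<theta>)"
      using DERIV_mult[OF DERIV_sin pdiff_coord_DERIV(3)[OF dd[OF S(4)]]] by (simp add: xx mult.commute)
    ultimately show ?thesis by (simp add: DERIV_imp_deriv)
  qed
  have rr: "deriv (\<lambda>s. s\<^sup>2 / (lapse \<Lambda> m s)\<^sup>2 * deriv (\<lambda>s'. \<psi> s' t (sph \<theta> \<phi>)) s) r = \<tau> * d0 (Fs 1) x - Fs 1 x"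
  proof (rule DERIV_imp_deriv)
    have "((\<lambda>s. - (s * Fs 1 (1 / s, t, \<theta>, \<phi>))) has_real_derivative \<tau> * d0 (Fs 1) x - Fs 1 x) (at r)"
    proof -
      have frr: "(1 / r, t, \<theta>, \<phi>) \<in> full_reg T" using fr unfolding r(2) .
      have "((\<lambda>s. Fs 1 (1 / s, t, \<theta>, \<phi>)) has_real_derivative d0 (Fs 1) (1 / r, t, \<theta>, \<phi>) * (- (1 / r)\<^sup>2)) (at r)"
        by (rule DERIV_chain2[where f = "\<lambda>s. Fs 1 (s, t, \<theta>, \<phi>)" and g = "\<lambda>s. 1 / s", OF pdiff_coord_DERIV(1)[OF smooth_on_differentiable[OF Fs_smooth frr]]])
           (use r(3) in \<open>auto intro!: derivative_eq_intros simp: power2_eq_square divide_simps simp del: Fs.simps\<close>)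
      note D = DERIV_minus[OF DERIV_mult[OF DERIV_ident this]]
      have tr: "\<tau>\<^sup>2 * r = \<tau>" using \<tau> by (simp add: r_def power2_eq_square)
      have "- (1 * A + B * - \<tau>\<^sup>2 * r) = \<tau> * B - A" for A B
      proof -
        have "- (1 * A + B * - \<tau>\<^sup>2 * r) = B * (\<tau>\<^sup>2 * r) - A" by (simp add: algebra_simps)
        then show ?thesis unfolding tr by (simp add: mult.commute)
      qed
      then have "- (1 * Fs 1 (1 / r, t, \<theta>, \<phi>) + d0 (Fs 1) (1 / r, t, \<theta>, \<phi>) * - (1 / r)\<^sup>2 * r) = \<tau> * d0 (Fs 1) x - Fs 1 x"
        unfolding r(2) xx by blast
      with D show ?thesis by metis
    qed
    moreover have "\<forall>\<^sub>F s in nhds r. - (s * Fs 1 (1 / s, t, \<theta>, \<phi>)) = s\<^sup>2 / (lapse \<Lambda> m s)\<^sup>2 * deriv (\<lambda>s'. \<psi> s' t (sph \<theta> \<phi>)) s"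
    proof -
      have "\<forall>\<^sub>F s in nhds r. s \<in> {SdS_rC \<Lambda> m<..}" using r by (intro eventually_nhds_in_open) auto
      then show ?thesis
      proof eventually_elim
        case (elim s)
        then have s: "s > SdS_rC \<Lambda> m" "s > 0" using rC(1) by auto
        have "deriv (\<lambda>s'. \<psi> s' t (sph \<theta> \<phi>)) s = - (1 / s)\<^sup>2 * d0 Psi (1 / s, t, \<theta>, \<phi>)"
          using dr_pull(2)[OF Psi_smooth Psi_pull s(1)] by (simp add: dr_def)
        moreover have "P (1 / s) > 0" using inv_r[OF s(1)] by (intro P_pos) auto
        moreover have "- (s * (q / (1 / s) * D)) = s\<^sup>2 / ((1 / s)\<^sup>2 / q) * (- (1 / s)\<^sup>2 * D)" if "q > 0" for q D
          using s(2) that by (simp add: power2_eq_square field_simps)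
        ultimately show ?case unfolding lapse_sq[OF s(1)] by (simp add: power2_eq_square)
      qed
    qed
    ultimately show "((\<lambda>s. s\<^sup>2 / (lapse \<Lambda> m s)\<^sup>2 * deriv (\<lambda>s'. \<psi> s' t (sph \<theta> \<phi>)) s) has_real_derivative \<tau> * d0 (Fs 1) x - Fs 1 x) (at r)"
      by (rule DERIV_transform_nhds)
  qed
  have "box_g \<Lambda> m \<psi> r t \<theta> \<phi> = 0" by (rule wave[OF r(1) th])
  then have "\<tau>\<^sup>2 / P \<tau> * d1 (d1 Psi) x - \<tau>\<^sup>2 * (\<tau> * d0 (Fs 1) x - Fs 1 x)
      + \<tau>\<^sup>2 * ((1 / sin \<theta>) * (cos \<theta> * d2 Psi x + sin \<theta> * d2 (d2 Psi) x) + (1 / (sin \<theta>)\<^sup>2) * d3 (d3 Psi) x) = 0"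
    unfolding box_g_def tt pp th2 rr lapse_sq[OF r(1)] r(2) using r by (simp add: r_def power_divide)
  moreover have "(1 / sin \<theta>) * (cos \<theta> * d2 Psi x + sin \<theta> * d2 (d2 Psi) x) + (1 / (sin \<theta>)\<^sup>2) * d3 (d3 Psi) x = lap Psi x"
    using sn by (simp add: lap_def xx field_simps power2_eq_square)
  ultimately have "\<tau>\<^sup>2 / P \<tau> * d1 (d1 Psi) x - \<tau>\<^sup>2 * (\<tau> * d0 (Fs 1) x - Fs 1 x) + \<tau>\<^sup>2 * lap Psi x = 0" by metis
  moreover have "\<tau>\<^sup>2 / q * A - \<tau>\<^sup>2 * B + \<tau>\<^sup>2 * C = \<tau>\<^sup>2 * (inverse q * A - B + C)" for q A B C
    by (simp add: divide_inverse algebra_simps)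
  ultimately have "\<tau>\<^sup>2 * (inverse (P \<tau>) * d1 (d1 Psi) x - (\<tau> * d0 (Fs 1) x - Fs 1 x) + lap Psi x) = 0" by metis
  then have "inverse (P \<tau>) * d1 (d1 Psi) x - (\<tau> * d0 (Fs 1) x - Fs 1 x) + lap Psi x = 0"
    using \<tau> mult_eq_0_iff[of "\<tau>\<^sup>2"] by force
  then show ?thesis unfolding xx fst_conv by linarith
qed

lemma P_deriv: "(P has_real_derivative (- 2 * \<tau> + 6 * m * \<tau>\<^sup>2)) (at \<tau>)"
  unfolding P_def[abs_def] by (auto intro!: derivative_eq_intros simp: power2_eq_square)

text \<open>Differentiating \<open>wave_first_order\<close> cancels \<open>Fs 1\<close> against the
  derivative of the coefficient \<tau>. Every remaining term then contains a factor \<tau>, since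
  both the derivative of \<open>P\<close> and \<open>d0 Psi\<close> do, and dividing by it leaves a
  regular equation.\<close>

lemma Fs_wave:
  assumes x: "x \<in> chart_reg T"
  shows "d0 (d0 (Fs 1)) x = (inverse (P (fst x)))\<^sup>2 * d1 (d1 (Fs 1)) x + inverse (P (fst x)) * lap (Fs 1) x
        + (2 - 6 * m * fst x) * (inverse (P (fst x)))\<^sup>2 * d1 (d1 (Fs 0)) x"
proof -
  obtain \<tau> t \<theta> \<phi> where xx: "x = (\<tau>, t, \<theta>, \<phi>)" by (cases x)
  have \<tau>: "0 < \<tau>" "\<tau> < T" using x by (auto simp: xx chart_reg_def)
  have xf: "x \<in> full_reg T" using x chart_sub_full by blast
  have Pp: "P \<tau> > 0" using \<tau> by (intro P_pos) auto
  have Dp: "((\<lambda>\<tau>. inverse (P \<tau>)) has_real_derivative - ((- 2 * \<tau> + 6 * m * \<tau>\<^sup>2) * (inverse (P \<tau>))\<^sup>2)) (at \<tau>)"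
    using Pp by (auto intro!: derivative_eq_intros P_deriv simp: power2_eq_square)
  have kS: "smooth_on {0<..<T} (\<lambda>\<tau>. \<tau> * inverse (P \<tau>))"
  proof -
    have "P \<tau> \<noteq> 0" if "\<tau> \<in> {0<..<T}" for \<tau> using P_pos[of \<tau>] that by auto
    then show ?thesis by (intro smooth_on_mult smooth_on_inverse P_smooth smooth_on_linear bounded_linear_ident) auto
  qed
  have nz: "\<And>x. x \<in> chart_reg T \<Longrightarrow> sin (thv x) \<noteq> 0" using chart_sin_pos by force
  have sl: "smooth_on (chart_reg T) (lap Psi)"
    unfolding lap_def by (intro smooth_on_intros smooth_chart[OF smooth_on_d(3)] smooth_chart[OF smooth_on_d(4)]
        smooth_chart[OF smooth_on_d(3)[OF Psi_smooth]] smooth_on_d Psi_smooth smooth_on_thv open_reg; use nz in simp)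
  have dl: "lap Psi differentiable at (\<tau>, t, \<theta>, \<phi>)" using smooth_on_differentiable[OF sl x] by (simp add: xx)
  have dd: "f differentiable at (\<tau>, t, \<theta>, \<phi>)" if "smooth_on (full_reg T) f" for f
    using smooth_on_differentiable[OF that xf] by (simp add: xx)
  have L: "((\<lambda>s. s * d0 (Fs 1) (s, t, \<theta>, \<phi>) - Fs 1 (s, t, \<theta>, \<phi>)) has_real_derivative \<tau> * d0 (d0 (Fs 1)) x) (at \<tau>)"
    using DERIV_diff[OF DERIV_mult[OF DERIV_ident pdiff_coord_DERIV(1)[OF dd[OF smooth_on_d(1)[OF Fs_smooth[of 1]]]]]
      pdiff_coord_DERIV(1)[OF dd[OF Fs_smooth[of 1]]]] by (simp add: xx mult.commute del: One_nat_def Fs.simps)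
  have R: "((\<lambda>s. inverse (P s) * d1 (d1 Psi) (s, t, \<theta>, \<phi>) + lap Psi (s, t, \<theta>, \<phi>)) has_real_derivative
     (- ((- 2 * \<tau> + 6 * m * \<tau>\<^sup>2) * (inverse (P \<tau>))\<^sup>2) * d1 (d1 Psi) x + d0 (d1 (d1 Psi)) x * inverse (P \<tau>)) + d0 (lap Psi) x) (at \<tau>)"
    unfolding xx by (intro DERIV_add DERIV_mult Dp pdiff_coord_DERIV(1) dl dd smooth_on_d Psi_smooth)
  have ev: "\<forall>\<^sub>F s in nhds \<tau>. s * d0 (Fs 1) (s, t, \<theta>, \<phi>) - Fs 1 (s, t, \<theta>, \<phi>) = inverse (P s) * d1 (d1 Psi) (s, t, \<theta>, \<phi>) + lap Psi (s, t, \<theta>, \<phi>)"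
  proof -
    have "\<forall>\<^sub>F s in nhds \<tau>. s \<in> {0<..<T}" using \<tau> by (intro eventually_nhds_in_open) auto
    then show ?thesis
    proof eventually_elim
      case (elim s)
      then have "(s, t, \<theta>, \<phi>) \<in> chart_reg T" using x by (auto simp: xx chart_reg_def)
      from wave_first_order[OF this] show ?case by simp
    qed
  qed
  have main: "\<tau> * d0 (d0 (Fs 1)) x = - ((- 2 * \<tau> + 6 * m * \<tau>\<^sup>2) * (inverse (P \<tau>))\<^sup>2) * d1 (d1 Psi) x + d0 (d1 (d1 Psi)) x * inverse (P \<tau>) + d0 (lap Psi) x"
    by (rule DERIV_unique[OF DERIV_transform_nhds[OF L ev] R])
  have F0: "d0 Psi y = (\<lambda>\<tau>. \<tau> * inverse (P \<tau>)) (fst y) * Fs 1 y" if "y \<in> full_reg T" for y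
    using Fs_0[OF that] by simp
  have "d0 (d1 (d1 Psi)) x = \<tau> * inverse (P \<tau>) * d1 (d1 (Fs 1)) x" "d0 (lap Psi) x = \<tau> * inverse (P \<tau>) * lap (Fs 1) x"
    using d0_lap_commute[OF Psi_smooth x] lap_transform[OF F0 xf] lap_cmult[OF Fs_smooth kS xf, of 1] by (simp_all add: xx)
  then have "\<tau> * d0 (d0 (Fs 1)) x = \<tau> * ((inverse (P \<tau>))\<^sup>2 * d1 (d1 (Fs 1)) x + inverse (P \<tau>) * lap (Fs 1) x
        + (2 - 6 * m * \<tau>) * (inverse (P \<tau>))\<^sup>2 * d1 (d1 Psi) x)"
    using main by (simp add: power2_eq_square algebra_simps)
  then show ?thesis using \<tau> by (simp add: xx)
qed

lemma hierarchy: "wave_hierarchy (\<Lambda> / 3) m T \<tau>0 Fs"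
proof
  show "0 < \<tau>0" "\<tau>0 < T" by (rule T_pos)+
  show "smooth_on (full_reg T) (Fs j)" for j by (rule Fs_smooth)
  show "Fs j (\<tau>, t, \<theta>, \<phi> + 2 * pi) = Fs j (\<tau>, t, \<theta>, \<phi>)" for j \<tau> t \<theta> \<phi> by (rule Fs_periodic)
  show "d0 (Fs (Suc j)) x = Fs (Suc (Suc j)) x" for j x by simp
qed (fact P_pos[unfolded P_def] Fs_0[unfolded P_def] Fs_wave[unfolded P_def])+

sublocale wh: wave_hierarchy "\<Lambda> / 3" m T \<tau>0 P Fs
  by (rule hierarchy) (rule P_def[abs_def])

end

section \<open>Initial energy of the hierarchy from the energies of radial derivatives\<close>

lemma pdiff_sum:
  "(\<And>i. i \<in> A \<Longrightarrow> f i differentiable (at x)) \<Longrightarrow> pdiff v (\<lambda>x. \<Sum>i\<in>A. f i x) x = (\<Sum>i\<in>A. pdiff v (f i) x)"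
  by (rule pdiff_eqI[of _ "\<lambda>v. \<Sum>i\<in>A. pdiff v (f i) x"])
     (intro has_derivative_sum differentiable_has_derivative_pdiff)

text \<open>The energies of the hierarchy are taken over a closed period in \<phi>, those of the
  hypothesis over an open one; the domains differ inside two null hyperplanes.\<close>

lemma AE_hyperplane: "AE p :: real \<times> real \<times> real in lborel. snd (snd p) \<noteq> c"
proof -
  let ?a = "(0, 0, 1) :: real \<times> real \<times> real"
  have e: "{p. ?a \<bullet> p = c} = {p. snd (snd p) = c}" by (auto simp: inner_prod_def)
  have b: "{p. snd (snd p) = c} \<in> sets (lborel :: (real \<times> real \<times> real) measure)"
    using closed_hyperplane[of ?a c] unfolding e by (simp add: borel_closed)
  have "negligible {p. ?a \<bullet> p = c}" by (rule negligible_hyperplane) (simp add: zero_prod_def)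
  then have "{p. snd (snd p) = c} \<in> null_sets (lebesgue :: (real \<times> real \<times> real) measure)"
    unfolding e negligible_iff_null_sets .
  then have "{p. snd (snd p) = c} \<in> null_sets (lborel :: (real \<times> real \<times> real) measure)"
    unfolding null_sets_completion_iff[OF b] .
  from AE_not_in[OF this] show ?thesis by simp
qed

context sds_wave
begin

text \<open>Iterated r-derivatives of the solution in the coordinate \<tau>: for
  \<open>k \<le> 2\<close> the functions whose energies the hypothesis bounds.\<close>

fun G :: "nat \<Rightarrow> R4 \<Rightarrow> real" where
  "G 0 = Psi"
| "G (Suc k) = (\<lambda>x. - (fst x)\<^sup>2 * d0 (G k) x)"

lemma sq_smooth: "smooth_on {0<..<T} (\<lambda>\<tau>. - \<tau>\<^sup>2)"
  unfolding power2_eq_square by (intro smooth_on_intros smooth_on_linear bounded_linear_ident open_greaterThanLessThan)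

lemma G_smooth: "smooth_on (full_reg T) (G k)"
proof (induction k)
  case (Suc k)
  show ?case using smooth_on_mult[OF open_reg(2) smooth_on_coef[OF sq_smooth] smooth_on_d(1)[OF Suc]] by simp
qed (simp add: Psi_smooth)

lemma G_pull: "0 < \<tau> \<Longrightarrow> \<tau> < T \<Longrightarrow> G k (\<tau>, t, \<theta>, \<phi>) = (dr ^^ k) \<psi> (1 / \<tau>) t (sph \<theta> \<phi>)"
proof (induction k arbitrary: \<tau> t \<theta> \<phi>)
  case (Suc k)
  show ?case using dr_pull(2)[OF G_smooth Suc.IH inv_T[OF Suc.prems], of t \<theta> \<phi>] by simp
qed (simp add: Psi_pull)

declare G.simps [simp del]

lemma smooth_coef_deriv:
  assumes c: "smooth_on {0<..<T} c"
  shows "smooth_on {0<..<T} (pdiff 1 c)" "s \<in> {0<..<T} \<Longrightarrow> (c has_real_derivative pdiff 1 c s) (at s)"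
proof -
  show "smooth_on {0<..<T} (pdiff 1 c)" by (rule smooth_on_pdiff[OF c]) simp
  show "(c has_real_derivative pdiff 1 c s) (at s)" if "s \<in> {0<..<T}"
    using has_derivative_comp_curve_pdiff[of c "\<lambda>s. s" s 1 UNIV] smooth_on_differentiable[OF c that]
    by (simp add: has_vector_derivative_def has_derivative_ident)
qed

text \<open>Undifferentiated \<psi> does not appear: \<open>Fs 1\<close> is a multiple of the first
  r-derivative, and each \<tau>-derivative shifts the index by at most one. This matters because the
  energies see derivatives only.\<close>

lemma Fs_G: "\<exists>c. (\<forall>i. smooth_on {0<..<T} (c i)) \<and> (\<forall>x\<in>full_reg T. Fs (Suc j) x = (\<Sum>i\<le>j. c i (fst x) * G (Suc i) x))"
proof (induction j)
  case 0
  define c where "c s = (P s / s) / (- s\<^sup>2)" for s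
  have "smooth_on {0<..<T} c"
    unfolding c_def by (intro smooth_on_divide PT_smooth sq_smooth open_greaterThanLessThan) simp
  moreover have "Fs (Suc 0) x = (\<Sum>i\<le>0. c (fst x) * G (Suc i) x)" if "x \<in> full_reg T" for x
    using full_fst[OF that] by (simp add: c_def G.simps)
  ultimately show ?case by (intro exI[of _ "\<lambda>i. c"]) simp
next
  case (Suc j)
  then obtain c where c: "\<And>i. smooth_on {0<..<T} (c i)"
    and F: "\<And>x. x \<in> full_reg T \<Longrightarrow> Fs (Suc j) x = (\<Sum>i\<le>j. c i (fst x) * G (Suc i) x)" by blast
  \<comment> \<open>Product rule: \<open>a\<close> collects the derivatives of coefficients,
    \<open>b\<close> the terms with shifted index, coming from
    \<open>d0 (G i) = - G (Suc i) / \<tau>\<^sup>2\<close>.\<close>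
  define a where "a i = (if i \<le> j then pdiff 1 (c i) else (\<lambda>_. 0))" for i
  define b where "b i = (if i = 0 then (\<lambda>_. 0) else (\<lambda>s. c (i - 1) s / (- s\<^sup>2)))" for i
  have "smooth_on {0<..<T} (\<lambda>s. a i s + b i s)" for i
  proof (intro smooth_on_add open_greaterThanLessThan)
    show "smooth_on {0<..<T} (a i)" using smooth_coef_deriv(1)[OF c] smooth_on_const[OF open_greaterThanLessThan, of 0 T 0] by (simp add: a_def)
    have "smooth_on {0<..<T} (\<lambda>s. c (i - 1) s / (- s\<^sup>2))"
      by (rule smooth_on_divide[OF open_greaterThanLessThan c sq_smooth]) simp
    then show "smooth_on {0<..<T} (b i)" using smooth_on_const[OF open_greaterThanLessThan, of 0 T 0] by (simp add: b_def)
  qed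
  moreover have "Fs (Suc (Suc j)) x = (\<Sum>i\<le>Suc j. (a i (fst x) + b i (fst x)) * G (Suc i) x)" if x: "x \<in> full_reg T" for x
  proof -
    have fx: "fst x \<in> {0<..<T}" using full_fst[OF x] by simp
    have "Fs (Suc (Suc j)) x = d0 (\<lambda>x. \<Sum>i\<le>j. c i (fst x) * G (Suc i) x) x"
      using pdiff_transform_open(2)[OF open_reg(2) F x] by simp
    also have "\<dots> = (\<Sum>i\<le>j. d0 (\<lambda>x. c i (fst x) * G (Suc i) x) x)"
      by (intro pdiff_sum smooth_on_differentiable[OF _ x] smooth_on_mult open_reg smooth_on_coef c G_smooth)
    also have "\<dots> = (\<Sum>i\<le>j. a i (fst x) * G (Suc i) x + b (Suc i) (fst x) * G (Suc (Suc i)) x)"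
    proof (intro sum.cong refl)
      fix i assume "i \<in> {..j}"
      then have "i \<le> j" by simp
      moreover have "d0 (\<lambda>x. c i (fst x) * G (Suc i) x) x = pdiff 1 (c i) (fst x) * G (Suc i) x + c i (fst x) * d0 (G (Suc i)) x"
        by (rule coef_pdiff(1)[OF x G_smooth c smooth_coef_deriv(2)[OF c fx]])
      moreover have "c i (fst x) * d0 (G (Suc i)) x = b (Suc i) (fst x) * G (Suc (Suc i)) x"
        using fx by (simp add: b_def G.simps(2)[of "Suc i"])
      ultimately show "d0 (\<lambda>x. c i (fst x) * G (Suc i) x) x = a i (fst x) * G (Suc i) x + b (Suc i) (fst x) * G (Suc (Suc i)) x"
        by (simp add: a_def)
    qed
    also have "\<dots> = (\<Sum>i\<le>j. a i (fst x) * G (Suc i) x) + (\<Sum>i\<le>j. b (Suc i) (fst x) * G (Suc (Suc i)) x)"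
      by (rule sum.distrib)
    also have "(\<Sum>i\<le>j. a i (fst x) * G (Suc i) x) = (\<Sum>i\<le>Suc j. a i (fst x) * G (Suc i) x)"
      by (simp add: a_def)
    also have "(\<Sum>i\<le>j. b (Suc i) (fst x) * G (Suc (Suc i)) x) = (\<Sum>i\<le>Suc j. b i (fst x) * G (Suc i) x)"
      by (subst sum.atMost_Suc_shift) (simp add: b_def)
    also have "(\<Sum>i\<le>Suc j. a i (fst x) * G (Suc i) x) + (\<Sum>i\<le>Suc j. b i (fst x) * G (Suc i) x)
        = (\<Sum>i\<le>Suc j. (a i (fst x) + b i (fst x)) * G (Suc i) x)"
      unfolding distrib_right by (rule sum.distrib[symmetric])
    finally show ?thesis .
  qed
  ultimately show ?case by (intro exI[of _ "\<lambda>i s. a i s + b i s"]) blast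
qed

definition e_dens :: "nat \<Rightarrow> real \<times> real \<times> real \<Rightarrow> real" where
  "e_dens k q = (G (Suc k) (\<tau>0, q))\<^sup>2 + (d1 (G k) (\<tau>0, q))\<^sup>2 + (d2 (G k) (\<tau>0, q))\<^sup>2 + (d3 (G k) (\<tau>0, q) / sin (fst (snd q)))\<^sup>2"

definition e_sum :: "real \<times> real \<times> real \<Rightarrow> real" where "e_sum q = (\<Sum>k\<le>2. e_dens k q)"

lemma e_dens_nonneg: "0 \<le> e_dens k q" by (simp add: e_dens_def)

lemma sum_e_dens_le: "j \<le> 2 \<Longrightarrow> (\<Sum>k\<le>j. e_dens k q) \<le> e_sum q"
  unfolding e_sum_def by (rule sum_mono2) (auto simp: e_dens_nonneg)

lemma sum_e_dens_Suc_le: "Suc j \<le> 2 \<Longrightarrow> (\<Sum>k\<le>j. e_dens (Suc k) q) \<le> e_sum q"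
  using sum_e_dens_le[of "Suc j" q] e_dens_nonneg[of 0 q] sum.atMost_Suc_shift[of "\<lambda>k. e_dens k q" j] by linarith

lemma sum_sq_le:
  fixes c b :: "nat \<Rightarrow> real"
  assumes "\<And>i. i \<le> j \<Longrightarrow> (b i)\<^sup>2 \<le> e i" "(\<Sum>i\<le>j. e i) \<le> E"
  shows "(\<Sum>i\<le>j. c i * b i)\<^sup>2 \<le> (\<Sum>i\<le>j. (c i)\<^sup>2) * E"
proof -
  have "(\<Sum>i\<le>j. (b i)\<^sup>2) \<le> (\<Sum>i\<le>j. e i)" using assms(1) by (intro sum_mono) simp
  then have "(\<Sum>i\<le>j. (c i)\<^sup>2) * (\<Sum>i\<le>j. (b i)\<^sup>2) \<le> (\<Sum>i\<le>j. (c i)\<^sup>2) * E"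
    using assms(2) by (intro mult_left_mono sum_nonneg) auto
  then show ?thesis using Cauchy_Schwarz_ineq_sum[of c b "{..j}"] by linarith
qed

lemma tau0_full: "(\<tau>0, q) \<in> full_reg T"
  using T_pos by (cases q) (simp add: full_reg_def)

text \<open>\<open>G (Suc i)\<close> is the r-derivative inside the energy of \<open>G i\<close>, so
  the value of \<open>Fs (Suc j)\<close> uses energies up to order \<open>j\<close>, and its
  gradient one order more. By this count energies of order at most 2 cover all of level 2, including
  \<open>d0 (Fs 2) = Fs 3\<close>.\<close>

lemma Fs_bound:
  "\<exists>C\<ge>0. \<forall>q. (j \<le> 2 \<longrightarrow> (Fs (Suc j) (\<tau>0, q))\<^sup>2 \<le> C * e_sum q) \<and>
    (Suc j \<le> 2 \<longrightarrow> (d1 (Fs (Suc j)) (\<tau>0, q))\<^sup>2 \<le> C * e_sum q \<and> (d2 (Fs (Suc j)) (\<tau>0, q))\<^sup>2 \<le> C * e_sum q \<and>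
      (d3 (Fs (Suc j)) (\<tau>0, q) / sin (fst (snd q)))\<^sup>2 \<le> C * e_sum q)"
proof -
  obtain c where c: "\<And>i. smooth_on {0<..<T} (c i)"
    and F: "\<And>x. x \<in> full_reg T \<Longrightarrow> Fs (Suc j) x = (\<Sum>i\<le>j. c i (fst x) * G (Suc i) x)" using Fs_G[of j] by blast
  have t0: "fst (\<tau>0, q) \<in> {0<..<T}" for q :: "real \<times> real \<times> real" using T_pos by simp
  have df: "(\<lambda>x. c i (fst x) * G (Suc i) x) differentiable at (\<tau>0, q)" for i q
    by (intro smooth_on_differentiable[OF _ tau0_full] smooth_on_mult open_reg smooth_on_coef c G_smooth)
  note co = coef_pdiff[OF tau0_full G_smooth c smooth_coef_deriv(2)[OF c t0]]
  have s: "pdiff v (Fs (Suc j)) (\<tau>0, q) = (\<Sum>i\<le>j. pdiff v (\<lambda>x. c i (fst x) * G (Suc i) x) (\<tau>0, q))" for v q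
    using pdiff_transform_open(2)[OF open_reg(2) F tau0_full, where v = v] pdiff_sum[OF df, where v = v and A = "{..j}"] by simp
  have D: "d1 (Fs (Suc j)) (\<tau>0, q) = (\<Sum>i\<le>j. c i \<tau>0 * d1 (G (Suc i)) (\<tau>0, q))"
    "d2 (Fs (Suc j)) (\<tau>0, q) = (\<Sum>i\<le>j. c i \<tau>0 * d2 (G (Suc i)) (\<tau>0, q))"
    "d3 (Fs (Suc j)) (\<tau>0, q) / sin (fst (snd q)) = (\<Sum>i\<le>j. c i \<tau>0 * (d3 (G (Suc i)) (\<tau>0, q) / sin (fst (snd q))))" for q
    unfolding s co(2-4) by (simp_all add: sum_divide_distrib)
  have F0: "Fs (Suc j) (\<tau>0, q) = (\<Sum>i\<le>j. c i \<tau>0 * G (Suc i) (\<tau>0, q))" for q using F[OF tau0_full] by simp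
  let ?C = "\<Sum>i\<le>j. (c i \<tau>0)\<^sup>2"
  have "(Fs (Suc j) (\<tau>0, q))\<^sup>2 \<le> ?C * e_sum q" if "j \<le> 2" for q
    unfolding F0 by (rule sum_sq_le[OF _ sum_e_dens_le[OF that]]) (simp add: e_dens_def)
  moreover have "(d1 (Fs (Suc j)) (\<tau>0, q))\<^sup>2 \<le> ?C * e_sum q" "(d2 (Fs (Suc j)) (\<tau>0, q))\<^sup>2 \<le> ?C * e_sum q"
    "(d3 (Fs (Suc j)) (\<tau>0, q) / sin (fst (snd q)))\<^sup>2 \<le> ?C * e_sum q" if "Suc j \<le> 2" for q
    unfolding D by (rule sum_sq_le[OF _ sum_e_dens_Suc_le[OF that]]; simp add: e_dens_def)+
  ultimately show ?thesis by (intro exI[of _ ?C] conjI) (auto intro: sum_nonneg)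
qed

lemma N_dens_bound: "\<exists>C\<ge>0. \<forall>q. wh.N_dens 2 (\<tau>0, q) \<le> C * e_sum q"
proof -
  obtain C0 where C0: "C0 \<ge> 0" "\<And>q. (d1 (Fs 1) (\<tau>0, q))\<^sup>2 \<le> C0 * e_sum q" "\<And>q. (d2 (Fs 1) (\<tau>0, q))\<^sup>2 \<le> C0 * e_sum q"
    "\<And>q. (d3 (Fs 1) (\<tau>0, q) / sin (fst (snd q)))\<^sup>2 \<le> C0 * e_sum q" using Fs_bound[of 0] by (auto simp del: Fs.simps)
  obtain C1 where C1: "C1 \<ge> 0" "\<And>q. (d1 (Fs 2) (\<tau>0, q))\<^sup>2 \<le> C1 * e_sum q" "\<And>q. (d2 (Fs 2) (\<tau>0, q))\<^sup>2 \<le> C1 * e_sum q"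
    "\<And>q. (d3 (Fs 2) (\<tau>0, q) / sin (fst (snd q)))\<^sup>2 \<le> C1 * e_sum q" "\<And>q. (Fs 2 (\<tau>0, q))\<^sup>2 \<le> C1 * e_sum q"
    using Fs_bound[of 1] by (auto simp: numeral_2_eq_2 simp del: Fs.simps)
  obtain C2 where C2: "C2 \<ge> 0" "\<And>q. (Fs 3 (\<tau>0, q))\<^sup>2 \<le> C2 * e_sum q"
    using Fs_bound[of 2] by (auto simp: numeral_2_eq_2 numeral_3_eq_3 simp del: Fs.simps)
  have "wh.N_dens 2 (\<tau>0, q) \<le> (1 + 3 * C0 + 4 * C1 + C2) * e_sum q" for q
  proof -
    have d: "d0 (Fs 1) = Fs 2" "d0 (Fs 2) = Fs 3" by (simp_all add: numeral_2_eq_2 numeral_3_eq_3)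
    have th: "thv (\<tau>0, q) = fst (snd q)" by simp
    have "wh.n_dens 0 (\<tau>0, q) \<le> e_dens 0 q" by (simp add: wh.n_dens_def e_dens_def G.simps(1))
    also have "\<dots> \<le> e_sum q" using sum_e_dens_le[of 0 q] by simp
    finally have 0: "wh.n_dens 0 (\<tau>0, q) \<le> e_sum q" .
    have 1: "wh.n_dens 1 (\<tau>0, q) \<le> C1 * e_sum q + C0 * e_sum q + C0 * e_sum q + C0 * e_sum q"
      unfolding wh.n_dens_def d th using C0(2-4)[of q] C1(5)[of q] by simp
    have 2: "wh.n_dens 2 (\<tau>0, q) \<le> C2 * e_sum q + C1 * e_sum q + C1 * e_sum q + C1 * e_sum q"
      unfolding wh.n_dens_def d th using C1(2-4)[of q] C2(2)[of q] by simp
    have "wh.N_dens 2 (\<tau>0, q) = wh.n_dens 0 (\<tau>0, q) + wh.n_dens 1 (\<tau>0, q) + wh.n_dens 2 (\<tau>0, q)"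
      by (simp add: wh.N_dens_def numeral_2_eq_2)
    then show ?thesis using 0 1 2 by (simp add: algebra_simps)
  qed
  then show ?thesis using C0(1) C1(1) C2(1) by (intro exI[of _ "1 + 3 * C0 + 4 * C1 + C2"]) auto
qed

lemma slice_measurable: "smooth_on (full_reg T) f \<Longrightarrow> (\<lambda>q. f (\<tau>0, q)) \<in> borel_measurable borel"
  by (rule borel_measurable_continuous_onI) (rule wh.F_slice_continuous[OF T_pos(2,3)])

lemma G_slice_measurable [measurable]:
  "(\<lambda>q. G k (\<tau>0, q)) \<in> borel_measurable borel" "(\<lambda>q. d1 (G k) (\<tau>0, q)) \<in> borel_measurable borel"
  "(\<lambda>q. d2 (G k) (\<tau>0, q)) \<in> borel_measurable borel" "(\<lambda>q. d3 (G k) (\<tau>0, q)) \<in> borel_measurable borel"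
  by (intro slice_measurable G_smooth smooth_on_d)+

lemma e_dens_measurable [measurable]: "e_dens k \<in> borel_measurable borel"
  unfolding e_dens_def[abs_def] by measurable

text \<open>At the fixed radius \<open>r0\<close> the weights in the energy are positive constants
  \<open>a\<close> and \<open>b\<close>, so the density with unit weights is at most a multiple of
  the weighted one; \<open>K\<close> makes \<open>K * a\<close>, \<open>K * b\<close> and
  \<open>K\<close> at least 1.\<close>

lemma e_dens_integral: "k \<le> 2 \<Longrightarrow> (\<integral>\<^sup>+q\<in>sph_dom. ennreal (sin (fst (snd q)) * e_dens k q) \<partial>lborel) < \<infinity>"
proof -
  assume k: "k \<le> 2"
  define a where "a = r0\<^sup>2 / (lapse \<Lambda> m r0)\<^sup>2"
  define b where "b = r0\<^sup>2 * (lapse \<Lambda> m r0)\<^sup>2"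
  have r0p: "r0 > 0" using r0 rC(1) by simp
  have "lapse \<Lambda> m r0 > 0" using rC(2)[OF r0] by (simp add: lapse_def)
  then have ab: "a > 0" "b > 0" using r0p by (simp_all add: a_def b_def)
  have r0': "1 / \<tau>0 = r0" "0 < \<tau>0" "\<tau>0 < T" using T_pos by (simp_all add: \<tau>0_def)
  define w where "w q = (a * (G (Suc k) (\<tau>0, q))\<^sup>2 + b * (d1 (G k) (\<tau>0, q))\<^sup>2
      + ((d2 (G k) (\<tau>0, q))\<^sup>2 + (d3 (G k) (\<tau>0, q))\<^sup>2 / (sin (fst (snd q)))\<^sup>2)) * sin (fst (snd q))" for q
  have wm [measurable]: "w \<in> borel_measurable borel" unfolding w_def[abs_def] by measurable
  let ?u = "(dr ^^ k) \<psi>"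
  have pl: "G k (\<tau>0, t, \<theta>, \<phi>) = ?u r0 t (sph \<theta> \<phi>)" for t \<theta> \<phi> using G_pull[OF r0'(2,3), of k] r0'(1) by simp
  have df: "G k differentiable at (\<tau>0, q)" for q by (rule smooth_on_differentiable[OF G_smooth tau0_full])
  have D: "dr ?u r0 t (sph \<theta> \<phi>) = G (Suc k) (\<tau>0, t, \<theta>, \<phi>)" "deriv (\<lambda>s. ?u r0 s (sph \<theta> \<phi>)) t = d1 (G k) (\<tau>0, t, \<theta>, \<phi>)"
    "deriv (\<lambda>a. ?u r0 t (sph a \<phi>)) \<theta> = d2 (G k) (\<tau>0, t, \<theta>, \<phi>)" "deriv (\<lambda>b. ?u r0 t (sph \<theta> b)) \<phi> = d3 (G k) (\<tau>0, t, \<theta>, \<phi>)" for t \<theta> \<phi>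
  proof -
    show "dr ?u r0 t (sph \<theta> \<phi>) = G (Suc k) (\<tau>0, t, \<theta>, \<phi>)" using G_pull[OF r0'(2,3), of "Suc k"] r0'(1) by simp
    show "deriv (\<lambda>s. ?u r0 s (sph \<theta> \<phi>)) t = d1 (G k) (\<tau>0, t, \<theta>, \<phi>)"
      using DERIV_imp_deriv[OF pdiff_coord_DERIV(2)[OF df]] by (simp only: pl)
    show "deriv (\<lambda>a. ?u r0 t (sph a \<phi>)) \<theta> = d2 (G k) (\<tau>0, t, \<theta>, \<phi>)"
      using DERIV_imp_deriv[OF pdiff_coord_DERIV(3)[OF df]] by (simp only: pl)
    show "deriv (\<lambda>b. ?u r0 t (sph \<theta> b)) \<phi> = d3 (G k) (\<tau>0, t, \<theta>, \<phi>)"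
      using DERIV_imp_deriv[OF pdiff_coord_DERIV(4)[OF df]] by (simp only: pl)
  qed
  have en: "energy \<Lambda> m ?u r0 = ennreal (1/2) * (\<integral>\<^sup>+q\<in>sph_dom. ennreal (w q) \<partial>lborel)"
    unfolding energy_def D a_def[symmetric] b_def[symmetric]
    by (subst nn_integral_sph_dom[symmetric, of "\<lambda>q. ennreal (w q)"]) (simp_all add: w_def)
  have le: "energy \<Lambda> m ?u r0 \<le> (\<Sum>k\<le>2. energy \<Lambda> m ((dr ^^ k) \<psi>) r0)"
    using k by (intro member_le_sum) auto
  have "ennreal (1/2) * (\<integral>\<^sup>+q\<in>sph_dom. ennreal (w q) \<partial>lborel) < \<infinity>"
    using order_le_less_trans[OF le finite_energy] unfolding en .
  then have fin: "(\<integral>\<^sup>+q\<in>sph_dom. ennreal (w q) \<partial>lborel) < \<infinity>" by (auto simp: ennreal_mult_less_top)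
  define K where "K = 1 / a + 1 / b + 1"
  have Ka: "K * a = 1 + a / b + a" "K * b = b / a + 1 + b" using ab by (simp_all add: K_def distrib_right)
  have pos: "0 < a / b" "0 < b / a" "0 < 1 / a" "0 < 1 / b" using ab by simp_all
  have K: "K > 0" "1 \<le> K * a" "1 \<le> K * b" "1 \<le> K" unfolding Ka using pos ab unfolding K_def by linarith+
  have "sin (fst (snd q)) * e_dens k q \<le> K * w q" if "q \<in> sph_dom" for q
  proof -
    have s: "sin (fst (snd q)) > 0" by (rule sph_dom_sin[OF that])
    have "e_dens k q \<le> K * a * (G (Suc k) (\<tau>0, q))\<^sup>2 + K * b * (d1 (G k) (\<tau>0, q))\<^sup>2 + K * (d2 (G k) (\<tau>0, q))\<^sup>2 + K * (d3 (G k) (\<tau>0, q) / sin (fst (snd q)))\<^sup>2"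
      unfolding e_dens_def
      using mult_right_mono[OF K(2) zero_le_power2[of "G (Suc k) (\<tau>0, q)"]] mult_right_mono[OF K(3) zero_le_power2[of "d1 (G k) (\<tau>0, q)"]]
        mult_right_mono[OF K(4) zero_le_power2[of "d2 (G k) (\<tau>0, q)"]] mult_right_mono[OF K(4) zero_le_power2[of "d3 (G k) (\<tau>0, q) / sin (fst (snd q))"]]
      by linarith
    then have "sin (fst (snd q)) * e_dens k q \<le> sin (fst (snd q)) * (K * a * (G (Suc k) (\<tau>0, q))\<^sup>2 + K * b * (d1 (G k) (\<tau>0, q))\<^sup>2 + K * (d2 (G k) (\<tau>0, q))\<^sup>2 + K * (d3 (G k) (\<tau>0, q) / sin (fst (snd q)))\<^sup>2)"
      using s by (intro mult_left_mono) auto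
    also have "\<dots> = K * w q" by (simp add: w_def power_divide algebra_simps)
    finally show ?thesis .
  qed
  then have "(\<integral>\<^sup>+q\<in>sph_dom. ennreal (sin (fst (snd q)) * e_dens k q) \<partial>lborel) \<le> (\<integral>\<^sup>+q. ennreal K * (ennreal (w q) * indicator sph_dom q) \<partial>lborel)"
    using K(1) by (intro nn_integral_mono) (auto simp: indicator_def ennreal_mult'[symmetric] intro!: ennreal_leI)
  also have "\<dots> = ennreal K * (\<integral>\<^sup>+q\<in>sph_dom. ennreal (w q) \<partial>lborel)"
    by (rule nn_integral_cmult) measurable
  also have "\<dots> < \<infinity>" using fin by (simp add: ennreal_mult_less_top)
  finally show ?thesis .
qed

lemma initial_energy: "(\<integral>\<^sup>+p\<in>UNIV \<times> {0<..<pi} \<times> {0..2 * pi}. ennreal (sin (fst (snd p)) * wh.N_dens 2 (\<tau>0, p)) \<partial>lborel) < \<infinity>"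
proof -
  obtain C where C: "C \<ge> 0" "\<And>q. wh.N_dens 2 (\<tau>0, q) \<le> C * e_sum q" using N_dens_bound by blast
  have "(\<integral>\<^sup>+p\<in>UNIV \<times> {0<..<pi} \<times> {0..2 * pi}. ennreal (sin (fst (snd p)) * wh.N_dens 2 (\<tau>0, p)) \<partial>lborel)
      = (\<integral>\<^sup>+p\<in>sph_dom. ennreal (sin (fst (snd p)) * wh.N_dens 2 (\<tau>0, p)) \<partial>lborel)"
  proof (rule nn_integral_cong_AE)
    show "AE p in lborel. ennreal (sin (fst (snd p)) * wh.N_dens 2 (\<tau>0, p)) * indicator (UNIV \<times> {0<..<pi} \<times> {0..2 * pi}) p
        = ennreal (sin (fst (snd p)) * wh.N_dens 2 (\<tau>0, p)) * indicator sph_dom p"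
      using AE_hyperplane[of 0] AE_hyperplane[of "2 * pi"] by eventually_elim (auto simp: sph_dom_def indicator_def)
  qed
  also have "\<dots> \<le> (\<integral>\<^sup>+q. (\<Sum>k\<le>2. ennreal C * (ennreal (sin (fst (snd q)) * e_dens k q) * indicator sph_dom q)) \<partial>lborel)"
  proof (rule nn_integral_mono)
    fix q :: "real \<times> real \<times> real"
    show "ennreal (sin (fst (snd q)) * wh.N_dens 2 (\<tau>0, q)) * indicator sph_dom q
        \<le> (\<Sum>k\<le>2. ennreal C * (ennreal (sin (fst (snd q)) * e_dens k q) * indicator sph_dom q))"
    proof (cases "q \<in> sph_dom")
      case True
      then have s: "sin (fst (snd q)) > 0" by (rule sph_dom_sin)
      have "sin (fst (snd q)) * wh.N_dens 2 (\<tau>0, q) \<le> sin (fst (snd q)) * (C * e_sum q)"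
        using C(2)[of q] s by (intro mult_left_mono) auto
      also have "\<dots> = (\<Sum>k\<le>2. C * (sin (fst (snd q)) * e_dens k q))"
        unfolding e_sum_def sum_distrib_left by (intro sum.cong) auto
      finally have "ennreal (sin (fst (snd q)) * wh.N_dens 2 (\<tau>0, q)) \<le> ennreal (\<Sum>k\<le>2. C * (sin (fst (snd q)) * e_dens k q))"
        by (rule ennreal_leI)
      also have "\<dots> = (\<Sum>k\<le>2. ennreal C * ennreal (sin (fst (snd q)) * e_dens k q))"
        using C(1) s by (subst sum_ennreal[symmetric]) (auto simp: e_dens_nonneg ennreal_mult)
      finally show ?thesis using True by simp
    qed simp
  qed
  also have "\<dots> = (\<Sum>k\<le>2. ennreal C * (\<integral>\<^sup>+q\<in>sph_dom. ennreal (sin (fst (snd q)) * e_dens k q) \<partial>lborel))"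
    by (subst nn_integral_sum) (auto intro!: sum.cong nn_integral_cmult)
  also have "\<dots> < \<infinity>" using e_dens_integral by (auto simp: ennreal_sum_less_top ennreal_mult_less_top)
  finally show ?thesis .
qed

sublocale sw: spherical_wave_hierarchy "\<Lambda> / 3" m T \<tau>0 P Fs
  by unfold_locales (use Psi_pole in \<open>simp\<close>, rule initial_energy)

end

section \<open>The expansion at infinity\<close>

lemma tendsto_0_ennrealI:
  fixes f :: "'a \<Rightarrow> ennreal"
  assumes "\<And>e. e > 0 \<Longrightarrow> \<forall>\<^sub>F x in F. f x \<le> ennreal e"
  shows "(f \<longlongrightarrow> 0) F"
proof (rule order_tendstoI)
  fix a :: ennreal assume "0 < a"
  then obtain b where b: "0 < b" "b < a" using dense by blast
  then obtain e where e: "b = ennreal e" "e \<ge> 0" by (cases b) auto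
  with b(1) have "e > 0" by (cases "e = 0") auto
  from assms[OF this] show "\<forall>\<^sub>F x in F. f x < a"
    by eventually_elim (use b(2) e(1) in \<open>auto intro: order_le_less_trans\<close>)
qed simp

text \<open>The squared homogeneous norm of a gradient given in the orthonormal frame, with
  components numbered 1 to 3 as in \<open>cmp\<close>.\<close>

definition sph_sq :: "(nat \<Rightarrow> real \<times> real \<times> real \<Rightarrow> real) \<Rightarrow> ennreal" where
  "sph_sq X = (\<integral>\<^sup>+q\<in>sph_dom. ennreal (sin (fst (snd q)) * ((X 1 q)\<^sup>2 + (X 2 q)\<^sup>2 + (X 3 q)\<^sup>2)) \<partial>lborel)"

text \<open>The third component is the one in the orthonormal frame, hence the factor \<open>sin \<theta>\<close>.\<close>
definition has_frame_grad :: "(real \<Rightarrow> real^3 \<Rightarrow> real) \<Rightarrow> (nat \<Rightarrow> real \<times> real \<times> real \<Rightarrow> real) \<Rightarrow> bool" where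
  "has_frame_grad u X \<longleftrightarrow> has_weak_grad u (grad_of (X 1) (X 2) (\<lambda>q. sin (fst (snd q)) * X 3 q))"

lemma has_frame_grad_lincomb:
  assumes "has_frame_grad u X" "has_frame_grad v Y"
  shows "has_frame_grad (\<lambda>t \<omega>. x * u t \<omega> + y * v t \<omega>) (\<lambda>k q. x * X k q + y * Y k q)"
proof -
  have "x * (s * a) + y * (s * b) = s * (x * a + y * b)" for s a b :: real by (simp add: algebra_simps)
  then show ?thesis
    using has_weak_grad_lincomb[OF assms[unfolded has_frame_grad_def], of x y] by (simp only: has_frame_grad_def)
qed

lemma has_frame_grad_cmult: "has_frame_grad u X \<Longrightarrow> has_frame_grad (\<lambda>t \<omega>. x * u t \<omega>) (\<lambda>k q. x * X k q)"
  using has_frame_grad_lincomb[of u X u X x 0] by simp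

lemma has_frame_grad_diff:
  "has_frame_grad u X \<Longrightarrow> has_frame_grad v Y \<Longrightarrow> has_frame_grad (\<lambda>t \<omega>. u t \<omega> - v t \<omega>) (\<lambda>k q. X k q - Y k q)"
  using has_frame_grad_lincomb[of u X v Y 1 "-1"] by simp

lemma sph_dens_frame:
  assumes "q \<in> sph_dom"
  shows "sph_dens q (a, b, sin (fst (snd q)) * c) = sin (fst (snd q)) * (a\<^sup>2 + b\<^sup>2 + c\<^sup>2)"
proof -
  obtain t \<theta> \<phi> where q: "q = (t, \<theta>, \<phi>)" by (cases q)
  have "sin \<theta> \<noteq> 0" using sph_dom_sin[OF assms] by (simp add: q)
  then show ?thesis by (simp add: sph_dens_def q power_mult_distrib)
qed

lemma H1dot_dist_sq_frame:
  assumes "has_frame_grad u X" "has_frame_grad v Y"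
  shows "H1dot_dist_sq u v = sph_sq (\<lambda>k q. X k q - Y k q)"
  unfolding H1dot_dist_sq_eq[OF assms[unfolded has_frame_grad_def]] sph_sq_def right_diff_distrib[symmetric]
  by (intro nn_integral_cong) (auto simp: indicator_def sph_dens_frame)

lemma in_H1dot_frame:
  assumes u: "has_frame_grad u X" and m: "\<And>k. X k \<in> borel_measurable borel" and f: "sph_sq X < \<infinity>"
  shows "in_H1dot u"
proof -
  have [measurable]: "X 1 \<in> borel_measurable borel" "X 2 \<in> borel_measurable borel" "X 3 \<in> borel_measurable borel" by (rule m)+
  have s: "(\<lambda>q::real \<times> real \<times> real. sin (fst (snd q)) * X 3 q) \<in> borel_measurable borel" by measurable
  have "grad_sq_norm (grad_of (X 1) (X 2) (\<lambda>q. sin (fst (snd q)) * X 3 q)) = sph_sq X"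
    unfolding grad_sq_norm_eq[OF m m s] sph_sq_def
    by (intro nn_integral_cong) (auto simp: indicator_def sph_dens_frame)
  with f have "grad_sq_norm (grad_of (X 1) (X 2) (\<lambda>q. sin (fst (snd q)) * X 3 q)) < \<infinity>" by simp
  with u show ?thesis unfolding in_H1dot_def has_frame_grad_def by (intro exI conjI)
qed

lemma sph_sq_split:
  assumes m: "\<And>k. X k \<in> borel_measurable borel"
  shows "sph_sq X = (\<Sum>k\<in>{1,2,3}. \<integral>\<^sup>+q\<in>sph_dom. ennreal (sin (fst (snd q)) * (X k q)\<^sup>2) \<partial>lborel)"
proof -
  have m' [measurable]: "(\<lambda>q. ennreal (sin (fst (snd q)) * (X k q)\<^sup>2) * indicator sph_dom q) \<in> borel_measurable lborel" for k
    using m[of k] by measurable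
  have "sph_sq X = (\<integral>\<^sup>+q. (\<Sum>k\<in>{1,2,3}. ennreal (sin (fst (snd q)) * (X k q)\<^sup>2) * indicator sph_dom q) \<partial>lborel)"
    unfolding sph_sq_def
  proof (rule nn_integral_cong)
    fix q :: "real \<times> real \<times> real"
    show "ennreal (sin (fst (snd q)) * ((X 1 q)\<^sup>2 + (X 2 q)\<^sup>2 + (X 3 q)\<^sup>2)) * indicator sph_dom q
        = (\<Sum>k\<in>{1,2,3}. ennreal (sin (fst (snd q)) * (X k q)\<^sup>2) * indicator sph_dom q)"
      using sph_dom_sin[of q] by (cases "q \<in> sph_dom") (auto simp: distrib_left ennreal_plus[symmetric] add.assoc simp del: ennreal_plus)
  qed
  then show ?thesis by (simp only: nn_integral_sum[OF m'])
qed

lemma sph_sq_scaled_add: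
  assumes "\<And>k. A k \<in> borel_measurable borel" "\<And>k. V k \<in> borel_measurable borel"
  shows "sph_sq (\<lambda>k q. c * (A k q + V k q)) \<le> ennreal (2 * c\<^sup>2) * (sph_sq A + sph_sq V)"
proof -
  let ?w = "\<lambda>X q. sin (fst (snd q)) * ((X (1::nat) q)\<^sup>2 + (X 2 q)\<^sup>2 + (X 3 q)\<^sup>2)"
  have [measurable]: "A k \<in> borel_measurable borel" "V k \<in> borel_measurable borel" for k by (rule assms)+
  have sq: "(c * (x + y))\<^sup>2 \<le> 2 * c\<^sup>2 * (x\<^sup>2 + y\<^sup>2)" for x y :: real
  proof -
    have "(x + y)\<^sup>2 \<le> 2 * (x\<^sup>2 + y\<^sup>2)" using sum_squares_ge_zero[of "x - y" 0] by (simp add: power2_eq_square algebra_simps)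
    from mult_left_mono[OF this zero_le_power2[of c]] show ?thesis by (simp only: power_mult_distrib mult_ac)
  qed
  have "sph_sq (\<lambda>k q. c * (A k q + V k q)) \<le> (\<integral>\<^sup>+q. ennreal (2 * c\<^sup>2) * (ennreal (?w A q) * indicator sph_dom q + ennreal (?w V q) * indicator sph_dom q) \<partial>lborel)"
    unfolding sph_sq_def
  proof (rule nn_integral_mono)
    fix q :: "real \<times> real \<times> real"
    show "ennreal (?w (\<lambda>k q. c * (A k q + V k q)) q) * indicator sph_dom q
        \<le> ennreal (2 * c\<^sup>2) * (ennreal (?w A q) * indicator sph_dom q + ennreal (?w V q) * indicator sph_dom q)"
    proof (cases "q \<in> sph_dom")
      case True
      then have s: "sin (fst (snd q)) > 0" by (rule sph_dom_sin)
      have "?w (\<lambda>k q. c * (A k q + V k q)) q \<le> sin (fst (snd q)) * (2 * c\<^sup>2 * ((A 1 q)\<^sup>2 + (V 1 q)\<^sup>2) + 2 * c\<^sup>2 * ((A 2 q)\<^sup>2 + (V 2 q)\<^sup>2) + 2 * c\<^sup>2 * ((A 3 q)\<^sup>2 + (V 3 q)\<^sup>2))"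
        using s by (intro mult_left_mono add_mono sq) auto
      also have "\<dots> = 2 * c\<^sup>2 * (?w A q + ?w V q)" by (simp only: algebra_simps)
      finally have "ennreal (?w (\<lambda>k q. c * (A k q + V k q)) q) \<le> ennreal (2 * c\<^sup>2 * (?w A q + ?w V q))" by (rule ennreal_leI)
      also have "\<dots> = ennreal (2 * c\<^sup>2) * (ennreal (?w A q) + ennreal (?w V q))"
      proof -
        have "0 \<le> ?w A q" "0 \<le> ?w V q" using s by (auto intro!: mult_nonneg_nonneg add_nonneg_nonneg)
        then show ?thesis by (simp only: ennreal_plus[symmetric] ennreal_mult[symmetric] add_nonneg_nonneg zero_le_power2 mult_nonneg_nonneg zero_le_numeral)
      qed
      finally show ?thesis using True by simp
    qed simp
  qed
  also have "\<dots> = ennreal (2 * c\<^sup>2) * (sph_sq A + sph_sq V)"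
    unfolding sph_sq_def by (subst nn_integral_cmult, measurable, subst nn_integral_add) auto
  finally show ?thesis .
qed

text \<open>The descent through the expansion: if the remainder of one order tends to 0 and its
  coefficient has finite norm, then the remainder of the preceding order, smaller by a power of
  \<open>1 / r\<close>, tends to 0 too.\<close>

lemma sph_sq_scaled_tendsto:
  assumes A: "((\<lambda>r. sph_sq (A r)) \<longlongrightarrow> 0) at_top" "\<forall>\<^sub>F r in at_top. \<forall>k. A r k \<in> borel_measurable borel"
    and V: "\<And>k. V k \<in> borel_measurable borel" "sph_sq V < \<infinity>" and n: "n \<ge> 1"
  shows "((\<lambda>r. sph_sq (\<lambda>k q. (1 / r) ^ n * (A r k q + V k q))) \<longlongrightarrow> 0) (at_top :: real filter)"
proof (rule tendsto_sandwich[OF _ _ tendsto_const])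
  show "\<forall>\<^sub>F r in at_top. 0 \<le> sph_sq (\<lambda>k q. (1 / r) ^ n * (A r k q + V k q))" by simp
  show "\<forall>\<^sub>F r in at_top. sph_sq (\<lambda>k q. (1 / r) ^ n * (A r k q + V k q)) \<le> ennreal (2 * ((1 / r) ^ n)\<^sup>2) * (sph_sq (A r) + sph_sq V)"
    using A(2) by eventually_elim (use V(1) in \<open>blast intro: sph_sq_scaled_add\<close>)
  have "((\<lambda>r::real. 1 / r) \<longlongrightarrow> 0) at_top" using tendsto_inverse_0_at_top[OF filterlim_ident] by (simp add: inverse_eq_divide)
  then have "((\<lambda>r::real. 2 * ((1 / r) ^ n)\<^sup>2) \<longlongrightarrow> 2 * (0 ^ n)\<^sup>2) at_top" by (intro tendsto_intros)
  then have "((\<lambda>r::real. ennreal (2 * ((1 / r) ^ n)\<^sup>2)) \<longlongrightarrow> ennreal 0) at_top" using n by (intro tendsto_ennrealI) (simp add: power_0_left)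
  moreover have "((\<lambda>r. sph_sq (A r) + sph_sq V) \<longlongrightarrow> 0 + sph_sq V) at_top" by (intro tendsto_add A tendsto_const)
  ultimately have "((\<lambda>r::real. ennreal (2 * ((1 / r) ^ n)\<^sup>2) * (sph_sq (A r) + sph_sq V)) \<longlongrightarrow> ennreal 0 * (0 + sph_sq V)) at_top"
    using V(2) by (intro tendsto_mult_ennreal) auto
  then show "((\<lambda>r::real. ennreal (2 * ((1 / r) ^ n)\<^sup>2) * (sph_sq (A r) + sph_sq V)) \<longlongrightarrow> 0) at_top" by simp
qed

section \<open>Assembling the three limits\<close>

context sds_wave
begin

text \<open>The functions \<open>Fs\<close> rewritten in r and a point of the sphere: the limits
  have to be functions on the sphere itself and not of its polar angles.\<close>

fun U :: "nat \<Rightarrow> real \<Rightarrow> real \<Rightarrow> real^3 \<Rightarrow> real" where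
  "U 0 = \<psi>"
| "U (Suc 0) = (\<lambda>r t \<omega>. - (P (1 / r) * r ^ 3) * dr \<psi> r t \<omega>)"
| "U (Suc (Suc n)) = (\<lambda>r t \<omega>. - r\<^sup>2 * dr (U (Suc n)) r t \<omega>)"

lemma U_pull: "0 < \<tau> \<Longrightarrow> \<tau> < T \<Longrightarrow> Fs j (\<tau>, t, \<theta>, \<phi>) = U j (1 / \<tau>) t (sph \<theta> \<phi>)"
proof (induction j arbitrary: \<tau> t \<theta> \<phi> rule: U.induct)
  case 1
  then show ?case by (simp add: Psi_pull)
next
  case 2
  have "dr \<psi> (1 / \<tau>) t (sph \<theta> \<phi>) = - (1 / (1 / \<tau>))\<^sup>2 * d0 Psi (1 / (1 / \<tau>), t, \<theta>, \<phi>)"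
    by (rule dr_pull(2)[OF Psi_smooth Psi_pull inv_T[OF 2]])
  then show ?case using 2 by (simp add: field_simps power2_eq_square power3_eq_cube)
next
  case (3 n)
  have "dr (U (Suc n)) (1 / \<tau>) t (sph \<theta> \<phi>) = - (1 / (1 / \<tau>))\<^sup>2 * d0 (Fs (Suc n)) (1 / (1 / \<tau>), t, \<theta>, \<phi>)"
    by (rule dr_pull(2)[OF Fs_smooth 3(1) inv_T[OF 3(2,3)]])
  then show ?case using 3(2) by (simp add: power_divide)
qed

text \<open>Total by means of \<open>lim\<close>. For \<open>j \<le> 2\<close> the sequence
  converges almost everywhere on the chart, so arbitrary values are confined to a null set
  there.\<close>

definition lim_fn :: "nat \<Rightarrow> real \<Rightarrow> real^3 \<Rightarrow> real" where
  "lim_fn j t \<omega> = lim (\<lambda>n. U j (1 / wh.tseq n) t \<omega>)"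

lemma pull_lim_fn: "pull (lim_fn j) = sw.ll 0 j"
proof
  fix q :: "real \<times> real \<times> real"
  obtain t \<theta> \<phi> where q: "q = (t, \<theta>, \<phi>)" by (cases q)
  have "sw.yy 0 q j (wh.tseq n) = U j (1 / wh.tseq n) t (sph \<theta> \<phi>)" for n
    using sw.yy_components(1)[OF sw.tseq_T[of n], of q j] sw.tseq_T[of n] U_pull[of "wh.tseq n" j t \<theta> \<phi>] by (simp add: q)
  then show "pull (lim_fn j) q = sw.ll 0 j q"
    by (simp add: pull_def lim_fn_def sw.ll_def wh.clim_def q)
qed

lemma lim_fn_grad: "j \<le> 2 \<Longrightarrow> has_frame_grad (lim_fn j) (\<lambda>k. sw.ll k j)"
  unfolding has_frame_grad_def by (rule sw.limit_weak_grad[OF _ pull_lim_fn])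

lemma slice_grad: "r > SdS_rC \<Lambda> m \<Longrightarrow> has_frame_grad (\<psi> r) (\<lambda>k q. sw.yy k q 0 (1 / r))"
  unfolding has_frame_grad_def
  by (rule sw.slice_weak_grad) (use inv_r in \<open>auto simp: pull_def Psi_def fun_eq_iff\<close>)

definition "W0 k = sw.ll k 0"
text \<open>The factors 1/2 and 1/3, here and in \<open>W3\<close>, come from integrating \<sigma>
  and \<open>\<sigma>\<^sup>2\<close> in the Taylor expansion; \<open>\<Lambda> / 3\<close> is the
  value of \<open>P\<close> at 0.\<close>

definition "W2 k q = 1 / (2 * (\<Lambda> / 3)) * sw.ll k 1 q"
definition "W3 k q = 1 / (3 * (\<Lambda> / 3)) * sw.ll k 2 q"
definition "\<psi>2 t \<omega> = 1 / (2 * (\<Lambda> / 3)) * lim_fn 1 t \<omega>"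
definition "\<psi>3 t \<omega> = 1 / (3 * (\<Lambda> / 3)) * lim_fn 2 t \<omega>"

lemma W_measurable [measurable]: "W0 k \<in> borel_measurable borel" "W2 k \<in> borel_measurable borel" "W3 k \<in> borel_measurable borel"
  unfolding W0_def W2_def[abs_def] W3_def[abs_def] by measurable

lemma W_grad: "has_frame_grad (lim_fn 0) W0" "has_frame_grad \<psi>2 W2" "has_frame_grad \<psi>3 W3"
  unfolding W0_def[abs_def] W2_def[abs_def] W3_def[abs_def] \<psi>2_def[abs_def] \<psi>3_def[abs_def]
  by (intro has_frame_grad_cmult lim_fn_grad; simp)+

lemma ll_finite: "j \<le> 2 \<Longrightarrow> sph_sq (\<lambda>k. sw.ll k j) < \<infinity>"
  using sw.ll_L2[of _ j] by (subst sph_sq_split) (auto simp: sw.ll_measurable ennreal_sum_less_top)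

lemma sph_sq_cmult_finite:
  "sph_sq X < \<infinity> \<Longrightarrow> (\<And>k. X k \<in> borel_measurable borel) \<Longrightarrow> sph_sq (\<lambda>k q. c * X k q) < \<infinity>"
proof -
  assume X: "sph_sq X < \<infinity>" and [measurable]: "\<And>k. X k \<in> borel_measurable borel"
  have "sph_sq (\<lambda>k q. c * (X k q + (\<lambda>_ _. 0) k q)) \<le> ennreal (2 * c\<^sup>2) * (sph_sq X + sph_sq (\<lambda>_ _. 0))"
    by (intro sph_sq_scaled_add) measurable
  also have "\<dots> < \<infinity>" using X by (auto simp: sph_sq_def ennreal_mult_less_top)
  finally show ?thesis by simp
qed

lemma W_finite: "sph_sq W0 < \<infinity>" "sph_sq W2 < \<infinity>" "sph_sq W3 < \<infinity>"
  unfolding W0_def[abs_def] W2_def[abs_def] W3_def[abs_def]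
  by (intro sph_sq_cmult_finite ll_finite sw.ll_measurable; simp)+

text \<open>Frame gradient of the rescaled cubic remainder minus its limit. \<open>Z2\<close> is
  obtained from it, in the shape that \<open>sph_sq_scaled_tendsto\<close> handles;
  \<open>Z_eq\<close> identifies it with the rescaled quadratic remainder.\<close>

definition "Z3 r k q = r ^ 3 * (sw.yy k q 0 (1 / r) - W0 k q - 1 / r\<^sup>2 * W2 k q) - W3 k q"
definition "Z2 r k q = (1 / r) ^ 1 * (Z3 r k q + W3 k q)"

lemma Z_measurable: "r > SdS_rC \<Lambda> m \<Longrightarrow> Z3 r k \<in> borel_measurable borel" "r > SdS_rC \<Lambda> m \<Longrightarrow> Z2 r k \<in> borel_measurable borel"
proof -
  assume "r > SdS_rC \<Lambda> m"
  then have [measurable]: "(\<lambda>q. sw.yy k q 0 (1 / r)) \<in> borel_measurable borel" using inv_r by (intro sw.yy_measurable) auto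
  show "Z3 r k \<in> borel_measurable borel" unfolding Z3_def[abs_def] by measurable
  then show "Z2 r k \<in> borel_measurable borel" unfolding Z2_def[abs_def] by measurable
qed

lemma eventually_rC: "\<forall>\<^sub>F r in at_top. r > SdS_rC \<Lambda> m" by (rule eventually_gt_at_top)

text \<open>The square of the factor \<open>r ^ 3\<close> compensates exactly the
  \<open>\<tau> ^ 6\<close> of \<open>cubic_remainder\<close>.\<close>

lemma Z3_tendsto: "((\<lambda>r. sph_sq (Z3 r)) \<longlongrightarrow> 0) at_top"
proof (rule tendsto_0_ennrealI)
  fix e :: real assume e: "e > 0"
  have comp: "\<forall>\<^sub>F r in at_top. (\<integral>\<^sup>+q\<in>sph_dom. ennreal (sin (fst (snd q)) * (Z3 r k q)\<^sup>2) \<partial>lborel) \<le> ennreal (e / 3)"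
    if k: "1 \<le> k" "k \<le> 3" for k
  proof -
    define R where "R \<tau> q = sw.yy k q 0 \<tau> - sw.ll k 0 q - \<tau>\<^sup>2 * (sw.ll k 1 q / (2 * (\<Lambda> / 3))) - \<tau> ^ 3 * (sw.ll k 2 q / (3 * (\<Lambda> / 3)))" for \<tau> q
    have e3: "e / 3 > 0" using e by simp
    obtain \<delta> where \<delta>: "\<delta> > 0" "\<And>\<tau>. 0 < \<tau> \<Longrightarrow> \<tau> < \<delta> \<Longrightarrow>
        (\<integral>\<^sup>+q\<in>sph_dom. ennreal (sin (fst (snd q)) * (R \<tau> q)\<^sup>2) \<partial>lborel) \<le> ennreal (e / 3 * \<tau> ^ 6)"
      using sw.cubic_remainder[OF k e3] unfolding R_def by blast
    show ?thesis using eventually_rC eventually_gt_at_top[of "1 / \<delta>"]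
    proof eventually_elim
      case (elim r)
      have r: "r > 0" using elim(1) rC(1) by simp
      have t: "0 < 1 / r" "1 / r < \<delta>" using r elim(2) \<delta>(1) by (simp_all add: field_simps)
      have [measurable]: "(\<lambda>q. sw.yy k q 0 (1 / r)) \<in> borel_measurable borel" using inv_r[OF elim(1)] by (intro sw.yy_measurable) auto
      have [measurable]: "R (1 / r) \<in> borel_measurable borel" unfolding R_def[abs_def] by measurable
      have "Z3 r k q = r ^ 3 * R (1 / r) q" for q
      proof -
        have "r ^ 3 * (1 / r) ^ 3 = 1" using r by (simp add: power_divide)
        moreover have "R (1 / r) q = sw.yy k q 0 (1 / r) - W0 k q - 1 / r\<^sup>2 * W2 k q - (1 / r) ^ 3 * W3 k q"
          by (simp add: R_def W0_def W2_def W3_def power_divide)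
        ultimately show ?thesis by (simp add: Z3_def right_diff_distrib mult.assoc[symmetric])
      qed
      then have z: "sin (fst (snd q)) * (Z3 r k q)\<^sup>2 = r ^ 6 * (sin (fst (snd q)) * (R (1 / r) q)\<^sup>2)" for q
        by (simp add: power_mult_distrib power_mult[symmetric])
      have "(\<integral>\<^sup>+q\<in>sph_dom. ennreal (sin (fst (snd q)) * (Z3 r k q)\<^sup>2) \<partial>lborel)
          = (\<integral>\<^sup>+q. ennreal (r ^ 6) * (ennreal (sin (fst (snd q)) * (R (1 / r) q)\<^sup>2) * indicator sph_dom q) \<partial>lborel)"
        unfolding z using r by (intro nn_integral_cong) (simp add: ennreal_mult' mult.assoc)
      also have "\<dots> = ennreal (r ^ 6) * (\<integral>\<^sup>+q\<in>sph_dom. ennreal (sin (fst (snd q)) * (R (1 / r) q)\<^sup>2) \<partial>lborel)"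
        by (rule nn_integral_cmult) measurable
      also have "\<dots> \<le> ennreal (r ^ 6) * ennreal (e / 3 * (1 / r) ^ 6)" by (intro mult_left_mono \<delta>(2) t) simp
      also have "\<dots> = ennreal (e / 3)"
      proof -
        have "r ^ 6 * (e / 3 * (1 / r) ^ 6) = e / 3" using r by (simp add: power_divide)
        then show ?thesis using r e by (simp only: ennreal_mult'[symmetric] zero_le_power less_imp_le)
      qed
      finally show ?case .
    qed
  qed
  show "\<forall>\<^sub>F r in at_top. sph_sq (Z3 r) \<le> ennreal e"
    using eventually_rC comp[of 1, simplified] comp[of 2, simplified] comp[of 3, simplified]
  proof eventually_elim
    case (elim r)
    have "sph_sq (Z3 r) \<le> ennreal (e / 3) + (ennreal (e / 3) + ennreal (e / 3))"
      unfolding sph_sq_split[OF Z_measurable(1)[OF elim(1)]] using elim(2-4) by (simp add: add_mono)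
    also have "\<dots> = ennreal e" using e by (simp add: ennreal_plus[symmetric] del: ennreal_plus)
    finally show ?case .
  qed
qed

lemma Z2_tendsto: "((\<lambda>r. sph_sq (Z2 r)) \<longlongrightarrow> 0) at_top"
  unfolding Z2_def[abs_def]
  by (rule sph_sq_scaled_tendsto[OF Z3_tendsto eventually_mono[OF eventually_rC] W_measurable(3) W_finite(3)]) (use Z_measurable(1) in auto)

lemma Z1_tendsto: "((\<lambda>r. sph_sq (\<lambda>k q. (1 / r) ^ 2 * (Z2 r k q + W2 k q))) \<longlongrightarrow> 0) at_top"
  by (rule sph_sq_scaled_tendsto[OF Z2_tendsto eventually_mono[OF eventually_rC] W_measurable(2) W_finite(2)]) (use Z_measurable(2) in auto)

lemma Z_eq:
  assumes "r > 0"
  shows "Z2 r k q = r\<^sup>2 * (sw.yy k q 0 (1 / r) - W0 k q) - W2 k q"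
    "(1 / r) ^ 2 * (Z2 r k q + W2 k q) = sw.yy k q 0 (1 / r) - W0 k q"
proof -
  show *: "Z2 r k q = r\<^sup>2 * (sw.yy k q 0 (1 / r) - W0 k q) - W2 k q"
    using assms by (simp add: Z2_def Z3_def field_simps power2_eq_square power3_eq_cube)
  show "(1 / r) ^ 2 * (Z2 r k q + W2 k q) = sw.yy k q 0 (1 / r) - W0 k q"
    unfolding * using assms by (simp add: power_divide)
qed

theorem expansion:
  "in_H1dot (lim_fn 0)" "((\<lambda>r. H1dot_dist_sq (\<psi> r) (lim_fn 0)) \<longlongrightarrow> 0) at_top"
  "in_H1dot \<psi>2" "((\<lambda>r. H1dot_dist_sq (\<lambda>t \<omega>. r\<^sup>2 * (\<psi> r t \<omega> - lim_fn 0 t \<omega>)) \<psi>2) \<longlongrightarrow> 0) at_top"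
  "in_H1dot \<psi>3"
  "((\<lambda>r. H1dot_dist_sq (\<lambda>t \<omega>. r ^ 3 * (\<psi> r t \<omega> - lim_fn 0 t \<omega> - \<psi>2 t \<omega> / r\<^sup>2)) \<psi>3) \<longlongrightarrow> 0) at_top"
proof -
  show "in_H1dot (lim_fn 0)" "in_H1dot \<psi>2" "in_H1dot \<psi>3"
    using in_H1dot_frame[OF W_grad(1) W_measurable(1) W_finite(1)] in_H1dot_frame[OF W_grad(2) W_measurable(2) W_finite(2)]
      in_H1dot_frame[OF W_grad(3) W_measurable(3) W_finite(3)] by auto
  \<comment> \<open>Frame gradients are linear, so each distance is \<open>sph_sq\<close> of the
    matching combination of gradients; this holds for r beyond the horizon, hence
    eventually.\<close>
  have d1: "H1dot_dist_sq (\<psi> r) (lim_fn 0) = sph_sq (\<lambda>k q. (1 / r) ^ 2 * (Z2 r k q + W2 k q))" if r: "r > SdS_rC \<Lambda> m" for r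
    using H1dot_dist_sq_frame[OF slice_grad[OF r] W_grad(1)] Z_eq(2)[of r] r rC(1) by simp
  have d2: "H1dot_dist_sq (\<lambda>t \<omega>. r\<^sup>2 * (\<psi> r t \<omega> - lim_fn 0 t \<omega>)) \<psi>2 = sph_sq (Z2 r)" if r: "r > SdS_rC \<Lambda> m" for r
  proof -
    have "Z2 r = (\<lambda>k q. r\<^sup>2 * (sw.yy k q 0 (1 / r) - W0 k q) - W2 k q)"
      using Z_eq(1)[of r] r rC(1) by (intro ext) simp
    then show ?thesis
      using H1dot_dist_sq_frame[OF has_frame_grad_cmult[OF has_frame_grad_diff[OF slice_grad[OF r] W_grad(1)]] W_grad(2), of "r\<^sup>2"] by simp
  qed
  have d3: "H1dot_dist_sq (\<lambda>t \<omega>. r ^ 3 * (\<psi> r t \<omega> - lim_fn 0 t \<omega> - \<psi>2 t \<omega> / r\<^sup>2)) \<psi>3 = sph_sq (Z3 r)" if r: "r > SdS_rC \<Lambda> m" for r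
  proof -
    have "(\<lambda>t \<omega>. r ^ 3 * (\<psi> r t \<omega> - lim_fn 0 t \<omega> - \<psi>2 t \<omega> / r\<^sup>2)) = (\<lambda>t \<omega>. r ^ 3 * (\<psi> r t \<omega> - lim_fn 0 t \<omega> - 1 / r\<^sup>2 * \<psi>2 t \<omega>))"
      by simp
    then show ?thesis
      using H1dot_dist_sq_frame[OF has_frame_grad_cmult[OF has_frame_grad_diff[OF has_frame_grad_diff[OF slice_grad[OF r] W_grad(1)]
          has_frame_grad_cmult[OF W_grad(2), of "1 / r\<^sup>2"]], of "r ^ 3"] W_grad(3)] by (simp only: Z3_def[abs_def])
  qed
  show "((\<lambda>r. H1dot_dist_sq (\<psi> r) (lim_fn 0)) \<longlongrightarrow> 0) at_top"
    by (rule Lim_transform_eventually[OF Z1_tendsto]) (use eventually_rC in \<open>eventually_elim, simp only: d1\<close>)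
  show "((\<lambda>r. H1dot_dist_sq (\<lambda>t \<omega>. r\<^sup>2 * (\<psi> r t \<omega> - lim_fn 0 t \<omega>)) \<psi>2) \<longlongrightarrow> 0) at_top"
    by (rule Lim_transform_eventually[OF Z2_tendsto]) (use eventually_rC in \<open>eventually_elim, simp only: d2\<close>)
  show "((\<lambda>r. H1dot_dist_sq (\<lambda>t \<omega>. r ^ 3 * (\<psi> r t \<omega> - lim_fn 0 t \<omega> - \<psi>2 t \<omega> / r\<^sup>2)) \<psi>3) \<longlongrightarrow> 0) at_top"
    by (rule Lim_transform_eventually[OF Z3_tendsto]) (use eventually_rC in \<open>eventually_elim, simp only: d3\<close>)
qed

end

theorem theorem1p1:
  fixes \<Lambda> m r0 :: real and \<psi> :: "real \<Rightarrow> real \<Rightarrow> real^3 \<Rightarrow> real"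
  assumes \<Lambda>_pos: "\<Lambda> > 0"
    and subextremal: "0 < 3 * m" "3 * m < 1 / sqrt \<Lambda>"
    and smooth: "smooth_on ({SdS_rC \<Lambda> m<..} \<times> UNIV \<times> - {0})
                   (\<lambda>(r, t, x). \<psi> r t (x /\<^sub>R norm x))"
    and wave: "\<And>r t \<theta> \<phi>. r > SdS_rC \<Lambda> m \<Longrightarrow> 0 < \<theta> \<Longrightarrow> \<theta> < pi \<Longrightarrow>
                 box_g \<Lambda> m \<psi> r t \<theta> \<phi> = 0"
    and r0: "r0 > SdS_rC \<Lambda> m"
    and finite_energy: "(\<Sum>k\<le>2. energy \<Lambda> m ((dr ^^ k) \<psi>) r0) < \<infinity>"
  shows "\<exists>\<psi>0. in_H1dot \<psi>0 \<and>
           ((\<lambda>r. H1dot_dist_sq (\<psi> r) \<psi>0) \<longlongrightarrow> 0) at_top \<and>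
         (\<exists>\<psi>2. in_H1dot \<psi>2 \<and>
           ((\<lambda>r. H1dot_dist_sq (\<lambda>t \<omega>. r\<^sup>2 * (\<psi> r t \<omega> - \<psi>0 t \<omega>)) \<psi>2) \<longlongrightarrow> 0) at_top \<and>
         (\<exists>\<psi>3. in_H1dot \<psi>3 \<and>
           ((\<lambda>r. H1dot_dist_sq
                   (\<lambda>t \<omega>. r ^ 3 * (\<psi> r t \<omega> - \<psi>0 t \<omega> - \<psi>2 t \<omega> / r\<^sup>2)) \<psi>3) \<longlongrightarrow> 0) at_top))"
proof -
  interpret sds_wave \<Lambda> m r0 \<psi>
    by unfold_locales (fact \<Lambda>_pos subextremal smooth wave r0 finite_energy)+
  show ?thesis using expansion by blast
qed

end
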